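(* Let $1\le p,q\le\infty$ and let $n$ be a natural number. There exists a complete isometry of $S_p^n$ onto a completely complemented subspace of $S_q^n(\ell_p^{n^2})$. Moreover, both the isometry and the projection are completely positive maps. The result also holds in the vector valued case: for every operator space $E$ there is a complete isometry of $S_p^n[E]$ onto a completely complemented subspace of $S_q^n(\ell_p^{n^2}[E])$.
   Context: Operator space conventions. $M_n=B(\ell_2^n)=S_\infty^n$ carries the operator norm and its $C^*$-algebra operator space structure. $S_1^n$ is $M_n$ with the trace norm and the operator space structure of the dual $M_n^*$ via the pairing $\langle A,B\rangle=\mathrm{tr}(AB^t)$. For an operator space $E$: $S_\infty^n[E]=M_n\otimes_{\min}E$, $S_1^n[E]=S_1^n\hat\otimes E$ (operator space projective tensor product), and $S_p^n[E]=(S_\infty^n[E],S_1^n[E])_{1/p}$ by complex interpolation, where interpolation spaces carry the matrix norms $M_k[(E_0,E_1)_\theta]=(M_k[E_0],M_k[E_1])_\theta$; $S_p^n=S_p^n[\mathbb C]$. $\ell_p^N[E]$ is the diagonal subspace of $S_p^N[E]$ and $\ell_p^N=\ell_p^N[\mathbb C]$. We write $S_q^n(X)=S_q^n[X]$. Positivity: as vector spaces $S_p^n$ and $S_q^n(\ell_p^N)$ are identified with the $C^*$-algebras $M_n$ and $M_n\otimes\ell_\infty^N$, and "completely positive" refers to these $C^*$-algebras. A map $T:E\to F$ is a complete isometry if $\mathrm{id}_{M_k}\otimes T:M_k[E]\to M_k[F]$ is isometric for every $k$; completely contractive maps are defined analogously. A subspace is completely complemented if it is the range of a completely contractive projection.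 *)

theory Defs
  imports "HOL-Analysis.Analysis" "HOL-Library.Function_Algebras"
begin

class complex_vector = ab_group_add +
  fixes scaleC :: "complex \<Rightarrow> 'a \<Rightarrow> 'a"
  assumes scaleC_add_right: "scaleC c (x + y) = scaleC c x + scaleC c y"
    and scaleC_add_left: "scaleC (c + d) x = scaleC c x + scaleC d x"
    and scaleC_scaleC: "scaleC c (scaleC d x) = scaleC (c * d) x"
    and scaleC_one: "scaleC 1 x = x"

instantiation complex :: complex_vector
begin
definition scaleC_complex :: "complex \<Rightarrow> complex \<Rightarrow> complex"
  where "scaleC_complex c x = c * x"
instance by standard (auto simp: scaleC_complex_def algebra_simps)
end

instantiation "fun" :: (type, complex_vector) complex_vector
begin
definition scaleC_fun :: "complex \<Rightarrow> ('a \<Rightarrow> 'b) \<Rightarrow> 'a \<Rightarrow> 'b"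
  where "scaleC_fun c f = (\<lambda>i. scaleC c (f i))"
instance by standard
  (auto simp: scaleC_fun_def fun_eq_iff scaleC_add_right scaleC_add_left scaleC_scaleC scaleC_one)
end

instantiation vec :: (complex_vector, finite) complex_vector
begin
definition scaleC_vec :: "complex \<Rightarrow> ('a, 'b) vec \<Rightarrow> ('a, 'b) vec"
  where "scaleC_vec c v = (\<chi> i. scaleC c (v $ i))"
instance by standard
  (auto simp: scaleC_vec_def vec_eq_iff scaleC_add_right scaleC_add_left scaleC_scaleC scaleC_one)
end

abbreviation clinear :: "('a::complex_vector \<Rightarrow> 'b::complex_vector) \<Rightarrow> bool"
  where "clinear \<equiv> Vector_Spaces.linear scaleC scaleC"


section \<open>Matrix norms and operator spaces\<close>

text \<open>
  A k-by-l matrix is a function of two natural indices of which only the entries with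
  \<open>i < k\<close> and \<open>j < l\<close> matter. A matrix norm structure on a vector space E gives, for each k,
  the norm of \<open>M\<^sub>k[E]\<close>.
\<close>

type_synonym 'a matrix = "nat \<Rightarrow> nat \<Rightarrow> 'a"
type_synonym 'a matnorms = "nat \<Rightarrow> 'a matrix \<Rightarrow> real"

definition op_norm :: "nat \<Rightarrow> nat \<Rightarrow> complex matrix \<Rightarrow> real"
  where "op_norm k l A =
    (SUP v \<in> {v :: nat \<Rightarrow> complex. L2_set (\<lambda>j. cmod (v j)) {..<l} \<le> 1}.
       L2_set (\<lambda>i. cmod (\<Sum>j<l. A i j * v j)) {..<k})"

definition two_sided :: "nat \<Rightarrow> complex matrix \<Rightarrow> ('a::complex_vector) matrix \<Rightarrow> complex matrix \<Rightarrow> 'a matrix"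
  where "two_sided l \<alpha> x \<beta> = (\<lambda>i j. \<Sum>r<l. \<Sum>s<l. scaleC (\<alpha> i r * \<beta> s j) (x r s))"

definition direct_sum :: "nat \<Rightarrow> ('a::zero) matrix \<Rightarrow> 'a matrix \<Rightarrow> 'a matrix"
  where "direct_sum k x y = (\<lambda>i j. if i < k \<and> j < k then x i j
      else if k \<le> i \<and> k \<le> j then y (i - k) (j - k) else 0)"

definition vnorm :: "('a::complex_vector) matnorms \<Rightarrow> 'a \<Rightarrow> real"
  where "vnorm E e = E 1 (\<lambda>_ _. e)"

text \<open>
  Ruan's axioms together with completeness. The first condition says that \<open>E k\<close> is a
  function of the k-by-k block.
\<close>

definition operator_space :: "('a::complex_vector) matnorms \<Rightarrow> bool"
  where "operator_space E \<longleftrightarrow>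
    (\<forall>k x y. (\<forall>i<k. \<forall>j<k. x i j = y i j) \<longrightarrow> E k x = E k y) \<and>
    (\<forall>k x. 0 \<le> E k x) \<and>
    (\<forall>k x. E k x = 0 \<longleftrightarrow> (\<forall>i<k. \<forall>j<k. x i j = 0)) \<and>
    (\<forall>k c x. E k (scaleC c x) = cmod c * E k x) \<and>
    (\<forall>k x y. E k (x + y) \<le> E k x + E k y) \<and>
    (\<forall>k l x y. E (k + l) (direct_sum k x y) = max (E k x) (E l y)) \<and>
    (\<forall>k l \<alpha> x \<beta>. E k (two_sided l \<alpha> x \<beta>) \<le> op_norm k l \<alpha> * E l x * op_norm l k \<beta>) \<and>
    (\<forall>X :: nat \<Rightarrow> 'a. (\<forall>e>0. \<exists>m0. \<forall>m\<ge>m0. \<forall>m'\<ge>m0. vnorm E (X m - X m') < e) \<longrightarrow>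
       (\<exists>a. (\<lambda>m. vnorm E (X m - a)) \<longlonglongrightarrow> 0))"

definition scalars :: "complex matnorms"
  where "scalars k A = op_norm k k A"

definition amplify :: "('a \<Rightarrow> 'b) \<Rightarrow> 'a matrix \<Rightarrow> 'b matrix"
  where "amplify T x = (\<lambda>i j. T (x i j))"

definition complete_isometry ::
    "('a::complex_vector) matnorms \<Rightarrow> ('b::complex_vector) matnorms \<Rightarrow> ('a \<Rightarrow> 'b) \<Rightarrow> bool"
  where "complete_isometry E F T \<longleftrightarrow> clinear T \<and> (\<forall>k x. F k (amplify T x) = E k x)"

definition completely_contractive ::
    "('a::complex_vector) matnorms \<Rightarrow> ('b::complex_vector) matnorms \<Rightarrow> ('a \<Rightarrow> 'b) \<Rightarrow> bool"
  where "completely_contractive E F T \<longleftrightarrow> clinear T \<and> (\<forall>k x. F k (amplify T x) \<le> E k x)"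

definition cc_projection_onto ::
    "('a::complex_vector) matnorms \<Rightarrow> 'a set \<Rightarrow> ('a \<Rightarrow> 'a) \<Rightarrow> bool"
  where "cc_projection_onto E W P \<longleftrightarrow>
    completely_contractive E E P \<and> P \<circ> P = P \<and> range P = W"

definition completely_complemented :: "('a::complex_vector) matnorms \<Rightarrow> 'a set \<Rightarrow> bool"
  where "completely_complemented E W \<longleftrightarrow> (\<exists>P. cc_projection_onto E W P)"


section \<open>Complex interpolation\<close>

text \<open>
  Calderon's method for two norms on the same vector space, which is all that is needed here:
  \<open>S\<^sub>\<infinity>\<^sup>n[E]\<close> and \<open>S\<^sub>1\<^sup>n[E]\<close> are both the space of n-by-n matrices over E. The ambient space
  of the couple carries the norm of \<open>E\<^sub>0 + E\<^sub>1\<close>.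
\<close>

definition sum_norm :: "('a::complex_vector \<Rightarrow> real) \<Rightarrow> ('a \<Rightarrow> real) \<Rightarrow> 'a \<Rightarrow> real"
  where "sum_norm N0 N1 x = (INF a. N0 a + N1 (x - a))"

definition calderon :: "('a::complex_vector \<Rightarrow> real) \<Rightarrow> ('a \<Rightarrow> real) \<Rightarrow> (complex \<Rightarrow> 'a) set"
  where "calderon N0 N1 = {f. let S = {z. 0 \<le> Re z \<and> Re z \<le> 1}; K = sum_norm N0 N1 in
    (\<exists>B. \<forall>z\<in>S. K (f z) \<le> B) \<and>
    (\<forall>z\<in>S. ((\<lambda>w. K (f w - f z)) \<longlongrightarrow> 0) (at z within S)) \<and>
    (\<forall>z\<in>interior S. \<exists>D. ((\<lambda>w. K (scaleC (inverse (w - z)) (f w - f z) - D)) \<longlongrightarrow> 0) (at z)) \<and>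
    (\<forall>t::real. ((\<lambda>s. N0 (f (Complex 0 s) - f (Complex 0 t))) \<longlongrightarrow> 0) (at t)) \<and>
    (\<forall>t::real. ((\<lambda>s. N1 (f (Complex 1 s) - f (Complex 1 t))) \<longlongrightarrow> 0) (at t)) \<and>
    ((\<lambda>t. N0 (f (Complex 0 t))) \<longlongrightarrow> 0) at_infinity \<and>
    ((\<lambda>t. N1 (f (Complex 1 t))) \<longlongrightarrow> 0) at_infinity}"

definition interp_norm :: "real \<Rightarrow> ('a::complex_vector \<Rightarrow> real) \<Rightarrow> ('a \<Rightarrow> real) \<Rightarrow> 'a \<Rightarrow> real"
  where "interp_norm \<theta> N0 N1 x =
    (INF f \<in> {f \<in> calderon N0 N1. f (complex_of_real \<theta>) = x}.
       max (SUP t. N0 (f (Complex 0 t))) (SUP t. N1 (f (Complex 1 t))))"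

definition interp :: "real \<Rightarrow> ('a::complex_vector) matnorms \<Rightarrow> 'a matnorms \<Rightarrow> 'a matnorms"
  where "interp \<theta> E0 E1 k = interp_norm \<theta> (E0 k) (E1 k)"


section \<open>The spaces \<open>S\<^sub>p\<^sup>n[E]\<close> and \<open>\<ell>\<^sub>p\<^sup>N[E]\<close>\<close>

text \<open>
  \<open>M\<^sub>k(M\<^sub>n(E)) = M\<^sub>k\<^sub>n(E)\<close>, where the index set \<open>'n\<close> is enumerated by \<open>from_nat_into UNIV\<close>.
  Matrix norms of an operator space are invariant under simultaneous permutations of rows and
  columns, so the choice of the enumeration does not matter.
\<close>

definition flatten :: "('a^'n^'n) matrix \<Rightarrow> 'a matrix"
  where "flatten x = (\<lambda>r s. x (r div CARD('n)) (s div CARD('n))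
     $ from_nat_into UNIV (r mod CARD('n)) $ from_nat_into UNIV (s mod CARD('n)))"

text \<open>
  For \<open>E \<subseteq> B(H)\<close>, the minimal tensor product \<open>M\<^sub>n \<otimes>\<^sub>m\<^sub>i\<^sub>n E\<close> is \<open>M\<^sub>n(E)\<close> with the norms
  inherited from \<open>B(\<ell>\<^sub>2\<^sup>k \<otimes> \<ell>\<^sub>2\<^sup>n \<otimes> H)\<close>, that is, from \<open>M\<^sub>k\<^sub>n(E)\<close>.
\<close>

definition S_inf :: "('a::complex_vector) matnorms \<Rightarrow> ('a^'n^'n) matnorms"
  where "S_inf E k x = E (k * CARD('n)) (flatten x)"

text \<open>
  The dual structure \<open>M\<^sub>k(M\<^sub>n\<^sup>*) = CB(M\<^sub>n, M\<^sub>k)\<close> for the pairing \<open>tr(A B\<^sup>t)\<close>.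
\<close>

definition S_one_scalar :: "(complex^'n^'n) matnorms"
  where "S_one_scalar k A =
    Sup {op_norm (k * m) (k * m)
           (\<lambda>r s. trace (A (r div m) (s div m) ** transpose (B (r mod m) (s mod m)))) | m B.
         S_inf scalars m (B :: (complex^'n^'n) matrix) \<le> 1}"

text \<open>
  The operator space projective norm on \<open>M\<^sub>k(F \<otimes> E)\<close>: the infimum of
  \<open>\<parallel>\<alpha>\<parallel> \<parallel>v\<parallel> \<parallel>w\<parallel> \<parallel>\<beta>\<parallel>\<close> over all \<open>u = \<alpha> (v \<otimes> w) \<beta>\<close>. The bilinear map \<open>t\<close> realises the
  algebraic tensor product of F and E.
\<close>

definition proj_tensor :: "('f \<Rightarrow> 'e \<Rightarrow> 'g::complex_vector) \<Rightarrow> 'f matnorms \<Rightarrow> 'e matnorms \<Rightarrow> 'g matnorms"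
  where "proj_tensor t F E k u =
    Inf {op_norm k (l * m) \<alpha> * F l v * E m w * op_norm (l * m) k \<beta> | l m \<alpha> v w \<beta>.
      \<forall>i<k. \<forall>j<k. u i j = two_sided (l * m) \<alpha>
        (\<lambda>r s. t (v (r div m) (s div m)) (w (r mod m) (s mod m))) \<beta> i j}"

definition matrix_tensor :: "complex^'n^'n \<Rightarrow> 'a::complex_vector \<Rightarrow> 'a^'n^'n"
  where "matrix_tensor A e = (\<chi> a b. scaleC (A $ a $ b) e)"

definition S_one :: "('a::complex_vector) matnorms \<Rightarrow> ('a^'n^'n) matnorms"
  where "S_one E = proj_tensor matrix_tensor S_one_scalar E"

definition S_p :: "ereal \<Rightarrow> ('a::complex_vector) matnorms \<Rightarrow> ('a^'n^'n) matnorms"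
  where "S_p p E = (if p = \<infinity> then S_inf E else if p = 1 then S_one E
     else interp (real_of_ereal (1 / p)) (S_inf E) (S_one E))"

definition diag :: "('a::zero)^'m \<Rightarrow> 'a^'m^'m"
  where "diag x = (\<chi> a b. if a = b then x $ a else 0)"

definition ell_p :: "ereal \<Rightarrow> ('a::complex_vector) matnorms \<Rightarrow> ('a^'m) matnorms"
  where "ell_p p E k x = S_p p E k (amplify diag x)"


section \<open>Complete positivity\<close>

definition psd :: "nat \<Rightarrow> complex matrix \<Rightarrow> bool"
  where "psd k A \<longleftrightarrow> (\<forall>v. (\<Sum>i<k. \<Sum>j<k. cnj (v i) * A i j * v j) \<in> \<real>\<^sub>\<ge>\<^sub>0)"

text \<open>The positive cones of \<open>M\<^sub>k(M\<^sub>n)\<close> and of \<open>M\<^sub>k(M\<^sub>n \<otimes> \<ell>\<^sub>\<infinity>\<^sup>N)\<close>, the latter being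
  the N-fold direct sum of \<open>M\<^sub>k(M\<^sub>n)\<close>.\<close>

definition pos_Mn :: "nat \<Rightarrow> (complex^'n^'n) matrix \<Rightarrow> bool"
  where "pos_Mn k x \<longleftrightarrow> psd (k * CARD('n)) (flatten x)"

definition pos_Mn_ell :: "nat \<Rightarrow> ((complex^'m)^'n^'n) matrix \<Rightarrow> bool"
  where "pos_Mn_ell k x \<longleftrightarrow> (\<forall>g. pos_Mn k (amplify (\<lambda>y. \<chi> a b. y $ a $ b $ g) x))"

definition completely_positive ::
    "(nat \<Rightarrow> ('a::complex_vector) matrix \<Rightarrow> bool) \<Rightarrow> (nat \<Rightarrow> ('b::complex_vector) matrix \<Rightarrow> bool) \<Rightarrow>
     ('a \<Rightarrow> 'b) \<Rightarrow> bool"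
  where "completely_positive C D T \<longleftrightarrow> clinear T \<and> (\<forall>k x. C k x \<longrightarrow> D k (amplify T x))"

end

theory Submission
  imports Defs "HOL-Complex_Analysis.Complex_Analysis"
begin

text \<open>
  Let \<open>(u\<^sub>g)\<close> be the \<open>n\<^sup>2\<close> unitaries \<open>weyl g\<close>: products of cyclic shifts and diagonal matrices of
  roots of unity. They are pairwise orthogonal for the Hilbert-Schmidt inner product, so the matrix
  with rows indexed by pairs of indices and with columns \<open>n^(-1/2) u\<^sub>g\<close> is itself unitary. Put
  \<open>J x = n^(-s) (u\<^sub>g x u\<^sub>g\<^sup>*)\<^sub>g\<close> and \<open>R y = n^(s-2) \<Sum>\<^sub>g u\<^sub>g\<^sup>* y\<^sub>g u\<^sub>g\<close> with \<open>s = 1/p + 1/q\<close>. Both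
  maps are completely positive, being positive combinations of maps \<open>x \<mapsto> a x a\<^sup>*\<close>, and \<open>R J = 1\<close>
  because every summand of \<open>R (J x)\<close> is \<open>n^(-2) x\<close>. If J and R are complete contractions, then J
  is a complete isometry and \<open>J R\<close> is a completely contractive projection onto its range, which is
  the theorem. It remains to bound the conjugation maps \<open>weyl_embed\<close> and \<open>weyl_project\<close> by
  \<open>n\<^sup>s\<close> and \<open>n^(2-s)\<close>.

  Only one value of q has to be treated for each of them. Since \<open>\<parallel>y\<parallel> \<le> n \<parallel>y\<parallel>\<close> from \<open>S\<^sub>\<infinity>\<^sup>n[F]\<close> to
  \<open>S\<^sub>1\<^sup>n[F]\<close> (\<open>S_one_le_S_inf\<close>), a bound \<open>n^(1/p)\<close> for the embedding with \<open>q = \<infinity>\<close> gives \<open>n^(1/p+1)\<close>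
  for \<open>q = 1\<close>, and a bound \<open>n^(1-1/p)\<close> for the projection with \<open>q = 1\<close> gives \<open>n^(2-1/p)\<close> for
  \<open>q = \<infinity>\<close>; interpolation fills in the other exponents. For the embedding this uses that a vector with known
  endpoint norms has a small interpolation norm (\<open>interp_norm_upper\<close>). For the projection it uses the
  converse, a bound of a single seminorm by the interpolation norm, which is the vector-valued three
  lines theorem: compose with a norming functional from the Hahn-Banach theorem
  (\<open>interp_norm_lower\<close>).

  For \<open>q = \<infinity>\<close> the matrix norms of \<open>S\<^sub>\<infinity>\<^sup>n[\<ell>\<^sub>p[E]]\<close> are norms of block matrices over
  \<open>S\<^sub>p\<^sup>N[E]\<close> with \<open>N = n\<^sup>2\<close> and diagonal entries, and the embedding is a map from matrices over
  \<open>S\<^sub>p\<^sup>n[E]\<close> to such matrices (\<open>embed_diag\<close>) that does not depend on p. It is interpolated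
  between \<open>p = \<infinity>\<close>, where it is a direct sum of unitary conjugations and has norm at most 1, and \<open>p = 1\<close>,
  where its norm is at most n. Dually, for \<open>q = 1\<close> an element of \<open>S\<^sub>1\<^sup>n[\<ell>\<^sub>p[E]]\<close> is
  \<open>\<alpha> (v \<otimes> w) \<beta>\<close> by the definition of the projective tensor product, and with v fixed the projection
  of \<open>v \<otimes> w\<close> is linear in w (\<open>twist\<close>). This map is interpolated between \<open>p = \<infinity>\<close>, with
  norm at most \<open>n \<parallel>v\<parallel>\<close>, and \<open>p = 1\<close>, with norm at most \<open>\<parallel>v\<parallel>\<close>.

  The endpoint estimates that involve both the trace class and the matrix norms of E rest on
  \<open>mn_contraction\<close>: contracting the \<open>S\<^sub>1\<^sup>n\<close> index of a matrix over \<open>S\<^sub>1\<^sup>n\<close> with an \<open>M\<^sub>n\<close> index of a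
  matrix over E is jointly completely contractive. For scalar E this is the definition of the dual
  operator space structure. In general it follows from the factorisation \<open>x \<mapsto> \<alpha> (1 \<otimes> x) \<beta>\<close> of a
  completely bounded map on \<open>M\<^sub>n\<close>, since a map of this form acts on \<open>M\<^sub>n(E)\<close> with the same
  bound. The factorisation is obtained from the Hahn-Banach theorem: its optimal cost is the value of a
  linear functional, whose parts are two positive functionals and a bilinear form dominated by them; writing these
  functionals as Gram matrices by a Cholesky factorisation turns the form into a contraction against which
  the dual norm can be tested (\<open>fac_norm_le_S1\<close>).

  Matrices are indexed throughout by arbitrary finite sets (\<open>opn\<close> and \<open>mn\<close>), so that
  \<open>M\<^sub>k(M\<^sub>n(E))\<close> is the space of matrices over a product index set and tensor products of matrices need
  no enumeration of their indices.
\<close>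

section \<open>Complex linear maps\<close>

(* the dollar sign is kept for the components of finite-dimensional vectors *)
no_notation fps_nth (infixl "$" 75)

interpretation cvec: vector_space "scaleC :: complex \<Rightarrow> 'a::complex_vector \<Rightarrow> 'a"
  by unfold_locales (simp_all add: scaleC_add_right scaleC_add_left scaleC_scaleC scaleC_one)

lemma clinear_iff:
  "clinear T \<longleftrightarrow> (\<forall>x y. T (x + y) = T x + T y) \<and> (\<forall>c x. T (scaleC c x) = scaleC c (T x))"
  unfolding Vector_Spaces.linear_iff
  by (simp add: cvec.vector_space_axioms)

lemma clinear_add: "clinear T \<Longrightarrow> T (x + y) = T x + T y"
  and clinear_scale: "clinear T \<Longrightarrow> T (scaleC c x) = scaleC c (T x)"
  by (simp_all add: clinear_iff)

lemma clinear_zero: "clinear T \<Longrightarrow> T 0 = 0"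
  using clinear_add[of T 0 0] by simp

lemma clinear_diff: "clinear T \<Longrightarrow> T (x - y) = T x - T y"
  using clinear_add[of T "x - y" y] by (simp add: algebra_simps)

lemma scaleC_complex_eq [simp]: "scaleC c (z::complex) = c * z"
  by (simp add: scaleC_complex_def)

lemma scaleC_fun_apply [simp]: "scaleC c f i = scaleC c (f i)"
  by (simp add: scaleC_fun_def)

lemma scaleC_vec_nth [simp]: "scaleC c v $ i = scaleC c (v $ i)"
  by (simp add: scaleC_vec_def)

section \<open>Operator norms over arbitrary finite index sets\<close>

abbreviation l2 :: "'i set \<Rightarrow> ('i \<Rightarrow> complex) \<Rightarrow> real"
  where "l2 I v \<equiv> L2_set (\<lambda>i. cmod (v i)) I"

text \<open>
  For initial segments of the naturals this is \<open>op_norm\<close>. Product sets and images under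
  bijections occur as index sets without being enumerated.
\<close>

definition opn :: "'i set \<Rightarrow> 'j set \<Rightarrow> ('i \<Rightarrow> 'j \<Rightarrow> complex) \<Rightarrow> real"
  where "opn I J A = (SUP v \<in> {v. l2 J v \<le> 1}. l2 I (\<lambda>i. \<Sum>j\<in>J. A i j * v j))"

lemma op_norm_eq_opn: "op_norm k l A = opn {..<k} {..<l} A"
  by (simp add: op_norm_def opn_def)

lemma l2_scale: "l2 I (\<lambda>i. c * v i) = cmod c * l2 I v"
  by (simp add: norm_mult L2_set_right_distrib)

lemma l2_power2: "(l2 I v)\<^sup>2 = (\<Sum>i\<in>I. (cmod (v i))\<^sup>2)"
  by (simp add: L2_set_def sum_nonneg)

lemma l2_triangle: "l2 I (\<lambda>i. u i + v i) \<le> l2 I u + l2 I v"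
proof -
  have "l2 I (\<lambda>i. u i + v i) \<le> L2_set (\<lambda>i. cmod (u i) + cmod (v i)) I"
    by (rule L2_set_mono) (simp_all add: norm_triangle_ineq)
  also have "\<dots> \<le> l2 I u + l2 I v" by (rule L2_set_triangle_ineq)
  finally show ?thesis .
qed

lemma l2_zero [simp]: "L2_set (\<lambda>i. 0) I = 0"
  by (rule L2_set_0') simp

lemma l2_cong: "(\<And>i. i \<in> I \<Longrightarrow> u i = v i) \<Longrightarrow> l2 I u = l2 I v"
  by (rule L2_set_cong) auto

text \<open>
  The unit ball is nonempty because it contains the zero vector.
\<close>

lemma opn_least:
  assumes "\<And>v. l2 J v \<le> 1 \<Longrightarrow> l2 I (\<lambda>i. \<Sum>j\<in>J. A i j * v j) \<le> c"
  shows "opn I J A \<le> c"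
  unfolding opn_def
proof (rule cSUP_least)
  have "(\<lambda>_. 0) \<in> {v. l2 J v \<le> 1}" by simp
  then show "{v. l2 J v \<le> 1} \<noteq> {}" by (metis empty_iff)
next
  fix v assume "v \<in> {v. l2 J v \<le> 1}"
  then show "l2 I (\<lambda>i. \<Sum>j\<in>J. A i j * v j) \<le> c" using assms by simp
qed

lemma opn_le:
  assumes "0 \<le> c" and "\<And>v. l2 I (\<lambda>i. \<Sum>j\<in>J. A i j * v j) \<le> c * l2 J v"
  shows "opn I J A \<le> c"
proof (rule opn_least)
  fix v assume v: "l2 J v \<le> 1"
  show "l2 I (\<lambda>i. \<Sum>j\<in>J. A i j * v j) \<le> c"
    by (rule order_trans[OF assms(2) mult_left_le[OF v assms(1)]])
qed

lemma opn_bdd: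
  assumes "finite I" "finite J"
  shows "bdd_above ((\<lambda>v. l2 I (\<lambda>i. \<Sum>j\<in>J. A i j * v j)) ` {v. l2 J v \<le> 1})"
proof (rule bdd_aboveI2)
  fix v :: "'b \<Rightarrow> complex" assume "v \<in> {v. l2 J v \<le> 1}"
  then have v: "l2 J v \<le> 1" by simp
  have 1: "cmod (v j) \<le> 1" if "j \<in> J" for j
    using member_le_L2_set[OF assms(2) that, of "\<lambda>j. cmod (v j)"] v by linarith
  have "l2 I (\<lambda>i. \<Sum>j\<in>J. A i j * v j) \<le> (\<Sum>i\<in>I. cmod (\<Sum>j\<in>J. A i j * v j))"
    by (rule L2_set_le_sum) simp
  also have "\<dots> \<le> (\<Sum>i\<in>I. \<Sum>j\<in>J. cmod (A i j))"
  proof (rule sum_mono)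
    fix i
    have "cmod (\<Sum>j\<in>J. A i j * v j) \<le> (\<Sum>j\<in>J. cmod (A i j * v j))" by (rule norm_sum)
    also have "\<dots> \<le> (\<Sum>j\<in>J. cmod (A i j))"
      by (rule sum_mono) (simp add: norm_mult 1 mult_left_le)
    finally show "cmod (\<Sum>j\<in>J. A i j * v j) \<le> (\<Sum>j\<in>J. cmod (A i j))" .
  qed
  finally show "l2 I (\<lambda>i. \<Sum>j\<in>J. A i j * v j) \<le> (\<Sum>i\<in>I. \<Sum>j\<in>J. cmod (A i j))" .
qed

lemma opn_bound:
  assumes "finite I" "finite J"
  shows "l2 I (\<lambda>i. \<Sum>j\<in>J. A i j * v j) \<le> opn I J A * l2 J v"
proof (cases "l2 J v = 0")
  case True
  then have "\<And>j. j \<in> J \<Longrightarrow> v j = 0"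
    using assms(2) by (simp add: L2_set_eq_0_iff)
  then have "(\<Sum>j\<in>J. A i j * v j) = 0" for i by (simp add: sum.neutral)
  then show ?thesis using True by simp
next
  case False
  define s where "s = l2 J v"
  have s: "s > 0" using False by (simp add: s_def less_le)
  define w where "w j = complex_of_real (1 / s) * v j" for j
  have "l2 J w = 1"
    unfolding w_def l2_scale using s by (simp add: s_def[symmetric] norm_divide)
  then have "l2 I (\<lambda>i. \<Sum>j\<in>J. A i j * w j) \<le> opn I J A"
    unfolding opn_def by (intro cSUP_upper opn_bdd assms) simp
  moreover have "(\<Sum>j\<in>J. A i j * w j) = complex_of_real (1 / s) * (\<Sum>j\<in>J. A i j * v j)" for i
    by (simp add: w_def sum_distrib_left mult_ac)
  ultimately have "(1 / s) * l2 I (\<lambda>i. \<Sum>j\<in>J. A i j * v j) \<le> opn I J A"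
    using s by (simp only: l2_scale) (simp add: norm_divide)
  then show ?thesis using s by (simp add: s_def[symmetric] field_simps)
qed

lemma opn_nonneg: "finite I \<Longrightarrow> finite J \<Longrightarrow> 0 \<le> opn I J A"
proof -
  assume f: "finite I" "finite J"
  have "0 \<le> l2 I (\<lambda>i. \<Sum>j\<in>J. A i j * (\<lambda>_. 0) j)" by simp
  also have "\<dots> \<le> opn I J A"
    unfolding opn_def using f by (intro cSUP_upper opn_bdd) simp_all
  finally show ?thesis .
qed

lemma opn_cong:
  assumes "\<And>i j. i \<in> I \<Longrightarrow> j \<in> J \<Longrightarrow> A i j = B i j"
  shows "opn I J A = opn I J B"
proof -
  have "l2 I (\<lambda>i. \<Sum>j\<in>J. A i j * v j) = l2 I (\<lambda>i. \<Sum>j\<in>J. B i j * v j)" for v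
    by (intro l2_cong sum.cong) (auto simp: assms)
  then show ?thesis by (simp add: opn_def)
qed

lemma cauchy_schwarz_l2: "cmod (\<Sum>i\<in>I. u i * v i) \<le> l2 I u * l2 I v"
proof -
  have "cmod (\<Sum>i\<in>I. u i * v i) \<le> (\<Sum>i\<in>I. \<bar>cmod (u i)\<bar> * \<bar>cmod (v i)\<bar>)"
    by (rule order_trans[OF norm_sum]) (simp add: norm_mult)
  also have "\<dots> \<le> l2 I u * l2 I v" by (rule L2_set_mult_ineq)
  finally show ?thesis .
qed

lemma opn_bilinear:
  assumes "finite I" "finite J"
  shows "cmod (\<Sum>i\<in>I. \<Sum>j\<in>J. u i * A i j * v j) \<le> opn I J A * l2 I u * l2 J v"
proof -
  have "(\<Sum>i\<in>I. \<Sum>j\<in>J. u i * A i j * v j) = (\<Sum>i\<in>I. u i * (\<Sum>j\<in>J. A i j * v j))"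
    by (simp add: sum_distrib_left mult_ac)
  also have "cmod \<dots> \<le> l2 I u * l2 I (\<lambda>i. \<Sum>j\<in>J. A i j * v j)"
    by (rule cauchy_schwarz_l2)
  also have "\<dots> \<le> l2 I u * (opn I J A * l2 J v)"
    by (intro mult_left_mono opn_bound assms) simp
  finally show ?thesis by (simp add: mult_ac)
qed

text \<open>
  Testing with \<open>u = cnj (A v)\<close> turns the bilinear bound into \<open>\<parallel>A v\<parallel>\<^sup>2 \<le> c \<parallel>A v\<parallel> \<parallel>v\<parallel>\<close>.
\<close>

lemma opn_le_bilinear:
  assumes "0 \<le> c"
    and b: "\<And>u v. cmod (\<Sum>i\<in>I. \<Sum>j\<in>J. u i * A i j * v j) \<le> c * l2 I u * l2 J v"
  shows "opn I J A \<le> c"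
proof (rule opn_le[OF assms(1)])
  fix v
  define w where "w i = (\<Sum>j\<in>J. A i j * v j)" for i
  have "(l2 I w)\<^sup>2 = cmod (\<Sum>i\<in>I. \<Sum>j\<in>J. cnj (w i) * A i j * v j)"
  proof -
    have "(\<Sum>i\<in>I. \<Sum>j\<in>J. cnj (w i) * A i j * v j) = (\<Sum>i\<in>I. cnj (w i) * w i)"
      by (subst (2) w_def) (simp add: sum_distrib_left mult_ac)
    also have "\<dots> = complex_of_real (\<Sum>i\<in>I. (cmod (w i))\<^sup>2)"
      unfolding of_real_sum
      by (rule sum.cong) (simp_all only: complex_norm_square mult.commute)
    also have "\<dots> = complex_of_real ((l2 I w)\<^sup>2)" by (simp only: l2_power2)
    finally have "cmod (\<Sum>i\<in>I. \<Sum>j\<in>J. cnj (w i) * A i j * v j)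
        = cmod (complex_of_real ((l2 I w)\<^sup>2))" by (rule arg_cong)
    then show ?thesis by (simp only: norm_of_real abs_of_nonneg zero_le_power2)
  qed
  also have "\<dots> \<le> c * l2 I w * l2 J v" using b[of "\<lambda>i. cnj (w i)" v] by simp
  finally have *: "l2 I w * l2 I w \<le> l2 I w * (c * l2 J v)" by (simp add: power2_eq_square mult_ac)
  have "l2 I w \<le> c * l2 J v"
  proof (cases "l2 I w = 0")
    case True then show ?thesis using assms(1) by simp
  next
    case False
    then have "l2 I w > 0" by (simp add: less_le)
    then show ?thesis using * by simp
  qed
  then show "l2 I (\<lambda>i. \<Sum>j\<in>J. A i j * v j) \<le> c * l2 J v" by (simp add: w_def)
qed

lemma opn_transpose_le:
  assumes "finite I" "finite J"
  shows "opn J I (\<lambda>j i. A i j) \<le> opn I J A"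
proof (rule opn_le_bilinear)
  show "0 \<le> opn I J A" using assms by (rule opn_nonneg)
  fix u v
  have "(\<Sum>j\<in>J. \<Sum>i\<in>I. u j * A i j * v i) = (\<Sum>i\<in>I. \<Sum>j\<in>J. v i * A i j * u j)"
    by (subst sum.swap) (simp add: mult_ac)
  then show "cmod (\<Sum>j\<in>J. \<Sum>i\<in>I. u j * A i j * v i) \<le> opn I J A * l2 J u * l2 I v"
    using opn_bilinear[OF assms, of v A u] by (simp add: mult_ac)
qed

lemma opn_transpose:
  assumes "finite I" "finite J"
  shows "opn J I (\<lambda>j i. A i j) = opn I J A"
  using opn_transpose_le[OF assms, of A] opn_transpose_le[OF assms(2,1), of "\<lambda>j i. A i j"] by simp

lemma opn_mult:
  assumes "finite I" "finite J" "finite K"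
  shows "opn I K (\<lambda>i k. \<Sum>j\<in>J. A i j * B j k) \<le> opn I J A * opn J K B"
proof (rule opn_le)
  show "0 \<le> opn I J A * opn J K B" using assms by (simp add: opn_nonneg)
  fix v
  have "(\<Sum>k\<in>K. (\<Sum>j\<in>J. A i j * B j k) * v k) = (\<Sum>j\<in>J. A i j * (\<Sum>k\<in>K. B j k * v k))" for i
    unfolding sum_distrib_left sum_distrib_right by (subst sum.swap) (simp add: mult_ac)
  then have "l2 I (\<lambda>i. \<Sum>k\<in>K. (\<Sum>j\<in>J. A i j * B j k) * v k)
      \<le> opn I J A * l2 J (\<lambda>j. \<Sum>k\<in>K. B j k * v k)"
    using opn_bound[OF assms(1,2), of A "\<lambda>j. \<Sum>k\<in>K. B j k * v k"] by simp
  also have "\<dots> \<le> opn I J A * (opn J K B * l2 K v)"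
    using assms by (intro mult_left_mono opn_bound opn_nonneg)
  finally show "l2 I (\<lambda>i. \<Sum>k\<in>K. (\<Sum>j\<in>J. A i j * B j k) * v k) \<le> opn I J A * opn J K B * l2 K v"
    by (simp add: mult_ac)
qed

lemma opn_triangle:
  assumes "finite I" "finite J"
  shows "opn I J (\<lambda>i j. A i j + B i j) \<le> opn I J A + opn I J B"
proof (rule opn_le)
  show "0 \<le> opn I J A + opn I J B" using assms by (simp add: opn_nonneg)
  fix v
  have "l2 I (\<lambda>i. \<Sum>j\<in>J. (A i j + B i j) * v j)
      = l2 I (\<lambda>i. (\<Sum>j\<in>J. A i j * v j) + (\<Sum>j\<in>J. B i j * v j))"
    by (simp add: distrib_right sum.distrib)
  also have "\<dots> \<le> opn I J A * l2 J v + opn I J B * l2 J v"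
    by (intro order_trans[OF l2_triangle] add_mono opn_bound assms)
  finally show "l2 I (\<lambda>i. \<Sum>j\<in>J. (A i j + B i j) * v j) \<le> (opn I J A + opn I J B) * l2 J v"
    by (simp add: distrib_right)
qed

lemma opn_scale:
  assumes "finite I" "finite J"
  shows "opn I J (\<lambda>i j. c * A i j) = cmod c * opn I J A"
proof -
  have le: "opn I J (\<lambda>i j. c * A i j) \<le> cmod c * opn I J A" for c A
  proof (rule opn_le)
    show "0 \<le> cmod c * opn I J A" using assms by (simp add: opn_nonneg)
    fix v
    have "(\<Sum>j\<in>J. c * A i j * v j) = c * (\<Sum>j\<in>J. A i j * v j)" for i
      by (simp add: sum_distrib_left mult_ac)
    then show "l2 I (\<lambda>i. \<Sum>j\<in>J. c * A i j * v j) \<le> cmod c * opn I J A * l2 J v"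
      using mult_left_mono[OF opn_bound[OF assms, of A v], of "cmod c"]
      by (simp only: l2_scale) (simp add: mult_ac)
  qed
  show ?thesis
  proof (cases "c = 0")
    case True
    then show ?thesis using le[of c A] opn_nonneg[OF assms, of "\<lambda>i j. c * A i j"] by simp
  next
    case False
    have "opn I J A = opn I J (\<lambda>i j. inverse c * (c * A i j))"
      using False by (simp add: mult.assoc[symmetric])
    also have "\<dots> \<le> cmod (inverse c) * opn I J (\<lambda>i j. c * A i j)" by (rule le)
    finally have "cmod c * opn I J A \<le> opn I J (\<lambda>i j. c * A i j)"
      using False by (simp add: norm_inverse norm_divide pos_divide_le_eq field_simps)
    with le[of c A] show ?thesis by simp
  qed
qed

text \<open>
  Vectors are transported along the bijection of the columns, which preserves their norms.
\<close>

lemma opn_reindex_le: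
  assumes f: "bij_betw f I I'" and g: "bij_betw g J J'" and fin: "finite I'" "finite J'"
  shows "opn I J (\<lambda>i j. A (f i) (g j)) \<le> opn I' J' A"
proof (rule opn_le)
  show "0 \<le> opn I' J' A" using fin by (rule opn_nonneg)
  fix v :: "_ \<Rightarrow> complex"
  define w where "w j = v (the_inv_into J g j)" for j
  have w: "w (g j) = v j" if "j \<in> J" for j
    using that g by (simp add: w_def the_inv_into_f_f bij_betw_def)
  have "(\<Sum>j\<in>J. A i (g j) * v j) = (\<Sum>j\<in>J'. A i j * w j)" for i
    using sum.reindex_bij_betw[OF g, of "\<lambda>j. A i j * w j"] by (simp add: w)
  then have "l2 I (\<lambda>i. \<Sum>j\<in>J. A (f i) (g j) * v j) = l2 I' (\<lambda>i. \<Sum>j\<in>J'. A i j * w j)"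
    using sum.reindex_bij_betw[OF f, of "\<lambda>i. (cmod (\<Sum>j\<in>J'. A i j * w j))\<^sup>2"]
    by (simp add: L2_set_def)
  also have "\<dots> \<le> opn I' J' A * l2 J' w" using fin by (rule opn_bound)
  also have "l2 J' w = l2 J v"
    using sum.reindex_bij_betw[OF g, of "\<lambda>j. (cmod (w j))\<^sup>2"] by (simp add: L2_set_def w)
  finally show "l2 I (\<lambda>i. \<Sum>j\<in>J. A (f i) (g j) * v j) \<le> opn I' J' A * l2 J v" .
qed

lemma opn_reindex:
  assumes f: "bij_betw f I I'" and g: "bij_betw g J J'" and fin: "finite I'" "finite J'"
  shows "opn I J (\<lambda>i j. A (f i) (g j)) = opn I' J' A"
proof (rule antisym[OF opn_reindex_le[OF assms]])
  have fin': "finite I" "finite J"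
    using bij_betw_finite[OF f] bij_betw_finite[OF g] fin by auto
  have "opn I' J' (\<lambda>i j. A (f (the_inv_into I f i)) (g (the_inv_into J g j)))
      \<le> opn I J (\<lambda>i j. A (f i) (g j))"
    by (rule opn_reindex_le[OF bij_betw_the_inv_into[OF f] bij_betw_the_inv_into[OF g] fin'])
  also have "opn I' J' (\<lambda>i j. A (f (the_inv_into I f i)) (g (the_inv_into J g j))) = opn I' J' A"
    using f g by (intro opn_cong) (auto simp: f_the_inv_into_f_bij_betw)
  finally show "opn I' J' A \<le> opn I J (\<lambda>i j. A (f i) (g j))" .
qed

lemma l2_Sigma:
  assumes "finite I" "\<And>i. i \<in> I \<Longrightarrow> finite (K i)"
  shows "(l2 (Sigma I K) v)\<^sup>2 = (\<Sum>i\<in>I. (l2 (K i) (\<lambda>k. v (i, k)))\<^sup>2)"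
  unfolding l2_power2 using assms by (subst sum.Sigma) auto

text \<open>
  By orthogonality of the blocks, \<open>\<parallel>A v\<parallel>\<^sup>2\<close> is the sum of the \<open>\<parallel>A\<^sub>k v\<^sub>k\<parallel>\<^sup>2\<close>. The bound c is kept
  separate from the norms of the blocks so that K may be empty.
\<close>

lemma opn_block_diagonal:
  assumes fin: "finite K" "\<And>k. k \<in> K \<Longrightarrow> finite (I k)" "\<And>k. k \<in> K \<Longrightarrow> finite (J k)"
    and c: "0 \<le> c" and A: "\<And>k. k \<in> K \<Longrightarrow> opn (I k) (J k) (A k) \<le> c"
  shows "opn (Sigma K I) (Sigma K J) (\<lambda>(k, i) (l, j). if k = l then A k i j else 0) \<le> c"
proof (rule opn_le[OF c])
  fix v :: "_ \<Rightarrow> complex"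
  define w where
    "w i = (\<Sum>j\<in>Sigma K J. (case i of (k, i) \<Rightarrow> \<lambda>(l, j). if k = l then A k i j else 0) j * v j)" for i
  have w: "w (k, i) = (\<Sum>j\<in>J k. A k i j * v (k, j))" if "k \<in> K" for k i
  proof -
    have "w (k, i) = (\<Sum>l\<in>K. \<Sum>j\<in>J l. (if k = l then A k i j else 0) * v (l, j))"
      unfolding w_def using fin by (subst sum.Sigma) (auto simp: split_def intro!: sum.cong)
    also have "\<dots> = (\<Sum>l\<in>K. if k = l then (\<Sum>j\<in>J k. A k i j * v (k, j)) else 0)"
      by (intro sum.cong) auto
    finally show ?thesis using that fin by simp
  qed
  have "(l2 (Sigma K I) w)\<^sup>2 = (\<Sum>k\<in>K. (l2 (I k) (\<lambda>i. \<Sum>j\<in>J k. A k i j * v (k, j)))\<^sup>2)"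
    by (subst l2_Sigma) (auto simp: fin w intro!: sum.cong)
  also have "\<dots> \<le> (\<Sum>k\<in>K. (c * l2 (J k) (\<lambda>j. v (k, j)))\<^sup>2)"
  proof (intro sum_mono power_mono)
    fix k assume k: "k \<in> K"
    show "l2 (I k) (\<lambda>i. \<Sum>j\<in>J k. A k i j * v (k, j)) \<le> c * l2 (J k) (\<lambda>j. v (k, j))"
      by (rule order_trans[OF opn_bound[OF fin(2,3)[OF k]] mult_right_mono[OF A[OF k]]]) simp
  qed simp
  also have "\<dots> = (c * l2 (Sigma K J) v)\<^sup>2"
    by (subst power_mult_distrib, subst l2_Sigma) (auto simp: fin power_mult_distrib sum_distrib_left)
  finally have "l2 (Sigma K I) w \<le> c * l2 (Sigma K J) v"
    by (rule power2_le_imp_le) (simp add: c)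
  then show "l2 (Sigma K I) (\<lambda>i. \<Sum>j\<in>Sigma K J.
      (case i of (k, i) \<Rightarrow> \<lambda>(l, j). if k = l then A k i j else 0) j * v j) \<le> c * l2 (Sigma K J) v"
    by (simp only: w_def)
qed

text \<open>
  The hypothesis says that the columns are orthogonal with norm c, so \<open>\<parallel>A v\<parallel> = c \<parallel>v\<parallel>\<close>. Equality is
  not claimed, since J may be empty.
\<close>

lemma opn_isometry:
  assumes fin: "finite I" "finite J" and c: "0 \<le> c"
    and A: "\<And>j j'. j \<in> J \<Longrightarrow> j' \<in> J \<Longrightarrow>
      (\<Sum>i\<in>I. cnj (A i j) * A i j') = (if j = j' then complex_of_real (c\<^sup>2) else 0)"
  shows "opn I J A \<le> c"
proof (rule opn_le[OF c])
  fix v :: "_ \<Rightarrow> complex"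
  have "complex_of_real ((l2 I (\<lambda>i. \<Sum>j\<in>J. A i j * v j))\<^sup>2)
      = (\<Sum>i\<in>I. cnj (\<Sum>j\<in>J. A i j * v j) * (\<Sum>j'\<in>J. A i j' * v j'))"
    unfolding l2_power2 of_real_sum
    by (rule sum.cong) (simp_all only: complex_norm_square mult.commute)
  also have "\<dots> = (\<Sum>i\<in>I. \<Sum>j\<in>J. \<Sum>j'\<in>J. cnj (v j) * v j' * (cnj (A i j) * A i j'))"
    by (simp add: sum_product) (simp add: mult_ac)
  also have "\<dots> = (\<Sum>j\<in>J. \<Sum>i\<in>I. \<Sum>j'\<in>J. cnj (v j) * v j' * (cnj (A i j) * A i j'))"
    by (rule sum.swap)
  also have "\<dots> = (\<Sum>j\<in>J. \<Sum>j'\<in>J. \<Sum>i\<in>I. cnj (v j) * v j' * (cnj (A i j) * A i j'))"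
    by (intro sum.cong refl sum.swap)
  also have "\<dots> = (\<Sum>j\<in>J. \<Sum>j'\<in>J. cnj (v j) * v j' * (if j = j' then complex_of_real (c\<^sup>2) else 0))"
    by (intro sum.cong refl) (simp only: sum_distrib_left[symmetric] A)
  also have "\<dots> = (\<Sum>j\<in>J. cnj (v j) * v j * complex_of_real (c\<^sup>2))"
    using fin by (intro sum.cong refl) (simp add: if_distrib cong: if_cong)
  also have "\<dots> = complex_of_real ((c * l2 J v)\<^sup>2)"
    unfolding power_mult_distrib l2_power2 of_real_sum of_real_mult sum_distrib_left
    by (rule sum.cong) (simp_all only: complex_norm_square mult_ac)
  finally have "(l2 I (\<lambda>i. \<Sum>j\<in>J. A i j * v j))\<^sup>2 = (c * l2 J v)\<^sup>2"
    by (simp only: of_real_eq_iff)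
  then show "l2 I (\<lambda>i. \<Sum>j\<in>J. A i j * v j) \<le> c * l2 J v"
    using c by (simp add: power2_eq_iff_nonneg)
qed

lemma opn_select:
  assumes fin: "finite I" "finite L" and h: "inj_on h I" "h ` I \<subseteq> L"
  shows "opn I L (\<lambda>i r. if r = h i then 1 else 0) \<le> 1"
proof (rule opn_le)
  fix v :: "_ \<Rightarrow> complex"
  have "(\<Sum>r\<in>L. (if r = h i then 1 else 0) * v r) = v (h i)" if "i \<in> I" for i
  proof -
    have "(\<Sum>r\<in>L. (if r = h i then 1 else 0) * v r) = (\<Sum>r\<in>L. if r = h i then v (h i) else 0)"
      by (rule sum.cong) auto
    then show ?thesis using that h fin by auto
  qed
  then have "l2 I (\<lambda>i. \<Sum>r\<in>L. (if r = h i then 1 else 0) * v r) = l2 I (\<lambda>i. v (h i))"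
    by (intro l2_cong) auto
  also have "\<dots> = l2 (h ` I) v"
    using h by (simp add: L2_set_def sum.reindex)
  also have "\<dots> \<le> l2 L v"
    unfolding L2_set_def using fin h by (intro real_sqrt_le_mono sum_mono2) auto
  finally show "l2 I (\<lambda>i. \<Sum>r\<in>L. (if r = h i then 1 else 0) * v r) \<le> 1 * l2 L v" by simp
qed simp

section \<open>Matrix norms over arbitrary finite index sets\<close>

text \<open>
  Ruan's axioms for a family of matrix seminorms. All constructions below, namely \<open>S_inf\<close>,
  \<open>S_one\<close>, complex interpolation and \<open>ell_p\<close>, stay inside this class, so that estimates proved for
  the class apply to iterated constructions such as \<open>S\<^sub>q\<^sup>n[\<ell>\<^sub>p[E]]\<close>.
\<close>

definition ruan :: "('a::complex_vector) matnorms \<Rightarrow> bool"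
  where "ruan E \<longleftrightarrow>
    (\<forall>k x y. (\<forall>i<k. \<forall>j<k. x i j = y i j) \<longrightarrow> E k x = E k y) \<and>
    (\<forall>k x. 0 \<le> E k x) \<and>
    (\<forall>k c x. E k (scaleC c x) = cmod c * E k x) \<and>
    (\<forall>k x y. E k (x + y) \<le> E k x + E k y) \<and>
    (\<forall>k l x y. E (k + l) (direct_sum k x y) \<le> max (E k x) (E l y)) \<and>
    (\<forall>k l \<alpha> x \<beta>. E k (two_sided l \<alpha> x \<beta>) \<le> op_norm k l \<alpha> * E l x * op_norm l k \<beta>)"

lemma operator_space_imp_ruan: "operator_space E \<Longrightarrow> ruan E"
  unfolding operator_space_def ruan_def by simp

lemma ruan_local: "ruan E \<Longrightarrow> (\<And>i j. i < k \<Longrightarrow> j < k \<Longrightarrow> x i j = y i j) \<Longrightarrow> E k x = E k y"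
  unfolding ruan_def by simp

lemma ruan_nonneg: "ruan E \<Longrightarrow> 0 \<le> E k x"
  and ruan_scale: "ruan E \<Longrightarrow> E k (scaleC c x) = cmod c * E k x"
  and ruan_triangle: "ruan E \<Longrightarrow> E k (x + y) \<le> E k x + E k y"
  and ruan_direct_sum: "ruan E \<Longrightarrow> E (k + l) (direct_sum k x y) \<le> max (E k x) (E l y)"
  and ruan_two_sided: "ruan E \<Longrightarrow> E k (two_sided l \<alpha> x \<beta>) \<le> op_norm k l \<alpha> * E l x * op_norm l k \<beta>"
  unfolding ruan_def by blast+

definition cseminorm :: "('a::complex_vector \<Rightarrow> real) \<Rightarrow> bool"
  where "cseminorm N \<longleftrightarrow> (\<forall>x. 0 \<le> N x) \<and> (\<forall>x y. N (x + y) \<le> N x + N y) \<and>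
    (\<forall>c x. N (scaleC c x) = cmod c * N x)"

lemma cseminorm_nonneg: "cseminorm N \<Longrightarrow> 0 \<le> N x"
  and cseminorm_add: "cseminorm N \<Longrightarrow> N (x + y) \<le> N x + N y"
  and cseminorm_scale: "cseminorm N \<Longrightarrow> N (scaleC c x) = cmod c * N x"
  unfolding cseminorm_def by auto

lemma ruan_cseminorm: "ruan E \<Longrightarrow> cseminorm (E k)"
  unfolding cseminorm_def using ruan_nonneg ruan_triangle ruan_scale by blast

definition enum :: "'i set \<Rightarrow> nat \<Rightarrow> 'i"
  where "enum I = (SOME h. bij_betw h {..<card I} I)"

lemma bij_enum: "finite I \<Longrightarrow> bij_betw (enum I) {..<card I} I"
  unfolding enum_def
proof -
  assume "finite I"
  then have "\<exists>h. bij_betw h {..<card I} I"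
    using ex_bij_betw_nat_finite[of I] by (simp add: atLeast0LessThan)
  then show "bij_betw (SOME h. bij_betw h {..<card I} I) {..<card I} I" by (rule someI_ex)
qed

text \<open>
  The norm of \<open>M\<^sub>I[E]\<close>. The enumeration of I is irrelevant: compressing by permutation matrices
  replaces it by any other one (\<open>mn_bij\<close>).
\<close>

definition mn :: "'a matnorms \<Rightarrow> 'i set \<Rightarrow> ('i \<Rightarrow> 'i \<Rightarrow> 'a) \<Rightarrow> real"
  where "mn E I x = E (card I) (\<lambda>i j. x (enum I i) (enum I j))"

lemma two_sided_bij:
  assumes E: "ruan E" and e: "bij_betw e {..<k} I" and f: "bij_betw f {..<l} L"
    and y: "\<And>i j. i \<in> I \<Longrightarrow> j \<in> I \<Longrightarrow> y i j = (\<Sum>r\<in>L. \<Sum>s\<in>L. scaleC (\<alpha> i r * \<beta> s j) (x r s))"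
  shows "E k (\<lambda>i j. y (e i) (e j))
    \<le> opn I L \<alpha> * E l (\<lambda>r s. x (f r) (f s)) * opn L I \<beta>"
proof -
  have fin: "finite I" "finite L"
    using bij_betw_finite[OF e] bij_betw_finite[OF f] by auto
  let ?y = "two_sided l (\<lambda>i r. \<alpha> (e i) (f r)) (\<lambda>r s. x (f r) (f s)) (\<lambda>s j. \<beta> (f s) (e j))"
  have "E k (\<lambda>i j. y (e i) (e j)) = E k ?y"
  proof (rule ruan_local[OF E])
    fix i j assume "i < k" "j < k"
    then have *: "e i \<in> I" "e j \<in> I" using e by (auto simp: bij_betw_def)
    have "?y i j = (\<Sum>r<l. \<Sum>s<l. (\<lambda>s. scaleC (\<alpha> (e i) (f r) * \<beta> s (e j)) (x (f r) s)) (f s))"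
      by (simp add: two_sided_def)
    also have "\<dots> = (\<Sum>r<l. (\<lambda>r. \<Sum>s\<in>L. scaleC (\<alpha> (e i) r * \<beta> s (e j)) (x r s)) (f r))"
      by (subst sum.reindex_bij_betw[OF f]) simp
    also have "\<dots> = (\<Sum>r\<in>L. \<Sum>s\<in>L. scaleC (\<alpha> (e i) r * \<beta> s (e j)) (x r s))"
      by (rule sum.reindex_bij_betw[OF f])
    finally show "y (e i) (e j) = ?y i j" by (simp add: y[OF *])
  qed
  also have "\<dots> \<le> op_norm k l (\<lambda>i r. \<alpha> (e i) (f r)) * E l (\<lambda>r s. x (f r) (f s))
      * op_norm l k (\<lambda>s j. \<beta> (f s) (e j))"
    by (rule ruan_two_sided[OF E])
  also have "op_norm k l (\<lambda>i r. \<alpha> (e i) (f r)) = opn I L \<alpha>"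
    unfolding op_norm_eq_opn by (rule opn_reindex[OF e f fin])
  also have "op_norm l k (\<lambda>s j. \<beta> (f s) (e j)) = opn L I \<beta>"
    unfolding op_norm_eq_opn by (rule opn_reindex[OF f e fin(2,1)])
  finally show ?thesis .
qed

lemma mn_two_sided:
  assumes "ruan E" "finite I" "finite L"
    and "\<And>i j. i \<in> I \<Longrightarrow> j \<in> I \<Longrightarrow> y i j = (\<Sum>r\<in>L. \<Sum>s\<in>L. scaleC (\<alpha> i r * \<beta> s j) (x r s))"
  shows "mn E I y \<le> opn I L \<alpha> * mn E L x * opn L I \<beta>"
  unfolding mn_def
  by (rule two_sided_bij[OF assms(1) bij_enum[OF assms(2)] bij_enum[OF assms(3)] assms(4)])

lemma mn_nonneg: "ruan E \<Longrightarrow> 0 \<le> mn E I x"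
  by (simp add: mn_def ruan_nonneg)

lemma mn_two_sided_le:
  assumes "ruan E" "finite I" "finite L"
    and "\<And>i j. i \<in> I \<Longrightarrow> j \<in> I \<Longrightarrow> y i j = (\<Sum>r\<in>L. \<Sum>s\<in>L. scaleC (\<alpha> i r * \<beta> s j) (x r s))"
    and "opn I L \<alpha> \<le> a" "opn L I \<beta> \<le> b"
  shows "mn E I y \<le> a * mn E L x * b"
proof -
  have "mn E I y \<le> opn I L \<alpha> * mn E L x * opn L I \<beta>" by (rule mn_two_sided[OF assms(1-4)])
  also have "\<dots> \<le> a * mn E L x * b"
    using assms opn_nonneg[OF assms(2,3), of \<alpha>] opn_nonneg[OF assms(3,2), of \<beta>]
    by (intro mult_mono mult_nonneg_nonneg mn_nonneg) auto
  finally show ?thesis .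
qed

lemma sum_delta2:
  fixes x :: "'i \<Rightarrow> 'i \<Rightarrow> 'a::complex_vector"
  assumes "finite L" "a \<in> L" "b \<in> L"
  shows "(\<Sum>r\<in>L. \<Sum>s\<in>L. scaleC ((if r = a then 1 else 0) * (if s = b then 1 else 0)) (x r s)) = x a b"
proof -
  have "(\<Sum>r\<in>L. \<Sum>s\<in>L. scaleC ((if r = a then 1 else 0) * (if s = b then 1 else 0)) (x r s))
    = (\<Sum>r\<in>L. if r = a then (\<Sum>s\<in>L. if s = b then x a b else 0) else 0)"
    by (intro sum.cong) (auto simp: scaleC_one intro!: sum.cong sum.neutral)
  then show ?thesis using assms by simp
qed

lemma mn_bij:
  assumes E: "ruan E" and e: "bij_betw e {..<k} I"
  shows "mn E I x = E k (\<lambda>i j. x (e i) (e j))"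
proof -
  have fin: "finite I" using bij_betw_finite[OF e] by auto
  let ?d = "\<lambda>i r. if r = i then 1 else 0 :: complex"
  let ?d' = "\<lambda>s j. if s = j then 1 else 0 :: complex"
  have d: "opn I I ?d \<le> 1" using opn_select[OF fin fin, of "\<lambda>i. i"] by simp
  have d': "opn I I ?d' \<le> 1" using opn_transpose[OF fin fin, of ?d] d by simp
  have x: "x i j = (\<Sum>r\<in>I. \<Sum>s\<in>I. scaleC (?d i r * ?d' s j) (x r s))" if "i \<in> I" "j \<in> I" for i j
    using sum_delta2[OF fin that, of x] by simp
  have *: "E m (\<lambda>i j. x (g i) (g j)) \<le> E m' (\<lambda>i j. x (h i) (h j))"
    if "bij_betw g {..<m} I" "bij_betw h {..<m'} I" for g h m m'
  proof -
    let ?X = "E m' (\<lambda>i j. x (h i) (h j))"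
    have "E m (\<lambda>i j. x (g i) (g j)) \<le> opn I I ?d * ?X * opn I I ?d'"
      by (rule two_sided_bij[OF E that x])
    also have "\<dots> \<le> 1 * ?X * 1"
      using d d' by (intro mult_mono mult_nonneg_nonneg ruan_nonneg[OF E] opn_nonneg fin) auto
    finally show ?thesis by simp
  qed
  show ?thesis
    unfolding mn_def using *[OF e bij_enum[OF fin]] *[OF bij_enum[OF fin] e] by (rule antisym[rotated])
qed

lemma mn_lessThan: "ruan E \<Longrightarrow> mn E {..<k} x = E k x"
  using mn_bij[of E "\<lambda>i. i" k "{..<k}" x] by (simp add: bij_betw_def)

lemma mn_reindex:
  assumes "ruan E" "finite I" and h: "bij_betw h I L"
  shows "mn E L x = mn E I (\<lambda>i j. x (h i) (h j))"
  using mn_bij[OF assms(1) bij_betw_trans[OF bij_enum[OF assms(2)] h], of x] by (simp add: mn_def)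

text \<open>
  Choosing rows and columns by an injection is a two-sided multiplication with partial isometries.
\<close>

lemma mn_compress:
  assumes E: "ruan E" and fin: "finite I" "finite L" and h: "inj_on h I" "h ` I \<subseteq> L"
    and y: "\<And>i j. i \<in> I \<Longrightarrow> j \<in> I \<Longrightarrow> y i j = x (h i) (h j)"
  shows "mn E I y \<le> mn E L x"
proof -
  have "mn E I y \<le> 1 * mn E L x * 1"
  proof (rule mn_two_sided_le[OF E fin])
    show "y i j = (\<Sum>r\<in>L. \<Sum>s\<in>L. scaleC ((if r = h i then 1 else 0) * (if s = h j then 1 else 0)) (x r s))"
      if "i \<in> I" "j \<in> I" for i j
    proof -
      have "h i \<in> L" "h j \<in> L" using that h by auto
      then show ?thesis by (simp only: sum_delta2[OF fin(2)] y[OF that])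
    qed
    show "opn I L (\<lambda>i r. if r = h i then 1 else 0) \<le> 1" by (rule opn_select[OF fin h])
    then show "opn L I (\<lambda>s j. if s = h j then 1 else 0) \<le> 1"
      using opn_transpose[OF fin, of "\<lambda>i r. if r = h i then 1 else 0"] by simp
  qed
  then show ?thesis by simp
qed

lemma mn_cong:
  assumes "ruan E" "finite I" "\<And>i j. i \<in> I \<Longrightarrow> j \<in> I \<Longrightarrow> x i j = y i j"
  shows "mn E I x = mn E I y"
  unfolding mn_def using bij_enum[OF assms(2)]
  by (intro ruan_local[OF assms(1)] assms(3)) (auto simp: bij_betw_def)

lemma mn_cseminorm: "ruan E \<Longrightarrow> cseminorm (mn E I)"
  unfolding cseminorm_def mn_def
proof (intro conjI allI)
  assume E: "ruan E"
  let ?k = "card I" and ?e = "\<lambda>x i j. x (enum I i) (enum I j)"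
  show "0 \<le> E ?k (?e x)" for x by (rule ruan_nonneg[OF E])
  show "E ?k (?e (x + y)) \<le> E ?k (?e x) + E ?k (?e y)" for x y
    using ruan_triangle[OF E, of ?k "?e x" "?e y"] by (simp add: plus_fun_def)
  show "E ?k (?e (scaleC c x)) = cmod c * E ?k (?e x)" for c x
    using ruan_scale[OF E, of ?k c "?e x"] by (simp add: scaleC_fun_def)
qed

lemma cseminorm_zero: "cseminorm N \<Longrightarrow> N 0 = 0"
  using cseminorm_scale[of N 0 0] by simp

lemma mn_zero: "ruan E \<Longrightarrow> finite I \<Longrightarrow> (\<And>i j. i \<in> I \<Longrightarrow> j \<in> I \<Longrightarrow> x i j = 0) \<Longrightarrow> mn E I x = 0"
  using mn_cong[of E I x 0] cseminorm_zero[OF mn_cseminorm[of E I]] by simp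

text \<open>
  An enumeration of A followed by one of B exhibits the matrix as a direct sum.
\<close>

lemma mn_Un:
  assumes E: "ruan E" and fin: "finite A" "finite B" and disj: "A \<inter> B = {}"
    and z: "\<And>a b. a \<in> A \<Longrightarrow> b \<in> B \<Longrightarrow> x a b = 0 \<and> x b a = 0"
  shows "mn E (A \<union> B) x \<le> max (mn E A x) (mn E B x)"
proof -
  let ?k = "card A" and ?l = "card B"
  define h where "h i = (if i < ?k then enum A i else enum B (i - ?k))" for i
  have A: "enum A i \<in> A" if "i < ?k" for i using that bij_enum[OF fin(1)] by (auto simp: bij_betw_def)
  have B: "enum B i \<in> B" if "i < ?l" for i using that bij_enum[OF fin(2)] by (auto simp: bij_betw_def)
  have 1: "bij_betw h {..<?k} A"
    using bij_enum[OF fin(1)] by (rule bij_betw_cong[THEN iffD1, rotated]) (simp add: h_def)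
  have "bij_betw (enum B \<circ> (\<lambda>i. i - ?k)) {?k..<?k + ?l} B"
    by (rule bij_betw_trans[OF _ bij_enum[OF fin(2)]], rule bij_betw_byWitness[where f' = "\<lambda>i. i + ?k"]) auto
  then have 2: "bij_betw h {?k..<?k + ?l} B"
    by (rule bij_betw_cong[THEN iffD1, rotated]) (simp add: h_def)
  have "bij_betw h ({..<?k} \<union> {?k..<?k + ?l}) (A \<union> B)"
    by (rule bij_betw_combine[OF 1 2 disj])
  also have "{..<?k} \<union> {?k..<?k + ?l} = {..<?k + ?l}" by auto
  finally have "mn E (A \<union> B) x = E (?k + ?l) (\<lambda>i j. x (h i) (h j))" by (rule mn_bij[OF E])
  also have "\<dots> = E (?k + ?l) (direct_sum ?k (\<lambda>i j. x (enum A i) (enum A j)) (\<lambda>i j. x (enum B i) (enum B j)))"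
    by (rule ruan_local[OF E]) (auto simp: direct_sum_def h_def z A B)
  also have "\<dots> \<le> max (mn E A x) (mn E B x)" unfolding mn_def by (rule ruan_direct_sum[OF E])
  finally show ?thesis .
qed

lemma mn_block_diagonal:
  assumes E: "ruan E" and fin: "finite K" "\<And>k. k \<in> K \<Longrightarrow> finite (I k)" and c: "0 \<le> c"
    and x: "\<And>k. k \<in> K \<Longrightarrow> mn E (I k) (x k) \<le> c"
  shows "mn E (Sigma K I) (\<lambda>(k, i) (l, j). if k = l then x k i j else 0) \<le> c"
  using fin x
proof (induction K rule: finite_induct)
  case empty
  have "mn E (Sigma {} I) (\<lambda>(k, i) (l, j). if k = l then x k i j else 0) = 0"
    by (rule mn_zero[OF E]) auto
  then show ?case using c by simp
next
  case (insert g K)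
  let ?x = "\<lambda>(k, i) (l, j). if k = l then x k i j else 0"
  have "Sigma (insert g K) I = {g} \<times> I g \<union> Sigma K I" by auto
  then have "mn E (Sigma (insert g K) I) ?x \<le> max (mn E ({g} \<times> I g) ?x) (mn E (Sigma K I) ?x)"
    using insert.hyps insert.prems by (simp only:) (intro mn_Un[OF E]; auto)
  moreover have "mn E ({g} \<times> I g) ?x = mn E (I g) (x g)"
    using mn_reindex[OF E, of "I g" "Pair g" "{g} \<times> I g" ?x] insert.prems
    by (auto simp: bij_betw_def inj_on_def)
  moreover have "mn E (I g) (x g) \<le> c" "mn E (Sigma K I) ?x \<le> c"
    using insert by auto
  ultimately show ?case by linarith
qed

lemma opn_tensor_left:
  assumes "finite I" "finite J" "finite K"
  shows "opn (K \<times> I) (K \<times> J) (\<lambda>(k, i) (l, j). if k = l then A i j else 0) \<le> opn I J A"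
  using assms by (intro opn_block_diagonal) (auto simp: opn_nonneg)

lemma opn_tensor_right:
  assumes "finite I" "finite J" "finite K"
  shows "opn (I \<times> K) (J \<times> K) (\<lambda>(i, k) (j, l). if k = l then A i j else 0) \<le> opn I J A"
proof -
  have "opn (I \<times> K) (J \<times> K) (\<lambda>(i, k) (j, l). if k = l then A i j else 0)
     = opn (I \<times> K) (J \<times> K) (\<lambda>i j. (\<lambda>(k, i) (l, j). if k = l then A i j else 0) (prod.swap i) (prod.swap j))"
    by (intro opn_cong) auto
  also have "\<dots> = opn (K \<times> I) (K \<times> J) (\<lambda>(k, i) (l, j). if k = l then A i j else 0)"
    using assms by (intro opn_reindex) (auto simp: bij_betw_def)
  also have "\<dots> \<le> opn I J A" by (rule opn_tensor_left[OF assms])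
  finally show ?thesis .
qed

lemma sum_Times: "sum f (A \<times> B) = (\<Sum>a\<in>A. \<Sum>b\<in>B. f (a, b))"
  by (simp add: sum.cartesian_product)

text \<open>
  The matrices \<open>\<alpha> \<otimes> 1\<^sub>K\<close> and \<open>1\<^sub>K \<otimes> \<beta>\<close> have the norms of \<open>\<alpha>\<close> and \<open>\<beta>\<close>.
\<close>

lemma mn_two_sided_tensor_right:
  assumes E: "ruan E" and fin: "finite I" "finite L" "finite K"
    and y: "\<And>i j a b. i \<in> I \<Longrightarrow> j \<in> I \<Longrightarrow> a \<in> K \<Longrightarrow> b \<in> K \<Longrightarrow>
      y (i, a) (j, b) = (\<Sum>r\<in>L. \<Sum>s\<in>L. scaleC (\<alpha> i r * \<beta> s j) (x (r, a) (s, b)))"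
  shows "mn E (I \<times> K) y \<le> opn I L \<alpha> * mn E (L \<times> K) x * opn L I \<beta>"
proof (rule mn_two_sided_le[OF E])
  let ?a = "\<lambda>(i, k) (j, l). if k = l then \<alpha> i j else 0"
  let ?b = "\<lambda>(i, k) (j, l). if k = l then \<beta> i j else 0"
  show "opn (I \<times> K) (L \<times> K) ?a \<le> opn I L \<alpha>" "opn (L \<times> K) (I \<times> K) ?b \<le> opn L I \<beta>"
    using fin by (simp_all only: opn_tensor_right)
  fix p q assume "p \<in> I \<times> K" "q \<in> I \<times> K"
  then obtain i a j b where pq: "p = (i, a)" "q = (j, b)" and *: "i \<in> I" "a \<in> K" "j \<in> I" "b \<in> K" by auto
  have "(\<Sum>r\<in>L \<times> K. \<Sum>s\<in>L \<times> K. scaleC (?a p r * ?b s q) (x r s))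
     = (\<Sum>r\<in>L. \<Sum>c\<in>K. \<Sum>s\<in>L. \<Sum>d\<in>K. scaleC (?a p (r, c) * ?b (s, d) q) (x (r, c) (s, d)))"
    unfolding sum_Times ..
  also have "\<dots> = (\<Sum>r\<in>L. \<Sum>c\<in>K. if c = a then \<Sum>s\<in>L. \<Sum>d\<in>K. if d = b then
      scaleC (\<alpha> i r * \<beta> s j) (x (r, a) (s, b)) else 0 else 0)"
    by (intro sum.cong refl) (auto simp: pq intro!: sum.cong sum.neutral)
  also have "\<dots> = (\<Sum>r\<in>L. \<Sum>s\<in>L. scaleC (\<alpha> i r * \<beta> s j) (x (r, a) (s, b)))"
    using * fin by simp
  finally show "y p q = (\<Sum>r\<in>L \<times> K. \<Sum>s\<in>L \<times> K. scaleC (?a p r * ?b s q) (x r s))"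
    using y * pq by simp
qed (use fin in auto)

lemma mn_swap:
  assumes "ruan E" "finite I" "finite K"
  shows "mn E (K \<times> I) y = mn E (I \<times> K) (\<lambda>p q. y (prod.swap p) (prod.swap q))"
  using assms by (intro mn_reindex) (auto simp: bij_betw_def)

lemma mn_two_sided_tensor_left:
  assumes E: "ruan E" and fin: "finite I" "finite L" "finite K"
    and y: "\<And>i j a b. i \<in> I \<Longrightarrow> j \<in> I \<Longrightarrow> a \<in> K \<Longrightarrow> b \<in> K \<Longrightarrow>
      y (a, i) (b, j) = (\<Sum>r\<in>L. \<Sum>s\<in>L. scaleC (\<alpha> i r * \<beta> s j) (x (a, r) (b, s)))"
  shows "mn E (K \<times> I) y \<le> opn I L \<alpha> * mn E (K \<times> L) x * opn L I \<beta>"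
  unfolding mn_swap[OF E fin(1,3)] mn_swap[OF E fin(2,3)]
  by (rule mn_two_sided_tensor_right[OF E fin]) (simp add: y)

subsection \<open>Scalars\<close>

lemma scalars_eq_opn: "scalars k x = opn {..<k} {..<k} x"
  by (simp add: scalars_def op_norm_eq_opn)

text \<open>
  Orthogonality of the two blocks, as in \<open>opn_block_diagonal\<close>, but for the shifted indexing that
  \<open>direct_sum\<close> uses.
\<close>

lemma opn_direct_sum:
  "opn {..<k + l} {..<k + l} (direct_sum k x y) \<le> max (opn {..<k} {..<k} x) (opn {..<l} {..<l} y)"
    (is "_ \<le> ?m")
proof (rule opn_le)
  have m: "0 \<le> ?m" by (simp add: opn_nonneg le_max_iff_disj)
  then show "0 \<le> ?m" .
  fix v :: "nat \<Rightarrow> complex"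
  let ?u = "\<lambda>i. \<Sum>j<k + l. direct_sum k x y i j * v j"
  have split: "(\<Sum>i<k + l. f i) = (\<Sum>i<k. f i) + (\<Sum>i<l. f (k + i))" for f :: "nat \<Rightarrow> 'z::comm_monoid_add"
    by (induction l) (simp_all add: add.assoc)
  have u1: "?u i = (\<Sum>j<k. x i j * v j)" if "i < k" for i
    using that by (simp add: split direct_sum_def)
  have u2: "?u (k + i) = (\<Sum>j<l. y i j * v (k + j))" for i
    by (simp add: split direct_sum_def)
  have "(l2 {..<k + l} ?u)\<^sup>2 = (l2 {..<k} (\<lambda>i. \<Sum>j<k. x i j * v j))\<^sup>2
      + (l2 {..<l} (\<lambda>i. \<Sum>j<l. y i j * v (k + j)))\<^sup>2"
    unfolding l2_power2 split[of "\<lambda>i. (cmod (?u i))\<^sup>2"] by (simp add: u1 u2)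
  also have "\<dots> \<le> (?m * l2 {..<k} v)\<^sup>2 + (?m * l2 {..<l} (\<lambda>j. v (k + j)))\<^sup>2"
    by (intro add_mono power_mono order_trans[OF opn_bound mult_right_mono]) auto
  also have "\<dots> = (?m * l2 {..<k + l} v)\<^sup>2"
    by (simp add: power_mult_distrib l2_power2 split[of "\<lambda>i. (cmod (v i))\<^sup>2"] distrib_left)
  finally show "l2 {..<k + l} ?u \<le> ?m * l2 {..<k + l} v"
    by (rule power2_le_imp_le) (use m in simp)
qed

lemma ruan_scalars: "ruan scalars"
  unfolding ruan_def scalars_eq_opn op_norm_eq_opn
proof (intro conjI allI impI)
  fix k l c and \<alpha> x \<beta> y :: "complex matrix"
  show "\<forall>i<k. \<forall>j<k. x i j = y i j \<Longrightarrow> opn {..<k} {..<k} x = opn {..<k} {..<k} y"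
    by (rule opn_cong) auto
  show "0 \<le> opn {..<k} {..<k} x" by (simp add: opn_nonneg)
  show "opn {..<k} {..<k} (scaleC c x) = cmod c * opn {..<k} {..<k} x"
    using opn_scale[of "{..<k}" "{..<k}" c x] by (simp add: scaleC_fun_def)
  show "opn {..<k} {..<k} (x + y) \<le> opn {..<k} {..<k} x + opn {..<k} {..<k} y"
    using opn_triangle[of "{..<k}" "{..<k}" x y] by (simp add: plus_fun_def)
  show "opn {..<k + l} {..<k + l} (direct_sum k x y) \<le> max (opn {..<k} {..<k} x) (opn {..<l} {..<l} y)"
    by (rule opn_direct_sum)
  have "two_sided l \<alpha> x \<beta> = (\<lambda>i j. \<Sum>s<l. (\<Sum>r<l. \<alpha> i r * x r s) * \<beta> s j)"
    unfolding two_sided_def sum_distrib_right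
    by (subst sum.swap) (simp add: mult_ac)
  then have "opn {..<k} {..<k} (two_sided l \<alpha> x \<beta>)
      \<le> opn {..<k} {..<l} (\<lambda>i s. \<Sum>r<l. \<alpha> i r * x r s) * opn {..<l} {..<k} \<beta>"
    by (simp only:) (rule opn_mult; simp)
  also have "\<dots> \<le> opn {..<k} {..<l} \<alpha> * opn {..<l} {..<l} x * opn {..<l} {..<k} \<beta>"
    by (intro mult_right_mono opn_mult opn_nonneg) simp_all
  finally show "opn {..<k} {..<k} (two_sided l \<alpha> x \<beta>)
      \<le> opn {..<k} {..<l} \<alpha> * opn {..<l} {..<l} x * opn {..<l} {..<k} \<beta>" .
qed

lemma mn_scalars: "finite I \<Longrightarrow> mn scalars I x = opn I I x"
  unfolding mn_def scalars_eq_opn using bij_enum[of I] by (intro opn_reindex)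

subsection \<open>The spaces \<open>S_inf E\<close>\<close>

lemma bij_div_mod: "bij_betw (\<lambda>r. (r div m, r mod m)) {..<l * m} ({..<l} \<times> {..<m :: nat})"
proof (rule bij_betw_byWitness[where f' = "\<lambda>(a, b). a * m + b"])
  show "(\<lambda>(a, b). a * m + b) ` ({..<l} \<times> {..<m}) \<subseteq> {..<l * m}"
  proof clarsimp
    fix a b assume "a < l" "b < m"
    then have "a * m + b < Suc a * m" by simp
    also have "\<dots> \<le> l * m" using \<open>a < l\<close> by (intro mult_right_mono) auto
    finally show "a * m + b < l * m" .
  qed
  have "m > 0" if "r < l * m" for r using that by (cases m) auto
  then show "(\<lambda>r. (r div m, r mod m)) ` {..<l * m} \<subseteq> {..<l} \<times> {..<m}"
    by (auto simp: less_mult_imp_div_less)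
qed auto

lemma bij_flatten:
  "bij_betw (\<lambda>r. (r div CARD('n), from_nat_into (UNIV :: 'n::finite set) (r mod CARD('n))))
    {..<k * CARD('n)} ({..<k} \<times> UNIV)"
proof -
  have "bij_betw (map_prod id (from_nat_into (UNIV :: 'n set)) \<circ> (\<lambda>r. (r div CARD('n), r mod CARD('n))))
      {..<k * CARD('n)} ({..<k} \<times> UNIV)"
    by (intro bij_betw_trans[OF bij_div_mod] bij_betw_map_prod bij_betw_from_nat_into_finite) auto
  then show ?thesis by (simp add: comp_def map_prod_def)
qed

lemma S_inf_eq:
  fixes x :: "('a::complex_vector^'n^'n) matrix"
  assumes "ruan E"
  shows "S_inf E k x = mn E ({..<k} \<times> UNIV) (\<lambda>(i, a) (j, b). x i j $ a $ b)"
  unfolding S_inf_def mn_bij[OF assms bij_flatten] flatten_def by simp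

text \<open>
  Each axiom for \<open>S_inf E\<close> is the same axiom for E over a product index set.
\<close>

lemma ruan_S_inf:
  fixes E :: "('a::complex_vector) matnorms"
  assumes E: "ruan E"
  shows "ruan (S_inf E :: ('a^'n^'n) matnorms)"
  unfolding ruan_def S_inf_eq[OF E]
proof (intro conjI allI impI)
  fix k l c and \<alpha> \<beta> :: "complex matrix" and x y :: "('a^'n^'n) matrix"
  let ?x = "\<lambda>x :: ('a^'n^'n) matrix. \<lambda>(i, a) (j, b). x i j $ a $ b"
  let ?I = "\<lambda>k. {..<k} \<times> (UNIV :: 'n set)"
  show "\<forall>i<k. \<forall>j<k. x i j = y i j \<Longrightarrow> mn E (?I k) (?x x) = mn E (?I k) (?x y)"
    by (rule mn_cong[OF E]) auto
  show "0 \<le> mn E (?I k) (?x x)" by (rule mn_nonneg[OF E])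
  have "?x (scaleC c x) = scaleC c (?x x)" "?x (x + y) = ?x x + ?x y" by (auto simp: fun_eq_iff)
  then show "mn E (?I k) (?x (scaleC c x)) = cmod c * mn E (?I k) (?x x)"
    "mn E (?I k) (?x (x + y)) \<le> mn E (?I k) (?x x) + mn E (?I k) (?x y)"
    by (simp_all only: cseminorm_scale[OF mn_cseminorm[OF E]] cseminorm_add[OF mn_cseminorm[OF E]])
  show "mn E (?I (k + l)) (?x (direct_sum k x y)) \<le> max (mn E (?I k) (?x x)) (mn E (?I l) (?x y))"
  proof -
    let ?B = "{k..<k + l} \<times> (UNIV :: 'n set)" and ?z = "?x (direct_sum k x y)"
    have I: "?I (k + l) = ?I k \<union> ?B" by auto
    have "mn E (?I (k + l)) ?z \<le> max (mn E (?I k) ?z) (mn E ?B ?z)"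
      unfolding I by (rule mn_Un[OF E]) (auto simp: direct_sum_def)
    also have "mn E (?I k) ?z = mn E (?I k) (?x x)"
      by (rule mn_cong[OF E]) (auto simp: direct_sum_def)
    also have "mn E ?B ?z = mn E (?I l) (\<lambda>p q. ?z (map_prod ((+) k) id p) (map_prod ((+) k) id q))"
      by (rule mn_reindex[OF E]) (auto intro!: bij_betw_map_prod bij_betw_byWitness[where f' = "\<lambda>i. i - k"])
    also have "\<dots> = mn E (?I l) (?x y)"
      by (rule mn_cong[OF E]) (auto simp: direct_sum_def)
    finally show ?thesis .
  qed
  show "mn E (?I k) (?x (two_sided l \<alpha> x \<beta>)) \<le> op_norm k l \<alpha> * mn E (?I l) (?x x) * op_norm l k \<beta>"
    unfolding op_norm_eq_opn
    by (rule mn_two_sided_tensor_right[OF E]) (auto simp: two_sided_def)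
qed

lemma mn_S_inf:
  fixes x :: "'i \<Rightarrow> 'i \<Rightarrow> 'a::complex_vector^'n^'n"
  assumes E: "ruan E" and I: "finite I"
  shows "mn (S_inf E) I x = mn E (I \<times> UNIV) (\<lambda>(i, a) (j, b). x i j $ a $ b)"
proof -
  have "mn E (I \<times> UNIV) (\<lambda>(i, a) (j, b). x i j $ a $ b)
      = mn E ({..<card I} \<times> UNIV) (\<lambda>p q. (\<lambda>(i, a) (j, b). x i j $ a $ b)
          (map_prod (enum I) id p) (map_prod (enum I) id q))"
    by (rule mn_reindex[OF E]) (auto intro!: bij_betw_map_prod bij_enum[OF I])
  then show ?thesis
    unfolding mn_def[of "S_inf E"] S_inf_eq[OF E] by (simp add: split_def)
qed

section \<open>The dual structure on the trace class\<close>

text \<open>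
  Norms defined by infima are estimated through all strictly larger constants c.
\<close>

lemma le_mult_limit:
  fixes a b y :: real
  assumes "0 \<le> a" and "\<And>c. b < c \<Longrightarrow> y \<le> a * c"
  shows "y \<le> a * b"
proof (cases "a = 0")
  case True
  then show ?thesis using assms(2)[of "b + 1"] by simp
next
  case False
  then have a: "a > 0" using assms(1) by simp
  have "y / a \<le> b"
    by (rule dense_ge) (use assms(2) a in \<open>simp add: field_simps\<close>)
  then show ?thesis using a by (simp add: field_simps)
qed

text \<open>
  The matrix whose norm defines the dual structure: the entries of v are paired with those of B by
  \<open>tr(v B\<^sup>t)\<close>, which leaves a scalar matrix over the product of the two index sets.
\<close>

definition pairing :: "('i \<Rightarrow> 'i \<Rightarrow> complex^'n^'n) \<Rightarrow> ('j \<Rightarrow> 'j \<Rightarrow> complex^'n^'n) \<Rightarrow> 'i \<times> 'j \<Rightarrow> 'i \<times> 'j \<Rightarrow> complex"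
  where "pairing v B = (\<lambda>(i, r) (j, s). \<Sum>a\<in>UNIV. \<Sum>b\<in>UNIV. v i j $ a $ b * B r s $ a $ b)"

abbreviation flat :: "('j \<Rightarrow> 'j \<Rightarrow> 'a^'n^'n) \<Rightarrow> 'j \<times> 'n \<Rightarrow> 'j \<times> 'n \<Rightarrow> 'a"
  where "flat B \<equiv> \<lambda>(i, a) (j, b). B i j $ a $ b"

lemma opn_tensor:
  assumes "finite I" "finite J"
  shows "opn (I \<times> J) (I \<times> J) (\<lambda>(i, r) (j, s). A i j * B r s) \<le> opn I I A * opn J J B"
proof -
  let ?A = "\<lambda>(i, k) (j, l). if k = l then A i j else 0"
  let ?B = "\<lambda>(k, i) (l, j). if k = l then B i j else 0"
  have "opn (I \<times> J) (I \<times> J) (\<lambda>(i, r) (j, s). A i j * B r s)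
      = opn (I \<times> J) (I \<times> J) (\<lambda>p q. \<Sum>r\<in>I \<times> J. ?A p r * ?B r q)"
  proof (intro opn_cong)
    fix p q assume "p \<in> I \<times> J" "q \<in> I \<times> J"
    then obtain i r j s where pq: "p = (i, r)" "q = (j, s)" "i \<in> I" "r \<in> J" "j \<in> I" "s \<in> J" by auto
    have "(\<Sum>t\<in>I \<times> J. ?A p t * ?B t q) = (\<Sum>a\<in>I. if a = j then \<Sum>b\<in>J. if b = r then A i j * B r s else 0 else 0)"
      unfolding sum_Times by (intro sum.cong) (auto simp: pq intro!: sum.cong sum.neutral)
    also have "\<dots> = A i j * B r s" using pq assms by simp
    finally show "(case p of (i, r) \<Rightarrow> \<lambda>(j, s). A i j * B r s) q = (\<Sum>t\<in>I \<times> J. ?A p t * ?B t q)"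
      by (simp add: pq)
  qed
  also have "\<dots> \<le> opn (I \<times> J) (I \<times> J) ?A * opn (I \<times> J) (I \<times> J) ?B"
    using assms by (intro opn_mult) auto
  also have "\<dots> \<le> opn I I A * opn J J B"
    using assms by (intro mult_mono opn_tensor_left opn_tensor_right opn_nonneg) auto
  finally show ?thesis .
qed

lemma opn_sum:
  assumes "finite I" "finite J" "finite S"
  shows "opn I J (\<lambda>i j. \<Sum>a\<in>S. A a i j) \<le> (\<Sum>a\<in>S. opn I J (A a))"
  using assms(3)
proof (induction S rule: finite_induct)
  case empty
  show ?case by (rule opn_le) simp_all
next
  case (insert a S)
  have "opn I J (\<lambda>i j. \<Sum>a\<in>insert a S. A a i j) = opn I J (\<lambda>i j. A a i j + (\<Sum>a\<in>S. A a i j))"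
    using insert.hyps by simp
  also have "\<dots> \<le> opn I J (A a) + opn I J (\<lambda>i j. \<Sum>a\<in>S. A a i j)"
    by (rule opn_triangle[OF assms(1,2)])
  finally show ?case using insert by simp
qed

lemma opn_entry_le_flat:
  fixes B :: "'j \<Rightarrow> 'j \<Rightarrow> complex^'n^'n"
  assumes J: "finite J"
  shows "opn J J (\<lambda>r s. B r s $ a $ b) \<le> opn (J \<times> UNIV) (J \<times> UNIV) (flat B)"
proof -
  have JU: "finite (J \<times> (UNIV :: 'n set))" using J by simp
  have "mn scalars J (\<lambda>r s. B r s $ a $ b) \<le> 1 * mn scalars (J \<times> UNIV) (flat B) * 1"
  proof (rule mn_two_sided_le[OF ruan_scalars J JU])
    let ?h = "\<lambda>a j r. if r = (j, a) then 1 else 0 :: complex"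
    show h: "opn J (J \<times> UNIV) (?h a) \<le> 1" for a :: 'n
      by (rule opn_select[OF J JU]) (auto simp: inj_on_def)
    show "opn (J \<times> UNIV) J (\<lambda>s j. ?h b j s) \<le> 1"
      using opn_transpose[OF J JU, of "?h b"] h by simp
    fix i j assume "i \<in> J" "j \<in> J"
    then show "B i j $ a $ b = (\<Sum>r\<in>J \<times> UNIV. \<Sum>s\<in>J \<times> UNIV. scaleC (?h a i r * ?h b j s) (flat B r s))"
      by (subst sum_delta2) (use JU in auto)
  qed
  then show ?thesis by (simp add: mn_scalars J)
qed

text \<open>
  This crude bound, entry by entry, shows that the supremum in the definition of \<open>S_one_scalar\<close> is
  finite.
\<close>

lemma pairing_bdd:
  assumes "finite I" "finite J"
  shows "opn (I \<times> J) (I \<times> J) (pairing v B)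
    \<le> (\<Sum>a\<in>UNIV. \<Sum>b\<in>UNIV. opn I I (\<lambda>i j. v i j $ a $ b)) * opn (J \<times> UNIV) (J \<times> UNIV) (flat B)"
proof -
  have "opn (I \<times> J) (I \<times> J) (pairing v B) = opn (I \<times> J) (I \<times> J)
    (\<lambda>p q. \<Sum>a\<in>UNIV. \<Sum>b\<in>UNIV. (\<lambda>(i, r) (j, s). v i j $ a $ b * B r s $ a $ b) p q)"
    by (intro opn_cong) (auto simp: pairing_def)
  also have "\<dots> \<le> (\<Sum>a\<in>UNIV. \<Sum>b\<in>UNIV. opn (I \<times> J) (I \<times> J) (\<lambda>(i, r) (j, s). v i j $ a $ b * B r s $ a $ b))"
    using assms by (intro order_trans[OF opn_sum] sum_mono opn_sum) auto
  also have "\<dots> \<le> (\<Sum>a\<in>UNIV. \<Sum>b\<in>UNIV. opn I I (\<lambda>i j. v i j $ a $ b) * opn (J \<times> UNIV) (J \<times> UNIV) (flat B))"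
    using assms
    by (intro sum_mono order_trans[OF opn_tensor] mult_left_mono opn_entry_le_flat opn_nonneg) auto
  finally show ?thesis by (simp add: sum_distrib_right)
qed

lemma trace_mult_transpose:
  fixes A B :: "complex^'n^'n"
  shows "trace (A ** transpose B) = (\<Sum>a\<in>UNIV. \<Sum>b\<in>UNIV. A $ a $ b * B $ a $ b)"
  by (simp add: trace_def matrix_matrix_mult_def transpose_def)

lemma S_one_scalar_eq:
  fixes v :: "(complex^'n^'n) matrix"
  shows "S_one_scalar k v = Sup {opn ({..<k} \<times> {..<m::nat}) ({..<k} \<times> {..<m}) (pairing v B) | m B.
    opn ({..<m} \<times> UNIV) ({..<m} \<times> UNIV) (flat B) \<le> 1}"
proof -
  have 1: "op_norm (k * m) (k * m)
      (\<lambda>r s. trace (v (r div m) (s div m) ** transpose (B (r mod m) (s mod m))))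
    = opn ({..<k} \<times> {..<m}) ({..<k} \<times> {..<m}) (pairing v B)" for m and B :: "(complex^'n^'n) matrix"
    unfolding op_norm_eq_opn
    by (subst opn_reindex[OF bij_div_mod bij_div_mod, symmetric])
      (auto simp: pairing_def trace_mult_transpose)
  have 2: "S_inf scalars m B = opn ({..<m} \<times> UNIV) ({..<m} \<times> UNIV) (flat B)"
    for m and B :: "(complex^'n^'n) matrix"
    by (simp add: S_inf_eq ruan_scalars mn_scalars)
  show ?thesis unfolding S_one_scalar_def 1 2 ..
qed

lemma S_one_scalar_least:
  fixes v :: "(complex^'n^'n) matrix"
  assumes "\<And>m B. opn ({..<m::nat} \<times> UNIV) ({..<m} \<times> UNIV) (flat B) \<le> 1 \<Longrightarrow>
    opn ({..<k} \<times> {..<m}) ({..<k} \<times> {..<m}) (pairing v B) \<le> c"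
  shows "S_one_scalar k v \<le> c"
  unfolding S_one_scalar_eq
proof (rule cSup_least)
  have "opn ({..<0::nat} \<times> UNIV) ({..<0} \<times> UNIV) (flat (\<lambda>_ _. 0 :: complex^'n^'n)) \<le> 1"
    by (rule opn_le) simp_all
  then have "opn ({..<k} \<times> {..<0::nat}) ({..<k} \<times> {..<0}) (pairing v (\<lambda>_ _. 0 :: complex^'n^'n))
    \<in> {opn ({..<k} \<times> {..<m::nat}) ({..<k} \<times> {..<m}) (pairing v B) | m B.
      opn ({..<m} \<times> UNIV) ({..<m} \<times> UNIV) (flat B) \<le> 1}"
    by (intro CollectI exI[of _ "0::nat"] exI[of _ "\<lambda>_ _. 0 :: complex^'n^'n"] conjI) simp_all
  then show "{opn ({..<k} \<times> {..<m::nat}) ({..<k} \<times> {..<m}) (pairing v B) | m B.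
    opn ({..<m} \<times> UNIV) ({..<m} \<times> UNIV) (flat B) \<le> 1} \<noteq> {}"
    by (metis empty_iff)
qed (use assms in auto)

lemma S_one_scalar_upper:
  fixes v :: "(complex^'n^'n) matrix"
  assumes "opn ({..<m::nat} \<times> UNIV) ({..<m} \<times> UNIV) (flat B) \<le> 1"
  shows "opn ({..<k} \<times> {..<m}) ({..<k} \<times> {..<m}) (pairing v B) \<le> S_one_scalar k v"
  unfolding S_one_scalar_eq
proof (rule cSup_upper)
  let ?c = "\<Sum>a\<in>UNIV. \<Sum>b\<in>UNIV. opn {..<k} {..<k} (\<lambda>i j. v i j $ a $ b)"
  have "opn ({..<k} \<times> {..<m}) ({..<k} \<times> {..<m}) (pairing v B) \<le> ?c"
    if "opn ({..<m} \<times> UNIV) ({..<m} \<times> UNIV) (flat B) \<le> 1" for m and B :: "(complex^'n^'n) matrix"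
  proof -
    have "opn ({..<k} \<times> {..<m}) ({..<k} \<times> {..<m}) (pairing v B)
        \<le> ?c * opn ({..<m} \<times> UNIV) ({..<m} \<times> UNIV) (flat B)"
      by (rule pairing_bdd) auto
    also have "\<dots> \<le> ?c"
      using that by (intro mult_left_le sum_nonneg opn_nonneg) auto
    finally show ?thesis .
  qed
  then show "bdd_above {opn ({..<k} \<times> {..<m::nat}) ({..<k} \<times> {..<m}) (pairing v B) | m B.
    opn ({..<m} \<times> UNIV) ({..<m} \<times> UNIV) (flat B) \<le> 1}"
    by (intro bdd_aboveI[of _ ?c]) auto
qed (use assms in auto)

lemma S_one_scalar_nonneg: "0 \<le> S_one_scalar k v"
proof -
  have "0 \<le> opn ({..<k} \<times> {..<0::nat}) ({..<k} \<times> {..<0}) (pairing v (\<lambda>_ _. 0))"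
    by (rule opn_nonneg) auto
  also have "\<dots> \<le> S_one_scalar k v"
    by (rule S_one_scalar_upper, rule opn_le) simp_all
  finally show ?thesis .
qed

text \<open>
  One inequality suffices, applied to c and to its inverse.
\<close>

lemma cseminorm_scale_eqI:
  fixes N :: "'a::complex_vector \<Rightarrow> real"
  assumes nn: "\<And>x. 0 \<le> N x" and le: "\<And>c x. N (scaleC c x) \<le> cmod c * N x"
  shows "N (scaleC c x) = cmod c * N x"
proof (cases "c = 0")
  case True
  then show ?thesis using le[of c x] nn[of "scaleC c x"] by simp
next
  case False
  have "N x = N (scaleC (inverse c) (scaleC c x))" using False by (simp add: scaleC_scaleC scaleC_one)
  also have "\<dots> \<le> cmod (inverse c) * N (scaleC c x)" by (rule le)
  finally have "cmod c * N x \<le> N (scaleC c x)" using False by (simp add: norm_inverse norm_divide field_simps)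
  with le[of c x] show ?thesis by simp
qed

lemma pairing_linear:
  "pairing (x + y) B = (\<lambda>p q. pairing x B p q + pairing y B p q)"
  "pairing (scaleC c x) B = (\<lambda>p q. c * pairing x B p q)"
  "pairing v (scaleC c B) = (\<lambda>p q. c * pairing v B p q)"
  by (auto simp: pairing_def fun_eq_iff sum.distrib sum_distrib_left algebra_simps)

text \<open>
  The pairing is linear in v, so that the axioms are inherited from the scalar matrix norms.
\<close>

lemma ruan_S_one_scalar: "ruan (S_one_scalar :: (complex^'n^'n) matnorms)"
  unfolding ruan_def
proof (intro conjI allI impI)
  fix k l c and \<alpha> \<beta> :: "complex matrix" and x y :: "(complex^'n^'n) matrix"
  let ?S = "S_one_scalar :: (complex^'n^'n) matnorms"
  let ?o = "\<lambda>k (m::nat) A. opn ({..<k::nat} \<times> {..<m}) ({..<k} \<times> {..<m}) A"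
  have s: "mn scalars ({..<k} \<times> {..<m}) A = ?o k m A" for k m :: nat and A by (simp add: mn_scalars)
  show "?S k x = ?S k y" if "\<forall>i<k. \<forall>j<k. x i j = y i j"
  proof -
    have "?o k m (pairing x B) = ?o k m (pairing y B)" for m and B :: "(complex^'n^'n) matrix"
      by (intro opn_cong) (auto simp: pairing_def that)
    then show ?thesis unfolding S_one_scalar_eq by simp
  qed
  show "0 \<le> ?S k x" by (rule S_one_scalar_nonneg)
  show "?S k (scaleC c x) = cmod c * ?S k x"
  proof (rule cseminorm_scale_eqI[of "?S k"])
    show "?S k (scaleC c x) \<le> cmod c * ?S k x" for c x
      by (rule S_one_scalar_least) (auto simp: pairing_linear opn_scale intro!: mult_left_mono S_one_scalar_upper)
  qed (rule S_one_scalar_nonneg)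
  show "?S k (x + y) \<le> ?S k x + ?S k y"
    by (rule S_one_scalar_least)
      (auto simp: pairing_linear intro!: order_trans[OF opn_triangle] add_mono S_one_scalar_upper)
  show "?S (k + l) (direct_sum k x y) \<le> max (?S k x) (?S l y)"
  proof (rule S_one_scalar_least)
    fix m and B :: "(complex^'n^'n) matrix"
    assume B: "opn ({..<m} \<times> UNIV) ({..<m} \<times> UNIV) (flat B) \<le> 1"
    let ?z = "pairing (direct_sum k x y) B" and ?B = "{k..<k + l} \<times> {..<m}"
    have I: "{..<k + l} \<times> {..<m} = {..<k} \<times> {..<m} \<union> ?B" by auto
    have "?o (k + l) m ?z = mn scalars ({..<k} \<times> {..<m} \<union> ?B) ?z"
      by (simp add: mn_scalars I)
    also have "\<dots> \<le> max (mn scalars ({..<k} \<times> {..<m}) ?z) (mn scalars ?B ?z)"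
      by (rule mn_Un[OF ruan_scalars]) (auto simp: direct_sum_def pairing_def)
    also have "mn scalars ({..<k} \<times> {..<m}) ?z = ?o k m (pairing x B)"
      unfolding s by (rule opn_cong) (auto simp: direct_sum_def pairing_def)
    also have "mn scalars ?B ?z = mn scalars ({..<l} \<times> {..<m})
        (\<lambda>p q. ?z (map_prod ((+) k) id p) (map_prod ((+) k) id q))"
    proof (rule mn_reindex[OF ruan_scalars])
      have "bij_betw ((+) k) {..<l} {k..<k + l}"
        by (rule bij_betw_byWitness[where f' = "\<lambda>i. i - k"]) auto
      then show "bij_betw (map_prod ((+) k) id) ({..<l} \<times> {..<m}) ?B"
        by (intro bij_betw_map_prod) auto
    qed auto
    also have "\<dots> = ?o l m (pairing y B)"
      unfolding s by (rule opn_cong) (auto simp: direct_sum_def pairing_def)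
    also have "max (?o k m (pairing x B)) \<dots> \<le> max (?S k x) (?S l y)"
      by (intro max.mono S_one_scalar_upper B)
    finally show "?o (k + l) m ?z \<le> max (?S k x) (?S l y)" .
  qed
  show "?S k (two_sided l \<alpha> x \<beta>) \<le> op_norm k l \<alpha> * ?S l x * op_norm l k \<beta>"
    unfolding op_norm_eq_opn
  proof (rule S_one_scalar_least)
    fix m and B :: "(complex^'n^'n) matrix"
    assume B: "opn ({..<m} \<times> UNIV) ({..<m} \<times> UNIV) (flat B) \<le> 1"
    have "mn scalars ({..<k} \<times> {..<m}) (pairing (two_sided l \<alpha> x \<beta>) B)
        \<le> opn {..<k} {..<l} \<alpha> * mn scalars ({..<l} \<times> {..<m}) (pairing x B) * opn {..<l} {..<k} \<beta>"
    proof (rule mn_two_sided_tensor_right[OF ruan_scalars])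
      fix i j a b
      have "pairing (two_sided l \<alpha> x \<beta>) B (i, a) (j, b)
          = (\<Sum>c\<in>UNIV. \<Sum>d\<in>UNIV. \<Sum>r<l. \<Sum>s<l. \<alpha> i r * \<beta> s j * (x r s $ c $ d * B a b $ c $ d))"
        by (simp add: pairing_def two_sided_def sum_distrib_right sum_distrib_left mult_ac)
      also have "\<dots> = (\<Sum>r<l. \<Sum>s<l. \<Sum>c\<in>UNIV. \<Sum>d\<in>UNIV. \<alpha> i r * \<beta> s j * (x r s $ c $ d * B a b $ c $ d))"
        by (simp only: sum.swap[of _ "{..<l}" UNIV])
      finally show "pairing (two_sided l \<alpha> x \<beta>) B (i, a) (j, b)
          = (\<Sum>r<l. \<Sum>s<l. scaleC (\<alpha> i r * \<beta> s j) (pairing x B (r, a) (s, b)))"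
        by (simp add: pairing_def sum_distrib_left)
    qed auto
    also have "\<dots> \<le> opn {..<k} {..<l} \<alpha> * ?S l x * opn {..<l} {..<k} \<beta>"
      unfolding s by (intro mult_right_mono mult_left_mono S_one_scalar_upper B opn_nonneg) auto
    finally show "?o k m (pairing (two_sided l \<alpha> x \<beta>) B)
      \<le> opn {..<k} {..<l} \<alpha> * ?S l x * opn {..<l} {..<k} \<beta>" unfolding s .
  qed
qed

abbreviation S1 :: "'i set \<Rightarrow> ('i \<Rightarrow> 'i \<Rightarrow> complex^'n^'n) \<Rightarrow> real"
  where "S1 \<equiv> mn S_one_scalar"

text \<open>
  The definition of the dual norm, freed from the normalisation of B and from the enumeration of the
  index sets.
\<close>

lemma opn_pairing_le:
  fixes v :: "'i \<Rightarrow> 'i \<Rightarrow> complex^'n^'n"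
  assumes fin: "finite I" "finite J"
  shows "opn (I \<times> J) (I \<times> J) (pairing v B) \<le> S1 I v * opn (J \<times> UNIV) (J \<times> UNIV) (flat B)"
proof -
  let ?b = "opn (J \<times> UNIV) (J \<times> UNIV) (flat B)"
  let ?e = "map_prod (enum I) (enum J)" and ?f = "map_prod (enum J) (id :: 'n \<Rightarrow> 'n)"
  let ?v = "\<lambda>i j. v (enum I i) (enum I j)"
  have e: "bij_betw ?e ({..<card I} \<times> {..<card J}) (I \<times> J)"
    by (intro bij_betw_map_prod bij_enum fin)
  have f: "bij_betw ?f ({..<card J} \<times> UNIV) (J \<times> UNIV)"
    by (intro bij_betw_map_prod bij_enum fin) auto
  have b: "0 \<le> ?b" using fin by (simp add: opn_nonneg)
  have "opn (I \<times> J) (I \<times> J) (pairing v B) \<le> S1 I v * c" if "c > ?b" for c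
  proof -
    have c: "c > 0" using that b by simp
    let ?B = "\<lambda>r s. scaleC (complex_of_real (1 / c)) (B (enum J r) (enum J s))"
    have "opn ({..<card J} \<times> UNIV) ({..<card J} \<times> UNIV) (flat ?B)
       = opn ({..<card J} \<times> UNIV) ({..<card J} \<times> UNIV) (\<lambda>p q. complex_of_real (1 / c) * flat B (?f p) (?f q))"
      by (rule opn_cong) auto
    also have "\<dots> = (1 / c) * ?b"
      using c fin by (subst opn_scale, simp, simp, subst opn_reindex[OF f f]) (auto simp: norm_divide)
    also have "\<dots> \<le> 1" using that c by simp
    finally have "opn ({..<card I} \<times> {..<card J}) ({..<card I} \<times> {..<card J}) (pairing ?v ?B) \<le> S1 I v"
      unfolding mn_def by (rule S_one_scalar_upper)
    also have "pairing ?v ?B = (\<lambda>p q. complex_of_real (1 / c) * pairing v B (?e p) (?e q))"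
      by (auto simp: fun_eq_iff pairing_def sum_divide_distrib)
    also have "opn ({..<card I} \<times> {..<card J}) ({..<card I} \<times> {..<card J}) \<dots>
        = (1 / c) * opn (I \<times> J) (I \<times> J) (pairing v B)"
      using c fin by (subst opn_scale, simp, simp, subst opn_reindex[OF e e]) (auto simp: norm_divide)
    finally show ?thesis using c by (simp add: field_simps)
  qed
  then show ?thesis by (rule le_mult_limit[OF mn_nonneg[OF ruan_S_one_scalar]])
qed

lemma S1_least:
  fixes v :: "'i \<Rightarrow> 'i \<Rightarrow> complex^'n^'n"
  assumes I: "finite I" and c: "0 \<le> c"
    and le: "\<And>m B. opn (I \<times> {..<m::nat}) (I \<times> {..<m}) (pairing v B) \<le> c * opn ({..<m} \<times> UNIV) ({..<m} \<times> UNIV) (flat B)"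
  shows "S1 I v \<le> c"
  unfolding mn_def
proof (rule S_one_scalar_least)
  fix m and B :: "(complex^'n^'n) matrix"
  assume B: "opn ({..<m} \<times> UNIV) ({..<m} \<times> UNIV) (flat B) \<le> 1"
  let ?e = "map_prod (enum I) id" and ?v = "\<lambda>i j. v (enum I i) (enum I j)"
  have e: "bij_betw ?e ({..<card I} \<times> {..<m}) (I \<times> {..<m})"
    by (intro bij_betw_map_prod bij_enum I) auto
  have "opn ({..<card I} \<times> {..<m}) ({..<card I} \<times> {..<m}) (pairing ?v B)
      = opn ({..<card I} \<times> {..<m}) ({..<card I} \<times> {..<m}) (\<lambda>p q. pairing v B (?e p) (?e q))"
    by (rule opn_cong) (auto simp: pairing_def)
  also have "\<dots> = opn (I \<times> {..<m}) (I \<times> {..<m}) (pairing v B)"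
    using I by (intro opn_reindex[OF e e]) auto
  also have "\<dots> \<le> c" using le[of m B] mult_left_le[OF B c] by linarith
  finally show "opn ({..<card I} \<times> {..<m}) ({..<card I} \<times> {..<m}) (pairing ?v B) \<le> c" .
qed

section \<open>The projective tensor product with the trace class\<close>

lemma matrix_tensor_nth [simp]: "matrix_tensor A e $ a $ b = scaleC (A $ a $ b) e"
  by (simp add: matrix_tensor_def)

lemma matrix_tensor_zero [simp]: "matrix_tensor 0 e = 0" "matrix_tensor A 0 = 0"
  by (simp_all add: vec_eq_iff)

abbreviation tens :: "('l \<Rightarrow> 'l \<Rightarrow> complex^'n^'n) \<Rightarrow> ('m \<Rightarrow> 'm \<Rightarrow> 'a::complex_vector) \<Rightarrow> 'l \<times> 'm \<Rightarrow> 'l \<times> 'm \<Rightarrow> 'a^'n^'n"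
  where "tens v w p q \<equiv> matrix_tensor (v (fst p) (fst q)) (w (snd p) (snd q))"

definition S_one_costs :: "('a::complex_vector) matnorms \<Rightarrow> nat \<Rightarrow> ('a^'n^'n) matrix \<Rightarrow> real set"
  where "S_one_costs E k u =
    {op_norm k (l * m) \<alpha> * S_one_scalar l v * E m w * op_norm (l * m) k \<beta> | l m \<alpha> v w \<beta>.
      \<forall>i<k. \<forall>j<k. u i j = two_sided (l * m) \<alpha>
        (\<lambda>r s. matrix_tensor (v (r div m) (s div m)) (w (r mod m) (s mod m))) \<beta> i j}"

lemma S_one_Inf: "S_one E k u = Inf (S_one_costs E k u)"
  unfolding S_one_def proj_tensor_def S_one_costs_def ..

lemma sum_scaleC_select:
  fixes f :: "'p \<Rightarrow> 'a::complex_vector"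
  assumes "finite P" "finite Q" "h ` Q \<subseteq> P"
  shows "(\<Sum>p\<in>P. scaleC (\<Sum>q\<in>Q. a q * (if p = h q then 1 else 0)) (f p)) = (\<Sum>q\<in>Q. scaleC (a q) (f (h q)))"
proof -
  have "(\<Sum>p\<in>P. scaleC (\<Sum>q\<in>Q. a q * (if p = h q then 1 else 0)) (f p))
      = (\<Sum>q\<in>Q. \<Sum>p\<in>P. scaleC (a q * (if p = h q then 1 else 0)) (f p))"
    unfolding cvec.scale_sum_left by (rule sum.swap)
  also have "\<dots> = (\<Sum>q\<in>Q. \<Sum>p\<in>P. if p = h q then scaleC (a q) (f (h q)) else 0)"
    by (intro sum.cong) auto
  also have "\<dots> = (\<Sum>q\<in>Q. scaleC (a q) (f (h q)))"
    using assms by (intro sum.cong refl) auto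
  finally show ?thesis .
qed

text \<open>
  Representations of u over arbitrary finite index sets, and with rows and columns restricted along an
  injection h into \<open>L \<times> M\<close>, can be brought into the form required by the definition: \<open>\<alpha>\<close> and \<open>\<beta>\<close>
  are extended by zero outside the range of h. The injection makes room for the block-diagonal
  representations of direct sums, where only pairs of indices from the same summand occur.
\<close>

lemma S_one_costs_rep:
  fixes E :: "('a::complex_vector) matnorms" and u :: "('a^'n^'n) matrix"
  assumes E: "ruan E" and fin: "finite Q" "finite L" "finite M"
    and h: "inj_on h Q" "h ` Q \<subseteq> L \<times> M"
    and u: "\<And>i j. i < k \<Longrightarrow> j < k \<Longrightarrow>
      u i j = (\<Sum>p\<in>Q. \<Sum>q\<in>Q. scaleC (\<alpha> i p * \<beta> q j) (tens v w (h p) (h q)))"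
  shows "\<exists>c \<in> S_one_costs E k u. c \<le> opn {..<k} Q \<alpha> * S1 L v * mn E M w * opn Q {..<k} \<beta>"
proof -
  let ?l = "card L" and ?m = "card M" and ?P = "L \<times> M"
  define e where "e r = (enum L (r div ?m), enum M (r mod ?m))" for r
  have "bij_betw (map_prod (enum L) (enum M) \<circ> (\<lambda>r. (r div ?m, r mod ?m))) {..<?l * ?m} ?P"
    by (intro bij_betw_trans[OF bij_div_mod] bij_betw_map_prod bij_enum fin)
  then have e: "bij_betw e {..<?l * ?m} ?P" by (simp add: e_def[abs_def] comp_def map_prod_def)
  have P: "finite ?P" using fin by simp
  define A where "A i p = (\<Sum>q\<in>Q. \<alpha> i q * (if p = h q then 1 else 0))" for i p
  define B where "B p j = (\<Sum>q\<in>Q. (if p = h q then 1 else 0) * \<beta> q j)" for p j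
  have sel: "opn Q ?P (\<lambda>q p. if p = h q then 1 else 0) \<le> 1"
    by (rule opn_select[OF fin(1) P h])
  then have sel': "opn ?P Q (\<lambda>p q. if p = h q then 1 else 0) \<le> 1"
    by (simp add: opn_transpose[OF fin(1) P])
  have A: "opn {..<k} ?P A \<le> opn {..<k} Q \<alpha>"
  proof -
    have "opn {..<k} ?P A \<le> opn {..<k} Q \<alpha> * opn Q ?P (\<lambda>q p. if p = h q then 1 else 0)"
      unfolding A_def[abs_def] using fin P by (intro opn_mult) auto
    also have "\<dots> \<le> opn {..<k} Q \<alpha>" using sel fin by (intro mult_left_le opn_nonneg) auto
    finally show ?thesis .
  qed
  have B: "opn ?P {..<k} B \<le> opn Q {..<k} \<beta>"
  proof -
    have "opn ?P {..<k} B \<le> opn ?P Q (\<lambda>p q. if p = h q then 1 else 0) * opn Q {..<k} \<beta>"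
      unfolding B_def[abs_def] using fin P by (intro opn_mult) auto
    also have "\<dots> \<le> opn Q {..<k} \<beta>"
      using sel' fin P by (intro mult_left_le_one_le opn_nonneg) auto
    finally show ?thesis .
  qed
  let ?c = "op_norm k (?l * ?m) (\<lambda>i r. A i (e r)) * S1 L v * mn E M w
      * op_norm (?l * ?m) k (\<lambda>r j. B (e r) j)"
  have oA: "op_norm k (?l * ?m) (\<lambda>i r. A i (e r)) = opn {..<k} ?P A"
    unfolding op_norm_eq_opn using opn_reindex[OF bij_betw_id e] P by auto
  have oB: "op_norm (?l * ?m) k (\<lambda>r j. B (e r) j) = opn ?P {..<k} B"
    unfolding op_norm_eq_opn using opn_reindex[OF e bij_betw_id] P by auto
  have "?c \<in> S_one_costs E k u"
    unfolding S_one_costs_def mem_Collect_eq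
  proof (rule exI[of _ ?l], rule exI[of _ ?m], rule exI[of _ "\<lambda>i r. A i (e r)"],
      rule exI[of _ "\<lambda>i j. v (enum L i) (enum L j)"], rule exI[of _ "\<lambda>i j. w (enum M i) (enum M j)"],
      rule exI[of _ "\<lambda>r j. B (e r) j"], intro conjI allI impI)
    let ?v = "\<lambda>i j. v (enum L i) (enum L j)" and ?w = "\<lambda>i j. w (enum M i) (enum M j)"
    show "?c = op_norm k (?l * ?m) (\<lambda>i r. A i (e r)) * S_one_scalar ?l ?v * E ?m ?w
      * op_norm (?l * ?m) k (\<lambda>r j. B (e r) j)" unfolding mn_def ..
    fix i j assume ij: "i < k" "j < k"
    have "two_sided (?l * ?m) (\<lambda>i r. A i (e r))
        (\<lambda>r s. matrix_tensor (?v (r div ?m) (s div ?m)) (?w (r mod ?m) (s mod ?m))) (\<lambda>r j. B (e r) j) i j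
      = (\<Sum>r<?l * ?m. \<Sum>s<?l * ?m. scaleC (A i (e r) * B (e s) j) (tens v w (e r) (e s)))"
      by (simp add: two_sided_def e_def)
    also have "\<dots> = (\<Sum>r<?l * ?m. \<Sum>q\<in>?P. scaleC (A i (e r) * B q j) (tens v w (e r) q))"
      by (intro sum.cong refl sum.reindex_bij_betw[OF e])
    also have "\<dots> = (\<Sum>p\<in>?P. \<Sum>q\<in>?P. scaleC (A i p * B q j) (tens v w p q))"
      by (rule sum.reindex_bij_betw[OF e])
    also have "\<dots> = (\<Sum>p\<in>?P. scaleC (A i p) (\<Sum>q\<in>?P. scaleC (B q j) (tens v w p q)))"
      by (simp add: cvec.scale_sum_right scaleC_scaleC)
    also have "\<dots> = (\<Sum>p\<in>?P. scaleC (A i p) (\<Sum>q\<in>Q. scaleC (\<beta> q j) (tens v w p (h q))))"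
      unfolding B_def mult.commute[of _ "\<beta> _ _"] sum_scaleC_select[OF P fin(1) h(2)] ..
    also have "\<dots> = (\<Sum>p\<in>Q. scaleC (\<alpha> i p) (\<Sum>q\<in>Q. scaleC (\<beta> q j) (tens v w (h p) (h q))))"
      unfolding A_def sum_scaleC_select[OF P fin(1) h(2)] ..
    also have "\<dots> = u i j"
      by (simp add: u[OF ij] cvec.scale_sum_right scaleC_scaleC)
    finally show "u i j = two_sided (?l * ?m) (\<lambda>i r. A i (e r))
        (\<lambda>r s. matrix_tensor (?v (r div ?m) (s div ?m)) (?w (r mod ?m) (s mod ?m))) (\<lambda>r j. B (e r) j) i j"
      by simp
  qed
  moreover have "?c \<le> opn {..<k} Q \<alpha> * S1 L v * mn E M w * opn Q {..<k} \<beta>"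
    unfolding oA oB using fin P
    by (intro mult_mono mult_nonneg_nonneg A B opn_nonneg mn_nonneg E ruan_S_one_scalar) auto
  ultimately show ?thesis by blast
qed

lemma S_one_costs_nonneg: "ruan E \<Longrightarrow> c \<in> S_one_costs E k u \<Longrightarrow> 0 \<le> c"
  unfolding S_one_costs_def op_norm_eq_opn
  by (clarsimp, intro mult_nonneg_nonneg opn_nonneg S_one_scalar_nonneg ruan_nonneg) simp_all

lemma S_one_le:
  fixes E :: "('a::complex_vector) matnorms" and u :: "('a^'n^'n) matrix"
  assumes E: "ruan E" and "finite Q" "finite L" "finite M" and "inj_on h Q" "h ` Q \<subseteq> L \<times> M"
    and "\<And>i j. i < k \<Longrightarrow> j < k \<Longrightarrow>
      u i j = (\<Sum>p\<in>Q. \<Sum>q\<in>Q. scaleC (\<alpha> i p * \<beta> q j) (tens v w (h p) (h q)))"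
  shows "S_one E k u \<le> opn {..<k} Q \<alpha> * S1 L v * mn E M w * opn Q {..<k} \<beta>"
proof -
  obtain c where c: "c \<in> S_one_costs E k u" "c \<le> opn {..<k} Q \<alpha> * S1 L v * mn E M w * opn Q {..<k} \<beta>"
    using S_one_costs_rep[of E Q L M h k u \<alpha> \<beta> v w] assms by blast
  have "S_one E k u \<le> c"
    unfolding S_one_Inf using S_one_costs_nonneg[OF E]
    by (intro cInf_lower c(1) bdd_belowI[of _ 0]) auto
  with c(2) show ?thesis by linarith
qed

definition unit_matrix :: "'n \<Rightarrow> 'n \<Rightarrow> complex^'n^'n"
  where "unit_matrix a b = (\<chi> c d. if c = a \<and> d = b then 1 else 0)"

lemma sum_unit_matrix: "(\<Sum>c\<in>UNIV. \<Sum>d\<in>UNIV. unit_matrix a b $ c $ d * f c d) = f a b"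
proof -
  have "unit_matrix a b $ c $ d * f c d = (if c = a then if d = b then f a b else 0 else 0)" for c d
    by (simp add: unit_matrix_def)
  then have "(\<Sum>c\<in>UNIV. \<Sum>d\<in>UNIV. unit_matrix a b $ c $ d * f c d)
    = (\<Sum>c\<in>UNIV. if c = a then \<Sum>d\<in>UNIV. if d = b then f a b else 0 else 0)"
    by (intro sum.cong refl) auto
  then show ?thesis by simp
qed

lemma sum_scaleC_row:
  fixes f :: "'p \<Rightarrow> 'q \<Rightarrow> 'a::complex_vector"
  assumes "finite I" "i \<in> I"
  shows "(\<Sum>p\<in>I \<times> K. scaleC (if fst p = i then 1 else 0) (f (fst p) (snd p))) = (\<Sum>k\<in>K. f i k)"
proof -
  have "(\<Sum>p\<in>I \<times> K. scaleC (if fst p = i then 1 else 0) (f (fst p) (snd p)))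
    = (\<Sum>l\<in>I. if l = i then \<Sum>k\<in>K. f i k else 0)"
    unfolding sum_Times by (intro sum.cong) (auto simp: scaleC_one)
  then show ?thesis using assms by simp
qed

text \<open>
  The matrix units form the canonical element of \<open>M\<^sub>n(S\<^sub>1\<^sup>n) = CB(M\<^sub>n, M\<^sub>n)\<close> that represents the
  identity map: pairing it with B gives B back, up to the order of the indices.
\<close>

lemma S1_unit_matrix: "S1 UNIV (unit_matrix :: 'n \<Rightarrow> 'n \<Rightarrow> complex^'n^'n) \<le> 1"
proof (rule S1_least)
  fix m :: nat and B :: "(complex^'n^'n) matrix"
  let ?J = "{..<m}"
  have "opn (UNIV \<times> ?J) (UNIV \<times> ?J) (pairing unit_matrix B)
     = opn (UNIV \<times> ?J) (UNIV \<times> ?J) (\<lambda>p q. flat B (prod.swap p) (prod.swap q))"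
    by (rule opn_cong) (auto simp: pairing_def sum_unit_matrix)
  also have "\<dots> = opn (?J \<times> UNIV) (?J \<times> UNIV) (flat B)"
    by (rule opn_reindex) (auto simp: bij_betw_def)
  finally show "opn (UNIV \<times> ?J) (UNIV \<times> ?J) (pairing unit_matrix B)
    \<le> 1 * opn (?J \<times> UNIV) (?J \<times> UNIV) (flat B)" by simp
qed auto

lemma opn_row_sum:
  assumes "finite I" "finite K"
  shows "opn I (I \<times> K) (\<lambda>i p. if fst p = i then 1 else 0) \<le> sqrt (card K)"
    "opn (I \<times> K) I (\<lambda>p i. if fst p = i then 1 else 0) \<le> sqrt (card K)"
proof -
  show *: "opn (I \<times> K) I (\<lambda>p i. if fst p = i then 1 else 0) \<le> sqrt (card K)"
  proof (rule opn_isometry)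
    fix i j assume "i \<in> I" "j \<in> I"
    have "(\<Sum>p\<in>I \<times> K. cnj (if fst p = i then 1 else 0) * (if fst p = j then 1 else 0))
        = (\<Sum>l\<in>I. if l = i then \<Sum>k\<in>K. if i = j then 1 else 0 else 0 :: complex)"
      unfolding sum_Times by (intro sum.cong) auto
    also have "\<dots> = (if i = j then complex_of_real ((sqrt (card K))\<^sup>2) else 0)"
      using assms \<open>i \<in> I\<close> by simp
    finally show "(\<Sum>p\<in>I \<times> K. cnj (if fst p = i then 1 else 0) * (if fst p = j then 1 else 0))
      = (if i = j then complex_of_real ((sqrt (card K))\<^sup>2) else 0)" .
  qed (use assms in auto)
  then show "opn I (I \<times> K) (\<lambda>i p. if fst p = i then 1 else 0) \<le> sqrt (card K)"
    using opn_transpose[of I "I \<times> K" "\<lambda>i p. if fst p = i then 1 else 0"] assms by simp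
qed

text \<open>
  The expansion \<open>u = \<Sum> e\<^sub>a\<^sub>b \<otimes> u\<^sub>a\<^sub>b\<close>, written as a compression of the tensor product of the
  canonical element of \<open>M\<^sub>n(S\<^sub>1\<^sup>n)\<close> with the matrix of all entries of u. The index a of the first factor
  is also recorded in the index of the second.
\<close>

lemma unit_matrix_rep:
  fixes u :: "('a::complex_vector^'n^'n) matrix"
  assumes "i < k" "j < k"
  shows "u i j = (\<Sum>p\<in>{..<k} \<times> UNIV. \<Sum>q\<in>{..<k} \<times> UNIV.
    scaleC ((if fst p = i then 1 else 0) * (if fst q = j then 1 else 0))
      (tens unit_matrix (flat u) (snd p, p) (snd q, q)))"
proof -
  have "(\<Sum>p\<in>{..<k} \<times> UNIV. \<Sum>q\<in>{..<k} \<times> UNIV.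
    scaleC ((if fst p = i then 1 else 0) * (if fst q = j then 1 else 0))
      (tens unit_matrix (flat u) (snd p, p) (snd q, q)))
    = (\<Sum>p\<in>{..<k} \<times> UNIV. scaleC (if fst p = i then 1 else 0)
        (\<Sum>q\<in>{..<k} \<times> UNIV. scaleC (if fst q = j then 1 else 0)
          (matrix_tensor (unit_matrix (snd p) (snd q)) (u (fst p) (fst q) $ snd p $ snd q))))"
    by (simp add: cvec.scale_sum_right scaleC_scaleC split_def)
  also have "\<dots> = (\<Sum>a\<in>UNIV. \<Sum>b\<in>UNIV. matrix_tensor (unit_matrix a b) (u i j $ a $ b))"
    using assms by (subst (2) sum_scaleC_row, simp, simp, subst sum_scaleC_row, simp, simp, simp)
  also have "\<dots> = u i j"
  proof -
    have "(\<Sum>a\<in>UNIV. \<Sum>b\<in>UNIV. matrix_tensor (unit_matrix a b) (u i j $ a $ b)) $ c $ d = u i j $ c $ d" for c d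
    proof -
      have "(\<Sum>a\<in>UNIV. \<Sum>b\<in>UNIV. matrix_tensor (unit_matrix a b) (u i j $ a $ b)) $ c $ d
        = (\<Sum>a\<in>UNIV. if a = c then \<Sum>b\<in>UNIV. if b = d then u i j $ c $ d else 0 else 0)"
        unfolding sum_component
        by (intro sum.cong refl) (auto simp: unit_matrix_def scaleC_one if_distrib[of "\<lambda>z. scaleC z _"] cong: if_cong)
      then show ?thesis by simp
    qed
    then show ?thesis by (simp add: vec_eq_iff)
  qed
  finally show ?thesis by simp
qed

lemma S_one_costs_nonempty:
  fixes E :: "('a::complex_vector) matnorms"
  assumes "ruan E"
  shows "S_one_costs E k (u :: ('a^'n^'n) matrix) \<noteq> {}"
  using S_one_costs_rep[OF assms, of "{..<k} \<times> UNIV" UNIV "{..<k} \<times> UNIV" "\<lambda>p. (snd p, p)" k u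
      "\<lambda>i p. if fst p = i then 1 else 0" "\<lambda>p i. if fst p = i then 1 else 0" unit_matrix "flat u"]
    unit_matrix_rep[of _ k _ u]
  by (auto simp: inj_on_def)

text \<open>
  In the expansion into matrix units the two outer matrices sum over n indices each and have norm
  \<open>\<surd>n\<close>.
\<close>

lemma S_one_le_S_inf:
  fixes E :: "('a::complex_vector) matnorms"
  assumes E: "ruan E"
  shows "S_one E k (u :: ('a^'n^'n) matrix) \<le> CARD('n) * S_inf E k u"
proof -
  let ?I = "{..<k} \<times> (UNIV :: 'n set)" and ?n = "sqrt (real CARD('n))"
  have "S_one E k u \<le> opn {..<k} ?I (\<lambda>i p. if fst p = i then 1 else 0) * S1 UNIV (unit_matrix :: 'n \<Rightarrow> _) * mn E ?I (flat u)
      * opn ?I {..<k} (\<lambda>p i. if fst p = i then 1 else 0)"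
    by (rule S_one_le[OF E, where h = "\<lambda>p. (snd p, p)"]) (auto simp: inj_on_def unit_matrix_rep)
  also have "\<dots> \<le> ?n * 1 * mn E ?I (flat u) * ?n"
    by (intro mult_mono mult_nonneg_nonneg opn_row_sum S1_unit_matrix mn_nonneg E opn_nonneg ruan_S_one_scalar) auto
  also have "\<dots> = CARD('n) * S_inf E k u"
    by (simp add: S_inf_eq[OF E] mult_ac)
  finally show ?thesis .
qed

text \<open>
  A representation that almost attains the infimum, reindexed by pairs instead of quotients and
  remainders.
\<close>

lemma S_one_obtain:
  fixes E :: "('a::complex_vector) matnorms" and u :: "('a^'n^'n) matrix"
  assumes E: "ruan E" and c: "S_one E k u < c"
  obtains l m :: nat and \<alpha> v w \<beta> where
    "\<And>i j. i < k \<Longrightarrow> j < k \<Longrightarrow>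
      u i j = (\<Sum>p\<in>{..<l} \<times> {..<m}. \<Sum>q\<in>{..<l} \<times> {..<m}. scaleC (\<alpha> i p * \<beta> q j) (tens v w p q))"
    "opn {..<k} ({..<l} \<times> {..<m}) \<alpha> * S_one_scalar l v * E m w * opn ({..<l} \<times> {..<m}) {..<k} \<beta> < c"
proof -
  obtain c' where c': "c' \<in> S_one_costs E k u" "c' < c"
    using cInf_lessD[OF S_one_costs_nonempty[OF E]] c unfolding S_one_Inf by blast
  then obtain l m \<alpha> v w \<beta> where c'_eq: "c' = op_norm k (l * m) \<alpha> * S_one_scalar l v * E m w * op_norm (l * m) k \<beta>"
    and u: "\<And>i j. i < k \<Longrightarrow> j < k \<Longrightarrow> u i j = two_sided (l * m) \<alpha>
        (\<lambda>r s. matrix_tensor (v (r div m) (s div m)) (w (r mod m) (s mod m))) \<beta> i j"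
    unfolding S_one_costs_def by blast
  let ?e = "\<lambda>r. (r div m, r mod m)" and ?P = "{..<l} \<times> {..<m}"
  let ?a = "\<lambda>i (r, s). \<alpha> i (r * m + s)" and ?b = "\<lambda>(r, s). \<beta> (r * m + s)"
  have e: "bij_betw ?e {..<l * m} ?P" by (rule bij_div_mod)
  have 1: "op_norm k (l * m) \<alpha> = opn {..<k} ?P ?a"
    unfolding op_norm_eq_opn using opn_reindex[OF bij_betw_id e, of "{..<k}" ?a] by simp
  have 2: "op_norm (l * m) k \<beta> = opn ?P {..<k} ?b"
    unfolding op_norm_eq_opn using opn_reindex[OF e bij_betw_id, of "{..<k}" ?b] by simp
  show thesis
  proof (rule that[where l = l and m = m and \<alpha> = ?a and \<beta> = ?b and v = v and w = w])
    show "opn {..<k} ?P ?a * S_one_scalar l v * E m w * opn ?P {..<k} ?b < c"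
      using c' c'_eq 1 2 by simp
    fix i j assume "i < k" "j < k"
    then have "u i j = (\<Sum>r<l * m. \<Sum>s<l * m. scaleC (?a i (?e r) * ?b (?e s) j) (tens v w (?e r) (?e s)))"
      by (simp add: u two_sided_def)
    also have "\<dots> = (\<Sum>r<l * m. \<Sum>q\<in>?P. scaleC (?a i (?e r) * ?b q j) (tens v w (?e r) q))"
      by (intro sum.cong refl sum.reindex_bij_betw[OF e])
    also have "\<dots> = (\<Sum>p\<in>?P. \<Sum>q\<in>?P. scaleC (?a i p * ?b q j) (tens v w p q))"
      by (rule sum.reindex_bij_betw[OF e])
    finally show "u i j = (\<Sum>p\<in>?P. \<Sum>q\<in>?P. scaleC (?a i p * ?b q j) (tens v w p q))" .
  qed
qed

lemma S_one_nonneg: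
  fixes E :: "('a::complex_vector) matnorms"
  shows "ruan E \<Longrightarrow> 0 \<le> S_one E k (u :: ('a^'n^'n) matrix)"
  unfolding S_one_Inf by (rule cInf_greatest[OF S_one_costs_nonempty S_one_costs_nonneg])

text \<open>
  A two-sided multiple of a two-sided multiple.
\<close>

lemma two_sided_rep:
  fixes T :: "'p \<Rightarrow> 'q \<Rightarrow> 'a::complex_vector"
  assumes "\<And>r s. r \<in> L \<Longrightarrow> s \<in> L \<Longrightarrow> x r s = (\<Sum>p\<in>P. \<Sum>q\<in>Q. scaleC (\<alpha> r p * \<beta> q s) (T p q))"
  shows "(\<Sum>r\<in>L. \<Sum>s\<in>L. scaleC (a r * b s) (x r s))
    = (\<Sum>p\<in>P. \<Sum>q\<in>Q. scaleC ((\<Sum>r\<in>L. a r * \<alpha> r p) * (\<Sum>s\<in>L. \<beta> q s * b s)) (T p q))"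
proof -
  have "(\<Sum>r\<in>L. \<Sum>s\<in>L. scaleC (a r * b s) (x r s))
    = (\<Sum>r\<in>L. \<Sum>s\<in>L. \<Sum>p\<in>P. \<Sum>q\<in>Q. scaleC ((a r * \<alpha> r p) * (\<beta> q s * b s)) (T p q))"
    by (intro sum.cong refl) (simp add: assms cvec.scale_sum_right scaleC_scaleC mult_ac)
  also have "\<dots> = (\<Sum>p\<in>P. \<Sum>q\<in>Q. \<Sum>r\<in>L. \<Sum>s\<in>L. scaleC ((a r * \<alpha> r p) * (\<beta> q s * b s)) (T p q))"
    by (simp only: sum.swap[of _ P L] sum.swap[of _ Q L])
  also have "\<dots> = (\<Sum>p\<in>P. \<Sum>q\<in>Q. scaleC ((\<Sum>r\<in>L. a r * \<alpha> r p) * (\<Sum>s\<in>L. \<beta> q s * b s)) (T p q))"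
    by (simp only: sum_product cvec.scale_sum_left)
  finally show ?thesis .
qed

lemma S_one_two_sided:
  fixes E :: "('a::complex_vector) matnorms" and x :: "('a^'n^'n) matrix"
  assumes E: "ruan E"
    and y: "\<And>i j. i < k \<Longrightarrow> j < k \<Longrightarrow> y i j = (\<Sum>r<l. \<Sum>s<l. scaleC (a i r * b s j) (x r s))"
  shows "S_one E k y \<le> opn {..<k} {..<l} a * S_one E l x * opn {..<l} {..<k} b"
proof -
  let ?a = "opn {..<k} {..<l} a" and ?b = "opn {..<l} {..<k} b"
  have nn: "0 \<le> ?a" "0 \<le> ?b" by (auto simp: opn_nonneg)
  have "S_one E k y \<le> (?a * ?b) * c" if c: "S_one E l x < c" for c
  proof -
    obtain l' m :: nat and \<alpha> v w \<beta> where
      rep: "\<And>i j. i < l \<Longrightarrow> j < l \<Longrightarrow>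
        x i j = (\<Sum>p\<in>{..<l'} \<times> {..<m}. \<Sum>q\<in>{..<l'} \<times> {..<m}. scaleC (\<alpha> i p * \<beta> q j) (tens v w p q))"
      and cost: "opn {..<l} ({..<l'} \<times> {..<m}) \<alpha> * S_one_scalar l' v * E m w * opn ({..<l'} \<times> {..<m}) {..<l} \<beta> < c"
      by (rule S_one_obtain[OF E c]) (rule that)
    let ?P = "{..<l'} \<times> {..<m}"
    have "S_one E k y \<le> opn {..<k} ?P (\<lambda>i p. \<Sum>r<l. a i r * \<alpha> r p) * S1 {..<l'} v * mn E {..<m} w
        * opn ?P {..<k} (\<lambda>q j. \<Sum>s<l. \<beta> q s * b s j)"
    proof (rule S_one_le[OF E, where h = id])
      fix i j assume "i < k" "j < k"
      then show "y i j = (\<Sum>p\<in>?P. \<Sum>q\<in>?P. scaleC ((\<Sum>r<l. a i r * \<alpha> r p) * (\<Sum>s<l. \<beta> q s * b s j))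
          (tens v w (id p) (id q)))"
        unfolding y[OF \<open>i < k\<close> \<open>j < k\<close>] id_apply
        by (intro two_sided_rep rep) auto
    qed auto
    also have "\<dots> \<le> (?a * opn {..<l} ?P \<alpha>) * S1 {..<l'} v * mn E {..<m} w * (opn ?P {..<l} \<beta> * ?b)"
      by (intro mult_mono mult_nonneg_nonneg opn_mult mn_nonneg E ruan_S_one_scalar opn_nonneg) auto
    also have "\<dots> = (?a * ?b) * (opn {..<l} ?P \<alpha> * S_one_scalar l' v * E m w * opn ?P {..<l} \<beta>)"
      by (simp add: mn_lessThan E ruan_S_one_scalar mult_ac)
    also have "\<dots> \<le> (?a * ?b) * c" using cost nn by (intro mult_left_mono) auto
    finally show ?thesis .
  qed
  then have "S_one E k y \<le> (?a * ?b) * S_one E l x" by (rule le_mult_limit[OF mult_nonneg_nonneg[OF nn]])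
  then show ?thesis by (simp add: mult_ac)
qed

text \<open>
  The product of four nonnegative factors is rearranged so that the two inner ones can be scaled to at
  most 1 and the two outer ones to at most \<open>\<surd>c\<close>. Every factor is first enlarged slightly, so that
  division is possible.
\<close>

lemma spread_factors:
  fixes a s e b c :: real
  assumes nn: "0 \<le> a" "0 \<le> s" "0 \<le> e" "0 \<le> b" and c: "a * s * e * b < c"
  obtains s' e' x y where "s < s'" "e < e'" "0 < x" "0 < y" "x * y = s' * e'"
    "x * a \<le> sqrt c" "y * b \<le> sqrt c"
proof -
  have "((\<lambda>d. (a + d) * (s + d) * (e + d) * (b + d)) \<longlongrightarrow> (a + 0) * (s + 0) * (e + 0) * (b + 0)) (at_right 0)"
    by (intro tendsto_intros)
  then have "eventually (\<lambda>d. (a + d) * (s + d) * (e + d) * (b + d) < c) (at_right 0)"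
    using c by (intro order_tendstoD(2)) auto
  moreover have "eventually (\<lambda>d::real. 0 < d) (at_right 0)" by (rule eventually_at_right_less)
  ultimately have "eventually (\<lambda>d. (a + d) * (s + d) * (e + d) * (b + d) < c \<and> 0 < d) (at_right (0::real))"
    by (rule eventually_conj)
  then obtain d where d: "(a + d) * (s + d) * (e + d) * (b + d) < c" "0 < d"
    using eventually_happens'[OF trivial_limit_at_right_real] by blast
  define A where "A = a + d"
  define S where "S = s + d"
  define F where "F = e + d"
  define B where "B = b + d"
  have pos: "0 < A" "0 < S" "0 < F" "0 < B" using d nn by (auto simp: A_def S_def F_def B_def)
  have lt: "A * S * F * B < c" using d by (simp add: A_def S_def F_def B_def)
  define x where "x = sqrt (S * F * B / A)"
  define y where "y = sqrt (S * F * A / B)"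
  have x: "x * A = sqrt (A * S * F * B)"
  proof -
    have "x * A = sqrt (S * F * B / A) * sqrt (A * A)" using pos by (simp add: x_def)
    also have "\<dots> = sqrt (S * F * B / A * (A * A))" by (rule real_sqrt_mult[symmetric])
    also have "S * F * B / A * (A * A) = A * S * F * B" using pos by (simp add: field_simps)
    finally show ?thesis .
  qed
  have y: "y * B = sqrt (A * S * F * B)"
  proof -
    have "y * B = sqrt (S * F * A / B) * sqrt (B * B)" using pos by (simp add: y_def)
    also have "\<dots> = sqrt (S * F * A / B * (B * B))" by (rule real_sqrt_mult[symmetric])
    also have "S * F * A / B * (B * B) = A * S * F * B" using pos by (simp add: field_simps)
    finally show ?thesis .
  qed
  have xy0: "0 < x" "0 < y" using pos by (auto simp: x_def y_def)
  have "x * y = sqrt ((S * F * B / A) * (S * F * A / B))" by (simp add: x_def y_def real_sqrt_mult[symmetric])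
  also have "(S * F * B / A) * (S * F * A / B) = (S * F)\<^sup>2" using pos by (simp add: field_simps power2_eq_square)
  finally have xy: "x * y = S * F" using pos by simp
  show thesis
  proof (rule that[of S F x y])
    show "s < S" "e < F" using d by (auto simp: S_def F_def)
    have "x * a \<le> x * A" using xy0 d by (simp add: A_def)
    also have "\<dots> \<le> sqrt c" using x lt by simp
    finally show "x * a \<le> sqrt c" .
    have "y * b \<le> y * B" using xy0 d by (simp add: B_def)
    also have "\<dots> \<le> sqrt c" using y lt by simp
    finally show "y * b \<le> sqrt c" .
  qed (use xy0 xy in auto)
qed

lemma S_one_obtain_normalized:
  fixes E :: "('a::complex_vector) matnorms" and u :: "('a^'n^'n) matrix"
  assumes E: "ruan E" and c: "S_one E k u < c"
  obtains l m :: nat and \<alpha> v w \<beta> where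
    "\<And>i j. i < k \<Longrightarrow> j < k \<Longrightarrow>
      u i j = (\<Sum>p\<in>{..<l} \<times> {..<m}. \<Sum>q\<in>{..<l} \<times> {..<m}. scaleC (\<alpha> i p * \<beta> q j) (tens v w p q))"
    "opn {..<k} ({..<l} \<times> {..<m}) \<alpha> \<le> sqrt c" "opn ({..<l} \<times> {..<m}) {..<k} \<beta> \<le> sqrt c"
    "S1 {..<l} v \<le> 1" "mn E {..<m} w \<le> 1"
proof -
  obtain l m :: nat and \<alpha> v w \<beta> where
    rep: "\<And>i j. i < k \<Longrightarrow> j < k \<Longrightarrow>
      u i j = (\<Sum>p\<in>{..<l} \<times> {..<m}. \<Sum>q\<in>{..<l} \<times> {..<m}. scaleC (\<alpha> i p * \<beta> q j) (tens v w p q))"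
    and cost: "opn {..<k} ({..<l} \<times> {..<m}) \<alpha> * S_one_scalar l v * E m w * opn ({..<l} \<times> {..<m}) {..<k} \<beta> < c"
    by (rule S_one_obtain[OF E c]) (rule that)
  let ?P = "{..<l} \<times> {..<m}"
  obtain s e x y where se: "S_one_scalar l v < s" "E m w < e" and xy: "0 < x" "0 < y" "x * y = s * e"
    and le: "x * opn {..<k} ?P \<alpha> \<le> sqrt c" "y * opn ?P {..<k} \<beta> \<le> sqrt c"
    using spread_factors[OF _ _ _ _ cost]
    by (metis E opn_nonneg S_one_scalar_nonneg ruan_nonneg finite_SigmaI finite_lessThan)
  have pos: "s > 0" "e > 0"
    using se S_one_scalar_nonneg[of l v] ruan_nonneg[OF E, of m w] by auto
  let ?a = "\<lambda>i p. complex_of_real x * \<alpha> i p" and ?b = "\<lambda>q j. complex_of_real y * \<beta> q j"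
  let ?v = "\<lambda>r t. scaleC (complex_of_real (1 / s)) (v r t)" and ?w = "\<lambda>r t. scaleC (complex_of_real (1 / e)) (w r t)"
  show thesis
  proof (rule that[where l = l and m = m and \<alpha> = ?a and \<beta> = ?b and v = ?v and w = ?w])
    show "opn {..<k} ?P ?a \<le> sqrt c" "opn ?P {..<k} ?b \<le> sqrt c"
      using le xy by (simp_all add: opn_scale)
    have "S1 {..<l} ?v = (1 / s) * S_one_scalar l v"
      using pos ruan_scale[OF ruan_S_one_scalar, of l "complex_of_real (1 / s)" v]
      by (simp add: mn_lessThan ruan_S_one_scalar scaleC_fun_def norm_divide)
    also have "\<dots> \<le> 1" using se pos by simp
    finally show "S1 {..<l} ?v \<le> 1" .
    have "mn E {..<m} ?w = (1 / e) * E m w"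
      using pos ruan_scale[OF E, of m "complex_of_real (1 / e)" w]
      by (simp add: mn_lessThan E scaleC_fun_def norm_divide)
    also have "\<dots> \<le> 1" using se pos by simp
    finally show "mn E {..<m} ?w \<le> 1" .
    fix i j assume "i < k" "j < k"
    have 1: "complex_of_real x * complex_of_real y * (complex_of_real (1 / s) * complex_of_real (1 / e)) = 1"
      using xy pos by (simp only: of_real_mult[symmetric]) simp
    have "scaleC (\<alpha> i p * \<beta> q j) (tens v w p q) = scaleC (?a i p * ?b q j) (tens ?v ?w p q)" for p q
    proof -
      have "tens ?v ?w p q = scaleC (complex_of_real (1 / s) * complex_of_real (1 / e)) (tens v w p q)"
        by (simp add: vec_eq_iff scaleC_scaleC mult_ac)
      then have "scaleC (?a i p * ?b q j) (tens ?v ?w p q)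
        = scaleC ((complex_of_real x * complex_of_real y * (complex_of_real (1 / s) * complex_of_real (1 / e)))
            * (\<alpha> i p * \<beta> q j)) (tens v w p q)"
        by (simp only: scaleC_scaleC) (simp add: mult_ac)
      then show ?thesis by (simp only: 1) simp
    qed
    then show "u i j = (\<Sum>p\<in>?P. \<Sum>q\<in>?P. scaleC (?a i p * ?b q j) (tens ?v ?w p q))"
      by (simp only: rep[OF \<open>i < k\<close> \<open>j < k\<close>])
  qed
qed

lemma sum_Sigma_single:
  assumes "finite K" "\<And>k. k \<in> K \<Longrightarrow> finite (I k)" "b \<in> K"
    and "\<And>k x. k \<noteq> b \<Longrightarrow> f (k, x) = 0"
  shows "sum f (Sigma K I) = (\<Sum>x\<in>I b. f (b, x))"
proof -
  have "sum f (Sigma K I) = (\<Sum>k\<in>K. \<Sum>x\<in>I k. f (k, x))"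
    using assms by (subst sum.Sigma) auto
  also have "\<dots> = (\<Sum>k\<in>K. if k = b then \<Sum>x\<in>I b. f (b, x) else 0)"
    by (intro sum.cong) (auto simp: assms(4))
  finally show ?thesis using assms by simp
qed

text \<open>
  Two normalised representations are put side by side as block-diagonal matrices. All eight
  ingredients are treated as families over the two-element index type \<open>bool\<close>, so that the lemmas on
  block-diagonal matrices apply. The normalisation makes the maximum of the products of the norms equal
  to the product of the maxima.
\<close>

lemma S_one_direct_sum:
  fixes E :: "('a::complex_vector) matnorms" and x y :: "('a^'n^'n) matrix"
  assumes E: "ruan E"
  shows "S_one E (k + l) (direct_sum k x y) \<le> max (S_one E k x) (S_one E l y)"
proof (rule dense_ge)
  fix c assume c: "max (S_one E k x) (S_one E l y) < c"
  define K where "K b = (if b then k else l)" for b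
  define u where "u b = (if b then x else y)" for b
  have cx: "S_one E k x < c" and cy: "S_one E l y < c" using c by auto
  have c0: "0 \<le> c" using c S_one_nonneg[OF E, of k x] by simp
  obtain l1 m1 :: nat and \<alpha>1 v1 w1 \<beta>1 where 1:
    "\<And>i j. i < k \<Longrightarrow> j < k \<Longrightarrow> x i j
      = (\<Sum>p\<in>{..<l1} \<times> {..<m1}. \<Sum>q\<in>{..<l1} \<times> {..<m1}. scaleC (\<alpha>1 i p * \<beta>1 q j) (tens v1 w1 p q))"
    "opn {..<k} ({..<l1} \<times> {..<m1}) \<alpha>1 \<le> sqrt c" "opn ({..<l1} \<times> {..<m1}) {..<k} \<beta>1 \<le> sqrt c"
    "S1 {..<l1} v1 \<le> 1" "mn E {..<m1} w1 \<le> 1"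
    by (rule S_one_obtain_normalized[OF E cx]) (rule that)
  obtain l2 m2 :: nat and \<alpha>2 v2 w2 \<beta>2 where 2:
    "\<And>i j. i < l \<Longrightarrow> j < l \<Longrightarrow> y i j
      = (\<Sum>p\<in>{..<l2} \<times> {..<m2}. \<Sum>q\<in>{..<l2} \<times> {..<m2}. scaleC (\<alpha>2 i p * \<beta>2 q j) (tens v2 w2 p q))"
    "opn {..<l} ({..<l2} \<times> {..<m2}) \<alpha>2 \<le> sqrt c" "opn ({..<l2} \<times> {..<m2}) {..<l} \<beta>2 \<le> sqrt c"
    "S1 {..<l2} v2 \<le> 1" "mn E {..<m2} w2 \<le> 1"
    by (rule S_one_obtain_normalized[OF E cy]) (rule that)
  define L where "L b = (if b then l1 else l2)" for b
  define M where "M b = (if b then m1 else m2)" for b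
  define \<alpha> where "\<alpha> b = (if b then \<alpha>1 else \<alpha>2)" for b
  define \<beta> where "\<beta> b = (if b then \<beta>1 else \<beta>2)" for b
  define v where "v b = (if b then v1 else v2)" for b
  define w where "w b = (if b then w1 else w2)" for b
  note fam = K_def u_def L_def M_def \<alpha>_def \<beta>_def v_def w_def
  have rep: "u b i j
      = (\<Sum>p\<in>{..<L b} \<times> {..<M b}. \<Sum>q\<in>{..<L b} \<times> {..<M b}. scaleC (\<alpha> b i p * \<beta> b q j) (tens (v b) (w b) p q))"
    if "i < K b" "j < K b" for b i j
    using that 1(1)[of i j] 2(1)[of i j] by (cases b) (simp_all only: fam if_True if_False)
  have \<alpha>: "opn {..<K b} ({..<L b} \<times> {..<M b}) (\<alpha> b) \<le> sqrt c"
    and \<beta>: "opn ({..<L b} \<times> {..<M b}) {..<K b} (\<beta> b) \<le> sqrt c"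
    and v: "S1 {..<L b} (v b) \<le> 1" and w: "mn E {..<M b} (w b) \<le> 1" for b
    using 1(2-5) 2(2-5) by (cases b; simp add: fam)+
  let ?K = "SIGMA b:UNIV. {..<K b}" and ?L = "SIGMA b:UNIV. {..<L b}" and ?M = "SIGMA b:UNIV. {..<M b}"
  let ?Q = "SIGMA b:UNIV. {..<L b} \<times> {..<M b}"
  define A where "A = (\<lambda>(b, i) (d, p). if b = d then \<alpha> b i p else 0)"
  define B where "B = (\<lambda>(b, p) (d, j). if b = d then \<beta> b p j else 0)"
  define V where "V = (\<lambda>(b, i) (d, j). if b = d then v b i j else 0)"
  define W where "W = (\<lambda>(b, i) (d, j). if b = d then w b i j else 0)"
  \<comment> \<open>Only pairs of indices from the same summand are used.\<close>
  define g where "g = (\<lambda>(b::bool, (r::nat, s::nat)). ((b, r), (b, s)))"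
  \<comment> \<open>Rows of the direct sum correspond to rows of the first and of the second summand.\<close>
  define h where "h i = (if i < k then (True, i) else (False, i - k))" for i
  have h: "bij_betw h {..<k + l} ?K"
    by (rule bij_betw_byWitness[where f' = "\<lambda>(b, i). if b then i else i + k"])
      (auto simp: h_def K_def split: if_splits)
  have "S_one E (k + l) (direct_sum k x y) \<le> opn {..<k + l} ?Q (\<lambda>i. A (h i)) * S1 ?L V * mn E ?M W
      * opn ?Q {..<k + l} (\<lambda>q j. B q (h j))"
  proof (rule S_one_le[OF E, where h = g])
    show "inj_on g ?Q" "g ` ?Q \<subseteq> ?L \<times> ?M" by (auto simp: g_def inj_on_def)
    fix i j assume ij: "i < k + l" "j < k + l"
    obtain b i' where i: "h i = (b, i')" by (cases "h i")
    obtain d j' where j: "h j = (d, j')" by (cases "h j")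
    have K: "i' < K b" "j' < K d" using ij i j by (auto simp: h_def K_def split: if_splits)
    have "(\<Sum>p\<in>?Q. \<Sum>q\<in>?Q. scaleC (A (h i) p * B q (h j)) (tens V W (g p) (g q)))
      = (\<Sum>p\<in>{..<L b} \<times> {..<M b}. \<Sum>q\<in>?Q. scaleC (A (h i) (b, p) * B q (h j)) (tens V W (g (b, p)) (g q)))"
      by (rule sum_Sigma_single) (auto simp: A_def i)
    also have "\<dots> = (\<Sum>p\<in>{..<L b} \<times> {..<M b}. \<Sum>q\<in>{..<L d} \<times> {..<M d}.
        scaleC (A (h i) (b, p) * B (d, q) (h j)) (tens V W (g (b, p)) (g (d, q))))"
      by (intro sum.cong refl sum_Sigma_single) (auto simp: B_def j)
    also have "\<dots> = (if b = d then u b i' j' else 0)"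
    proof (cases "b = d")
      case True
      then show ?thesis
        using rep[of i' b j'] K
        by (auto simp: A_def B_def V_def W_def g_def i j split_def)
    next
      case False
      then have "tens V W (g (b, p)) (g (d, q)) = 0" for p q
        by (cases p; cases q) (simp add: V_def g_def)
      then show ?thesis using False by simp
    qed
    also have "\<dots> = direct_sum k x y i j"
      using i j ij by (auto simp: h_def direct_sum_def u_def split: if_splits)
    finally show "direct_sum k x y i j
      = (\<Sum>p\<in>?Q. \<Sum>q\<in>?Q. scaleC (A (h i) p * B q (h j)) (tens V W (g p) (g q)))" by simp
  qed auto
  also have "\<dots> \<le> sqrt c * 1 * 1 * sqrt c"
  proof (intro mult_mono mult_nonneg_nonneg)
    have "opn {..<k + l} ?Q (\<lambda>i. A (h i)) = opn ?K ?Q A"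
      using opn_reindex[OF h bij_betw_id, of ?Q A] by auto
    also have "\<dots> \<le> sqrt c" unfolding A_def by (rule opn_block_diagonal) (use c0 \<alpha> in auto)
    finally show "opn {..<k + l} ?Q (\<lambda>i. A (h i)) \<le> sqrt c" .
    have "opn ?Q {..<k + l} (\<lambda>q j. B q (h j)) = opn ?Q ?K B"
      using opn_reindex[OF bij_betw_id h, of ?Q B] by auto
    also have "\<dots> \<le> sqrt c" unfolding B_def by (rule opn_block_diagonal) (use c0 \<beta> in auto)
    finally show "opn ?Q {..<k + l} (\<lambda>q j. B q (h j)) \<le> sqrt c" .
    show "S1 ?L V \<le> 1" unfolding V_def by (rule mn_block_diagonal[OF ruan_S_one_scalar]) (use v in auto)
    show "mn E ?M W \<le> 1" unfolding W_def by (rule mn_block_diagonal[OF E]) (use w in auto)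
  qed (use c0 in \<open>auto intro!: mn_nonneg E ruan_S_one_scalar opn_nonneg\<close>)
  also have "\<dots> = c" using c0 by simp
  finally show "S_one E (k + l) (direct_sum k x y) \<le> c" .
qed

text \<open>
  With \<open>s > \<parallel>x\<parallel>\<close> and \<open>t > \<parallel>y\<parallel>\<close>, the sum \<open>x + y\<close> is the compression of the direct sum of
  \<open>x / s\<close> and \<open>y / t\<close> by the row \<open>(\<surd>s, \<surd>t)\<close> and its transpose, which have norm
  \<open>\<surd>(s + t)\<close>. Hence the triangle inequality follows from the axioms for direct sums and for two-sided
  multiplication.
\<close>

lemma S_one_triangle:
  fixes E :: "('a::complex_vector) matnorms" and x y :: "('a^'n^'n) matrix"
  assumes E: "ruan E"
    and scale: "\<And>k c (x :: ('a^'n^'n) matrix). S_one E k (scaleC c x) \<le> cmod c * S_one E k x"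
  shows "S_one E k (x + y) \<le> S_one E k x + S_one E k y"
proof (rule field_le_epsilon)
  fix e :: real assume e: "0 < e"
  define s where "s = S_one E k x + e / 2"
  define t where "t = S_one E k y + e / 2"
  have st: "S_one E k x < s" "S_one E k y < t" "0 < s" "0 < t"
    using e S_one_nonneg[OF E, of k x] S_one_nonneg[OF E, of k y] by (auto simp: s_def t_def)
  let ?x = "scaleC (complex_of_real (1 / s)) x" and ?y = "scaleC (complex_of_real (1 / t)) y"
  have x: "S_one E k ?x \<le> 1"
    using order_trans[OF scale[of k "complex_of_real (1 / s)" x], of 1] st by (simp add: norm_divide)
  have y: "S_one E k ?y \<le> 1"
    using order_trans[OF scale[of k "complex_of_real (1 / t)" y], of 1] st by (simp add: norm_divide)
  \<comment> \<open>The row \<open>(\<surd>s, \<surd>t)\<close>, tensored with the identity of size k.\<close>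
  define a where "a i r = (if r = i then complex_of_real (sqrt s) else if r = i + k then complex_of_real (sqrt t) else 0)" for i r
  have split: "(\<Sum>i<k + k. f i) = (\<Sum>i<k. f i) + (\<Sum>i<k. f (k + i))" for f :: "nat \<Rightarrow> 'z::comm_monoid_add"
  proof -
    have "(\<Sum>i<k + l. f i) = (\<Sum>i<k. f i) + (\<Sum>i<l. f (k + i))" for l
      by (induction l) (simp_all add: add.assoc)
    then show ?thesis .
  qed
  have bo: "opn {..<k + k} {..<k} (\<lambda>r i. a i r) \<le> sqrt (s + t)"
  proof (rule opn_isometry)
    fix i j assume "i \<in> {..<k}" "j \<in> {..<k}"
    then have ij: "i < k" "j < k" by auto
    have "(\<Sum>r<k + k. cnj (a i r) * a j r)
      = (\<Sum>r<k. if r = i then if i = j then complex_of_real s else 0 else 0)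
      + (\<Sum>r<k. if r = i then if i = j then complex_of_real t else 0 else 0)"
      unfolding split using ij st
      by (intro arg_cong2[where f = "(+)"] sum.cong refl)
        (auto simp: a_def of_real_mult[symmetric] simp del: of_real_mult)
    also have "\<dots> = (if i = j then complex_of_real ((sqrt (s + t))\<^sup>2) else 0)"
      using ij st by simp
    finally show "(\<Sum>r<k + k. cnj (a i r) * a j r) = (if i = j then complex_of_real ((sqrt (s + t))\<^sup>2) else 0)" .
  qed (use st in auto)
  then have ao: "opn {..<k} {..<k + k} a \<le> sqrt (s + t)"
    using opn_transpose[of "{..<k}" "{..<k + k}" a] by simp
  have "S_one E k (x + y) \<le> opn {..<k} {..<k + k} a * S_one E (k + k) (direct_sum k ?x ?y) * opn {..<k + k} {..<k} (\<lambda>r i. a i r)"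
  proof (rule S_one_two_sided[OF E])
    fix i j assume ij: "i < k" "j < k"
    let ?D = "direct_sum k ?x ?y"
    have s: "complex_of_real (sqrt s) * complex_of_real (sqrt s) / complex_of_real s = 1"
      "complex_of_real (sqrt t) * complex_of_real (sqrt t) / complex_of_real t = 1"
      using st by (simp_all only: of_real_mult[symmetric] of_real_divide[symmetric]) simp_all
    have a1: "(\<Sum>r<k + k. scaleC (a i r) (f r)) = scaleC (complex_of_real (sqrt s)) (f i) + scaleC (complex_of_real (sqrt t)) (f (k + i))"
      if "i < k" for f :: "nat \<Rightarrow> 'a^'n^'n" and i
    proof -
      have "(\<Sum>r<k + k. scaleC (a i r) (f r))
        = (\<Sum>r<k. if r = i then scaleC (complex_of_real (sqrt s)) (f i) else 0)
        + (\<Sum>r<k. if r = i then scaleC (complex_of_real (sqrt t)) (f (k + i)) else 0)"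
        unfolding split using that
        by (intro arg_cong2[where f = "(+)"] sum.cong refl) (auto simp: a_def)
      then show ?thesis using that by simp
    qed
    have "(\<Sum>r<k + k. \<Sum>q<k + k. scaleC (a i r * a j q) (?D r q))
      = (\<Sum>r<k + k. scaleC (a i r) (\<Sum>q<k + k. scaleC (a j q) (?D r q)))"
      by (simp add: cvec.scale_sum_right scaleC_scaleC)
    also have "\<dots> = scaleC (complex_of_real (sqrt s)) (scaleC (complex_of_real (sqrt s)) (?D i j))
        + scaleC (complex_of_real (sqrt t)) (scaleC (complex_of_real (sqrt t)) (?D (k + i) (k + j)))"
      unfolding a1[OF ij(2)] a1[OF ij(1)] using ij by (simp add: direct_sum_def)
    also have "\<dots> = (x + y) i j"
      using ij by (simp add: direct_sum_def scaleC_scaleC s scaleC_one)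
    finally show "(x + y) i j = (\<Sum>r<k + k. \<Sum>q<k + k. scaleC (a i r * a j q) (?D r q))" by (rule sym)
  qed
  also have "\<dots> \<le> sqrt (s + t) * 1 * sqrt (s + t)"
    using x y st
    by (intro mult_mono mult_nonneg_nonneg ao bo order_trans[OF S_one_direct_sum[OF E]] S_one_nonneg E opn_nonneg) auto
  also have "\<dots> = S_one E k x + S_one E k y + e" using st by (simp add: s_def t_def)
  finally show "S_one E k (x + y) \<le> S_one E k x + S_one E k y + e" .
qed

lemma ruan_S_one:
  fixes E :: "('a::complex_vector) matnorms"
  assumes E: "ruan E"
  shows "ruan (S_one E :: ('a^'n^'n) matnorms)"
proof -
  let ?S = "S_one E :: ('a^'n^'n) matnorms"
  have scale: "?S k (scaleC c x) \<le> cmod c * ?S k x" for k c x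
  proof -
    have "?S k (scaleC c x) \<le> opn {..<k} {..<k} (\<lambda>i r. c * (if r = i then 1 else 0)) * ?S k x
        * opn {..<k} {..<k} (\<lambda>s j. if s = j then 1 else 0)"
    proof (rule S_one_two_sided[OF E])
      fix i j assume ij: "i < k" "j < k"
      have "(\<Sum>r<k. \<Sum>s<k. scaleC (c * (if r = i then 1 else 0) * (if s = j then 1 else 0)) (x r s))
        = scaleC c (\<Sum>r<k. \<Sum>s<k. scaleC ((if r = i then 1 else 0) * (if s = j then 1 else 0)) (x r s))"
        by (simp add: cvec.scale_sum_right scaleC_scaleC mult.assoc)
      also have "\<dots> = scaleC c x i j"
        using ij by (subst sum_delta2) auto
      finally show "scaleC c x i j
        = (\<Sum>r<k. \<Sum>s<k. scaleC (c * (if r = i then 1 else 0) * (if s = j then 1 else 0)) (x r s))" by simp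
    qed
    also have "\<dots> \<le> (cmod c * 1) * ?S k x * 1"
    proof (intro mult_mono mult_nonneg_nonneg)
      have 1: "opn {..<k} {..<k} (\<lambda>i r. if r = i then 1 else 0) \<le> 1"
        using opn_select[of "{..<k}" "{..<k}" "\<lambda>i. i"] by simp
      have "opn {..<k} {..<k} (\<lambda>s j. if s = j then 1 else 0)
        = opn {..<k} {..<k} (\<lambda>i r. if r = i then 1 else 0)" by (rule opn_cong) auto
      with 1 show "opn {..<k} {..<k} (\<lambda>s j. if s = j then 1 else 0) \<le> 1" by linarith
      have "opn {..<k} {..<k} (\<lambda>i r. c * (if r = i then 1 else 0))
        = cmod c * opn {..<k} {..<k} (\<lambda>i r. if r = i then 1 else 0)" by (rule opn_scale) auto
      also have "\<dots> \<le> cmod c * 1" using 1 by (rule mult_left_mono) simp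
      finally show "opn {..<k} {..<k} (\<lambda>i r. c * (if r = i then 1 else 0)) \<le> cmod c * 1" .
    qed (simp_all add: S_one_nonneg[OF E] opn_nonneg)
    finally show ?thesis by simp
  qed
  show ?thesis
    unfolding ruan_def
  proof (intro conjI allI impI)
    fix k l c and \<alpha> \<beta> :: "complex matrix" and x y :: "('a^'n^'n) matrix"
    show "?S k x = ?S k y" if "\<forall>i<k. \<forall>j<k. x i j = y i j"
    proof -
      have "(\<forall>i<k. \<forall>j<k. x i j = t i j) \<longleftrightarrow> (\<forall>i<k. \<forall>j<k. y i j = t i j)" for t
        using that by auto
      then have "S_one_costs E k x = S_one_costs E k y" by (simp only: S_one_costs_def)
      then show ?thesis by (simp add: S_one_Inf)
    qed
    show "0 \<le> ?S k x" by (rule S_one_nonneg[OF E])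
    show "?S k (scaleC c x) = cmod c * ?S k x"
      by (rule cseminorm_scale_eqI[of "?S k", OF S_one_nonneg[OF E] scale])
    show "?S k (x + y) \<le> ?S k x + ?S k y" by (rule S_one_triangle[OF E scale])
    show "?S (k + l) (direct_sum k x y) \<le> max (?S k x) (?S l y)" by (rule S_one_direct_sum[OF E])
    show "?S k (two_sided l \<alpha> x \<beta>) \<le> op_norm k l \<alpha> * ?S l x * op_norm l k \<beta>"
      unfolding op_norm_eq_opn by (rule S_one_two_sided[OF E]) (simp add: two_sided_def)
  qed
qed

lemma mn_S_one_le:
  fixes E :: "('a::complex_vector) matnorms" and u :: "'i \<Rightarrow> 'i \<Rightarrow> 'a^'n^'n"
  assumes E: "ruan E" and fin: "finite I" "finite L" "finite M"
    and u: "\<And>i j. i \<in> I \<Longrightarrow> j \<in> I \<Longrightarrow>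
      u i j = (\<Sum>p\<in>L \<times> M. \<Sum>q\<in>L \<times> M. scaleC (\<alpha> i p * \<beta> q j) (tens v w p q))"
  shows "mn (S_one E) I u \<le> opn I (L \<times> M) \<alpha> * S1 L v * mn E M w * opn (L \<times> M) I \<beta>"
proof -
  note e = bij_enum[OF fin(1)]
  have "mn (S_one E) I u \<le> opn {..<card I} (L \<times> M) (\<lambda>i. \<alpha> (enum I i)) * S1 L v * mn E M w
      * opn (L \<times> M) {..<card I} (\<lambda>q j. \<beta> q (enum I j))"
    unfolding mn_def[of "S_one E"]
  proof (rule S_one_le[OF E, where h = id and Q = "L \<times> M" and L = L and M = M and v = v and w = w
        and \<alpha> = "\<lambda>i. \<alpha> (enum I i)" and \<beta> = "\<lambda>q j. \<beta> q (enum I j)"])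
    fix i j assume "i < card I" "j < card I"
    then have "enum I i \<in> I" "enum I j \<in> I" using bij_betwE[OF e] by simp_all
    then show "u (enum I i) (enum I j)
      = (\<Sum>p\<in>L \<times> M. \<Sum>q\<in>L \<times> M. scaleC (\<alpha> (enum I i) p * \<beta> q (enum I j)) (tens v w (id p) (id q)))"
      by (simp only: u id_apply)
  qed (use fin in auto)
  also have "opn {..<card I} (L \<times> M) (\<lambda>i. \<alpha> (enum I i)) = opn I (L \<times> M) \<alpha>"
    using opn_reindex[OF e bij_betw_id, of "L \<times> M" \<alpha>] fin by auto
  also have "opn (L \<times> M) {..<card I} (\<lambda>q j. \<beta> q (enum I j)) = opn (L \<times> M) I \<beta>"
    using opn_reindex[OF bij_betw_id e, of "L \<times> M" \<beta>] fin by auto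
  finally show ?thesis .
qed

lemma mn_S_one_obtain:
  fixes E :: "('a::complex_vector) matnorms" and u :: "'i \<Rightarrow> 'i \<Rightarrow> 'a^'n^'n"
  assumes E: "ruan E" and I: "finite I" and c: "mn (S_one E) I u < c"
  obtains l m :: nat and \<alpha> v w \<beta> where
    "\<And>i j. i \<in> I \<Longrightarrow> j \<in> I \<Longrightarrow>
      u i j = (\<Sum>p\<in>{..<l} \<times> {..<m}. \<Sum>q\<in>{..<l} \<times> {..<m}. scaleC (\<alpha> i p * \<beta> q j) (tens v w p q))"
    "opn I ({..<l} \<times> {..<m}) \<alpha> * S1 {..<l} v * mn E {..<m} w * opn ({..<l} \<times> {..<m}) I \<beta> < c"
proof -
  note e = bij_enum[OF I]
  obtain l m :: nat and \<alpha> v w \<beta> where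
    rep: "\<And>i j. i < card I \<Longrightarrow> j < card I \<Longrightarrow> u (enum I i) (enum I j)
      = (\<Sum>p\<in>{..<l} \<times> {..<m}. \<Sum>q\<in>{..<l} \<times> {..<m}. scaleC (\<alpha> i p * \<beta> q j) (tens v w p q))"
    and cost: "opn {..<card I} ({..<l} \<times> {..<m}) \<alpha> * S_one_scalar l v * E m w * opn ({..<l} \<times> {..<m}) {..<card I} \<beta> < c"
    by (rule S_one_obtain[OF E c[unfolded mn_def]]) (rule that)
  define f where "f = the_inv_into {..<card I} (enum I)"
  have f: "bij_betw f I {..<card I}" unfolding f_def by (rule bij_betw_the_inv_into[OF e])
  have ef: "enum I (f i) = i" "f i < card I" if "i \<in> I" for i
    using that e bij_betwE[OF f] by (simp_all add: f_def f_the_inv_into_f_bij_betw)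
  show thesis
  proof (rule that[where l = l and m = m and \<alpha> = "\<lambda>i. \<alpha> (f i)" and \<beta> = "\<lambda>q j. \<beta> q (f j)" and v = v and w = w])
    show "u i j = (\<Sum>p\<in>{..<l} \<times> {..<m}. \<Sum>q\<in>{..<l} \<times> {..<m}. scaleC (\<alpha> (f i) p * \<beta> q (f j)) (tens v w p q))"
      if "i \<in> I" "j \<in> I" for i j
      using rep[of "f i" "f j"] ef that by simp
    show "opn I ({..<l} \<times> {..<m}) (\<lambda>i. \<alpha> (f i)) * S1 {..<l} v * mn E {..<m} w
        * opn ({..<l} \<times> {..<m}) I (\<lambda>q j. \<beta> q (f j)) < c"
      using cost opn_reindex[OF f bij_betw_id, of "{..<l} \<times> {..<m}" \<alpha>]
        opn_reindex[OF bij_betw_id f, of "{..<l} \<times> {..<m}" \<beta>]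
      by (simp add: mn_lessThan E ruan_S_one_scalar)
  qed
qed

section \<open>The Hahn-Banach theorem\<close>

text \<open>
  Real-linear functionals are considered on complex spaces, so that only real scalars occur.
\<close>

definition sublinear :: "('v::complex_vector \<Rightarrow> real) \<Rightarrow> bool"
  where "sublinear q \<longleftrightarrow> (\<forall>x y. q (x + y) \<le> q x + q y) \<and>
    (\<forall>t x. 0 \<le> t \<longrightarrow> q (scaleC (complex_of_real t) x) \<le> t * q x)"

lemma sublinear_add: "sublinear q \<Longrightarrow> q (x + y) \<le> q x + q y"
  and sublinear_scale_le: "sublinear q \<Longrightarrow> 0 \<le> t \<Longrightarrow> q (scaleC (complex_of_real t) x) \<le> t * q x"
  unfolding sublinear_def by auto

lemma sublinear_zero: "sublinear q \<Longrightarrow> q 0 = 0"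
  using sublinear_add[of q 0 0] sublinear_scale_le[of q 0 0] by simp

lemma sublinear_neg: "sublinear q \<Longrightarrow> - q (- x) \<le> q x"
  using sublinear_add[of q x "- x"] sublinear_zero[of q] by simp

lemma sublinear_scale:
  assumes "sublinear q" "0 \<le> t"
  shows "q (scaleC (complex_of_real t) x) = t * q x"
proof (cases "t = 0")
  case True
  then show ?thesis using sublinear_zero[OF assms(1)] by simp
next
  case False
  then have t: "t > 0" using assms(2) by simp
  have "q x = q (scaleC (complex_of_real (1 / t)) (scaleC (complex_of_real t) x))"
    using t by (simp add: scaleC_scaleC scaleC_one)
  also have "\<dots> \<le> (1 / t) * q (scaleC (complex_of_real t) x)"
    using t by (intro sublinear_scale_le assms(1)) simp
  finally have "t * q x \<le> q (scaleC (complex_of_real t) x)" using t by (simp add: field_simps)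
  with sublinear_scale_le[OF assms, of x] show ?thesis by simp
qed

text \<open>
  The infimal regularisation of q in the direction y. It is sublinear, lies below q and takes
  a value of at most \<open>- q y\<close> at \<open>- y\<close>. A minimal sublinear functional q coincides with all its
  regularisations and is therefore odd, hence linear.
\<close>

definition lower_along :: "('v::complex_vector \<Rightarrow> real) \<Rightarrow> 'v \<Rightarrow> 'v \<Rightarrow> real"
  where "lower_along q y x = (INF t \<in> {0..}. q (x + scaleC (complex_of_real t) y) - t * q y)"

lemma lower_along_bound:
  assumes q: "sublinear q" and "0 \<le> t"
  shows "- q (- x) \<le> q (x + scaleC (complex_of_real t) y) - t * q y"
proof -
  have "t * q y = q ((x + scaleC (complex_of_real t) y) + (- x))"
    using sublinear_scale[OF assms, of y] by simp
  also have "\<dots> \<le> q (x + scaleC (complex_of_real t) y) + q (- x)" by (rule sublinear_add[OF q])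
  finally show ?thesis by simp
qed

lemma lower_along_le:
  assumes q: "sublinear q" and "0 \<le> t"
  shows "lower_along q y x \<le> q (x + scaleC (complex_of_real t) y) - t * q y"
  unfolding lower_along_def
  by (rule cINF_lower) (use assms lower_along_bound[OF q] in \<open>auto intro!: bdd_belowI2\<close>)

lemma lower_along_witness:
  assumes q: "sublinear q" and "lower_along q y x < c"
  obtains t where "0 \<le> t" "q (x + scaleC (complex_of_real t) y) - t * q y < c"
proof -
  have bdd: "bdd_below ((\<lambda>t. q (x + scaleC (complex_of_real t) y) - t * q y) ` {0..})"
    by (rule bdd_belowI2[where m = "- q (- x)"]) (use lower_along_bound[OF q] in auto)
  have "{0::real..} \<noteq> {}" by auto
  from cINF_less_iff[OF this bdd, of c] assms(2)[unfolded lower_along_def]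
  obtain t where "t \<in> {0..}" "q (x + scaleC (complex_of_real t) y) - t * q y < c" by blast
  then show thesis by (intro that) auto
qed

lemma sublinear_lower_along:
  assumes q: "sublinear q"
  shows "sublinear (lower_along q y)"
  unfolding sublinear_def
proof (intro conjI allI impI)
  fix x x'
  show "lower_along q y (x + x') \<le> lower_along q y x + lower_along q y x'"
  proof (rule field_le_epsilon)
    fix e :: real assume e: "0 < e"
    obtain s where s: "0 \<le> s" "q (x + scaleC (complex_of_real s) y) - s * q y < lower_along q y x + e / 2"
      using lower_along_witness[OF q, of y x "lower_along q y x + e / 2"] e by auto
    obtain t where t: "0 \<le> t" "q (x' + scaleC (complex_of_real t) y) - t * q y < lower_along q y x' + e / 2"
      using lower_along_witness[OF q, of y x' "lower_along q y x' + e / 2"] e by auto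
    have "lower_along q y (x + x') \<le> q (x + x' + scaleC (complex_of_real (s + t)) y) - (s + t) * q y"
      by (rule lower_along_le[OF q]) (use s t in simp)
    also have "x + x' + scaleC (complex_of_real (s + t)) y
      = (x + scaleC (complex_of_real s) y) + (x' + scaleC (complex_of_real t) y)"
      by (simp add: scaleC_add_left algebra_simps)
    also have "q \<dots> - (s + t) * q y \<le> (q (x + scaleC (complex_of_real s) y) - s * q y)
        + (q (x' + scaleC (complex_of_real t) y) - t * q y)"
      using sublinear_add[OF q, of "x + scaleC (complex_of_real s) y" "x' + scaleC (complex_of_real t) y"]
      by (simp add: distrib_right)
    finally show "lower_along q y (x + x') \<le> lower_along q y x + lower_along q y x' + e"
      using s t by linarith
  qed
next
  fix r :: real and x assume r: "0 \<le> r"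
  have "lower_along q y (scaleC (complex_of_real r) x) \<le> r * c" if c: "lower_along q y x < c" for c
  proof -
    obtain s where s: "0 \<le> s" "q (x + scaleC (complex_of_real s) y) - s * q y < c"
      by (rule lower_along_witness[OF q c])
    have "lower_along q y (scaleC (complex_of_real r) x)
      \<le> q (scaleC (complex_of_real r) x + scaleC (complex_of_real (r * s)) y) - (r * s) * q y"
      by (rule lower_along_le[OF q]) (use r s in simp)
    also have "scaleC (complex_of_real r) x + scaleC (complex_of_real (r * s)) y
      = scaleC (complex_of_real r) (x + scaleC (complex_of_real s) y)"
      by (simp add: scaleC_add_right scaleC_scaleC)
    also have "q \<dots> = r * q (x + scaleC (complex_of_real s) y)" by (rule sublinear_scale[OF q r])
    also have "\<dots> - (r * s) * q y = r * (q (x + scaleC (complex_of_real s) y) - s * q y)"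
      by (simp add: algebra_simps)
    also have "\<dots> \<le> r * c" using s r by (intro mult_left_mono) auto
    finally show ?thesis .
  qed
  then show "lower_along q y (scaleC (complex_of_real r) x) \<le> r * lower_along q y x"
    by (rule le_mult_limit[OF r])
qed

text \<open>
  Zorn's lemma yields a minimal element among the sublinear functionals r below q that satisfy
  \<open>r (- x0) \<le> - q x0\<close>. Minimality makes it linear, by \<open>lower_along\<close>, and the side condition
  makes it agree with q at \<open>x0\<close>.
\<close>

theorem hahn_banach:
  fixes q :: "'v::complex_vector \<Rightarrow> real"
  assumes q: "sublinear q"
  obtains f where "\<And>x y. f (x + y) = f x + f y" "\<And>t x. f (scaleC (complex_of_real t) x) = t * f x"
    "\<And>x. f x \<le> q x" "f x0 = q x0"
proof -
  define S where "S = {r. sublinear r \<and> (\<forall>x. r x \<le> q x) \<and> r (- x0) \<le> - q x0}"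
  define P where "P a b \<longleftrightarrow> (\<forall>x. b x \<le> a x)" for a b :: "'v \<Rightarrow> real"
  have lower: "lower_along r y x \<le> r x" "lower_along r y (- y) \<le> - r y" if "sublinear r" for r y and x :: 'v
    using lower_along_le[OF that, of 0 y x] lower_along_le[OF that, of 1 y "- y"] sublinear_zero[OF that]
    by (simp_all add: scaleC_one)
  \<comment> \<open>The side condition defining S is met by the regularisation of q in the direction \<open>x0\<close>.\<close>
  have S0: "lower_along q x0 \<in> S"
    unfolding S_def using lower[OF q] sublinear_lower_along[OF q] by auto
  have "\<exists>m\<in>S. \<forall>a\<in>S. P m a \<longrightarrow> a = m"
  proof (rule predicate_Zorn)
    show "partial_order_on S (relation_of P S)"
      by (rule partial_order_on_relation_ofI) (auto simp: P_def fun_eq_iff intro: order_trans antisym)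
    fix C assume C: "C \<in> Chains (relation_of P S)"
    have CS: "C \<subseteq> S" using C by (auto simp: Chains_def relation_of_def)
    have comp: "P r r' \<or> P r' r" if "r \<in> C" "r' \<in> C" for r r'
      using C that by (auto simp: Chains_def relation_of_def)
    show "\<exists>u\<in>S. \<forall>a\<in>C. P a u"
    proof (cases "C = {}")
      case True
      then show ?thesis using S0 by auto
    next
      case False
      define u where "u x = (INF r\<in>C. r x)" for x
      have low: "- q (- x) \<le> r x" if "r \<in> C" for r x
      proof -
        have r: "sublinear r" "r (- x) \<le> q (- x)" using that CS by (auto simp: S_def)
        then show ?thesis using sublinear_neg[OF r(1), of x] by linarith
      qed
      have bdd: "bdd_below ((\<lambda>r. r x) ` C)" for x
        by (rule bdd_belowI2[where m = "- q (- x)"]) (rule low)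
      have u_le: "u x \<le> r x" if "r \<in> C" for r x
        unfolding u_def by (rule cINF_lower[OF bdd that])
      have u_wit: "\<exists>r\<in>C. r x < c" if "u x < c" for x c
        using cINF_less_iff[OF False bdd, of x c] that unfolding u_def by blast
      have "sublinear u"
        unfolding sublinear_def
      proof (intro conjI allI impI)
        fix x y
        show "u (x + y) \<le> u x + u y"
        proof (rule field_le_epsilon)
          fix e :: real assume e: "0 < e"
          obtain r where r: "r \<in> C" "r x < u x + e / 2" using u_wit[of x "u x + e / 2"] e by auto
          obtain r' where r': "r' \<in> C" "r' y < u y + e / 2" using u_wit[of y "u y + e / 2"] e by auto
          obtain m where m: "m \<in> C" "m x \<le> r x" "m y \<le> r' y"
            using comp[OF r(1) r'(1)] r(1) r'(1) by (auto simp: P_def)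
          have "sublinear m" using m CS by (auto simp: S_def)
          then have "u (x + y) \<le> m x + m y" using u_le[OF m(1), of "x + y"] sublinear_add[of m x y] by linarith
          then show "u (x + y) \<le> u x + u y + e" using m r r' by linarith
        qed
      next
        fix t :: real and x assume t: "0 \<le> t"
        have "u (scaleC (complex_of_real t) x) \<le> t * c" if c: "u x < c" for c
        proof -
          obtain r where r: "r \<in> C" "r x < c" using u_wit[OF c] by auto
          have "sublinear r" using r CS by (auto simp: S_def)
          then have "u (scaleC (complex_of_real t) x) \<le> t * r x"
            using u_le[OF r(1), of "scaleC (complex_of_real t) x"] sublinear_scale[of r t x] t by simp
          also have "\<dots> \<le> t * c" using r t by (intro mult_left_mono) auto
          finally show ?thesis .
        qed
        then show "u (scaleC (complex_of_real t) x) \<le> t * u x" by (rule le_mult_limit[OF t])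
      qed
      moreover obtain r where r: "r \<in> C" using False by auto
      moreover have "u x \<le> q x" for x
        using u_le[OF r, of x] r CS by (auto simp: S_def intro: order_trans)
      moreover have "u (- x0) \<le> - q x0"
        using u_le[OF r, of "- x0"] r CS by (auto simp: S_def)
      ultimately have "u \<in> S" by (auto simp: S_def)
      then show ?thesis using u_le by (auto simp: P_def)
    qed
  qed
  then obtain m where m: "m \<in> S" and min: "\<And>a. a \<in> S \<Longrightarrow> P m a \<Longrightarrow> a = m" by blast
  have sm: "sublinear m" and mq: "\<And>x. m x \<le> q x" and mx0: "m (- x0) \<le> - q x0" using m by (auto simp: S_def)
  have neg: "m (- y) = - m y" for y
  proof -
    have "lower_along m y = m"
    proof (rule min)
      show "P m (lower_along m y)" using lower(1)[OF sm] by (simp add: P_def)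
      show "lower_along m y \<in> S"
        unfolding S_def using lower(1)[OF sm] mq mx0 sublinear_lower_along[OF sm]
        by (auto intro: order_trans)
    qed
    then have "m (- y) \<le> - m y" using lower(2)[OF sm, of y] by simp
    with sublinear_neg[OF sm, of y] show ?thesis by simp
  qed
  have add: "m (x + y) = m x + m y" for x y
    using sublinear_add[OF sm, of x y] sublinear_add[OF sm, of "x + y" "- y"] neg[of y] by simp
  show thesis
  proof (rule that[of m])
    show "m (x + y) = m x + m y" for x y by (rule add)
    show "m (scaleC (complex_of_real t) x) = t * m x" for t x
    proof (cases "0 \<le> t")
      case True
      then show ?thesis by (rule sublinear_scale[OF sm])
    next
      case False
      then have "m (scaleC (complex_of_real (- t)) x) = - t * m x" by (intro sublinear_scale[OF sm]) simp
      moreover have "scaleC (complex_of_real (- t)) x = - scaleC (complex_of_real t) x" by simp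
      ultimately show ?thesis by (simp only: neg)
    qed
    show "m x \<le> q x" for x by (rule mq)
    show "m x0 = q x0" using mx0 mq[of x0] neg[of x0] by simp
  qed
qed

text \<open>
  The standard complexification \<open>\<phi> x = f x - \<i> f (\<i> x)\<close> of a dominated real functional f. Its real part
  at \<open>x0\<close> is \<open>N x0\<close>, and the bound \<open>\<bar>\<phi> x0\<bar> \<le> N x0\<close> leaves no room for an imaginary part.
\<close>

lemma hahn_banach_complex:
  fixes N :: "'v::complex_vector \<Rightarrow> real"
  assumes N: "cseminorm N"
  obtains \<phi> :: "'v \<Rightarrow> complex" where "clinear \<phi>" "\<And>x. cmod (\<phi> x) \<le> N x" "\<phi> x0 = complex_of_real (N x0)"
proof -
  have "sublinear N" unfolding sublinear_def
    using cseminorm_add[OF N] cseminorm_scale[OF N] by simp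
  then obtain f where f: "\<And>x y. f (x + y) = f x + f y" "\<And>t x. f (scaleC (complex_of_real t) x) = t * f x"
    "\<And>x. f x \<le> N x" "f x0 = N x0" by (rule hahn_banach[of N x0]) (rule that)
  define \<phi> where "\<phi> x = Complex (f x) (- f (scaleC \<i> x))" for x
  have f0: "f (- x) = - f x" for x using f(2)[of "-1" x] by (simp add: scaleC_one)
  have fz: "f (scaleC z x) = Re z * f x + Im z * f (scaleC \<i> x)" for z x
  proof -
    have "scaleC z x = scaleC (complex_of_real (Re z)) x + scaleC (complex_of_real (Im z)) (scaleC \<i> x)"
      by (simp add: scaleC_scaleC scaleC_add_left[symmetric] complex_eq[of z, symmetric] mult.commute)
    then show ?thesis by (simp only: f)
  qed
  have add: "\<phi> (x + y) = \<phi> x + \<phi> y" for x y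
    by (simp add: \<phi>_def f scaleC_add_right complex_eq_iff)
  have scale: "\<phi> (scaleC z x) = z * \<phi> x" for z x
  proof -
    have "\<phi> (scaleC z x) = Complex (f (scaleC z x)) (- f (scaleC (\<i> * z) x))"
      by (simp only: \<phi>_def scaleC_scaleC)
    also have "\<dots> = Complex (Re z * f x + Im z * f (scaleC \<i> x)) (- (Re (\<i> * z) * f x + Im (\<i> * z) * f (scaleC \<i> x)))"
      by (simp only: fz[of z x] fz[of "\<i> * z" x])
    also have "\<dots> = z * \<phi> x" by (simp add: \<phi>_def complex_eq_iff)
    finally show ?thesis .
  qed
  have bound: "cmod (\<phi> x) \<le> N x" for x
  proof (cases "\<phi> x = 0")
    case True
    then show ?thesis using cseminorm_nonneg[OF N] by simp
  next
    case False
    \<comment> \<open>Rotate x so that \<open>\<phi>\<close> becomes real and equal to f there.\<close>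
    define c where "c = cnj (\<phi> x) / cmod (\<phi> x)"
    have c: "c * \<phi> x = cmod (\<phi> x)" "cmod c = 1"
      using False by (simp_all add: c_def norm_divide complex_norm_square[symmetric] power2_eq_square mult.commute[of "cnj _"])
    have "cmod (\<phi> x) = Re (\<phi> (scaleC c x))" by (simp add: scale c)
    also have "\<dots> = f (scaleC c x)" by (simp add: \<phi>_def)
    also have "\<dots> \<le> N (scaleC c x)" by (rule f)
    also have "\<dots> = N x" by (simp add: cseminorm_scale[OF N] c)
    finally show ?thesis .
  qed
  show thesis
  proof (rule that[of \<phi>])
    show "clinear \<phi>" by (simp add: clinear_iff add scale)
    show "\<phi> x0 = complex_of_real (N x0)"
    proof -
      have Re: "Re (\<phi> x0) = N x0" by (simp add: \<phi>_def f)
      have "(cmod (\<phi> x0))\<^sup>2 \<le> (N x0)\<^sup>2"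
        using bound[of x0] by (intro power_mono) auto
      then have "(Im (\<phi> x0))\<^sup>2 \<le> 0" by (simp add: cmod_power2 Re)
      then show ?thesis using Re by (simp add: complex_eq_iff)
    qed
  qed (rule bound)
qed

section \<open>Cholesky factorisation\<close>

text \<open>
  Induction on the index set: the Schur complement K of the entry at the new index is again positive
  definite, because its quadratic form at z is the form of H at the extension of z that minimises
  it. The inverse k of the factor g is constructed along with g.
\<close>

lemma cholesky:
  fixes H :: "'i \<Rightarrow> 'i \<Rightarrow> complex"
  assumes "finite I" and "\<And>i j. i \<in> I \<Longrightarrow> j \<in> I \<Longrightarrow> H j i = cnj (H i j)"
    and "\<And>z. \<exists>i\<in>I. z i \<noteq> 0 \<Longrightarrow> 0 < Re (\<Sum>i\<in>I. \<Sum>j\<in>I. H i j * z i * cnj (z j))"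
  shows "\<exists>g k. (\<forall>i\<in>I. \<forall>j\<in>I. H i j = (\<Sum>r\<in>I. g i r * cnj (g j r))) \<and>
    (\<forall>r\<in>I. \<forall>s\<in>I. (\<Sum>i\<in>I. k r i * g i s) = (if r = s then 1 else 0)) \<and>
    (\<forall>i\<in>I. \<forall>j\<in>I. (\<Sum>r\<in>I. g i r * k r j) = (if i = j then 1 else 0))"
  using assms
proof (induction I arbitrary: H rule: finite_induct)
  case empty
  then show ?case by simp
next
  case (insert p I)
  note herm = insert.prems(1) and pos = insert.prems(2)
  define d where "d = Re (H p p)"
  have Hpp: "H p p = complex_of_real d"
    using herm[of p p] by (simp add: d_def complex_eq_iff)
  have "0 < Re (\<Sum>i\<in>insert p I. \<Sum>j\<in>insert p I. H i j * (if i = p then 1 else 0) * cnj (if j = p then 1 else 0))"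
    by (rule pos[of "\<lambda>i. if i = p then 1 else 0"]) auto
  also have "(\<Sum>i\<in>insert p I. \<Sum>j\<in>insert p I. H i j * (if i = p then 1 else 0) * cnj (if j = p then 1 else 0))
    = (\<Sum>i\<in>insert p I. if i = p then \<Sum>j\<in>insert p I. if j = p then H p p else 0 else 0)"
    by (intro sum.cong refl) (auto intro!: sum.cong sum.neutral)
  also have "\<dots> = H p p" using insert.hyps by simp
  finally have d: "0 < d" by (simp add: d_def)
  \<comment> \<open>The Schur complement of the entry at p.\<close>
  define K where "K i j = H i j - H i p * H p j / d" for i j
  have "\<exists>g k. (\<forall>i\<in>I. \<forall>j\<in>I. K i j = (\<Sum>r\<in>I. g i r * cnj (g j r))) \<and>
    (\<forall>r\<in>I. \<forall>s\<in>I. (\<Sum>i\<in>I. k r i * g i s) = (if r = s then 1 else 0)) \<and>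
    (\<forall>i\<in>I. \<forall>j\<in>I. (\<Sum>r\<in>I. g i r * k r j) = (if i = j then 1 else 0))"
  proof (rule insert.IH)
    fix i j assume ij: "i \<in> I" "j \<in> I"
    then show "K j i = cnj (K i j)" using herm[of i j] herm[of i p] herm[of p j] by (simp add: K_def)
  next
    fix z :: "'i \<Rightarrow> complex" assume z: "\<exists>i\<in>I. z i \<noteq> 0"
    define c where "c = (\<Sum>i\<in>I. H i p * z i)"
    \<comment> \<open>The value at p minimises the quadratic form of H for given values z elsewhere.\<close>
    define y where "y i = (if i = p then - c / d else z i)" for i
    have y: "y i = z i" if "i \<in> I" for i using that insert.hyps by (auto simp: y_def)
    have yp: "y p = - c / d" by (simp add: y_def)
    have cc: "(\<Sum>j\<in>I. H p j * cnj (z j)) = cnj c"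
      unfolding c_def cnj_sum by (intro sum.cong refl) (use herm[of _ p] in simp)
    have "(\<Sum>i\<in>insert p I. \<Sum>j\<in>insert p I. H i j * y i * cnj (y j))
      = H p p * y p * cnj (y p) + y p * (\<Sum>j\<in>I. H p j * cnj (z j)) + (\<Sum>i\<in>I. H i p * z i) * cnj (y p)
        + (\<Sum>i\<in>I. \<Sum>j\<in>I. H i j * z i * cnj (z j))"
      using insert.hyps by (simp add: y sum.distrib sum_distrib_left sum_distrib_right mult_ac)
    also have "\<dots> = (\<Sum>i\<in>I. \<Sum>j\<in>I. H i j * z i * cnj (z j)) - c * cnj c / d"
      unfolding cc c_def[symmetric] yp Hpp using d by (simp add: field_simps)
    also have "c * cnj c / d = (\<Sum>i\<in>I. \<Sum>j\<in>I. H i p * H p j / d * z i * cnj (z j))"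
    proof -
      have "c * cnj c = (\<Sum>i\<in>I. H i p * z i) * (\<Sum>j\<in>I. H p j * cnj (z j))"
        by (simp only: cc) (simp only: c_def)
      also have "\<dots> = (\<Sum>i\<in>I. \<Sum>j\<in>I. (H i p * z i) * (H p j * cnj (z j)))" by (rule sum_product)
      finally show ?thesis by (simp add: sum_divide_distrib mult_ac)
    qed
    also have "(\<Sum>i\<in>I. \<Sum>j\<in>I. H i j * z i * cnj (z j)) - \<dots> = (\<Sum>i\<in>I. \<Sum>j\<in>I. K i j * z i * cnj (z j))"
      by (simp add: K_def sum_subtractf algebra_simps)
    finally have eq: "(\<Sum>i\<in>insert p I. \<Sum>j\<in>insert p I. H i j * y i * cnj (y j))
      = (\<Sum>i\<in>I. \<Sum>j\<in>I. K i j * z i * cnj (z j))" .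
    have "0 < Re (\<Sum>i\<in>insert p I. \<Sum>j\<in>insert p I. H i j * y i * cnj (y j))"
      by (rule pos) (use z y in auto)
    then show "0 < Re (\<Sum>i\<in>I. \<Sum>j\<in>I. K i j * z i * cnj (z j))" by (simp only: eq)
  qed
  then obtain g' k' where *: "(\<forall>i\<in>I. \<forall>j\<in>I. K i j = (\<Sum>r\<in>I. g' i r * cnj (g' j r))) \<and>
    (\<forall>r\<in>I. \<forall>s\<in>I. (\<Sum>i\<in>I. k' r i * g' i s) = (if r = s then 1 else 0)) \<and>
    (\<forall>i\<in>I. \<forall>j\<in>I. (\<Sum>r\<in>I. g' i r * k' r j) = (if i = j then 1 else 0))"
    by (elim exE) (rule that)
  note g' = *[THEN conjunct1, THEN bspec, THEN bspec, symmetric]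
    and kg' = *[THEN conjunct2, THEN conjunct1, THEN bspec, THEN bspec]
    and gk' = *[THEN conjunct2, THEN conjunct2, THEN bspec, THEN bspec]
  define D where "D = complex_of_real (sqrt d)"
  have D: "D * D = complex_of_real d" "D \<noteq> 0" "cnj D = D"
    using d by (simp_all add: D_def of_real_mult[symmetric] del: of_real_mult)
  define g where "g i r = (if i = p then if r = p then D else 0 else if r = p then H i p / D else g' i r)" for i r
  define k where "k r i = (if r = p then if i = p then 1 / D else 0
    else if i = p then - (\<Sum>s\<in>I. k' r s * H s p) / d else k' r i)" for r i
  have np: "i \<noteq> p" if "i \<in> I" for i using that insert.hyps by auto
  have gI: "g i r = g' i r" "g i p = H i p / D" "g p r = 0" "k r i = k' r i" "k p i = 0"
    "k r p = - (\<Sum>s\<in>I. k' r s * H s p) / d" if "i \<in> I" "r \<in> I" for i r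
    using np[OF that(1)] np[OF that(2)] by (auto simp: g_def k_def)
  have gp: "g p p = D" "k p p = 1 / D" by (simp_all add: g_def k_def)
  have S: "(\<Sum>i\<in>insert p I. f i) = f p + (\<Sum>i\<in>I. f i)" for f :: "'i \<Rightarrow> complex"
    using insert.hyps by simp
  show ?case
  proof (rule exI[of _ g], rule exI[of _ k], intro conjI ballI)
    fix i j assume ij: "i \<in> insert p I" "j \<in> insert p I"
    consider "i = p" "j = p" | "i \<in> I" "j = p" | "i = p" "j \<in> I" | "i \<in> I" "j \<in> I" using ij by auto
    then show "H i j = (\<Sum>r\<in>insert p I. g i r * cnj (g j r))"
    proof cases
      case 1
      then show ?thesis by (simp add: S gp gI D Hpp)
    next
      case 2
      then show ?thesis using D by (simp add: S gp gI)
    next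
      case 3
      then show ?thesis using D herm[of j p] by (simp add: S gp gI)
    next
      case 4
      have "H i p / D * cnj (H j p / D) = H i p * H p j / d"
        using herm[of j p] 4 D by (simp add: field_simps)
      then show ?thesis using 4 by (simp add: S gI g' K_def)
    qed
    have "i = p \<or> i \<in> I" using ij(1) by auto
    then show "(\<Sum>r\<in>insert p I. g i r * k r j) = (if i = j then 1 else 0)"
    proof
      assume "i = p"
      then show ?thesis using ij(2) D np by (auto simp: S gp gI)
    next
      assume i: "i \<in> I"
      have "j = p \<or> j \<in> I" using ij(2) by auto
      then show ?thesis
      proof
        assume j: "j = p"
        have "(\<Sum>r\<in>I. g' i r * k r p) = - (\<Sum>r\<in>I. \<Sum>s\<in>I. g' i r * k' r s * H s p) / d"
          using i by (simp add: gI sum_distrib_left sum_divide_distrib sum_negf mult_ac)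
        also have "(\<Sum>r\<in>I. \<Sum>s\<in>I. g' i r * k' r s * H s p) = (\<Sum>s\<in>I. \<Sum>r\<in>I. g' i r * k' r s * H s p)"
          by (rule sum.swap)
        also have "\<dots> = (\<Sum>s\<in>I. if s = i then H i p else 0)"
          by (intro sum.cong refl) (use i in \<open>auto simp: sum_distrib_right[symmetric] gk'\<close>)
        also have "\<dots> = H i p" using i insert.hyps by simp
        finally show ?thesis using i j D np[OF i] by (simp add: S gp gI)
      next
        assume "j \<in> I"
        then show ?thesis using i by (simp add: S gI gk')
      qed
    qed
  next
    fix r s assume rs: "r \<in> insert p I" "s \<in> insert p I"
    have "r = p \<or> r \<in> I" using rs(1) by auto
    then show "(\<Sum>i\<in>insert p I. k r i * g i s) = (if r = s then 1 else 0)"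
    proof
      assume "r = p"
      then show ?thesis using rs(2) D np by (auto simp: S gp gI)
    next
      assume r: "r \<in> I"
      have "s = p \<or> s \<in> I" using rs(2) by auto
      then show ?thesis
      proof
        assume s: "s = p"
        have "(\<Sum>i\<in>I. k r i * g i p) = (\<Sum>i\<in>I. k' r i * H i p) / D"
          unfolding sum_divide_distrib using r by (intro sum.cong refl) (simp add: gI)
        moreover have "k r p * D = - (\<Sum>i\<in>I. k' r i * H i p) / D"
          unfolding gI(6)[OF r r] D(1)[symmetric] using D(2) by (simp add: divide_simps)
        ultimately show ?thesis using r s np[OF r] by (simp add: S gp)
      next
        assume "s \<in> I"
        then show ?thesis using r by (simp add: S gI kg')
      qed
    qed
  qed
qed

section \<open>Factorisation of completely bounded maps on matrix algebras\<close>

instantiation prod :: (complex_vector, complex_vector) complex_vector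
begin
definition scaleC_prod :: "complex \<Rightarrow> 'a \<times> 'b \<Rightarrow> 'a \<times> 'b"
  where "scaleC_prod c p = (scaleC c (fst p), scaleC c (snd p))"
instance by standard
  (auto simp: scaleC_prod_def prod_eq_iff scaleC_add_right scaleC_add_left scaleC_scaleC scaleC_one)
end

lemma scaleC_Pair [simp]: "scaleC c (x, y) = (scaleC c x, scaleC c y)"
  by (simp add: scaleC_prod_def)

text \<open>
  The hypothesis \<open>loc\<close> makes f a functional on matrices over \<open>I \<times> J\<close>; the coefficients come from its
  values at the matrix units and at their multiples by \<open>\<i>\<close>.
\<close>

lemma real_functional_matrix:
  fixes f :: "('i \<Rightarrow> 'j \<Rightarrow> complex) \<Rightarrow> real"
  assumes fin: "finite I" "finite J"
    and add: "\<And>x y. f (x + y) = f x + f y" and scale: "\<And>t x. f (scaleC (complex_of_real t) x) = t * f x"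
    and loc: "\<And>x. (\<And>i j. i \<in> I \<Longrightarrow> j \<in> J \<Longrightarrow> x i j = 0) \<Longrightarrow> f x = 0"
  obtains S where "\<And>x. f x = Re (\<Sum>i\<in>I. \<Sum>j\<in>J. S i j * x i j)"
proof -
  define e :: "'i \<Rightarrow> 'j \<Rightarrow> 'i \<Rightarrow> 'j \<Rightarrow> complex" where "e i j = (\<lambda>k l. if k = i \<and> l = j then 1 else 0)" for i j
  define S where "S i j = Complex (f (e i j)) (- f (scaleC \<i> (e i j)))" for i j
  have f0: "f 0 = 0" using add[of 0 0] by simp
  have fsum: "f (\<Sum>a\<in>A. g a) = (\<Sum>a\<in>A. f (g a))" if "finite A" for A :: "'z set" and g
    using that by (induction A rule: finite_induct) (simp_all only: sum.empty sum.insert f0 add not_False_eq_True)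
  have fz: "f (scaleC z (e i j)) = Re (S i j * z)" for z i j
  proof -
    have "scaleC z (e i j) = scaleC (complex_of_real (Re z)) (e i j) + scaleC (complex_of_real (Im z)) (scaleC \<i> (e i j))"
      by (simp add: scaleC_scaleC scaleC_add_left[symmetric] complex_eq[of z, symmetric] mult.commute)
    then have "f (scaleC z (e i j)) = Re z * f (e i j) + Im z * f (scaleC \<i> (e i j))"
      by (simp only: add scale)
    then show ?thesis by (simp add: S_def)
  qed
  have sum_apply: "(\<Sum>a\<in>A. g a) k = (\<Sum>a\<in>A. g a k)" for A :: "'z set" and g :: "'z \<Rightarrow> 'w \<Rightarrow> 'x::comm_monoid_add" and k
    by (induction A rule: infinite_finite_induct) simp_all
  show thesis
  proof (rule that[of S])
    fix x
    define y where "y = (\<Sum>p\<in>I \<times> J. scaleC (x (fst p) (snd p)) (e (fst p) (snd p)))"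
    have y: "y k l = x k l" if "k \<in> I" "l \<in> J" for k l
    proof -
      have "y k l = (\<Sum>p\<in>I \<times> J. if p = (k, l) then x k l else 0)"
        unfolding y_def by (simp add: sum_apply) (auto simp: e_def intro!: sum.cong)
      then show ?thesis using fin that by simp
    qed
    have "f x = f (y + (x - y))" by simp
    also have "\<dots> = f y + f (x - y)" by (rule add)
    also have "f (x - y) = 0" by (rule loc) (simp add: y)
    also have "f y = (\<Sum>p\<in>I \<times> J. Re (S (fst p) (snd p) * x (fst p) (snd p)))"
      unfolding y_def using fin by (subst fsum) (simp_all add: fz)
    also have "\<dots> = Re (\<Sum>i\<in>I. \<Sum>j\<in>J. S i j * x i j)"
      unfolding sum_Times by simp
    finally show "f x = Re (\<Sum>i\<in>I. \<Sum>j\<in>J. S i j * x i j)" by simp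
  qed
qed

text \<open>
  The vector a is read as a matrix with rows indexed by the first component; this is \<open>a a\<^sup>*\<close>.
\<close>

definition gram :: "('i \<times> 'n::finite \<Rightarrow> complex) \<Rightarrow> 'i \<Rightarrow> 'i \<Rightarrow> complex"
  where "gram a i j = (\<Sum>c\<in>UNIV. a (i, c) * cnj (a (j, c)))"

text \<open>
  A list of pairs \<open>(a\<^sub>t, b\<^sub>t)\<close> represents the sum of the \<open>a\<^sub>t b\<^sub>t\<close> (\<open>rank_sum\<close>), that is, the map
  \<open>x \<mapsto> \<alpha> (1 \<otimes> x) \<beta>\<close> on \<open>M\<^sub>n\<close>, where \<open>\<alpha>\<close> is the row of the \<open>a\<^sub>t\<close> and \<open>\<beta>\<close> the column of the
  \<open>b\<^sub>t\<close>. Then \<open>gram1\<close> is \<open>\<alpha> \<alpha>\<^sup>*\<close>, and \<open>gram2\<close> is the corresponding Gram matrix of \<open>\<beta>\<close>, so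
  that their norms are the squares of the norms of \<open>\<alpha>\<close> and \<open>\<beta>\<close>.
\<close>

type_synonym ('i, 'n) fac = "(('i \<times> 'n \<Rightarrow> complex) \<times> ('i \<times> 'n \<Rightarrow> complex)) list"

definition gram1 :: "('i, 'n::finite) fac \<Rightarrow> 'i \<Rightarrow> 'i \<Rightarrow> complex"
  where "gram1 f = (\<lambda>i j. \<Sum>(a, b)\<leftarrow>f. gram a i j)"

definition gram2 :: "('i, 'n::finite) fac \<Rightarrow> 'i \<Rightarrow> 'i \<Rightarrow> complex"
  where "gram2 f = (\<lambda>i j. \<Sum>(a, b)\<leftarrow>f. gram b i j)"

definition rank_sum :: "('i, 'n) fac \<Rightarrow> 'i \<times> 'n \<Rightarrow> 'i \<times> 'n \<Rightarrow> complex"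
  where "rank_sum f = (\<lambda>p q. \<Sum>(a, b)\<leftarrow>f. a p * b q)"

definition scale_fac :: "complex \<Rightarrow> ('i, 'n) fac \<Rightarrow> ('i, 'n) fac"
  where "scale_fac z f = map (\<lambda>(a, b). (\<lambda>p. z * a p, \<lambda>p. z * b p)) f"

lemma fac_append:
  "gram1 (f @ g) = gram1 f + gram1 g" "gram2 (f @ g) = gram2 f + gram2 g"
  "rank_sum (f @ g) p q = rank_sum f p q + rank_sum g p q"
  by (simp_all add: gram1_def gram2_def rank_sum_def fun_eq_iff)

lemma fac_Nil [simp]: "gram1 [] = 0" "gram2 [] = 0" "rank_sum [] p q = 0"
  by (simp_all add: gram1_def gram2_def rank_sum_def fun_eq_iff)

lemma fac_single: "gram1 [(a, b)] = gram a" "gram2 [(a, b)] = gram b" "rank_sum [(a, b)] p q = a p * b q"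
  by (simp_all add: gram1_def gram2_def rank_sum_def fun_eq_iff)

lemma gram_scale: "gram (\<lambda>p. z * a p) = scaleC (z * cnj z) (gram a)"
  by (simp add: gram_def fun_eq_iff sum_distrib_left mult_ac)

lemma fac_scale:
  "gram1 (scale_fac z f) = scaleC (z * cnj z) (gram1 f)" "gram2 (scale_fac z f) = scaleC (z * cnj z) (gram2 f)"
  "rank_sum (scale_fac z f) p q = z * z * rank_sum f p q"
proof -
  have "gram1 (scale_fac z f) i j = z * cnj z * gram1 f i j" for i j
    by (induction f) (auto simp: gram1_def scale_fac_def gram_scale distrib_left)
  then show "gram1 (scale_fac z f) = scaleC (z * cnj z) (gram1 f)" by (simp add: fun_eq_iff)
  have "gram2 (scale_fac z f) i j = z * cnj z * gram2 f i j" for i j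
    by (induction f) (auto simp: gram2_def scale_fac_def gram_scale distrib_left)
  then show "gram2 (scale_fac z f) = scaleC (z * cnj z) (gram2 f)" by (simp add: fun_eq_iff)
  show "rank_sum (scale_fac z f) p q = z * z * rank_sum f p q"
    by (induction f) (auto simp: rank_sum_def scale_fac_def distrib_left)
qed

definition facs :: "'i set \<Rightarrow> ('i \<times> 'n \<Rightarrow> 'i \<times> 'n \<Rightarrow> complex) \<Rightarrow> ('i, 'n::finite) fac set"
  where "facs I x = {f. \<forall>p\<in>I \<times> UNIV. \<forall>q\<in>I \<times> UNIV. x p q = rank_sum f p q}"

lemma facs_nonempty:
  assumes "finite I"
  shows "facs I (x :: 'i \<times> 'n::finite \<Rightarrow> _) \<noteq> {}"
proof -
  obtain ps :: "('i \<times> 'n) list" where ps: "set ps = I \<times> UNIV" "distinct ps"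
    using finite_distinct_list[of "I \<times> (UNIV :: 'n set)"] assms by auto
  let ?f = "map (\<lambda>r. (\<lambda>p. if p = r then 1 else 0, x r)) ps"
  have "x p q = rank_sum ?f p q" if "p \<in> I \<times> UNIV" for p q
  proof -
    have "rank_sum ?f p q = (\<Sum>r\<leftarrow>ps. (if p = r then 1 else 0) * x r q)"
      by (simp add: rank_sum_def comp_def)
    also have "\<dots> = (\<Sum>r\<in>I \<times> UNIV. (if p = r then 1 else 0) * x r q)"
      by (simp add: sum_list_distinct_conv_sum_set ps)
    also have "\<dots> = (\<Sum>r\<in>I \<times> UNIV. if p = r then x p q else 0)"
      by (intro sum.cong) auto
    also have "\<dots> = x p q" using that assms by simp
    finally show ?thesis by simp
  qed
  then have "?f \<in> facs I x" by (auto simp: facs_def)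
  then show ?thesis by auto
qed

definition fac_cost :: "'i set \<Rightarrow> ('i \<Rightarrow> 'i \<Rightarrow> complex) \<Rightarrow> ('i \<Rightarrow> 'i \<Rightarrow> complex) \<Rightarrow> ('i, 'n::finite) fac \<Rightarrow> real"
  where "fac_cost I X Y f = opn I I (X + gram1 f) + opn I I (Y + gram2 f)"

text \<open>
  At \<open>X = Y = 0\<close> this is the infimum of \<open>\<parallel>\<alpha>\<parallel>\<^sup>2 + \<parallel>\<beta>\<parallel>\<^sup>2\<close>, which is twice that of
  \<open>\<parallel>\<alpha>\<parallel> \<parallel>\<beta>\<parallel>\<close>. The two additional arguments X and Y make the functional jointly sublinear and
  let a dominated linear functional be tested at \<open>(- gram a, - gram b, a b)\<close>, where it is at most 0.
\<close>

definition fac_norm :: "'i set \<Rightarrow> ('i \<Rightarrow> 'i \<Rightarrow> complex) \<times> ('i \<Rightarrow> 'i \<Rightarrow> complex) \<times>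
    ('i \<times> 'n \<Rightarrow> 'i \<times> 'n::finite \<Rightarrow> complex) \<Rightarrow> real"
  where "fac_norm I = (\<lambda>(X, Y, x). INF f\<in>facs I x. fac_cost I X Y f)"

lemma fac_cost_nonneg: "finite I \<Longrightarrow> 0 \<le> fac_cost I X Y f"
  by (simp add: fac_cost_def opn_nonneg)

lemma fac_norm_le: "finite I \<Longrightarrow> f \<in> facs I x \<Longrightarrow> fac_norm I (X, Y, x) \<le> fac_cost I X Y f"
  unfolding fac_norm_def prod.case
  by (rule cINF_lower) (auto intro!: bdd_belowI2[of _ 0] fac_cost_nonneg)

lemma fac_norm_witness:
  assumes "finite I" "fac_norm I (X, Y, x) < c"
  shows "\<exists>f\<in>facs I x. fac_cost I X Y f < c"
proof -
  have "bdd_below (fac_cost I X Y ` facs I x)"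
    by (rule bdd_belowI2[of _ 0]) (rule fac_cost_nonneg[OF assms(1)])
  from cINF_less_iff[OF facs_nonempty[OF assms(1)] this, of c] assms(2)
  show ?thesis by (simp add: fac_norm_def)
qed

lemma opn_triangle': "finite I \<Longrightarrow> finite J \<Longrightarrow> opn I J (A + B) \<le> opn I J A + opn I J B"
  using opn_triangle[of I J A B] by (simp add: plus_fun_def)

lemma opn_scale': "finite I \<Longrightarrow> finite J \<Longrightarrow> opn I J (scaleC c A) = cmod c * opn I J A"
  using opn_scale[of I J c A] by (simp add: scaleC_fun_def)

lemma opn_zero [simp]: "finite I \<Longrightarrow> finite J \<Longrightarrow> opn I J 0 = 0"
  using opn_scale'[of I J 0 0] by simp

text \<open>
  Factorisations are added by concatenating lists, and scaled by distributing the square root of the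
  scalar over both sides.
\<close>

lemma sublinear_fac_norm:
  assumes I: "finite I"
  shows "sublinear (fac_norm I :: _ \<times> _ \<times> ('i \<times> 'n::finite \<Rightarrow> _) \<Rightarrow> real)"
proof -
  let ?N = "fac_norm I :: _ \<times> _ \<times> ('i \<times> 'n::finite \<Rightarrow> _) \<Rightarrow> real"
  have add: "?N (X + X', Y + Y', x + x') \<le> ?N (X, Y, x) + ?N (X', Y', x')" for X X' Y Y' x x'
  proof (rule field_le_epsilon)
    fix e :: real assume e: "0 < e"
    obtain f where f: "f \<in> facs I x" "fac_cost I X Y f < ?N (X, Y, x) + e / 2"
      using fac_norm_witness[OF I, of X Y x "?N (X, Y, x) + e / 2"] e by auto
    obtain g where g: "g \<in> facs I x'" "fac_cost I X' Y' g < ?N (X', Y', x') + e / 2"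
      using fac_norm_witness[OF I, of X' Y' x' "?N (X', Y', x') + e / 2"] e by auto
    have "?N (X + X', Y + Y', x + x') \<le> fac_cost I (X + X') (Y + Y') (f @ g)"
      by (rule fac_norm_le[OF I]) (use f g in \<open>auto simp: facs_def fac_append\<close>)
    also have "\<dots> = opn I I ((X + gram1 f) + (X' + gram1 g)) + opn I I ((Y + gram2 f) + (Y' + gram2 g))"
      by (simp add: fac_cost_def fac_append algebra_simps)
    also have "\<dots> \<le> fac_cost I X Y f + fac_cost I X' Y' g"
      using opn_triangle'[OF I I, of "X + gram1 f" "X' + gram1 g"] opn_triangle'[OF I I, of "Y + gram2 f" "Y' + gram2 g"]
      unfolding fac_cost_def by linarith
    finally show "?N (X + X', Y + Y', x + x') \<le> ?N (X, Y, x) + ?N (X', Y', x') + e" using f g by linarith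
  qed
  have scale: "?N (scaleC (complex_of_real t) X, scaleC (complex_of_real t) Y, scaleC (complex_of_real t) x) \<le> t * ?N (X, Y, x)"
    if t: "0 \<le> t" for t X Y x
  proof (rule le_mult_limit[OF t])
    fix c assume "?N (X, Y, x) < c"
    then obtain f where f: "f \<in> facs I x" "fac_cost I X Y f < c" using fac_norm_witness[OF I] by blast
    define z where "z = complex_of_real (sqrt t)"
    have z: "z * cnj z = complex_of_real t" "z * z = complex_of_real t"
      using t by (simp_all add: z_def of_real_mult[symmetric] del: of_real_mult)
    have "?N (scaleC (complex_of_real t) X, scaleC (complex_of_real t) Y, scaleC (complex_of_real t) x)
      \<le> fac_cost I (scaleC (complex_of_real t) X) (scaleC (complex_of_real t) Y) (scale_fac z f)"
      by (rule fac_norm_le[OF I]) (use f in \<open>auto simp: facs_def fac_scale z\<close>)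
    also have "\<dots> = opn I I (scaleC (complex_of_real t) (X + gram1 f)) + opn I I (scaleC (complex_of_real t) (Y + gram2 f))"
      by (simp add: fac_cost_def fac_scale z scaleC_add_right)
    also have "\<dots> = t * fac_cost I X Y f"
      using t I by (simp add: opn_scale' fac_cost_def distrib_left)
    also have "\<dots> \<le> t * c" using f t by (intro mult_left_mono) auto
    finally show "?N (scaleC (complex_of_real t) X, scaleC (complex_of_real t) Y, scaleC (complex_of_real t) x) \<le> t * c" .
  qed
  show ?thesis unfolding sublinear_def using add scale by auto
qed

text \<open>
  The bound is optimal at \<open>t = W / U\<close>; both numbers are enlarged by e to make the quotient meaningful.
\<close>

lemma am_gm_optimise:
  fixes U W Z :: real
  assumes "0 \<le> U" "0 \<le> W" and Z: "\<And>t. 0 < t \<Longrightarrow> Z \<le> t * U\<^sup>2 + W\<^sup>2 / t"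
  shows "Z \<le> 2 * U * W"
proof -
  have le: "Z \<le> 2 * (U + e) * (W + e)" if e: "0 < e" for e
  proof -
    define u where "u = U + e"
    define w where "w = W + e"
    have uw: "0 < u" "0 < w" "U \<le> u" "W \<le> w" using assms e by (auto simp: u_def w_def)
    have "Z \<le> (w / u) * U\<^sup>2 + W\<^sup>2 / (w / u)" by (rule Z) (use uw in simp)
    also have "\<dots> \<le> (w / u) * u\<^sup>2 + w\<^sup>2 / (w / u)"
      using uw assms by (intro add_mono mult_left_mono divide_right_mono power_mono) auto
    also have "\<dots> = 2 * u * w" using uw by (simp add: power2_eq_square field_simps)
    finally show ?thesis by (simp add: u_def w_def)
  qed
  have "((\<lambda>e. 2 * (U + e) * (W + e)) \<longlongrightarrow> 2 * (U + 0) * (W + 0)) (at_right 0)"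
    by (intro tendsto_intros)
  then have "Z \<le> 2 * (U + 0) * (W + 0)"
    by (rule tendsto_lowerbound)
      (use le in \<open>auto intro: eventually_mono[OF eventually_at_right_less]\<close>)
  then show ?thesis by simp
qed

lemma l2_power2_cnj: "complex_of_real ((l2 I v)\<^sup>2) = (\<Sum>i\<in>I. v i * cnj (v i))"
  unfolding l2_power2 of_real_sum by (simp only: complex_norm_square)

text \<open>
  The density matrix H of the positive functional f, made strictly positive by adding d, is factored
  as \<open>H = g g\<^sup>*\<close> with invertible g. Then \<open>f (z z\<^sup>*)\<close> is at most \<open>\<parallel>g\<^sup>t z\<parallel>\<^sup>2\<close>, and the
  squared Hilbert-Schmidt norm of g is the trace of H, which is at most \<open>f 1 + d card I \<le> 1 + d card I\<close>.
\<close>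

lemma positive_functional_gram:
  fixes f :: "('i \<Rightarrow> 'i \<Rightarrow> complex) \<Rightarrow> real"
  assumes I: "finite I"
    and add: "\<And>x y. f (x + y) = f x + f y" and scale: "\<And>t x. f (scaleC (complex_of_real t) x) = t * f x"
    and loc: "\<And>x. (\<And>i j. i \<in> I \<Longrightarrow> j \<in> I \<Longrightarrow> x i j = 0) \<Longrightarrow> f x = 0"
    and pos: "\<And>z. 0 \<le> f (\<lambda>i j. z i * cnj (z j))" and bound: "\<And>x. f x \<le> opn I I x"
    and d: "0 < (d :: real)"
  obtains g k where
    "\<And>r s. r \<in> I \<Longrightarrow> s \<in> I \<Longrightarrow> (\<Sum>i\<in>I. k r i * g i s) = (if r = s then 1 else 0)"
    "\<And>i j. i \<in> I \<Longrightarrow> j \<in> I \<Longrightarrow> (\<Sum>r\<in>I. g i r * k r j) = (if i = j then 1 else 0)"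
    "\<And>a :: 'i \<times> 'n::finite \<Rightarrow> complex. f (gram a) \<le> (\<Sum>c\<in>UNIV. (l2 I (\<lambda>r. \<Sum>i\<in>I. g i r * a (i, c)))\<^sup>2)"
    "(l2 (I \<times> I) (\<lambda>(i, r). g i r))\<^sup>2 \<le> 1 + d * card I"
proof -
  obtain S where S: "\<And>x. f x = Re (\<Sum>i\<in>I. \<Sum>j\<in>I. S i j * x i j)"
    using real_functional_matrix[where f = f, OF I I add scale loc] by blast
  define H where "H i j = (S i j + cnj (S j i)) / 2 + (if i = j then complex_of_real d else 0)" for i j
  have quad: "Re (\<Sum>i\<in>I. \<Sum>j\<in>I. H i j * z i * cnj (z j)) = f (\<lambda>i j. z i * cnj (z j)) + d * (l2 I z)\<^sup>2" for z
  proof -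
    define A where "A = (\<Sum>i\<in>I. \<Sum>j\<in>I. S i j * (z i * cnj (z j)))"
    have "(\<Sum>i\<in>I. \<Sum>j\<in>I. H i j * z i * cnj (z j))
      = (\<Sum>i\<in>I. \<Sum>j\<in>I. S i j * (z i * cnj (z j)) / 2 + cnj (S j i) * (z i * cnj (z j)) / 2
          + (if i = j then complex_of_real d * (z i * cnj (z i)) else 0))"
      by (intro sum.cong refl) (auto simp: H_def field_simps)
    also have "\<dots> = A / 2 + (\<Sum>i\<in>I. \<Sum>j\<in>I. cnj (S j i) * (z i * cnj (z j))) / 2
        + (\<Sum>i\<in>I. complex_of_real d * (z i * cnj (z i)))"
      using I by (simp add: A_def sum.distrib sum_divide_distrib)
    also have "(\<Sum>i\<in>I. \<Sum>j\<in>I. cnj (S j i) * (z i * cnj (z j))) = cnj A"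
      unfolding A_def by (subst sum.swap) (simp add: mult_ac)
    also have "(\<Sum>i\<in>I. complex_of_real d * (z i * cnj (z i))) = complex_of_real (d * (l2 I z)\<^sup>2)"
      by (simp only: of_real_mult l2_power2_cnj sum_distrib_left)
    finally have "(\<Sum>i\<in>I. \<Sum>j\<in>I. H i j * z i * cnj (z j)) = A / 2 + cnj A / 2 + complex_of_real (d * (l2 I z)\<^sup>2)" .
    moreover have "f (\<lambda>i j. z i * cnj (z j)) = Re A" by (simp only: S A_def)
    ultimately show ?thesis by (simp only:) simp
  qed
  have "\<exists>g k. (\<forall>i\<in>I. \<forall>j\<in>I. H i j = (\<Sum>r\<in>I. g i r * cnj (g j r))) \<and>
    (\<forall>r\<in>I. \<forall>s\<in>I. (\<Sum>i\<in>I. k r i * g i s) = (if r = s then 1 else 0)) \<and>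
    (\<forall>i\<in>I. \<forall>j\<in>I. (\<Sum>r\<in>I. g i r * k r j) = (if i = j then 1 else 0))"
  proof (rule cholesky[OF I])
    show "H j i = cnj (H i j)" for i j by (simp add: H_def)
    fix z :: "'i \<Rightarrow> complex" assume z: "\<exists>i\<in>I. z i \<noteq> 0"
    then have "l2 I z \<noteq> 0" using I by (auto simp: L2_set_eq_0_iff)
    then have "0 < d * (l2 I z)\<^sup>2" using d by simp
    then show "0 < Re (\<Sum>i\<in>I. \<Sum>j\<in>I. H i j * z i * cnj (z j))"
      using pos[of z] by (simp only: quad)
  qed
  then obtain g k where gk: "(\<forall>i\<in>I. \<forall>j\<in>I. H i j = (\<Sum>r\<in>I. g i r * cnj (g j r))) \<and>
    (\<forall>r\<in>I. \<forall>s\<in>I. (\<Sum>i\<in>I. k r i * g i s) = (if r = s then 1 else 0)) \<and>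
    (\<forall>i\<in>I. \<forall>j\<in>I. (\<Sum>r\<in>I. g i r * k r j) = (if i = j then 1 else 0))"
    by (elim exE) (rule that)
  note Hg = gk[THEN conjunct1, THEN bspec, THEN bspec]
  have fz: "f (\<lambda>i j. z i * cnj (z j)) \<le> (l2 I (\<lambda>r. \<Sum>i\<in>I. g i r * z i))\<^sup>2" for z
  proof -
    have "(\<Sum>i\<in>I. \<Sum>j\<in>I. H i j * z i * cnj (z j))
      = (\<Sum>i\<in>I. \<Sum>j\<in>I. \<Sum>r\<in>I. (g i r * z i) * cnj (g j r * z j))"
      by (intro sum.cong refl) (simp add: Hg sum_distrib_left sum_distrib_right mult_ac)
    also have "\<dots> = (\<Sum>r\<in>I. \<Sum>i\<in>I. \<Sum>j\<in>I. (g i r * z i) * cnj (g j r * z j))"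
    proof -
      have "(\<Sum>i\<in>I. \<Sum>j\<in>I. \<Sum>r\<in>I. (g i r * z i) * cnj (g j r * z j))
        = (\<Sum>i\<in>I. \<Sum>r\<in>I. \<Sum>j\<in>I. (g i r * z i) * cnj (g j r * z j))"
        by (intro sum.cong refl sum.swap)
      also have "\<dots> = (\<Sum>r\<in>I. \<Sum>i\<in>I. \<Sum>j\<in>I. (g i r * z i) * cnj (g j r * z j))"
        by (rule sum.swap)
      finally show ?thesis .
    qed
    also have "\<dots> = (\<Sum>r\<in>I. (\<Sum>i\<in>I. g i r * z i) * cnj (\<Sum>j\<in>I. g j r * z j))"
      by (simp only: sum_product cnj_sum)
    also have "\<dots> = complex_of_real ((l2 I (\<lambda>r. \<Sum>i\<in>I. g i r * z i))\<^sup>2)" by (simp only: l2_power2_cnj)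
    finally have "Re (\<Sum>i\<in>I. \<Sum>j\<in>I. H i j * z i * cnj (z j)) = (l2 I (\<lambda>r. \<Sum>i\<in>I. g i r * z i))\<^sup>2"
      by (simp only: Re_complex_of_real)
    then show ?thesis using quad[of z] d by simp
  qed
  show thesis
  proof (rule that[of k g])
    show "(\<Sum>i\<in>I. k r i * g i s) = (if r = s then 1 else 0)" if "r \<in> I" "s \<in> I" for r s
      using gk[THEN conjunct2, THEN conjunct1, THEN bspec, THEN bspec, OF that] .
    show "(\<Sum>r\<in>I. g i r * k r j) = (if i = j then 1 else 0)" if "i \<in> I" "j \<in> I" for i j
      using gk[THEN conjunct2, THEN conjunct2, THEN bspec, THEN bspec, OF that] .
    show "f (gram a) \<le> (\<Sum>c\<in>UNIV. (l2 I (\<lambda>r. \<Sum>i\<in>I. g i r * a (i, c)))\<^sup>2)"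
      for a :: "'i \<times> 'n::finite \<Rightarrow> complex"
    proof -
      have "(\<Sum>i\<in>I. \<Sum>j\<in>I. S i j * gram a i j) = (\<Sum>i\<in>I. \<Sum>j\<in>I. \<Sum>c\<in>UNIV. S i j * (a (i, c) * cnj (a (j, c))))"
        by (simp add: gram_def sum_distrib_left)
      also have "\<dots> = (\<Sum>c\<in>UNIV. \<Sum>i\<in>I. \<Sum>j\<in>I. S i j * (a (i, c) * cnj (a (j, c))))"
        by (simp only: sum.swap[of _ UNIV I])
      finally have "f (gram a) = (\<Sum>c\<in>UNIV. f (\<lambda>i j. a (i, c) * cnj (a (j, c))))"
        by (simp only: S Re_sum)
      also have "\<dots> \<le> (\<Sum>c\<in>UNIV. (l2 I (\<lambda>r. \<Sum>i\<in>I. g i r * a (i, c)))\<^sup>2)"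
        by (intro sum_mono fz)
      finally show ?thesis .
    qed
    show "(l2 (I \<times> I) (\<lambda>(i, r). g i r))\<^sup>2 \<le> 1 + d * card I"
    proof -
      let ?d = "\<lambda>i r. if r = i then 1 else 0 :: complex"
      have "complex_of_real ((l2 (I \<times> I) (\<lambda>(i, r). g i r))\<^sup>2) = (\<Sum>i\<in>I. H i i)"
        unfolding l2_power2_cnj sum_Times by (intro sum.cong refl) (simp add: Hg)
      then have "(l2 (I \<times> I) (\<lambda>(i, r). g i r))\<^sup>2 = Re (\<Sum>i\<in>I. H i i)"
        by (metis Re_complex_of_real)
      also have "\<dots> = Re (\<Sum>i\<in>I. S i i) + d * card I"
        by (simp add: H_def sum.distrib)
      also have "Re (\<Sum>i\<in>I. S i i) = f ?d"
        using I by (simp add: S if_distrib cong: if_cong)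
      also have "\<dots> \<le> 1"
        using bound[of ?d] opn_select[OF I I, of "\<lambda>i. i"] by simp
      finally show ?thesis by simp
    qed
  qed
qed

text \<open>
  A functional F that attains \<open>fac_norm\<close> at \<open>(0, 0, v)\<close> and is dominated by it splits into two
  positive functionals \<open>f1\<close>, \<open>f2\<close> of norm at most 1 and a functional h with
  \<open>h (a b) \<le> f1 (gram a) + f2 (gram b)\<close>. After replacing a and b by \<open>t^(1/2) a\<close> and
  \<open>t^(-1/2) b\<close> and optimising over t, this says that h is bounded by twice the geometric mean of
  \<open>f1\<close> and \<open>f2\<close>. With the factors g and \<open>g'\<close> of \<open>f1\<close> and \<open>f2\<close>, the coefficients of h are therefore
  \<open>2 g B g'\<^sup>t\<close> for a contraction B, and \<open>h v\<close> is twice the value of the matrix \<open>pairing v B\<close> at two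
  vectors g and \<open>g'\<close> of norm about 1. By duality this is at most \<open>2 \<parallel>v\<parallel>\<close>.
\<close>

lemma fac_norm_le_S1:
  fixes v :: "'i \<Rightarrow> 'i \<Rightarrow> complex^'n^'n"
  assumes I: "finite I"
  shows "fac_norm I (0, 0, flat v) \<le> 2 * S1 I v"
proof -
  let ?N = "fac_norm I :: _ \<times> _ \<times> ('i \<times> 'n \<Rightarrow> 'i \<times> 'n \<Rightarrow> complex) \<Rightarrow> real"
  let ?P = "I \<times> (UNIV :: 'n set)"
  have P: "finite ?P" using I by simp
  obtain F where Fadd: "\<And>x y. F (x + y) = F x + F y" and Fscale: "\<And>t x. F (scaleC (complex_of_real t) x) = t * F x"
    and FN: "\<And>x. F x \<le> ?N x" and F0: "F (0, 0, flat v) = ?N (0, 0, flat v)"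
    by (rule hahn_banach[OF sublinear_fac_norm[OF I], of "(0, 0, flat v)"]) (rule that)
  define f1 where "f1 X = F (X, 0, 0)" for X
  define f2 where "f2 Y = F (0, Y, 0)" for Y
  define h where "h x = F (0, 0, x)" for x
  have split: "F (X, Y, x) = f1 X + f2 Y + h x" for X Y x
    using Fadd[of "(X, 0, 0)" "(0, Y, 0)"] Fadd[of "(X, Y, 0)" "(0, 0, x)"]
    by (simp add: f1_def f2_def h_def)
  have add: "f1 (X + X') = f1 X + f1 X'" "f2 (X + X') = f2 X + f2 X'" "h (x + x') = h x + h x'" for X X' x x'
    using Fadd[of "(X, 0, 0)" "(X', 0, 0)"] Fadd[of "(0, X, 0)" "(0, X', 0)"] Fadd[of "(0, 0, x)" "(0, 0, x')"]
    by (simp_all add: f1_def f2_def h_def)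
  have scale: "f1 (scaleC (complex_of_real t) X) = t * f1 X" "f2 (scaleC (complex_of_real t) X) = t * f2 X"
    "h (scaleC (complex_of_real t) x) = t * h x" for t X x
    using Fscale[of t "(X, 0, 0)"] Fscale[of t "(0, X, 0)"] Fscale[of t "(0, 0, x)"]
    by (simp_all add: f1_def f2_def h_def)
  have zero: "f1 0 = 0" "f2 0 = 0" "h 0 = 0"
    using add(1)[of 0 0] add(2)[of 0 0] add(3)[of 0 0] by simp_all
  have neg: "f1 (- X) = - f1 X" "f2 (- X) = - f2 X" "h (- x) = - h x" for X x
    using add(1)[of X "- X"] add(2)[of X "- X"] add(3)[of x "- x"] zero by simp_all
  have nil: "[] \<in> facs I x" if "\<And>p q. p \<in> ?P \<Longrightarrow> q \<in> ?P \<Longrightarrow> x p q = 0" for x :: "'i \<times> 'n \<Rightarrow> 'i \<times> 'n \<Rightarrow> complex"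
    using that by (simp add: facs_def)
  have bound: "f1 X \<le> opn I I X" "f2 X \<le> opn I I X" for X
  proof -
    have "F (X, 0, 0) \<le> fac_cost I X 0 ([] :: ('i, 'n) fac)" "F (0, X, 0) \<le> fac_cost I 0 X ([] :: ('i, 'n) fac)"
      by (rule order_trans[OF FN fac_norm_le[OF I nil]], simp)+
    then show "f1 X \<le> opn I I X" "f2 X \<le> opn I I X" using I by (simp_all add: f1_def f2_def fac_cost_def)
  qed
  have opn0: "opn I I X = 0" if "\<And>i j. i \<in> I \<Longrightarrow> j \<in> I \<Longrightarrow> X i j = 0" for X
    using opn_cong[of I I X 0] that I by simp
  have loc: "f1 X = 0" "f2 X = 0" if "\<And>i j. i \<in> I \<Longrightarrow> j \<in> I \<Longrightarrow> X i j = 0" for X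
    using bound[of X] bound[of "- X"] opn0[of X] opn0[of "- X"] that by (simp_all add: neg)
  have hloc: "h x = 0" if x: "\<And>p q. p \<in> ?P \<Longrightarrow> q \<in> ?P \<Longrightarrow> x p q = 0" for x
  proof -
    have "h y \<le> 0" if "\<And>p q. p \<in> ?P \<Longrightarrow> q \<in> ?P \<Longrightarrow> y p q = 0" for y
      using order_trans[OF FN fac_norm_le[OF I nil[of y]], of 0 0] that I by (simp add: h_def fac_cost_def)
    from this[of x] this[of "- x"] show ?thesis using x by (simp add: neg)
  qed
  have dom: "h (\<lambda>p q. a p * b q) \<le> f1 (gram a) + f2 (gram b)" for a b
  proof -
    \<comment> \<open>The one-term factorisation cancels both Gram matrices.\<close>
    have "F (- gram a, - gram b, \<lambda>p q. a p * b q) \<le> fac_cost I (- gram a) (- gram b) [(a, b)]"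
      by (rule order_trans[OF FN fac_norm_le[OF I]]) (simp add: facs_def fac_single)
    also have "\<dots> = 0" using I by (simp add: fac_cost_def fac_single)
    finally show ?thesis by (simp add: split neg)
  qed
  have pos: "0 \<le> f1 (\<lambda>i j. z i * cnj (z j))" "0 \<le> f2 (\<lambda>i j. z i * cnj (z j))" for z
  proof -
    define c0 where "c0 = (undefined :: 'n)"
    \<comment> \<open>A single column: any index \<open>c0\<close> will do, and then \<open>gram a\<close> is \<open>z z\<^sup>*\<close>.\<close>
    define a where "a = (\<lambda>(i, c). if c = c0 then z i else 0)"
    have gr: "gram a = (\<lambda>i j. z i * cnj (z j))"
    proof (intro ext)
      fix i j
      have "gram a i j = (\<Sum>c\<in>UNIV. if c = c0 then z i * cnj (z j) else 0)"
        unfolding gram_def by (intro sum.cong) (auto simp: a_def)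
      then show "gram a i j = z i * cnj (z j)" by simp
    qed
    have g0: "gram (\<lambda>_ :: 'i \<times> 'n. 0) = 0" by (simp add: gram_def fun_eq_iff)
    have z0: "(\<lambda>(p :: 'i \<times> 'n) (q :: 'i \<times> 'n). 0 :: complex) = 0" by (simp add: fun_eq_iff)
    show "0 \<le> f1 (\<lambda>i j. z i * cnj (z j))" "0 \<le> f2 (\<lambda>i j. z i * cnj (z j))"
      using dom[of a "\<lambda>_. 0"] dom[of "\<lambda>_. 0" a] by (simp_all add: gr g0 zero z0)
  qed
  obtain hc where hc: "\<And>x. h x = Re (\<Sum>p\<in>?P. \<Sum>q\<in>?P. hc p q * x p q)"
    using real_functional_matrix[where f = h, OF P P add(3) scale(3) hloc] by blast
  have main: "?N (0, 0, flat v) \<le> (2 * S1 I v) * (1 + d * card I)" if d: "0 < d" for d :: real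
  proof -
    obtain g k where kg: "\<And>r s. r \<in> I \<Longrightarrow> s \<in> I \<Longrightarrow> (\<Sum>i\<in>I. k r i * g i s) = (if r = s then 1 else 0)"
      and gk: "\<And>i j. i \<in> I \<Longrightarrow> j \<in> I \<Longrightarrow> (\<Sum>r\<in>I. g i r * k r j) = (if i = j then 1 else 0)"
      and g_dom: "\<And>a :: 'i \<times> 'n \<Rightarrow> complex. f1 (gram a) \<le> (\<Sum>c\<in>UNIV. (l2 I (\<lambda>r. \<Sum>i\<in>I. g i r * a (i, c)))\<^sup>2)"
      and g_HS: "(l2 (I \<times> I) (\<lambda>(i, r). g i r))\<^sup>2 \<le> 1 + d * card I"
      by (rule positive_functional_gram[where f = f1, OF I add(1) scale(1) loc(1) pos(1) bound(1) d]) (assumption, rule that)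
    obtain g' k' where kg': "\<And>r s. r \<in> I \<Longrightarrow> s \<in> I \<Longrightarrow> (\<Sum>i\<in>I. k' r i * g' i s) = (if r = s then 1 else 0)"
      and gk': "\<And>i j. i \<in> I \<Longrightarrow> j \<in> I \<Longrightarrow> (\<Sum>r\<in>I. g' i r * k' r j) = (if i = j then 1 else 0)"
      and g_dom': "\<And>a :: 'i \<times> 'n \<Rightarrow> complex. f2 (gram a) \<le> (\<Sum>c\<in>UNIV. (l2 I (\<lambda>r. \<Sum>i\<in>I. g' i r * a (i, c)))\<^sup>2)"
      and g_HS': "(l2 (I \<times> I) (\<lambda>(i, r). g' i r))\<^sup>2 \<le> 1 + d * card I"
      by (rule positive_functional_gram[where f = f2, OF I add(2) scale(2) loc(2) pos(2) bound(2) d]) (assumption, rule that)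
    define B where "B = (\<lambda>(r, a) (s, b). (\<Sum>i\<in>I. \<Sum>j\<in>I. k r i * k' s j * hc (i, a) (j, b)) / 2)"
    have B: "opn ?P ?P B \<le> 1"
    proof (rule opn_le_bilinear)
      fix u w :: "'i \<times> 'n \<Rightarrow> complex"
      \<comment> \<open>The preimages of u and w under g and \<open>g'\<close>.\<close>
      define x where "x = (\<lambda>(i, a). \<Sum>r\<in>I. u (r, a) * k r i)"
      define y where "y = (\<lambda>(j, b). \<Sum>s\<in>I. w (s, b) * k' s j)"
      have gx: "(\<Sum>i\<in>I. g i r * x (i, a)) = u (r, a)" if "r \<in> I" for r a
      proof -
        have "(\<Sum>i\<in>I. g i r * x (i, a)) = (\<Sum>i\<in>I. \<Sum>s\<in>I. u (s, a) * (k s i * g i r))"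
          by (simp add: x_def sum_distrib_left mult_ac)
        also have "\<dots> = (\<Sum>s\<in>I. u (s, a) * (\<Sum>i\<in>I. k s i * g i r))"
          by (subst sum.swap) (simp add: sum_distrib_left)
        also have "\<dots> = (\<Sum>s\<in>I. if s = r then u (r, a) else 0)"
          using that by (intro sum.cong refl) (simp add: kg)
        finally show ?thesis using that I by simp
      qed
      have gy: "(\<Sum>i\<in>I. g' i r * y (i, a)) = w (r, a)" if "r \<in> I" for r a
      proof -
        have "(\<Sum>i\<in>I. g' i r * y (i, a)) = (\<Sum>i\<in>I. \<Sum>s\<in>I. w (s, a) * (k' s i * g' i r))"
          by (simp add: y_def sum_distrib_left mult_ac)
        also have "\<dots> = (\<Sum>s\<in>I. w (s, a) * (\<Sum>i\<in>I. k' s i * g' i r))"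
          by (subst sum.swap) (simp add: sum_distrib_left)
        also have "\<dots> = (\<Sum>s\<in>I. if s = r then w (r, a) else 0)"
          using that by (intro sum.cong refl) (simp add: kg')
        finally show ?thesis using that I by simp
      qed
      have swap_l2: "(\<Sum>c\<in>UNIV. (l2 I (\<lambda>r. u (r, c)))\<^sup>2) = (l2 ?P u)\<^sup>2" for u :: "'i \<times> 'n \<Rightarrow> complex"
        unfolding l2_power2 sum_Times by (rule sum.swap)
      have f1x: "f1 (gram x) \<le> (l2 ?P u)\<^sup>2"
      proof -
        have "f1 (gram x) \<le> (\<Sum>c\<in>UNIV. (l2 I (\<lambda>r. \<Sum>i\<in>I. g i r * x (i, c)))\<^sup>2)" by (rule g_dom)
        also have "\<dots> = (\<Sum>c\<in>UNIV. (l2 I (\<lambda>r. u (r, c)))\<^sup>2)"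
          by (intro sum.cong refl arg_cong[where f = "\<lambda>z. z\<^sup>2"] l2_cong gx)
        finally show ?thesis by (simp only: swap_l2)
      qed
      have f2y: "f2 (gram y) \<le> (l2 ?P w)\<^sup>2"
      proof -
        have "f2 (gram y) \<le> (\<Sum>c\<in>UNIV. (l2 I (\<lambda>r. \<Sum>i\<in>I. g' i r * y (i, c)))\<^sup>2)" by (rule g_dom')
        also have "\<dots> = (\<Sum>c\<in>UNIV. (l2 I (\<lambda>r. w (r, c)))\<^sup>2)"
          by (intro sum.cong refl arg_cong[where f = "\<lambda>z. z\<^sup>2"] l2_cong gy)
        finally show ?thesis by (simp only: swap_l2)
      qed
      define Z where "Z = (\<Sum>p\<in>?P. \<Sum>q\<in>?P. hc p q * (x p * y q))"
      have Z2: "(\<Sum>p\<in>?P. \<Sum>q\<in>?P. u p * B p q * w q) = Z / 2"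
      proof -
        have "Z = (\<Sum>i\<in>I. \<Sum>a\<in>UNIV. \<Sum>j\<in>I. \<Sum>b\<in>UNIV. \<Sum>r\<in>I. \<Sum>s\<in>I.
            u (r, a) * (k r i * k' s j * hc (i, a) (j, b)) * w (s, b))"
          unfolding Z_def sum_Times x_def y_def prod.case sum_product
          by (simp add: sum_distrib_left mult_ac)
        also have "\<dots> = (\<Sum>r\<in>I. \<Sum>a\<in>UNIV. \<Sum>s\<in>I. \<Sum>b\<in>UNIV. \<Sum>i\<in>I. \<Sum>j\<in>I.
            u (r, a) * (k r i * k' s j * hc (i, a) (j, b)) * w (s, b))"
        proof -
          have sw: "(\<Sum>i\<in>I. \<Sum>a\<in>UNIV. \<Sum>j\<in>I. \<Sum>b\<in>UNIV. \<Sum>r\<in>I. \<Sum>s\<in>I. G i a j b r s)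
            = (\<Sum>r\<in>I. \<Sum>a\<in>UNIV. \<Sum>s\<in>I. \<Sum>b\<in>UNIV. \<Sum>i\<in>I. \<Sum>j\<in>I. G i a j b r s)"
            for G :: "'i \<Rightarrow> 'n \<Rightarrow> 'i \<Rightarrow> 'n \<Rightarrow> 'i \<Rightarrow> 'i \<Rightarrow> complex"
          proof -
            have "(\<Sum>i\<in>I. \<Sum>a\<in>UNIV. \<Sum>j\<in>I. \<Sum>b\<in>UNIV. \<Sum>r\<in>I. \<Sum>s\<in>I. G i a j b r s)
              = (\<Sum>(i, a, j, b, r, s)\<in>I \<times> UNIV \<times> I \<times> UNIV \<times> I \<times> I. G i a j b r s)"
              by (simp add: sum.cartesian_product)
            also have "\<dots> = (\<Sum>(r, a, s, b, i, j)\<in>I \<times> UNIV \<times> I \<times> UNIV \<times> I \<times> I. G i a j b r s)"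
              by (rule sum.reindex_bij_witness[of _ "\<lambda>(r, a, s, b, i, j). (i, a, j, b, r, s)"
                  "\<lambda>(i, a, j, b, r, s). (r, a, s, b, i, j)"]) auto
            also have "\<dots> = (\<Sum>r\<in>I. \<Sum>a\<in>UNIV. \<Sum>s\<in>I. \<Sum>b\<in>UNIV. \<Sum>i\<in>I. \<Sum>j\<in>I. G i a j b r s)"
              by (simp add: sum.cartesian_product)
            finally show ?thesis .
          qed
          show ?thesis by (rule sw)
        qed
        also have "\<dots> = (\<Sum>p\<in>?P. \<Sum>q\<in>?P. u p * (2 * B p q) * w q)"
        proof -
          have B2: "2 * B (r, a) (s, b) = (\<Sum>i\<in>I. \<Sum>j\<in>I. k r i * k' s j * hc (i, a) (j, b))" for r a s b
            by (simp add: B_def)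
          show ?thesis
            unfolding sum_Times by (simp only: B2 sum_distrib_left sum_distrib_right)
        qed
        also have "\<dots> = 2 * (\<Sum>p\<in>?P. \<Sum>q\<in>?P. u p * B p q * w q)"
          by (simp add: sum_distrib_left mult_ac)
        finally show ?thesis by simp
      qed
      have "cmod Z \<le> 2 * l2 ?P u * l2 ?P w"
      proof (rule am_gm_optimise)
        fix t :: real assume t: "0 < t"
        obtain c where c: "cmod c = 1" "c * Z = complex_of_real (cmod Z)"
        proof (cases "Z = 0")
          case True
          then show ?thesis using that[of 1] by simp
        next
          case False
          then show ?thesis
            using that[of "cnj Z / cmod Z"]
            by (simp add: norm_divide complex_norm_square[symmetric] power2_eq_square mult.commute[of "cnj _"])
        qed
        \<comment> \<open>The unimodular c makes the form real; \<open>st\<close> shifts weight between the two Gram matrices.\<close>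
        define st where "st = complex_of_real (sqrt t)"
        have st: "st * cnj st = complex_of_real t" "st \<noteq> 0" "cnj st = st" "st * st = complex_of_real t"
          using t by (simp_all add: st_def of_real_mult[symmetric] del: of_real_mult)
        have cc: "(c * st) * cnj (c * st) = complex_of_real t"
        proof -
          have "c * cnj c = 1" using c(1) by (metis complex_norm_square of_real_1 power_one)
          moreover have "(c * st) * cnj (c * st) = (c * cnj c) * (st * cnj st)" by (simp add: mult_ac)
          ultimately show ?thesis using st(1) by simp
        qed
        have ii: "(1 / st) * cnj (1 / st) = complex_of_real (1 / t)"
          using st by simp
        have "cmod Z = Re (c * Z)" using c by simp
        also have "c * Z = (\<Sum>p\<in>?P. \<Sum>q\<in>?P. hc p q * ((c * st * x p) * (1 / st * y q)))"
          unfolding Z_def sum_distrib_left by (intro sum.cong refl) (use st in \<open>simp add: mult_ac\<close>)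
        also have "Re \<dots> = h (\<lambda>p q. (c * st * x p) * (1 / st * y q))" by (simp only: hc)
        also have "\<dots> \<le> f1 (gram (\<lambda>p. c * st * x p)) + f2 (gram (\<lambda>q. 1 / st * y q))" by (rule dom)
        also have "\<dots> = t * f1 (gram x) + (1 / t) * f2 (gram y)"
          by (simp only: gram_scale cc ii scale)
        also have "\<dots> \<le> t * (l2 ?P u)\<^sup>2 + (1 / t) * (l2 ?P w)\<^sup>2"
          using t by (intro add_mono mult_left_mono f1x f2y) auto
        finally show "cmod Z \<le> t * (l2 ?P u)\<^sup>2 + (l2 ?P w)\<^sup>2 / t" by simp
      qed auto
      then show "cmod (\<Sum>p\<in>?P. \<Sum>q\<in>?P. u p * B p q * w q) \<le> 1 * l2 ?P u * l2 ?P w"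
        by (simp add: Z2 norm_divide)
    qed simp
    define Bm :: "'i \<Rightarrow> 'i \<Rightarrow> complex^'n^'n" where "Bm r s = (\<chi> a b. B (r, a) (s, b))" for r s
    have flatB: "flat Bm = B" by (auto simp: fun_eq_iff Bm_def)
    have hcB: "hc (i, a) (j, b) = 2 * (\<Sum>r\<in>I. \<Sum>s\<in>I. g i r * g' j s * B (r, a) (s, b))"
      if ij: "i \<in> I" "j \<in> I" for i j a b
    proof -
      have "2 * (\<Sum>r\<in>I. \<Sum>s\<in>I. g i r * g' j s * B (r, a) (s, b))
        = (\<Sum>r\<in>I. \<Sum>s\<in>I. \<Sum>i'\<in>I. \<Sum>j'\<in>I. (g i r * k r i') * (g' j s * k' s j') * hc (i', a) (j', b))"
      proof -
        have B2: "2 * B (r, a) (s, b) = (\<Sum>i\<in>I. \<Sum>j\<in>I. k r i * k' s j * hc (i, a) (j, b))" for r s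
          by (simp add: B_def)
        have "2 * (\<Sum>r\<in>I. \<Sum>s\<in>I. g i r * g' j s * B (r, a) (s, b))
          = (\<Sum>r\<in>I. \<Sum>s\<in>I. g i r * g' j s * (2 * B (r, a) (s, b)))"
          by (simp add: sum_distrib_left mult_ac)
        then show ?thesis by (simp only: B2 sum_distrib_left) (simp add: mult_ac)
      qed
      also have "\<dots> = (\<Sum>r\<in>I. \<Sum>i'\<in>I. \<Sum>s\<in>I. \<Sum>j'\<in>I. (g i r * k r i') * (g' j s * k' s j') * hc (i', a) (j', b))"
        by (intro sum.cong refl sum.swap)
      also have "\<dots> = (\<Sum>i'\<in>I. \<Sum>r\<in>I. \<Sum>j'\<in>I. \<Sum>s\<in>I. (g i r * k r i') * (g' j s * k' s j') * hc (i', a) (j', b))"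
        by (subst sum.swap) (intro sum.cong refl sum.swap)
      also have "\<dots> = (\<Sum>i'\<in>I. \<Sum>j'\<in>I. \<Sum>r\<in>I. \<Sum>s\<in>I. (g i r * k r i') * (g' j s * k' s j') * hc (i', a) (j', b))"
        by (intro sum.cong refl sum.swap)
      also have "\<dots> = (\<Sum>i'\<in>I. \<Sum>j'\<in>I. (\<Sum>r\<in>I. g i r * k r i') * (\<Sum>s\<in>I. g' j s * k' s j') * hc (i', a) (j', b))"
      proof -
        have "(\<Sum>r\<in>I. \<Sum>s\<in>I. x r * y s * c) = (\<Sum>r\<in>I. x r) * (\<Sum>s\<in>I. y s) * c"
          for x y :: "'i \<Rightarrow> complex" and c
          by (subst sum_product) (simp only: sum_distrib_right)
        then show ?thesis by (simp only:)
      qed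
      also have "\<dots> = (\<Sum>i'\<in>I. if i' = i then \<Sum>j'\<in>I. if j' = j then hc (i, a) (j, b) else 0 else 0)"
        by (intro sum.cong refl) (use ij in \<open>auto simp: gk gk' intro!: sum.cong sum.neutral\<close>)
      also have "\<dots> = hc (i, a) (j, b)" using ij I by simp
      finally show ?thesis by simp
    qed
    have "?N (0, 0, flat v) = h (flat v)" using F0 by (simp add: h_def)
    also have "\<dots> = Re (\<Sum>p\<in>?P. \<Sum>q\<in>?P. hc p q * flat v p q)" by (rule hc)
    also have "(\<Sum>p\<in>?P. \<Sum>q\<in>?P. hc p q * flat v p q)
      = (\<Sum>i\<in>I. \<Sum>a\<in>UNIV. \<Sum>j\<in>I. \<Sum>b\<in>UNIV. \<Sum>r\<in>I. \<Sum>s\<in>I.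
          2 * (g i r * (v i j $ a $ b * Bm r s $ a $ b) * g' j s))"
      unfolding sum_Times prod.case
      by (intro sum.cong refl) (simp add: hcB Bm_def sum_distrib_left sum_distrib_right mult_ac)
    also have "\<dots> = (\<Sum>i\<in>I. \<Sum>r\<in>I. \<Sum>j\<in>I. \<Sum>s\<in>I. \<Sum>a\<in>UNIV. \<Sum>b\<in>UNIV.
          2 * (g i r * (v i j $ a $ b * Bm r s $ a $ b) * g' j s))"
    proof -
      have sw: "(\<Sum>i\<in>I. \<Sum>a\<in>UNIV. \<Sum>j\<in>I. \<Sum>b\<in>UNIV. \<Sum>r\<in>I. \<Sum>s\<in>I. G i a j b r s)
        = (\<Sum>i\<in>I. \<Sum>r\<in>I. \<Sum>j\<in>I. \<Sum>s\<in>I. \<Sum>a\<in>UNIV. \<Sum>b\<in>UNIV. G i a j b r s)"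
        for G :: "'i \<Rightarrow> 'n \<Rightarrow> 'i \<Rightarrow> 'n \<Rightarrow> 'i \<Rightarrow> 'i \<Rightarrow> complex"
      proof -
        have "(\<Sum>i\<in>I. \<Sum>a\<in>UNIV. \<Sum>j\<in>I. \<Sum>b\<in>UNIV. \<Sum>r\<in>I. \<Sum>s\<in>I. G i a j b r s)
          = (\<Sum>(i, a, j, b, r, s)\<in>I \<times> UNIV \<times> I \<times> UNIV \<times> I \<times> I. G i a j b r s)"
          by (simp add: sum.cartesian_product)
        also have "\<dots> = (\<Sum>(i, r, j, s, a, b)\<in>I \<times> I \<times> I \<times> I \<times> UNIV \<times> UNIV. G i a j b r s)"
          by (rule sum.reindex_bij_witness[of _ "\<lambda>(i, r, j, s, a, b). (i, a, j, b, r, s)"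
              "\<lambda>(i, a, j, b, r, s). (i, r, j, s, a, b)"]) auto
        also have "\<dots> = (\<Sum>i\<in>I. \<Sum>r\<in>I. \<Sum>j\<in>I. \<Sum>s\<in>I. \<Sum>a\<in>UNIV. \<Sum>b\<in>UNIV. G i a j b r s)"
          by (simp add: sum.cartesian_product)
        finally show ?thesis .
      qed
      show ?thesis by (rule sw)
    qed
    also have "\<dots> = 2 * (\<Sum>p\<in>I \<times> I. \<Sum>q\<in>I \<times> I. (case p of (i, r) \<Rightarrow> g i r) * pairing v Bm p q * (case q of (j, s) \<Rightarrow> g' j s))"
      unfolding sum_Times prod.case pairing_def by (simp add: sum_distrib_left sum_distrib_right)
    also have "Re \<dots> \<le> 2 * cmod (\<Sum>p\<in>I \<times> I. \<Sum>q\<in>I \<times> I. (case p of (i, r) \<Rightarrow> g i r) * pairing v Bm p q * (case q of (j, s) \<Rightarrow> g' j s))"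
    proof -
      have "Re (2 * z) \<le> 2 * cmod z" for z using complex_Re_le_cmod[of z] by simp
      then show ?thesis .
    qed
    also have "\<dots> \<le> 2 * (opn (I \<times> I) (I \<times> I) (pairing v Bm) * l2 (I \<times> I) (\<lambda>(i, r). g i r) * l2 (I \<times> I) (\<lambda>(j, s). g' j s))"
      using I by (intro mult_left_mono opn_bilinear) auto
    also have "\<dots> \<le> 2 * (S1 I v * sqrt (1 + d * card I) * sqrt (1 + d * card I))"
    proof (intro mult_left_mono mult_mono mult_nonneg_nonneg)
      have "opn (I \<times> I) (I \<times> I) (pairing v Bm) \<le> S1 I v * opn ?P ?P (flat Bm)"
        by (rule opn_pairing_le[OF I I])
      also have "\<dots> \<le> S1 I v"
        unfolding flatB using B by (intro mult_left_le mn_nonneg ruan_S_one_scalar) auto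
      finally show "opn (I \<times> I) (I \<times> I) (pairing v Bm) \<le> S1 I v" .
      show "l2 (I \<times> I) (\<lambda>(i, r). g i r) \<le> sqrt (1 + d * card I)"
        using g_HS by (simp add: real_le_rsqrt)
      show "l2 (I \<times> I) (\<lambda>(j, s). g' j s) \<le> sqrt (1 + d * card I)"
        using g_HS' by (simp add: real_le_rsqrt)
    qed (use I d in \<open>auto intro: mn_nonneg ruan_S_one_scalar opn_nonneg\<close>)
    also have "\<dots> = (2 * S1 I v) * (1 + d * card I)" using d by simp
    finally show ?thesis .
  qed
  have "((\<lambda>d::real. (2 * S1 I v) * (1 + d * card I)) \<longlongrightarrow> (2 * S1 I v) * (1 + (0::real) * card I)) (at_right 0)"
    by (intro tendsto_intros)
  then have "?N (0, 0, flat v) \<le> (2 * S1 I v) * (1 + (0::real) * card I)"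
    by (rule tendsto_lowerbound) (use main in \<open>auto intro: eventually_mono[OF eventually_at_right_less]\<close>)
  then show ?thesis by simp
qed

text \<open>
  One half of the identity \<open>\<parallel>A\<parallel>\<^sup>2 = \<parallel>A A\<^sup>*\<parallel>\<close>: the squared norm of \<open>A\<^sup>t u\<close> is a value of the
  sesquilinear form of the Gram matrix.
\<close>

lemma opn_power2_le_gram:
  assumes fin: "finite I" "finite K"
  shows "(opn I K A)\<^sup>2 \<le> opn I I (\<lambda>i j. \<Sum>k\<in>K. A i k * cnj (A j k))"
proof -
  let ?G = "\<lambda>i j. \<Sum>k\<in>K. A i k * cnj (A j k)"
  have G: "0 \<le> opn I I ?G" using fin by (simp add: opn_nonneg)
  have "opn K I (\<lambda>k i. A i k) \<le> sqrt (opn I I ?G)"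
  proof (rule opn_le)
    fix u :: "'a \<Rightarrow> complex"
    have "complex_of_real ((l2 K (\<lambda>k. \<Sum>i\<in>I. A i k * u i))\<^sup>2)
      = (\<Sum>k\<in>K. \<Sum>i\<in>I. \<Sum>j\<in>I. u i * (A i k * cnj (A j k)) * cnj (u j))"
      unfolding l2_power2_cnj cnj_sum sum_product by (simp add: mult_ac)
    also have "\<dots> = (\<Sum>i\<in>I. \<Sum>j\<in>I. \<Sum>k\<in>K. u i * (A i k * cnj (A j k)) * cnj (u j))"
      by (simp only: sum.swap[of _ I K])
    also have "\<dots> = (\<Sum>i\<in>I. \<Sum>j\<in>I. u i * ?G i j * cnj (u j))"
      by (simp only: sum_distrib_left sum_distrib_right)
    finally have "cmod (complex_of_real ((l2 K (\<lambda>k. \<Sum>i\<in>I. A i k * u i))\<^sup>2))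
        = cmod (\<Sum>i\<in>I. \<Sum>j\<in>I. u i * ?G i j * cnj (u j))" by (rule arg_cong)
    then have "(l2 K (\<lambda>k. \<Sum>i\<in>I. A i k * u i))\<^sup>2 = cmod (\<Sum>i\<in>I. \<Sum>j\<in>I. u i * ?G i j * cnj (u j))"
      by (simp only: norm_of_real abs_of_nonneg zero_le_power2)
    also have "\<dots> \<le> opn I I ?G * l2 I u * l2 I (\<lambda>j. cnj (u j))" by (rule opn_bilinear[OF fin(1) fin(1)])
    also have "\<dots> = (sqrt (opn I I ?G) * l2 I u)\<^sup>2"
      using G by (simp add: power_mult_distrib power2_eq_square)
    finally show "l2 K (\<lambda>k. \<Sum>i\<in>I. A i k * u i) \<le> sqrt (opn I I ?G) * l2 I u"
      by (rule power2_le_imp_le) (use G in simp)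
  qed (use G in simp)
  then have "(opn I K A)\<^sup>2 \<le> (sqrt (opn I I ?G))\<^sup>2"
    unfolding opn_transpose[OF fin] by (intro power_mono opn_nonneg fin)
  then show ?thesis using G by simp
qed

text \<open>
  For scalar E this is the definition of the norm dual to \<open>M\<^sub>n\<close>. For general E the map represented by v
  is written as \<open>x \<mapsto> \<alpha> (1 \<otimes> x) \<beta>\<close> with almost optimal norms; the contraction is then
  the two-sided multiplication by \<open>\<alpha>\<close> and \<open>\<beta>\<close> of a block-diagonal matrix with copies of W.
\<close>

lemma mn_contraction:
  fixes E :: "('a::complex_vector) matnorms" and v :: "'i \<Rightarrow> 'i \<Rightarrow> complex^'n^'n"
  assumes E: "ruan E" and fin: "finite I" "finite J"
    and y: "\<And>i j i' j'. i \<in> I \<Longrightarrow> i' \<in> I \<Longrightarrow> j \<in> J \<Longrightarrow> j' \<in> J \<Longrightarrow>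
      y (i, j) (i', j') = (\<Sum>a\<in>UNIV. \<Sum>b\<in>UNIV. scaleC (v i i' $ a $ b) (W (j, a) (j', b)))"
  shows "mn E (I \<times> J) y \<le> S1 I v * mn E (J \<times> UNIV) W"
proof -
  let ?w = "mn E (J \<times> (UNIV :: 'n set)) W"
  have w: "0 \<le> ?w" by (rule mn_nonneg[OF E])
  have "mn E (I \<times> J) y \<le> ?w * s" if s: "S1 I v < s" for s
  proof -
    have "fac_norm I (0, 0, flat v) < 2 * s" using fac_norm_le_S1[OF fin(1), of v] s by linarith
    then obtain f where f: "f \<in> facs I (flat v)" "fac_cost I 0 0 f < 2 * s"
      using fac_norm_witness[OF fin(1)] by blast
    define T where "T = {..<length f}"
    define \<alpha> where "\<alpha> i r = fst (f ! fst r) (i, snd r)" for i and r :: "nat \<times> 'n"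
    define \<beta> where "\<beta> r i = snd (f ! fst r) (i, snd r)" for i and r :: "nat \<times> 'n"
    have T: "finite T" "finite (T \<times> (UNIV :: 'n set))" by (simp_all add: T_def)
    have list_sum: "(\<Sum>(a, b)\<leftarrow>f. g a b) = (\<Sum>t\<in>T. g (fst (f ! t)) (snd (f ! t)))"
      for g :: "('i \<times> 'n \<Rightarrow> complex) \<Rightarrow> ('i \<times> 'n \<Rightarrow> complex) \<Rightarrow> complex"
      by (simp add: sum_list_sum_nth T_def atLeast0LessThan split_def)
    have v: "v i i' $ a $ b = (\<Sum>t\<in>T. \<alpha> i (t, a) * \<beta> (t, b) i')" if "i \<in> I" "i' \<in> I" for i i' a b
    proof -
      have "v i i' $ a $ b = rank_sum f (i, a) (i', b)" using f(1) that by (auto simp: facs_def)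
      then show ?thesis by (simp add: rank_sum_def list_sum \<alpha>_def \<beta>_def)
    qed
    have g1: "(\<lambda>i j. \<Sum>k\<in>T \<times> UNIV. \<alpha> i k * cnj (\<alpha> j k)) = gram1 f"
      unfolding gram1_def list_sum by (simp add: sum_Times gram_def \<alpha>_def)
    have g2: "(\<lambda>i j. \<Sum>k\<in>T \<times> UNIV. \<beta> k i * cnj (\<beta> k j)) = gram2 f"
      unfolding gram2_def list_sum by (simp add: sum_Times gram_def \<beta>_def)
    let ?a = "opn I (T \<times> UNIV) \<alpha>" and ?b = "opn (T \<times> UNIV) I \<beta>"
    have ab: "0 \<le> ?a" "0 \<le> ?b" using fin T by (simp_all add: opn_nonneg)
    have "?a\<^sup>2 \<le> opn I I (gram1 f)"
      using opn_power2_le_gram[OF fin(1) T(2), of \<alpha>] unfolding g1 .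
    moreover have "?b\<^sup>2 \<le> opn I I (gram2 f)"
      using opn_power2_le_gram[OF fin(1) T(2), of "\<lambda>i r. \<beta> r i"]
      unfolding g2 opn_transpose[OF T(2) fin(1)] .
    moreover have "2 * (?a * ?b) \<le> ?a\<^sup>2 + ?b\<^sup>2"
      using sum_squares_bound[of ?a ?b] by simp
    ultimately have abs: "?a * ?b \<le> s" using f(2) by (simp add: fac_cost_def)
    define X where "X = (\<lambda>((t :: nat, a :: 'n), j) ((t' :: nat, b :: 'n), j'). if t = t' then W (j, a) (j', b) else 0)"
    have "mn E ((T \<times> UNIV) \<times> J) X
      = mn E (T \<times> J \<times> UNIV) (\<lambda>p q. X ((\<lambda>(t, (j, a)). ((t, a), j)) p) ((\<lambda>(t, (j, a)). ((t, a), j)) q))"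
    proof (rule mn_reindex[OF E])
      show "bij_betw (\<lambda>(t, (j, a)). ((t, a), j)) (T \<times> J \<times> UNIV) ((T \<times> UNIV) \<times> J)"
        by (rule bij_betw_byWitness[where f' = "\<lambda>((t, a), j). (t, (j, a))"]) auto
    qed (use T fin in auto)
    also have "\<dots> = mn E (T \<times> J \<times> UNIV) (\<lambda>(t, p) (t', q). if t = t' then W p q else 0)"
      by (rule mn_cong[OF E]) (use T fin in \<open>auto simp: X_def\<close>)
    also have "\<dots> \<le> ?w"
      by (rule mn_block_diagonal[OF E]) (use T fin w in auto)
    finally have X: "mn E ((T \<times> UNIV) \<times> J) X \<le> ?w" .
    have "mn E (I \<times> J) y \<le> ?a * mn E ((T \<times> UNIV) \<times> J) X * ?b"
    proof (rule mn_two_sided_tensor_right[OF E fin(1) T(2) fin(2)])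
      fix i i' j j' assume ij: "i \<in> I" "i' \<in> I" "j \<in> J" "j' \<in> J"
      have "(\<Sum>r\<in>T \<times> UNIV. \<Sum>s\<in>T \<times> UNIV. scaleC (\<alpha> i r * \<beta> s i') (X (r, j) (s, j')))
        = (\<Sum>t\<in>T. \<Sum>a\<in>UNIV. \<Sum>t'\<in>T. if t' = t then \<Sum>b\<in>UNIV. scaleC (\<alpha> i (t, a) * \<beta> (t, b) i') (W (j, a) (j', b)) else 0)"
        unfolding sum_Times by (intro sum.cong refl) (auto simp: X_def)
      also have "\<dots> = (\<Sum>t\<in>T. \<Sum>a\<in>UNIV. \<Sum>b\<in>UNIV. scaleC (\<alpha> i (t, a) * \<beta> (t, b) i') (W (j, a) (j', b)))"
        using T by simp
      also have "\<dots> = (\<Sum>a\<in>UNIV. \<Sum>b\<in>UNIV. \<Sum>t\<in>T. scaleC (\<alpha> i (t, a) * \<beta> (t, b) i') (W (j, a) (j', b)))"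
        by (simp only: sum.swap[of _ UNIV T])
      also have "\<dots> = y (i, j) (i', j')"
        by (simp only: y[OF ij] v[OF ij(1,2)] cvec.scale_sum_left)
      finally show "y (i, j) (i', j')
        = (\<Sum>r\<in>T \<times> UNIV. \<Sum>s\<in>T \<times> UNIV. scaleC (\<alpha> i r * \<beta> s i') (X (r, j) (s, j')))" by (rule sym)
    qed
    also have "\<dots> \<le> ?a * ?w * ?b"
      using X ab by (intro mult_right_mono mult_left_mono)
    also have "\<dots> = ?w * (?a * ?b)" by (simp add: mult_ac)
    also have "\<dots> \<le> ?w * s" using abs w by (rule mult_left_mono)
    finally show ?thesis .
  qed
  then have "mn E (I \<times> J) y \<le> ?w * S1 I v" by (rule le_mult_limit[OF w])
  then show ?thesis by (simp add: mult.commute)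
qed

section \<open>Vector-valued functions on the strip\<close>

abbreviation strip :: "complex set"
  where "strip \<equiv> {z. 0 \<le> Re z \<and> Re z \<le> 1}"

lemma cseminorm_minus: "cseminorm N \<Longrightarrow> N (- x) = N x"
  using cseminorm_scale[of N "-1" x] by (simp add: scaleC_one)

lemma cseminorm_diff_zero:
  assumes N: "cseminorm N" and "N (x - y) = 0"
  shows "N x = N y"
  using cseminorm_add[OF N, of "x - y" y] cseminorm_add[OF N, of "y - x" x] cseminorm_minus[OF N, of "x - y"] assms(2)
  by simp

lemma sum_norm_le:
  assumes "cseminorm N0" "cseminorm N1"
  shows "sum_norm N0 N1 x \<le> N0 a + N1 (x - a)"
  unfolding sum_norm_def
  by (rule cINF_lower) (auto intro!: bdd_belowI2[where m = 0] add_nonneg_nonneg simp: cseminorm_nonneg assms)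

lemma sum_norm_greatest:
  assumes "\<And>a. c \<le> N0 a + N1 (x - a)"
  shows "c \<le> sum_norm N0 N1 x"
  unfolding sum_norm_def by (rule cINF_greatest) (use assms in auto)

lemma sum_norm_cseminorm:
  assumes N: "cseminorm N0" "cseminorm N1"
  shows "cseminorm (sum_norm N0 N1)"
proof -
  let ?K = "sum_norm N0 N1"
  have nn: "0 \<le> ?K x" for x
    by (rule sum_norm_greatest) (simp add: cseminorm_nonneg N)
  have add: "?K (x + y) \<le> ?K x + ?K y" for x y
  proof -
    have "?K (x + y) - (N0 b + N1 (y - b)) \<le> ?K x" for b
    proof (rule sum_norm_greatest)
      fix a
      have "?K (x + y) \<le> N0 (a + b) + N1 (x + y - (a + b))" by (rule sum_norm_le[OF N])
      also have "x + y - (a + b) = (x - a) + (y - b)" by simp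
      also have "N0 (a + b) + N1 ((x - a) + (y - b)) \<le> (N0 a + N0 b) + (N1 (x - a) + N1 (y - b))"
        by (intro add_mono cseminorm_add N)
      finally show "?K (x + y) - (N0 b + N1 (y - b)) \<le> N0 a + N1 (x - a)" by simp
    qed
    then have "?K (x + y) - ?K x \<le> ?K y" by (intro sum_norm_greatest) (simp add: algebra_simps)
    then show ?thesis by simp
  qed
  have scale: "?K (scaleC c x) \<le> cmod c * ?K x" for c x
  proof (cases "c = 0")
    case True
    then show ?thesis
      using sum_norm_le[OF N, of 0 0] cseminorm_zero[OF N(1)] cseminorm_zero[OF N(2)] by simp
  next
    case False
    have "?K (scaleC c x) / cmod c \<le> ?K x"
    proof (rule sum_norm_greatest)
      fix a
      have "?K (scaleC c x) \<le> N0 (scaleC c a) + N1 (scaleC c x - scaleC c a)" by (rule sum_norm_le[OF N])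
      also have "\<dots> = cmod c * (N0 a + N1 (x - a))"
        by (simp add: cvec.scale_right_diff_distrib[symmetric] cseminorm_scale N distrib_left)
      finally show "?K (scaleC c x) / cmod c \<le> N0 a + N1 (x - a)" using False by (simp add: field_simps)
    qed
    then show ?thesis using False by (simp add: field_simps)
  qed
  show ?thesis unfolding cseminorm_def
    using nn add cseminorm_scale_eqI[of ?K, OF nn scale] by blast
qed

lemma sum_norm_le_left: "cseminorm N0 \<Longrightarrow> cseminorm N1 \<Longrightarrow> sum_norm N0 N1 x \<le> N0 x"
  and sum_norm_le_right: "cseminorm N0 \<Longrightarrow> cseminorm N1 \<Longrightarrow> sum_norm N0 N1 x \<le> N1 x"
  using sum_norm_le[of N0 N1 x x] sum_norm_le[of N0 N1 x 0] by (simp_all add: cseminorm_zero)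

text \<open>
  An operator bounded at both endpoints is bounded on the sum of the two spaces.
\<close>

lemma sum_norm_linear:
  assumes N: "cseminorm N0'" "cseminorm N1'" "cseminorm N0" "cseminorm N1" and T: "clinear T"
    and a: "0 \<le> a0" "0 \<le> a1"
    and T0: "\<And>x. N0' (T x) \<le> a0 * N0 x" and T1: "\<And>x. N1' (T x) \<le> a1 * N1 x"
  shows "sum_norm N0' N1' (T x) \<le> max a0 a1 * sum_norm N0 N1 x"
proof (cases "max a0 a1 = 0")
  case True
  then have "a0 = 0" using a by simp
  then have "N0' (T x) \<le> 0" using T0[of x] by simp
  then show ?thesis using True sum_norm_le_left[OF N(1,2), of "T x"] by simp
next
  case False
  then have m: "0 < max a0 a1" using a by linarith
  have "sum_norm N0' N1' (T x) / max a0 a1 \<le> sum_norm N0 N1 x"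
  proof (rule sum_norm_greatest)
    fix b
    have "sum_norm N0' N1' (T x) \<le> N0' (T b) + N1' (T x - T b)" by (rule sum_norm_le[OF N(1,2)])
    also have "\<dots> = N0' (T b) + N1' (T (x - b))" by (simp add: clinear_diff[OF T])
    also have "\<dots> \<le> max a0 a1 * N0 b + max a0 a1 * N1 (x - b)"
      by (intro add_mono order_trans[OF T0] order_trans[OF T1] mult_right_mono cseminorm_nonneg N) auto
    finally show "sum_norm N0' N1' (T x) / max a0 a1 \<le> N0 b + N1 (x - b)"
      using m by (simp add: field_simps)
  qed
  then show ?thesis using m by (simp add: field_simps)
qed

text \<open>
  The conditions of \<open>calderon\<close> other than the decay at infinity. Constant functions satisfy them, and
  multiplying by \<open>damping\<close> produces the decay.
\<close>

definition precalderon :: "('a::complex_vector \<Rightarrow> real) \<Rightarrow> ('a \<Rightarrow> real) \<Rightarrow> (complex \<Rightarrow> 'a) \<Rightarrow> bool"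
  where "precalderon N0 N1 f \<longleftrightarrow>
    (\<exists>B. \<forall>z\<in>strip. sum_norm N0 N1 (f z) \<le> B) \<and>
    (\<forall>z\<in>strip. ((\<lambda>w. sum_norm N0 N1 (f w - f z)) \<longlongrightarrow> 0) (at z within strip)) \<and>
    (\<forall>z\<in>interior strip. \<exists>D. ((\<lambda>w. sum_norm N0 N1 (scaleC (inverse (w - z)) (f w - f z) - D)) \<longlongrightarrow> 0) (at z)) \<and>
    (\<forall>t::real. ((\<lambda>s. N0 (f (Complex 0 s) - f (Complex 0 t))) \<longlongrightarrow> 0) (at t)) \<and>
    (\<forall>t::real. ((\<lambda>s. N1 (f (Complex 1 s) - f (Complex 1 t))) \<longlongrightarrow> 0) (at t))"

lemma calderon_iff:
  "f \<in> calderon N0 N1 \<longleftrightarrow> precalderon N0 N1 f \<and>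
    ((\<lambda>t. N0 (f (Complex 0 t))) \<longlongrightarrow> 0) at_infinity \<and> ((\<lambda>t. N1 (f (Complex 1 t))) \<longlongrightarrow> 0) at_infinity"
  by (simp add: calderon_def precalderon_def Let_def)

lemma tendsto_zero_le:
  fixes f g :: "'b \<Rightarrow> real"
  assumes "(g \<longlongrightarrow> 0) F" "\<And>x. 0 \<le> f x" "\<And>x. f x \<le> g x"
  shows "(f \<longlongrightarrow> 0) F"
  by (rule tendsto_sandwich[OF _ _ tendsto_const assms(1)]) (use assms in auto)

lemma precalderon_const:
  assumes "cseminorm N0" "cseminorm N1"
  shows "precalderon N0 N1 (\<lambda>_. x)"
  unfolding precalderon_def
proof (intro conjI ballI allI)
  note K = sum_norm_cseminorm[OF assms]
  show "\<exists>D. ((\<lambda>w. sum_norm N0 N1 (scaleC (inverse (w - z)) (x - x) - D)) \<longlongrightarrow> 0) (at z)" for z :: complex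
    by (rule exI[of _ 0]) (simp add: cseminorm_zero[OF K])
  show "\<exists>B. \<forall>z\<in>strip. sum_norm N0 N1 x \<le> B" by blast
qed (simp_all add: cseminorm_zero sum_norm_cseminorm assms)

lemma precalderon_add:
  assumes N: "cseminorm N0" "cseminorm N1" and f: "precalderon N0 N1 f" and g: "precalderon N0 N1 g"
  shows "precalderon N0 N1 (\<lambda>z. f z + g z)"
proof -
  note K = sum_norm_cseminorm[OF N]
  have diff: "N (x + y - (x' + y')) \<le> N (x - x') + N (y - y')" if "cseminorm N" for N :: "'a \<Rightarrow> real" and x y x' y'
    using cseminorm_add[OF that, of "x - x'" "y - y'"] by (simp add: algebra_simps)
  show ?thesis
    unfolding precalderon_def
  proof (intro conjI ballI allI)
    obtain A B where "\<forall>z\<in>strip. sum_norm N0 N1 (f z) \<le> A" "\<forall>z\<in>strip. sum_norm N0 N1 (g z) \<le> B"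
      using f g unfolding precalderon_def by blast
    then show "\<exists>B. \<forall>z\<in>strip. sum_norm N0 N1 (f z + g z) \<le> B"
      by (intro exI[of _ "A + B"] ballI order_trans[OF cseminorm_add[OF K]] add_mono) auto
  next
    fix z :: complex assume z: "z \<in> strip"
    have "((\<lambda>w. sum_norm N0 N1 (f w - f z) + sum_norm N0 N1 (g w - g z)) \<longlongrightarrow> 0 + 0) (at z within strip)"
      using f g z unfolding precalderon_def by (intro tendsto_add) blast+
    then show "((\<lambda>w. sum_norm N0 N1 (f w + g w - (f z + g z))) \<longlongrightarrow> 0) (at z within strip)"
      by (intro tendsto_zero_le[OF _ cseminorm_nonneg[OF K] diff[OF K]]) simp
  next
    fix z :: complex assume z: "z \<in> interior strip"
    obtain D D' where "((\<lambda>w. sum_norm N0 N1 (scaleC (inverse (w - z)) (f w - f z) - D)) \<longlongrightarrow> 0) (at z)"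
      "((\<lambda>w. sum_norm N0 N1 (scaleC (inverse (w - z)) (g w - g z) - D')) \<longlongrightarrow> 0) (at z)"
      using f g z unfolding precalderon_def by blast
    then have "((\<lambda>w. sum_norm N0 N1 (scaleC (inverse (w - z)) (f w - f z) - D)
        + sum_norm N0 N1 (scaleC (inverse (w - z)) (g w - g z) - D')) \<longlongrightarrow> 0 + 0) (at z)"
      by (rule tendsto_add)
    then have "((\<lambda>w. sum_norm N0 N1 (scaleC (inverse (w - z)) (f w + g w - (f z + g z)) - (D + D'))) \<longlongrightarrow> 0) (at z)"
    proof (intro tendsto_zero_le[OF _ cseminorm_nonneg[OF K]])
      fix w
      have "scaleC (inverse (w - z)) (f w + g w - (f z + g z)) - (D + D')
        = (scaleC (inverse (w - z)) (f w - f z) - D) + (scaleC (inverse (w - z)) (g w - g z) - D')"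
        by (simp add: cvec.scale_right_diff_distrib scaleC_add_right algebra_simps)
      then show "sum_norm N0 N1 (scaleC (inverse (w - z)) (f w + g w - (f z + g z)) - (D + D'))
        \<le> sum_norm N0 N1 (scaleC (inverse (w - z)) (f w - f z) - D)
        + sum_norm N0 N1 (scaleC (inverse (w - z)) (g w - g z) - D')"
        by (simp only: cseminorm_add[OF K])
    qed simp
    then show "\<exists>D. ((\<lambda>w. sum_norm N0 N1 (scaleC (inverse (w - z)) (f w + g w - (f z + g z)) - D)) \<longlongrightarrow> 0) (at z)"
      by (rule exI)
  next
    fix t :: real
    have "((\<lambda>s. N0 (f (Complex 0 s) - f (Complex 0 t)) + N0 (g (Complex 0 s) - g (Complex 0 t))) \<longlongrightarrow> 0 + 0) (at t)"
      using f g unfolding precalderon_def by (intro tendsto_add) blast+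
    then show "((\<lambda>s. N0 (f (Complex 0 s) + g (Complex 0 s) - (f (Complex 0 t) + g (Complex 0 t)))) \<longlongrightarrow> 0) (at t)"
      by (intro tendsto_zero_le[OF _ cseminorm_nonneg[OF N(1)] diff[OF N(1)]]) simp
    have "((\<lambda>s. N1 (f (Complex 1 s) - f (Complex 1 t)) + N1 (g (Complex 1 s) - g (Complex 1 t))) \<longlongrightarrow> 0 + 0) (at t)"
      using f g unfolding precalderon_def by (intro tendsto_add) blast+
    then show "((\<lambda>s. N1 (f (Complex 1 s) + g (Complex 1 s) - (f (Complex 1 t) + g (Complex 1 t)))) \<longlongrightarrow> 0) (at t)"
      by (intro tendsto_zero_le[OF _ cseminorm_nonneg[OF N(2)] diff[OF N(2)]]) simp
  qed
qed

lemma precalderon_linear: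
  assumes N: "cseminorm N0'" "cseminorm N1'" "cseminorm N0" "cseminorm N1" and T: "clinear T"
    and a: "0 \<le> a0" "0 \<le> a1"
    and T0: "\<And>x. N0' (T x) \<le> a0 * N0 x" and T1: "\<And>x. N1' (T x) \<le> a1 * N1 x"
    and f: "precalderon N0 N1 f"
  shows "precalderon N0' N1' (\<lambda>z. T (f z))"
proof -
  let ?K = "sum_norm N0 N1" and ?K' = "sum_norm N0' N1'" and ?C = "max a0 a1"
  note K' = sum_norm_cseminorm[OF N(1,2)]
  have le: "?K' (T x) \<le> ?C * ?K x" for x by (rule sum_norm_linear[OF N T a T0 T1])
  have C: "0 \<le> ?C" using a by simp
  have lim: "((\<lambda>w. M' (T (h w))) \<longlongrightarrow> 0) F"
    if "((\<lambda>w. M (h w)) \<longlongrightarrow> 0) F" "\<And>x. M' (T x) \<le> b * M x" "\<And>x. 0 \<le> M' x"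
    for M M' :: "_ \<Rightarrow> real" and b :: real and h :: "'z \<Rightarrow> _" and F
    by (rule tendsto_zero_le[where g = "\<lambda>w. b * M (h w)"]) (use that in \<open>auto intro: tendsto_mult_right_zero\<close>)
  show ?thesis
    unfolding precalderon_def
  proof (intro conjI ballI allI)
    obtain B where "\<forall>z\<in>strip. ?K (f z) \<le> B" using f unfolding precalderon_def by blast
    then show "\<exists>B. \<forall>z\<in>strip. ?K' (T (f z)) \<le> B"
      by (intro exI[of _ "?C * B"] ballI order_trans[OF le] mult_left_mono C) auto
  next
    fix z :: complex assume "z \<in> strip"
    then have "((\<lambda>w. ?K (f w - f z)) \<longlongrightarrow> 0) (at z within strip)" using f unfolding precalderon_def by blast
    from lim[OF this le cseminorm_nonneg[OF K']]
    show "((\<lambda>w. ?K' (T (f w) - T (f z))) \<longlongrightarrow> 0) (at z within strip)" by (simp add: clinear_diff[OF T])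
  next
    fix z :: complex assume "z \<in> interior strip"
    then obtain D where "((\<lambda>w. ?K (scaleC (inverse (w - z)) (f w - f z) - D)) \<longlongrightarrow> 0) (at z)"
      using f unfolding precalderon_def by blast
    from lim[OF this le cseminorm_nonneg[OF K']]
    have "((\<lambda>w. ?K' (scaleC (inverse (w - z)) (T (f w) - T (f z)) - T D)) \<longlongrightarrow> 0) (at z)"
      by (simp add: clinear_diff[OF T] clinear_scale[OF T])
    then show "\<exists>D. ((\<lambda>w. ?K' (scaleC (inverse (w - z)) (T (f w) - T (f z)) - D)) \<longlongrightarrow> 0) (at z)" by (rule exI)
  next
    fix t :: real
    have "((\<lambda>s. N0 (f (Complex 0 s) - f (Complex 0 t))) \<longlongrightarrow> 0) (at t)" using f unfolding precalderon_def by blast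
    from lim[OF this T0 cseminorm_nonneg[OF N(1)]]
    show "((\<lambda>s. N0' (T (f (Complex 0 s)) - T (f (Complex 0 t)))) \<longlongrightarrow> 0) (at t)" by (simp add: clinear_diff[OF T])
    have "((\<lambda>s. N1 (f (Complex 1 s) - f (Complex 1 t))) \<longlongrightarrow> 0) (at t)" using f unfolding precalderon_def by blast
    from lim[OF this T1 cseminorm_nonneg[OF N(2)]]
    show "((\<lambda>s. N1' (T (f (Complex 1 s)) - T (f (Complex 1 t)))) \<longlongrightarrow> 0) (at t)" by (simp add: clinear_diff[OF T])
  qed
qed

lemma cseminorm_scale_diff:
  assumes "cseminorm M"
  shows "M (scaleC a x - scaleC b y) \<le> cmod a * M (x - y) + cmod (a - b) * M y"
proof -
  have "scaleC a x - scaleC b y = scaleC a (x - y) + scaleC (a - b) y"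
    by (simp add: cvec.scale_right_diff_distrib cvec.scale_left_diff_distrib)
  then show ?thesis using cseminorm_add[OF assms, of "scaleC a (x - y)" "scaleC (a - b) y"]
    by (simp add: cseminorm_scale[OF assms])
qed

lemma cseminorm_scale_lim:
  fixes \<gamma> :: "'z::t2_space \<Rightarrow> complex"
  assumes M: "cseminorm M" and f: "((\<lambda>s. M (f (\<gamma> s) - f (\<gamma> t))) \<longlongrightarrow> 0) (at t within A)"
    and w: "((\<lambda>s. w (\<gamma> s)) \<longlongrightarrow> w (\<gamma> t)) (at t within A)"
  shows "((\<lambda>s. M (scaleC (w (\<gamma> s)) (f (\<gamma> s)) - scaleC (w (\<gamma> t)) (f (\<gamma> t)))) \<longlongrightarrow> 0) (at t within A)"
proof -
  have "((\<lambda>s. cmod (w (\<gamma> s)) * M (f (\<gamma> s) - f (\<gamma> t)) + cmod (w (\<gamma> s) - w (\<gamma> t)) * M (f (\<gamma> t)))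
      \<longlongrightarrow> cmod (w (\<gamma> t)) * 0 + cmod (w (\<gamma> t) - w (\<gamma> t)) * M (f (\<gamma> t))) (at t within A)"
    by (intro tendsto_intros w f)
  then show ?thesis
    by (intro tendsto_zero_le[OF _ cseminorm_nonneg[OF M] cseminorm_scale_diff[OF M]]) simp
qed

text \<open>
  The derivative of \<open>w f\<close> is given by the product rule; the difference quotient is expanded so that
  each term tends to 0 separately.
\<close>

lemma precalderon_mult:
  assumes N: "cseminorm N0" "cseminorm N1" and f: "precalderon N0 N1 f"
    and w: "w holomorphic_on UNIV" and C: "\<And>z. z \<in> strip \<Longrightarrow> cmod (w z) \<le> C"
  shows "precalderon N0 N1 (\<lambda>z. scaleC (w z) (f z))"
proof -
  let ?K = "sum_norm N0 N1"
  note K = sum_norm_cseminorm[OF N]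
  have cont: "isCont w z" for z
    using holomorphic_on_imp_continuous_on[OF w] by (simp add: continuous_on_eq_continuous_at)
  have C0: "0 \<le> C" using C[of 0] norm_ge_zero[of "w 0"] by (simp del: norm_ge_zero)
  show ?thesis
    unfolding precalderon_def
  proof (intro conjI ballI allI)
    obtain B where B: "\<forall>z\<in>strip. ?K (f z) \<le> B" using f unfolding precalderon_def by blast
    show "\<exists>B. \<forall>z\<in>strip. ?K (scaleC (w z) (f z)) \<le> B"
    proof (intro exI ballI)
      fix z :: complex assume "z \<in> strip"
      then show "?K (scaleC (w z) (f z)) \<le> C * B"
        unfolding cseminorm_scale[OF K] using B C[of z] C0 by (intro mult_mono cseminorm_nonneg[OF K]) auto
    qed
  next
    fix z :: complex assume "z \<in> strip"
    then have "((\<lambda>w. ?K (f w - f z)) \<longlongrightarrow> 0) (at z within strip)" using f unfolding precalderon_def by blast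
    then show "((\<lambda>u. ?K (scaleC (w u) (f u) - scaleC (w z) (f z))) \<longlongrightarrow> 0) (at z within strip)"
      using cont[of z] by (intro cseminorm_scale_lim[where \<gamma> = "\<lambda>u. u", OF K])
        (auto simp: isCont_def intro: tendsto_within_subset)
  next
    fix t :: real
    have wl: "((\<lambda>s. w (Complex a s)) \<longlongrightarrow> w (Complex a t)) (at t)" for a
    proof (rule isCont_tendsto_compose[OF cont])
      show "(Complex a \<longlongrightarrow> Complex a t) (at t)" unfolding Complex_eq by (intro tendsto_intros)
    qed
    show "((\<lambda>s. N0 (scaleC (w (Complex 0 s)) (f (Complex 0 s)) - scaleC (w (Complex 0 t)) (f (Complex 0 t)))) \<longlongrightarrow> 0) (at t)"
      "((\<lambda>s. N1 (scaleC (w (Complex 1 s)) (f (Complex 1 s)) - scaleC (w (Complex 1 t)) (f (Complex 1 t)))) \<longlongrightarrow> 0) (at t)"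
      using f unfolding precalderon_def by (auto intro!: cseminorm_scale_lim N wl)
  next
    fix z :: complex assume "z \<in> interior strip"
    then obtain D where D: "((\<lambda>u. ?K (scaleC (inverse (u - z)) (f u - f z) - D)) \<longlongrightarrow> 0) (at z)"
      using f unfolding precalderon_def by blast
    obtain w' where "(w has_field_derivative w') (at z)"
      using w by (auto simp: holomorphic_on_def field_differentiable_def)
    then have w': "((\<lambda>u. (w u - w z) / (u - z)) \<longlongrightarrow> w') (at z)" by (simp add: has_field_derivative_iff)
    have wl: "(w \<longlongrightarrow> w z) (at z)" using cont[of z] by (simp add: isCont_def)
    let ?q = "\<lambda>u. scaleC (inverse (u - z)) (f u - f z) - D"
    have "((\<lambda>u. cmod (w u) * ?K (?q u) + (cmod (w u - w z) * ?K D + cmod ((w u - w z) / (u - z) - w') * ?K (f z)))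
      \<longlongrightarrow> cmod (w z) * 0 + (cmod (w z - w z) * ?K D + cmod (w' - w') * ?K (f z))) (at z)"
      by (intro tendsto_intros wl w' D)
    then have "((\<lambda>u. ?K (scaleC (inverse (u - z)) (scaleC (w u) (f u) - scaleC (w z) (f z))
        - (scaleC (w z) D + scaleC w' (f z)))) \<longlongrightarrow> 0) (at z)"
    proof (intro tendsto_zero_le[OF _ cseminorm_nonneg[OF K]])
      fix u
      have "scaleC (inverse (u - z)) (scaleC (w u) (f u) - scaleC (w z) (f z)) - (scaleC (w z) D + scaleC w' (f z))
        = scaleC (w u) (?q u) + (scaleC (w u - w z) D + scaleC ((w u - w z) / (u - z) - w') (f z))"
        by (simp add: cvec.scale_right_diff_distrib cvec.scale_left_diff_distrib scaleC_scaleC divide_inverse algebra_simps)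
      then show "?K (scaleC (inverse (u - z)) (scaleC (w u) (f u) - scaleC (w z) (f z)) - (scaleC (w z) D + scaleC w' (f z)))
        \<le> cmod (w u) * ?K (?q u) + (cmod (w u - w z) * ?K D + cmod ((w u - w z) / (u - z) - w') * ?K (f z))"
        by (simp only: cseminorm_scale[OF K, symmetric])
          (intro order_trans[OF cseminorm_add[OF K]] add_mono order_refl cseminorm_add[OF K])
    qed simp
    then show "\<exists>D. ((\<lambda>u. ?K (scaleC (inverse (u - z)) (scaleC (w u) (f u) - scaleC (w z) (f z)) - D)) \<longlongrightarrow> 0) (at z)"
      by (rule exI)
  qed
qed

section \<open>Interpolation norms\<close>

text \<open>
  A Gaussian factor with value 1 at \<open>\<theta>\<close> that decays along vertical lines. It is bounded by \<open>exp \<epsilon>\<close> on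
  the strip, which tends to 1 with \<open>\<epsilon>\<close>.
\<close>

definition damping :: "real \<Rightarrow> real \<Rightarrow> complex \<Rightarrow> complex"
  where "damping \<epsilon> \<theta> z = exp (complex_of_real \<epsilon> * (z\<^sup>2 - complex_of_real (\<theta>\<^sup>2)))"

lemma damping_holomorphic: "damping \<epsilon> \<theta> holomorphic_on A"
  unfolding damping_def by (intro holomorphic_intros)

lemma norm_damping: "cmod (damping \<epsilon> \<theta> z) = exp (\<epsilon> * ((Re z)\<^sup>2 - (Im z)\<^sup>2 - \<theta>\<^sup>2))"
  by (simp add: damping_def power2_eq_square)

lemma damping_self [simp]: "damping \<epsilon> \<theta> (complex_of_real \<theta>) = 1"
  by (simp add: damping_def)

lemma norm_damping_strip:
  assumes "0 \<le> \<epsilon>" "z \<in> strip"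
  shows "cmod (damping \<epsilon> \<theta> z) \<le> exp \<epsilon>"
proof -
  have "(Re z)\<^sup>2 \<le> 1" using assms(2) by (simp add: power_le_one)
  then have "(Re z)\<^sup>2 - (Im z)\<^sup>2 - \<theta>\<^sup>2 \<le> 1"
    using zero_le_power2[of "Im z"] zero_le_power2[of \<theta>] by linarith
  then have "\<epsilon> * ((Re z)\<^sup>2 - (Im z)\<^sup>2 - \<theta>\<^sup>2) \<le> \<epsilon>" using mult_left_mono[of _ 1 \<epsilon>] assms(1) by fastforce
  then show ?thesis by (simp add: norm_damping)
qed

lemma damping_tendsto:
  assumes e: "0 < \<epsilon>"
  shows "((\<lambda>t. cmod (damping \<epsilon> \<theta> (Complex a t))) \<longlongrightarrow> 0) at_infinity"
proof -
  have 1: "filterlim (\<lambda>s::real. \<epsilon> * (a\<^sup>2 - s\<^sup>2 - \<theta>\<^sup>2)) at_bot at_top"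
    unfolding filterlim_at_bot
  proof
    fix Z :: real
    show "\<forall>\<^sub>F s in at_top. \<epsilon> * (a\<^sup>2 - s\<^sup>2 - \<theta>\<^sup>2) \<le> Z"
    proof (rule eventually_at_top_linorderI)
      fix s :: real assume s: "max 1 (a\<^sup>2 - \<theta>\<^sup>2 - Z / \<epsilon>) \<le> s"
      have "s * 1 \<le> s * s" using s by (intro mult_left_mono) auto
      then have "s \<le> s\<^sup>2" by (simp add: power2_eq_square)
      moreover have "a\<^sup>2 - \<theta>\<^sup>2 - Z / \<epsilon> \<le> s" using s by simp
      ultimately have "a\<^sup>2 - s\<^sup>2 - \<theta>\<^sup>2 \<le> Z / \<epsilon>" by linarith
      then show "\<epsilon> * (a\<^sup>2 - s\<^sup>2 - \<theta>\<^sup>2) \<le> Z" using e by (simp add: field_simps)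
    qed
  qed
  have "filterlim (\<lambda>t::real. norm t) at_top at_infinity" by (rule filterlim_norm_at_top)
  from filterlim_compose[OF exp_at_bot filterlim_compose[OF 1 this]]
  show ?thesis by (simp add: norm_damping)
qed

text \<open>
  A continuous function that vanishes at infinity is bounded.
\<close>

lemma boundary_bounded:
  fixes h :: "real \<Rightarrow> 'a::complex_vector"
  assumes M: "cseminorm M" and cont: "\<And>t. ((\<lambda>s. M (h s - h t)) \<longlongrightarrow> 0) (at t)"
    and decay: "((\<lambda>t. M (h t)) \<longlongrightarrow> 0) at_infinity"
  obtains B where "\<And>t. M (h t) \<le> B"
proof -
  have c: "isCont (\<lambda>t. M (h t)) t" for t
  proof -
    have "\<bar>M x - M y\<bar> \<le> M (x - y)" for x y
      using cseminorm_add[OF M, of "x - y" y] cseminorm_add[OF M, of "y - x" x] cseminorm_minus[OF M, of "x - y"] by simp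
    then have "((\<lambda>s. \<bar>M (h s) - M (h t)\<bar>) \<longlongrightarrow> 0) (at t)" by (intro tendsto_zero_le[OF cont]) auto
    then have "((\<lambda>s. M (h s) - M (h t)) \<longlongrightarrow> 0) (at t)" by (rule tendsto_rabs_zero_cancel)
    then show ?thesis unfolding isCont_def by (rule LIM_zero_cancel)
  qed
  have "eventually (\<lambda>t. M (h t) < 1) at_infinity" by (rule order_tendstoD(2)[OF decay]) simp
  then obtain b where b: "0 < b" "\<And>t. b \<le> norm t \<Longrightarrow> M (h t) < 1"
    unfolding eventually_at_infinity_pos by blast
  have "\<exists>x\<in>{-b..b}. \<forall>y\<in>{-b..b}. M (h y) \<le> M (h x)"
    by (rule continuous_attains_sup) (use b c in \<open>auto intro: continuous_at_imp_continuous_on\<close>)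
  then obtain x where x: "\<And>y. y \<in> {-b..b} \<Longrightarrow> M (h y) \<le> M (h x)" by blast
  show thesis
  proof (rule that)
    fix t show "M (h t) \<le> max 1 (M (h x))"
    proof (cases "b \<le> norm t")
      case True
      then show ?thesis using b(2)[of t] by simp
    next
      case False
      then have "t \<in> {-b..b}" by auto
      then show ?thesis using x[of t] by simp
    qed
  qed
qed

lemma calderon_boundary_bounded:
  assumes N: "cseminorm N0" "cseminorm N1" and f: "f \<in> calderon N0 N1"
  shows "bdd_above (range (\<lambda>t. N0 (f (Complex 0 t))))" "bdd_above (range (\<lambda>t. N1 (f (Complex 1 t))))"
proof -
  have pre: "precalderon N0 N1 f" using f by (simp add: calderon_iff)
  have c: "((\<lambda>s. N0 (f (Complex 0 s) - f (Complex 0 t))) \<longlongrightarrow> 0) (at t)"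
    "((\<lambda>s. N1 (f (Complex 1 s) - f (Complex 1 t))) \<longlongrightarrow> 0) (at t)" for t
    using pre by (simp_all add: precalderon_def)
  have d: "((\<lambda>t. N0 (f (Complex 0 t))) \<longlongrightarrow> 0) at_infinity" "((\<lambda>t. N1 (f (Complex 1 t))) \<longlongrightarrow> 0) at_infinity"
    using f by (simp_all add: calderon_iff)
  obtain B where "\<And>t. N0 (f (Complex 0 t)) \<le> B" by (rule boundary_bounded[OF N(1) c(1) d(1)]) (rule that)
  then show "bdd_above (range (\<lambda>t. N0 (f (Complex 0 t))))" by (rule bdd_aboveI2)
  obtain B where "\<And>t. N1 (f (Complex 1 t)) \<le> B" by (rule boundary_bounded[OF N(2) c(2) d(2)]) (rule that)
  then show "bdd_above (range (\<lambda>t. N1 (f (Complex 1 t))))" by (rule bdd_aboveI2)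
qed

text \<open>
  The suprema in the definition of the interpolation norm are finite for functions in the
  Calderon space, since their boundary values are continuous and vanish at infinity.
\<close>

lemma interp_norm_le:
  assumes N: "cseminorm N0" "cseminorm N1" and f: "f \<in> calderon N0 N1" "f (complex_of_real \<theta>) = x"
    and c: "\<And>t. N0 (f (Complex 0 t)) \<le> c" "\<And>t. N1 (f (Complex 1 t)) \<le> c"
  shows "interp_norm \<theta> N0 N1 x \<le> c"
proof -
  have "interp_norm \<theta> N0 N1 x \<le> max (SUP t. N0 (f (Complex 0 t))) (SUP t. N1 (f (Complex 1 t)))"
    unfolding interp_norm_def
  proof (rule cINF_lower)
    show "bdd_below ((\<lambda>f. max (SUP t. N0 (f (Complex 0 t))) (SUP t. N1 (f (Complex 1 t)))) `
        {f \<in> calderon N0 N1. f (complex_of_real \<theta>) = x})"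
    proof (rule bdd_belowI2[where m = 0])
      fix g assume "g \<in> {f \<in> calderon N0 N1. f (complex_of_real \<theta>) = x}"
      then have "N0 (g (Complex 0 0)) \<le> (SUP t. N0 (g (Complex 0 t)))"
        by (intro cSUP_upper calderon_boundary_bounded[OF N]) auto
      then show "0 \<le> max (SUP t. N0 (g (Complex 0 t))) (SUP t. N1 (g (Complex 1 t)))"
        using cseminorm_nonneg[OF N(1), of "g (Complex 0 0)"] by linarith
    qed
  qed (use f in auto)
  also have "\<dots> \<le> c" by (intro max.boundedI cSUP_least c) auto
  finally show ?thesis .
qed

lemma calderon_scale:
  assumes N: "cseminorm N0" "cseminorm N1" and f: "f \<in> calderon N0 N1"
    and w: "w holomorphic_on UNIV" and C: "\<And>z. z \<in> strip \<Longrightarrow> cmod (w z) \<le> C"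
  shows "(\<lambda>z. scaleC (w z) (f z)) \<in> calderon N0 N1"
proof -
  have "((\<lambda>t. M (scaleC (w (Complex a t)) (f (Complex a t)))) \<longlongrightarrow> 0) at_infinity"
    if "cseminorm M" "((\<lambda>t. M (f (Complex a t))) \<longlongrightarrow> 0) at_infinity" "0 \<le> a" "a \<le> 1" for M a
    by (rule tendsto_zero_le[OF tendsto_mult_right_zero[OF that(2), of C]])
      (use that C in \<open>auto simp: cseminorm_scale cseminorm_nonneg intro!: mult_right_mono\<close>)
  then show ?thesis using f precalderon_mult[OF N _ w C] N by (simp add: calderon_iff)
qed

lemma calderon_damping_const:
  assumes N: "cseminorm N0" "cseminorm N1" and e: "0 < \<epsilon>"
  shows "(\<lambda>z. scaleC (damping \<epsilon> \<theta> z) x) \<in> calderon N0 N1"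
proof -
  have "((\<lambda>t. M (scaleC (damping \<epsilon> \<theta> (Complex a t)) x)) \<longlongrightarrow> 0) at_infinity" if "cseminorm M" for M a
    using tendsto_mult_left_zero[OF damping_tendsto[OF e, of \<theta> a], of "M x"] by (simp add: cseminorm_scale that)
  moreover have "precalderon N0 N1 (\<lambda>z. scaleC (damping \<epsilon> \<theta> z) x)"
    by (rule precalderon_mult[OF N precalderon_const[OF N] damping_holomorphic norm_damping_strip]) (use e in auto)
  ultimately show ?thesis using N by (simp add: calderon_iff)
qed

text \<open>
  The infimum is over a nonempty set, because damped constants belong to the Calderon space.
\<close>

lemma interp_norm_witness:
  assumes N: "cseminorm N0" "cseminorm N1" and c: "interp_norm \<theta> N0 N1 x < c"
  obtains f where "f \<in> calderon N0 N1" "f (complex_of_real \<theta>) = x"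
    "\<And>t. N0 (f (Complex 0 t)) \<le> c" "\<And>t. N1 (f (Complex 1 t)) \<le> c"
proof -
  let ?F = "{f \<in> calderon N0 N1. f (complex_of_real \<theta>) = x}"
  let ?b = "\<lambda>f. max (SUP t. N0 (f (Complex 0 t))) (SUP t. N1 (f (Complex 1 t)))"
  have "(\<lambda>z. scaleC (damping 1 \<theta> z) x) \<in> ?F"
    using calderon_damping_const[OF N, of 1 \<theta> x] by (simp add: scaleC_one)
  then have "?b ` ?F \<noteq> {}" by blast
  then obtain y where "y \<in> ?b ` ?F" "y < c"
    using c cInf_lessD[of "?b ` ?F" c] unfolding interp_norm_def by blast
  then obtain f where f: "f \<in> calderon N0 N1" "f (complex_of_real \<theta>) = x" "?b f < c" by blast
  show thesis
  proof (rule that[OF f(1,2)])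
    fix t
    have "N0 (f (Complex 0 t)) \<le> (SUP t. N0 (f (Complex 0 t)))" "N1 (f (Complex 1 t)) \<le> (SUP t. N1 (f (Complex 1 t)))"
      by (intro cSUP_upper calderon_boundary_bounded[OF N f(1)] UNIV_I)+
    then show "N0 (f (Complex 0 t)) \<le> c" "N1 (f (Complex 1 t)) \<le> c" using f(3) by auto
  qed
qed

lemma interp_norm_nonneg:
  assumes N: "cseminorm N0" "cseminorm N1"
  shows "0 \<le> interp_norm \<theta> N0 N1 x"
proof (rule ccontr)
  assume "\<not> 0 \<le> interp_norm \<theta> N0 N1 x"
  then have "interp_norm \<theta> N0 N1 x < 0" by simp
  then obtain y where y: "interp_norm \<theta> N0 N1 x < y" "y < 0" using dense by blast
  obtain f where "\<And>t. N0 (f (Complex 0 t)) \<le> y"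
    by (rule interp_norm_witness[OF N y(1)]) (rule that)
  then have "N0 (f (Complex 0 0)) < 0" using y(2) le_less_trans by blast
  then show False using cseminorm_nonneg[OF N(1), of "f (Complex 0 0)"] by linarith
qed

text \<open>
  A weight with value 1 at \<open>\<theta>\<close> whose modulus is constant on vertical lines. Multiplied by it, the
  endpoint constants \<open>a0\<close> and \<open>a1\<close> both become \<open>a0 powr (1 - \<theta>) * a1 powr \<theta>\<close>
  (\<open>balance_boundary\<close>).
\<close>

definition balance :: "real \<Rightarrow> real \<Rightarrow> real \<Rightarrow> complex \<Rightarrow> complex"
  where "balance \<theta> a0 a1 z = exp (complex_of_real (ln a0 - ln a1) * (z - complex_of_real \<theta>))"

lemma balance_holomorphic: "balance \<theta> a0 a1 holomorphic_on A"
  unfolding balance_def by (intro holomorphic_intros)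

lemma balance_self [simp]: "balance \<theta> a0 a1 (complex_of_real \<theta>) = 1"
  by (simp add: balance_def)

lemma norm_balance: "cmod (balance \<theta> a0 a1 z) = exp ((ln a0 - ln a1) * (Re z - \<theta>))"
  by (simp add: balance_def)

lemma balance_bounded: "z \<in> strip \<Longrightarrow> 0 < \<theta> \<Longrightarrow> \<theta> < 1 \<Longrightarrow> cmod (balance \<theta> a0 a1 z) \<le> exp \<bar>ln a0 - ln a1\<bar>"
proof -
  assume "z \<in> strip" "0 < \<theta>" "\<theta> < 1"
  then have "\<bar>Re z - \<theta>\<bar> \<le> 1" by auto
  then have "\<bar>(ln a0 - ln a1) * (Re z - \<theta>)\<bar> \<le> \<bar>ln a0 - ln a1\<bar>"
    by (simp add: abs_mult mult_left_le)
  then show ?thesis by (simp add: norm_balance)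
qed

lemma balance_boundary:
  assumes "0 < a0" "0 < a1"
  shows "cmod (balance \<theta> a0 a1 (Complex 0 t)) * a0 = a0 powr (1 - \<theta>) * a1 powr \<theta>"
    and "cmod (balance \<theta> a0 a1 (Complex 1 t)) * a1 = a0 powr (1 - \<theta>) * a1 powr \<theta>"
proof -
  have "exp ((ln a0 - ln a1) * (0 - \<theta>)) * exp (ln a0) = exp ((1 - \<theta>) * ln a0) * exp (\<theta> * ln a1)"
    unfolding exp_add[symmetric] by (simp add: algebra_simps)
  then show "cmod (balance \<theta> a0 a1 (Complex 0 t)) * a0 = a0 powr (1 - \<theta>) * a1 powr \<theta>"
    using assms by (simp add: norm_balance powr_def del: minus_diff_eq mult_minus_right diff_0)
  have "exp ((ln a0 - ln a1) * (1 - \<theta>)) * exp (ln a1) = exp ((1 - \<theta>) * ln a0) * exp (\<theta> * ln a1)"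
    unfolding exp_add[symmetric] by (simp add: algebra_simps)
  then show "cmod (balance \<theta> a0 a1 (Complex 1 t)) * a1 = a0 powr (1 - \<theta>) * a1 powr \<theta>"
    using assms by (simp add: norm_balance powr_def)
qed

lemma calderon_linear:
  assumes N: "cseminorm N0'" "cseminorm N1'" "cseminorm N0" "cseminorm N1" and T: "clinear T"
    and a: "0 \<le> a0" "0 \<le> a1"
    and T0: "\<And>x. N0' (T x) \<le> a0 * N0 x" and T1: "\<And>x. N1' (T x) \<le> a1 * N1 x"
    and f: "f \<in> calderon N0 N1"
  shows "(\<lambda>z. T (f z)) \<in> calderon N0' N1'"
proof -
  have "((\<lambda>t. N0' (T (f (Complex 0 t)))) \<longlongrightarrow> 0) at_infinity"
    by (rule tendsto_zero_le[OF tendsto_mult_right_zero[of "\<lambda>t. N0 (f (Complex 0 t))" _ a0]])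
      (use f T0 N in \<open>auto simp: calderon_iff cseminorm_nonneg\<close>)
  moreover have "((\<lambda>t. N1' (T (f (Complex 1 t)))) \<longlongrightarrow> 0) at_infinity"
    by (rule tendsto_zero_le[OF tendsto_mult_right_zero[of "\<lambda>t. N1 (f (Complex 1 t))" _ a1]])
      (use f T1 N in \<open>auto simp: calderon_iff cseminorm_nonneg\<close>)
  moreover have "precalderon N0' N1' (\<lambda>z. T (f z))"
    using precalderon_linear[OF N T a T0 T1] f by (simp add: calderon_iff)
  ultimately show ?thesis by (simp add: calderon_iff)
qed

lemma calderon_add:
  assumes N: "cseminorm N0" "cseminorm N1" and f: "f \<in> calderon N0 N1" and g: "g \<in> calderon N0 N1"
  shows "(\<lambda>z. f z + g z) \<in> calderon N0 N1"
proof -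
  have "((\<lambda>t. M (f (Complex a t) + g (Complex a t))) \<longlongrightarrow> 0) at_infinity"
    if M: "cseminorm M" and lim: "((\<lambda>t. M (f (Complex a t))) \<longlongrightarrow> 0) at_infinity" "((\<lambda>t. M (g (Complex a t))) \<longlongrightarrow> 0) at_infinity"
    for M a
    using tendsto_add[OF lim] by (intro tendsto_zero_le[OF _ cseminorm_nonneg[OF M] cseminorm_add[OF M]]) simp
  then show ?thesis using f g precalderon_add[OF N] N by (simp add: calderon_iff)
qed

text \<open>
  Riesz-Thorin interpolation: an almost optimal function for x is mapped by T and multiplied by the
  balancing weight.
\<close>

lemma interp_norm_linear:
  assumes N: "cseminorm N0'" "cseminorm N1'" "cseminorm N0" "cseminorm N1" and T: "clinear T"
    and a: "0 < a0" "0 < a1"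
    and T0: "\<And>x. N0' (T x) \<le> a0 * N0 x" and T1: "\<And>x. N1' (T x) \<le> a1 * N1 x"
    and \<theta>: "0 < \<theta>" "\<theta> < 1"
  shows "interp_norm \<theta> N0' N1' (T x) \<le> a0 powr (1 - \<theta>) * a1 powr \<theta> * interp_norm \<theta> N0 N1 x"
proof (rule le_mult_limit)
  let ?A = "a0 powr (1 - \<theta>) * a1 powr \<theta>"
  show "0 \<le> ?A" by simp
  fix c assume "interp_norm \<theta> N0 N1 x < c"
  then obtain f where f: "f \<in> calderon N0 N1" "f (complex_of_real \<theta>) = x"
    and c: "\<And>t. N0 (f (Complex 0 t)) \<le> c" "\<And>t. N1 (f (Complex 1 t)) \<le> c"
    using interp_norm_witness[OF N(3,4)] by blast
  let ?g = "\<lambda>z. scaleC (balance \<theta> a0 a1 z) (T (f z))"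
  show "interp_norm \<theta> N0' N1' (T x) \<le> ?A * c"
  proof (rule interp_norm_le[OF N(1,2)])
    show "?g \<in> calderon N0' N1'"
      by (rule calderon_scale[OF N(1,2) calderon_linear[OF N T _ _ T0 T1 f(1)] balance_holomorphic balance_bounded[OF _ \<theta>]])
        (use a in auto)
    show "?g (complex_of_real \<theta>) = T x" by (simp add: f(2) scaleC_one)
    fix t
    have "N0' (?g (Complex 0 t)) \<le> cmod (balance \<theta> a0 a1 (Complex 0 t)) * (a0 * c)"
      unfolding cseminorm_scale[OF N(1)]
      by (intro mult_left_mono order_trans[OF T0] c) (use a in auto)
    then show "N0' (?g (Complex 0 t)) \<le> ?A * c" by (simp only: mult.assoc[symmetric] balance_boundary[OF a])
    have "N1' (?g (Complex 1 t)) \<le> cmod (balance \<theta> a0 a1 (Complex 1 t)) * (a1 * c)"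
      unfolding cseminorm_scale[OF N(2)]
      by (intro mult_left_mono order_trans[OF T1] c) (use a in auto)
    then show "N1' (?g (Complex 1 t)) \<le> ?A * c" by (simp only: mult.assoc[symmetric] balance_boundary[OF a])
  qed
qed

text \<open>
  The constant function x, balanced and damped, is a competitor.
\<close>

lemma interp_norm_upper:
  assumes N: "cseminorm N0" "cseminorm N1" and a: "0 < a0" "0 < a1" and M: "0 \<le> M"
    and x: "N0 x \<le> a0 * M" "N1 x \<le> a1 * M" and \<theta>: "0 < \<theta>" "\<theta> < 1"
  shows "interp_norm \<theta> N0 N1 x \<le> a0 powr (1 - \<theta>) * a1 powr \<theta> * M"
proof -
  let ?A = "a0 powr (1 - \<theta>) * a1 powr \<theta>"
  have "interp_norm \<theta> N0 N1 x \<le> (?A * M) * s" if s: "1 < s" for s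
  proof -
    define \<epsilon> where "\<epsilon> = ln s"
    have e: "0 < \<epsilon>" "exp \<epsilon> = s" using s by (simp_all add: \<epsilon>_def)
    let ?g = "\<lambda>z. scaleC (balance \<theta> a0 a1 z) (scaleC (damping \<epsilon> \<theta> z) x)"
    show ?thesis
    proof (rule interp_norm_le[OF N])
      show "?g \<in> calderon N0 N1"
        by (rule calderon_scale[OF N calderon_damping_const[OF N e(1)] balance_holomorphic balance_bounded[OF _ \<theta>]])
      show "?g (complex_of_real \<theta>) = x" by (simp add: scaleC_one)
      fix t
      have d: "cmod (damping \<epsilon> \<theta> (Complex 0 t)) \<le> s" "cmod (damping \<epsilon> \<theta> (Complex 1 t)) \<le> s"
        using norm_damping_strip[of \<epsilon> "Complex 0 t" \<theta>] norm_damping_strip[of \<epsilon> "Complex 1 t" \<theta>] e by auto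
      have "N0 (?g (Complex 0 t)) \<le> cmod (balance \<theta> a0 a1 (Complex 0 t)) * (s * (a0 * M))"
        unfolding cseminorm_scale[OF N(1)]
        by (intro mult_left_mono mult_mono d x) (use s cseminorm_nonneg[OF N(1)] in auto)
      also have "\<dots> = (cmod (balance \<theta> a0 a1 (Complex 0 t)) * a0) * M * s" by (simp only: mult_ac)
      finally show "N0 (?g (Complex 0 t)) \<le> ?A * M * s" by (simp only: balance_boundary[OF a])
      have "N1 (?g (Complex 1 t)) \<le> cmod (balance \<theta> a0 a1 (Complex 1 t)) * (s * (a1 * M))"
        unfolding cseminorm_scale[OF N(2)]
        by (intro mult_left_mono mult_mono d x) (use s cseminorm_nonneg[OF N(2)] in auto)
      also have "\<dots> = (cmod (balance \<theta> a0 a1 (Complex 1 t)) * a1) * M * s" by (simp only: mult_ac)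
      finally show "N1 (?g (Complex 1 t)) \<le> ?A * M * s" by (simp only: balance_boundary[OF a])
    qed
  qed
  moreover have "0 \<le> ?A * M" by (intro mult_nonneg_nonneg M) simp_all
  ultimately have "interp_norm \<theta> N0 N1 x \<le> (?A * M) * 1" by (intro le_mult_limit[where b = 1]) auto
  then show ?thesis by simp
qed

text \<open>
  The case of equal bounds, including the value 0, for which \<open>balance\<close> would be degenerate.
\<close>

lemma interp_norm_linear_same:
  assumes N: "cseminorm N0'" "cseminorm N1'" "cseminorm N0" "cseminorm N1" and T: "clinear T"
    and a: "0 \<le> a" and T0: "\<And>x. N0' (T x) \<le> a * N0 x" and T1: "\<And>x. N1' (T x) \<le> a * N1 x"
    and \<theta>: "0 < \<theta>" "\<theta> < 1"
  shows "interp_norm \<theta> N0' N1' (T x) \<le> a * interp_norm \<theta> N0 N1 x"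
proof -
  have "interp_norm \<theta> N0' N1' (T x) \<le> interp_norm \<theta> N0 N1 x * b" if b: "a < b" for b
  proof -
    have "interp_norm \<theta> N0' N1' (T x) \<le> b powr (1 - \<theta>) * b powr \<theta> * interp_norm \<theta> N0 N1 x"
    proof (rule interp_norm_linear[OF N T _ _ _ _ \<theta>])
      show "N0' (T x) \<le> b * N0 x" "N1' (T x) \<le> b * N1 x" for x
        using T0[of x] T1[of x] mult_right_mono[of a b "N0 x"] mult_right_mono[of a b "N1 x"]
          b cseminorm_nonneg[OF N(3), of x] cseminorm_nonneg[OF N(4), of x] by linarith+
    qed (use a b in auto)
    also have "b powr (1 - \<theta>) * b powr \<theta> = b" using a b by (simp add: powr_add[symmetric])
    finally show ?thesis by (simp add: mult.commute)
  qed
  then have "interp_norm \<theta> N0' N1' (T x) \<le> interp_norm \<theta> N0 N1 x * a"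
    by (rule le_mult_limit[OF interp_norm_nonneg[OF N(3,4)]])
  then show ?thesis by (simp add: mult.commute)
qed

lemma clinear_scaleC: "clinear (scaleC c)"
  by (simp add: clinear_iff scaleC_add_right scaleC_scaleC mult.commute)

lemma interp_norm_cseminorm:
  assumes N: "cseminorm N0" "cseminorm N1" and \<theta>: "0 < \<theta>" "\<theta> < 1"
  shows "cseminorm (interp_norm \<theta> N0 N1)"
proof -
  let ?I = "interp_norm \<theta> N0 N1"
  have nn: "0 \<le> ?I x" for x by (rule interp_norm_nonneg[OF N])
  have scale: "?I (scaleC c x) \<le> cmod c * ?I x" for c x
    by (rule interp_norm_linear_same[OF N N clinear_scaleC _ _ _ \<theta>]) (simp_all add: cseminorm_scale N)
  have add: "?I (x + y) \<le> ?I x + ?I y" for x y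
  proof (rule field_le_epsilon)
    fix e :: real assume e: "0 < e"
    have "?I x < ?I x + e / 2" using e by simp
    then obtain f where f: "f \<in> calderon N0 N1" "f (complex_of_real \<theta>) = x"
      "\<And>t. N0 (f (Complex 0 t)) \<le> ?I x + e / 2" "\<And>t. N1 (f (Complex 1 t)) \<le> ?I x + e / 2"
      using interp_norm_witness[OF N] by blast
    have "?I y < ?I y + e / 2" using e by simp
    then obtain g where g: "g \<in> calderon N0 N1" "g (complex_of_real \<theta>) = y"
      "\<And>t. N0 (g (Complex 0 t)) \<le> ?I y + e / 2" "\<And>t. N1 (g (Complex 1 t)) \<le> ?I y + e / 2"
      using interp_norm_witness[OF N] by blast
    have "?I (x + y) \<le> (?I x + e / 2) + (?I y + e / 2)"
    proof (rule interp_norm_le[OF N calderon_add[OF N f(1) g(1)]])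
      fix t
      show "N0 (f (Complex 0 t) + g (Complex 0 t)) \<le> (?I x + e / 2) + (?I y + e / 2)"
        by (rule order_trans[OF cseminorm_add[OF N(1)] add_mono[OF f(3) g(3)]])
      show "N1 (f (Complex 1 t) + g (Complex 1 t)) \<le> (?I x + e / 2) + (?I y + e / 2)"
        by (rule order_trans[OF cseminorm_add[OF N(2)] add_mono[OF f(4) g(4)]])
    qed (simp add: f g)
    then show "?I (x + y) \<le> ?I x + ?I y + e" by simp
  qed
  show ?thesis unfolding cseminorm_def using nn add cseminorm_scale_eqI[of ?I, OF nn scale] by blast
qed

lemma interp_norm_eq_zero:
  assumes N: "cseminorm N0" "cseminorm N1" and x: "N0 x = 0" "N1 x = 0" and \<theta>: "0 < \<theta>" "\<theta> < 1"
  shows "interp_norm \<theta> N0 N1 x = 0"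
  using interp_norm_upper[OF N, of 1 1 0 x \<theta>] interp_norm_nonneg[OF N, of \<theta> x] x \<theta> by simp

section \<open>The three lines theorem\<close>

text \<open>
  After multiplication by \<open>damping\<close> the function is small on distant horizontal segments, so that the
  maximum principle applies to a rectangle; then \<open>\<epsilon>\<close> tends to 0.
\<close>

lemma three_lines:
  fixes G :: "complex \<Rightarrow> complex"
  assumes cont: "continuous_on strip G" and hol: "G holomorphic_on interior strip"
    and B: "\<And>z. z \<in> strip \<Longrightarrow> cmod (G z) \<le> B" and c0: "0 \<le> c"
    and c: "\<And>t. cmod (G (Complex 0 t)) \<le> c" "\<And>t. cmod (G (Complex 1 t)) \<le> c"
    and z: "z \<in> strip"
  shows "cmod (G z) \<le> c"
proof (rule dense_ge)
  fix c' assume c': "c < c'"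
  let ?k = "(Re z)\<^sup>2 - (Im z)\<^sup>2 - 1\<^sup>2"
  have main: "exp (\<epsilon> * ?k) * cmod (G z) \<le> c'" if e: "0 < \<epsilon>" for \<epsilon>
  proof -
    let ?d = "damping \<epsilon> 1"
    have B0: "0 \<le> B" using B[OF z] norm_ge_zero[of "G z"] by linarith
    have "((\<lambda>t. cmod (?d (Complex 1 t)) * B) \<longlongrightarrow> 0) at_infinity"
      by (rule tendsto_mult_left_zero[OF damping_tendsto[OF e]])
    then have "eventually (\<lambda>t. cmod (?d (Complex 1 t)) * B < c') at_infinity"
      by (rule order_tendstoD(2)) (use c0 c' in simp)
    then obtain b where b: "0 < b" "\<And>t. b \<le> norm t \<Longrightarrow> cmod (?d (Complex 1 t)) * B < c'"
      unfolding eventually_at_infinity_pos by blast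
    \<comment> \<open>The rectangle contains z and reaches the height b from which on the damped function is below \<open>c'\<close>.\<close>
    define R where "R = max b \<bar>Im z\<bar>"
    have R: "0 < R" "b \<le> R" "\<bar>Im z\<bar> \<le> R" using b by (auto simp: R_def)
    let ?S = "cbox (Complex 0 (- R)) (Complex 1 R)"
    have S: "?S \<subseteq> strip" by (auto simp: in_cbox_complex_iff)
    have "cmod (?d z * G z) \<le> c'"
    proof (rule maximum_modulus_frontier[where f = "\<lambda>z. ?d z * G z" and S = ?S])
      show "(\<lambda>z. ?d z * G z) holomorphic_on interior ?S"
        by (intro holomorphic_on_mult damping_holomorphic holomorphic_on_subset[OF hol] interior_mono S)
      have "continuous_on ?S ?d" by (rule holomorphic_on_imp_continuous_on[OF damping_holomorphic])
      then show "continuous_on (closure ?S) (\<lambda>z. ?d z * G z)"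
        using continuous_on_subset[OF cont S] by (simp add: continuous_on_mult)
      show "bounded ?S" by (rule bounded_cbox)
      show "z \<in> ?S" using z R by (auto simp: in_cbox_complex_iff)
      fix u assume "u \<in> frontier ?S"
      then have "u \<in> ?S" and nb: "u \<notin> box (Complex 0 (- R)) (Complex 1 R)"
        by (simp_all add: frontier_def)
      then have u: "0 \<le> Re u" "Re u \<le> 1" "- R \<le> Im u" "Im u \<le> R" by (auto simp: in_cbox_complex_iff)
      consider "Re u = 0" | "Re u = 1" | "\<bar>Im u\<bar> = R"
        using nb u by (auto simp: in_box_complex_iff)
      then show "cmod (?d u * G u) \<le> c'"
      proof cases
        case 1
        have "cmod (?d u) \<le> 1"
          using e 1 mult_nonneg_nonpos[of \<epsilon> "- (Im u)\<^sup>2 - 1"] zero_le_power2[of "Im u"]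
          unfolding norm_damping by simp
        moreover have "cmod (G u) \<le> c" using c(1)[of "Im u"] 1 by (metis complex_surj)
        ultimately have "cmod (?d u) * cmod (G u) \<le> 1 * c" by (intro mult_mono) auto
        then show ?thesis using c' by (simp add: norm_mult)
      next
        case 2
        have "cmod (?d u) \<le> 1" using e 2 by (simp add: norm_damping)
        moreover have "cmod (G u) \<le> c" using c(2)[of "Im u"] 2 by (metis complex_surj)
        ultimately have "cmod (?d u) * cmod (G u) \<le> 1 * c" by (intro mult_mono) auto
        then show ?thesis using c' by (simp add: norm_mult)
      next
        case 3
        have "(Re u)\<^sup>2 \<le> 1" using u by (simp add: power_le_one)
        then have "\<epsilon> * ((Re u)\<^sup>2 - (Im u)\<^sup>2 - 1\<^sup>2) \<le> \<epsilon> * (1\<^sup>2 - (Im u)\<^sup>2 - 1\<^sup>2)"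
          using e by (intro mult_left_mono) auto
        then have "cmod (?d u) \<le> cmod (?d (Complex 1 (Im u)))" by (simp only: norm_damping complex.sel exp_le_cancel_iff)
        then have "cmod (?d u) * cmod (G u) \<le> cmod (?d (Complex 1 (Im u))) * B"
          using B[of u] u by (intro mult_mono) auto
        also have "\<dots> \<le> c'" using b(2)[of "Im u"] 3 R by simp
        finally show ?thesis by (simp add: norm_mult)
      qed
    qed
    then show ?thesis by (simp add: norm_mult norm_damping)
  qed
  have "((\<lambda>\<epsilon>. exp (\<epsilon> * ?k) * cmod (G z)) \<longlongrightarrow> exp (0 * ?k) * cmod (G z)) (at_right 0)"
    by (intro tendsto_intros)
  then have "exp (0 * ?k) * cmod (G z) \<le> c'"
    by (rule tendsto_upperbound) (use main in \<open>auto intro: eventually_mono[OF eventually_at_right_less]\<close>)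
  then show "cmod (G z) \<le> c'" by simp
qed

text \<open>
  Composing an almost optimal function for x with T and with a functional that norms \<open>T x\<close> gives a
  scalar holomorphic function on the strip, to which the three lines theorem applies.
\<close>

lemma interp_norm_lower:
  assumes N: "cseminorm N0" "cseminorm N1" "cseminorm N" and T: "clinear T"
    and a: "0 < a0" "0 < a1"
    and T0: "\<And>x. N (T x) \<le> a0 * N0 x" and T1: "\<And>x. N (T x) \<le> a1 * N1 x"
    and \<theta>: "0 < \<theta>" "\<theta> < 1"
  shows "N (T x) \<le> a0 powr (1 - \<theta>) * a1 powr \<theta> * interp_norm \<theta> N0 N1 x"
proof (rule le_mult_limit)
  let ?A = "a0 powr (1 - \<theta>) * a1 powr \<theta>" and ?K = "sum_norm N0 N1" and ?C = "max a0 a1"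
  show "0 \<le> ?A" by simp
  fix c assume cc: "interp_norm \<theta> N0 N1 x < c"
  then obtain f where f: "f \<in> calderon N0 N1" "f (complex_of_real \<theta>) = x"
    and c: "\<And>t. N0 (f (Complex 0 t)) \<le> c" "\<And>t. N1 (f (Complex 1 t)) \<le> c"
    using interp_norm_witness[OF N(1,2)] by blast
  have c0: "0 \<le> c" using cc interp_norm_nonneg[OF N(1,2), of \<theta> x] by linarith
  obtain \<phi> where \<phi>: "clinear \<phi>" "\<And>y. cmod (\<phi> y) \<le> N y" "\<phi> (T x) = complex_of_real (N (T x))"
    by (rule hahn_banach_complex[OF N(3), of "T x"]) (rule that)
  have C: "0 < ?C" using a by simp
  have NK: "N (T y) \<le> ?C * ?K y" for y
  proof -
    have "N (T y) / ?C \<le> ?K y"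
    proof (rule sum_norm_greatest)
      fix b
      have "N (T y) = N (T b + T (y - b))" by (simp add: clinear_diff[OF T])
      also have "\<dots> \<le> N (T b) + N (T (y - b))" by (rule cseminorm_add[OF N(3)])
      also have "\<dots> \<le> ?C * N0 b + ?C * N1 (y - b)"
        by (intro add_mono order_trans[OF T0] order_trans[OF T1] mult_right_mono cseminorm_nonneg N) auto
      finally show "N (T y) / ?C \<le> N0 b + N1 (y - b)" using C by (simp add: field_simps)
    qed
    then show ?thesis using C by (simp add: field_simps)
  qed
  define F where "F z = \<phi> (T (f z))" for z
  have Flin: "\<phi> (T (u - v)) = \<phi> (T u) - \<phi> (T v)" "\<phi> (T (scaleC z u)) = z * \<phi> (T u)" for u v z
    by (simp_all add: clinear_diff[OF T] clinear_diff[OF \<phi>(1)] clinear_scale[OF T] clinear_scale[OF \<phi>(1)])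
  have FK: "cmod (\<phi> (T y)) \<le> ?C * ?K y" for y by (rule order_trans[OF \<phi>(2) NK])
  have pre: "precalderon N0 N1 f" using f by (simp add: calderon_iff)
  have contF: "continuous_on strip F"
    unfolding continuous_on_def
  proof
    fix z :: complex assume "z \<in> strip"
    then have "((\<lambda>w. ?K (f w - f z)) \<longlongrightarrow> 0) (at z within strip)" using pre unfolding precalderon_def by blast
    then have "((\<lambda>w. ?C * ?K (f w - f z)) \<longlongrightarrow> 0) (at z within strip)" by (rule tendsto_mult_right_zero)
    then have "((\<lambda>w. cmod (F w - F z)) \<longlongrightarrow> 0) (at z within strip)"
      by (rule tendsto_zero_le) (use FK in \<open>simp_all add: F_def Flin(1)[symmetric]\<close>)
    then have "((\<lambda>w. F w - F z) \<longlongrightarrow> 0) (at z within strip)" by (rule tendsto_norm_zero_cancel)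
    then show "(F \<longlongrightarrow> F z) (at z within strip)" by (rule LIM_zero_cancel)
  qed
  have holF: "F holomorphic_on interior strip"
  proof (rule holomorphic_onI)
    fix z :: complex assume "z \<in> interior strip"
    then obtain D where "((\<lambda>w. ?K (scaleC (inverse (w - z)) (f w - f z) - D)) \<longlongrightarrow> 0) (at z)"
      using pre unfolding precalderon_def by blast
    then have "((\<lambda>w. ?C * ?K (scaleC (inverse (w - z)) (f w - f z) - D)) \<longlongrightarrow> 0) (at z)"
      by (rule tendsto_mult_right_zero)
    then have "((\<lambda>w. cmod ((F w - F z) / (w - z) - \<phi> (T D))) \<longlongrightarrow> 0) (at z)"
    proof (rule tendsto_zero_le)
      fix w
      have "(F w - F z) / (w - z) - \<phi> (T D) = \<phi> (T (scaleC (inverse (w - z)) (f w - f z) - D))"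
        by (simp only: Flin F_def) (simp add: divide_inverse mult.commute)
      then show "cmod ((F w - F z) / (w - z) - \<phi> (T D)) \<le> ?C * ?K (scaleC (inverse (w - z)) (f w - f z) - D)"
        using FK by (simp only:)
    qed simp
    then have "((\<lambda>w. (F w - F z) / (w - z) - \<phi> (T D)) \<longlongrightarrow> 0) (at z)" by (rule tendsto_norm_zero_cancel)
    then have "((\<lambda>w. (F w - F z) / (w - z)) \<longlongrightarrow> \<phi> (T D)) (at z)" by (rule LIM_zero_cancel)
    then have "(F has_field_derivative \<phi> (T D)) (at z)" by (simp add: has_field_derivative_iff)
    then show "F field_differentiable at z within interior strip"
      using field_differentiable_at_within field_differentiable_def by blast
  qed
  obtain B where B: "\<forall>z\<in>strip. ?K (f z) \<le> B" using pre unfolding precalderon_def by blast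
  let ?w = "balance \<theta> a0 a1"
  have "cmod (?w (complex_of_real \<theta>) * F (complex_of_real \<theta>)) \<le> ?A * c"
  proof (rule three_lines[where G = "\<lambda>z. ?w z * F z"])
    show "continuous_on strip (\<lambda>z. ?w z * F z)"
      by (intro continuous_on_mult contF holomorphic_on_imp_continuous_on balance_holomorphic)
    show "(\<lambda>z. ?w z * F z) holomorphic_on interior strip"
      by (intro holomorphic_on_mult holF balance_holomorphic)
    show "0 \<le> ?A * c" using c0 by simp
    show "complex_of_real \<theta> \<in> strip" using \<theta> by simp
    show "cmod (?w z * F z) \<le> exp \<bar>ln a0 - ln a1\<bar> * (?C * B)" if z: "z \<in> strip" for z
      unfolding norm_mult
    proof (intro mult_mono balance_bounded[OF z \<theta>])
      show "cmod (F z) \<le> ?C * B"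
        unfolding F_def by (rule order_trans[OF FK mult_left_mono]) (use B z C in auto)
    qed auto
    fix t
    have "cmod (?w (Complex 0 t) * F (Complex 0 t)) \<le> cmod (?w (Complex 0 t)) * (a0 * c)"
      unfolding norm_mult F_def
      by (intro mult_left_mono order_trans[OF \<phi>(2)] order_trans[OF T0] c) (use a in auto)
    then show "cmod (?w (Complex 0 t) * F (Complex 0 t)) \<le> ?A * c"
      by (simp only: mult.assoc[symmetric] balance_boundary[OF a])
    have "cmod (?w (Complex 1 t) * F (Complex 1 t)) \<le> cmod (?w (Complex 1 t)) * (a1 * c)"
      unfolding norm_mult F_def
      by (intro mult_left_mono order_trans[OF \<phi>(2)] order_trans[OF T1] c) (use a in auto)
    then show "cmod (?w (Complex 1 t) * F (Complex 1 t)) \<le> ?A * c"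
      by (simp only: mult.assoc[symmetric] balance_boundary[OF a])
  qed
  then show "N (T x) \<le> ?A * c"
    using cseminorm_nonneg[OF N(3)] by (simp add: F_def f \<phi>(3))
qed

section \<open>Interpolation of matrix norms\<close>

lemma clinear_two_sided: "clinear (\<lambda>x. two_sided l \<alpha> x \<beta>)"
  by (auto simp: clinear_iff two_sided_def fun_eq_iff scaleC_add_right sum.distrib
      cvec.scale_sum_right scaleC_scaleC mult_ac)

text \<open>
  Local dependence, scaling and two-sided multiplication are instances of interpolation of operators.
  For direct sums the almost optimal functions of the two summands are combined on the strip.
\<close>

lemma ruan_interp:
  assumes E: "ruan E0" "ruan E1" and \<theta>: "0 < \<theta>" "\<theta> < 1"
  shows "ruan (interp \<theta> E0 E1)"
  unfolding ruan_def interp_def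
proof (intro conjI allI impI)
  note N = ruan_cseminorm[OF E(1)] ruan_cseminorm[OF E(2)]
  fix k l c and \<alpha> \<beta> :: "complex matrix" and x y :: "'a matrix"
  let ?I = "\<lambda>k. interp_norm \<theta> (E0 k) (E1 k)"
  note I = interp_norm_cseminorm[OF N(1)[of k] N(2)[of k] \<theta>]
  show "?I k x = ?I k y" if eq: "\<forall>i<k. \<forall>j<k. x i j = y i j"
  proof (rule cseminorm_diff_zero[OF I])
    have "E k (x - y) = 0" if E: "ruan E" for E
    proof -
      have "E k (x - y) = E k 0" by (rule ruan_local[OF E]) (simp add: eq)
      then show ?thesis by (simp add: cseminorm_zero[OF ruan_cseminorm[OF E]])
    qed
    then show "?I k (x - y) = 0" using E by (intro interp_norm_eq_zero N \<theta>)
  qed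
  show "0 \<le> ?I k x" by (rule cseminorm_nonneg[OF I])
  show "?I k (scaleC c x) = cmod c * ?I k x" by (rule cseminorm_scale[OF I])
  show "?I k (x + y) \<le> ?I k x + ?I k y" by (rule cseminorm_add[OF I])
  show "?I k (two_sided l \<alpha> x \<beta>) \<le> op_norm k l \<alpha> * ?I l x * op_norm l k \<beta>"
  proof -
    have "?I k (two_sided l \<alpha> x \<beta>) \<le> (op_norm k l \<alpha> * op_norm l k \<beta>) * ?I l x"
    proof (rule interp_norm_linear_same[OF N N clinear_two_sided _ _ _ \<theta>])
      show "0 \<le> op_norm k l \<alpha> * op_norm l k \<beta>" by (simp add: op_norm_eq_opn opn_nonneg)
      show "E0 k (two_sided l \<alpha> x \<beta>) \<le> op_norm k l \<alpha> * op_norm l k \<beta> * E0 l x"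
        "E1 k (two_sided l \<alpha> x \<beta>) \<le> op_norm k l \<alpha> * op_norm l k \<beta> * E1 l x" for x
        using ruan_two_sided[OF E(1), of k l \<alpha> x \<beta>] ruan_two_sided[OF E(2), of k l \<alpha> x \<beta>] by (simp_all add: mult_ac)
    qed
    then show ?thesis by (simp add: mult_ac)
  qed
  show "?I (k + l) (direct_sum k x y) \<le> max (?I k x) (?I l y)"
  proof (rule dense_ge)
    fix c assume "max (?I k x) (?I l y) < c"
    then have cx: "?I k x < c" and cy: "?I l y < c" by auto
    obtain f where f: "f \<in> calderon (E0 k) (E1 k)" "f (complex_of_real \<theta>) = x"
      "\<And>t. E0 k (f (Complex 0 t)) \<le> c" "\<And>t. E1 k (f (Complex 1 t)) \<le> c"
      using interp_norm_witness[OF N cx] by blast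
    obtain g where g: "g \<in> calderon (E0 l) (E1 l)" "g (complex_of_real \<theta>) = y"
      "\<And>t. E0 l (g (Complex 0 t)) \<le> c" "\<And>t. E1 l (g (Complex 1 t)) \<le> c"
      using interp_norm_witness[OF N cy] by blast
    have T: "clinear (\<lambda>x. direct_sum k x 0 :: 'a matrix)" "clinear (\<lambda>y. direct_sum k 0 y :: 'a matrix)"
      by (auto simp: clinear_iff direct_sum_def fun_eq_iff)
    have left: "E (k + l) (direct_sum k x 0) \<le> 1 * E k x" and right: "E (k + l) (direct_sum k 0 y) \<le> 1 * E l y"
      if E: "ruan E" for E and x y :: "'a matrix"
      using ruan_direct_sum[OF E, of k l x 0] ruan_direct_sum[OF E, of k l 0 y]
        cseminorm_zero[OF ruan_cseminorm[OF E], of k] cseminorm_zero[OF ruan_cseminorm[OF E], of l]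
        ruan_nonneg[OF E, of k x] ruan_nonneg[OF E, of l y] by simp_all
    have split: "direct_sum k x 0 + direct_sum k 0 y = direct_sum k x y" for x y :: "'a matrix"
      by (auto simp: direct_sum_def fun_eq_iff)
    have "(\<lambda>z. direct_sum k (f z) 0 + direct_sum k 0 (g z)) \<in> calderon (E0 (k + l)) (E1 (k + l))"
    proof (rule calderon_add[OF N])
      show "(\<lambda>z. direct_sum k (f z) 0) \<in> calderon (E0 (k + l)) (E1 (k + l))"
        by (rule calderon_linear[where ?a0.0 = 1 and ?a1.0 = 1, OF N N T(1) _ _ _ _ f(1)])
          (simp_all only: left[OF E(1)] left[OF E(2)] zero_le_one)
      show "(\<lambda>z. direct_sum k 0 (g z)) \<in> calderon (E0 (k + l)) (E1 (k + l))"
        by (rule calderon_linear[where ?a0.0 = 1 and ?a1.0 = 1, OF N N T(2) _ _ _ _ g(1)])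
          (simp_all only: right[OF E(1)] right[OF E(2)] zero_le_one)
    qed
    then have h: "(\<lambda>z. direct_sum k (f z) (g z)) \<in> calderon (E0 (k + l)) (E1 (k + l))" by (simp only: split)
    show "?I (k + l) (direct_sum k x y) \<le> c"
    proof (rule interp_norm_le[OF N h])
      show "direct_sum k (f (complex_of_real \<theta>)) (g (complex_of_real \<theta>)) = direct_sum k x y" by (simp add: f g)
      fix t
      show "E0 (k + l) (direct_sum k (f (Complex 0 t)) (g (Complex 0 t))) \<le> c"
        using ruan_direct_sum[OF E(1), of k l "f (Complex 0 t)" "g (Complex 0 t)"] f(3)[of t] g(3)[of t] by linarith
      show "E1 (k + l) (direct_sum k (f (Complex 1 t)) (g (Complex 1 t))) \<le> c"
        using ruan_direct_sum[OF E(2), of k l "f (Complex 1 t)" "g (Complex 1 t)"] f(4)[of t] g(4)[of t] by linarith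
    qed
  qed
qed

text \<open>
  Enumerating the index set is an isometry at both endpoints, in both directions, hence for the
  interpolation norm as well.
\<close>

lemma mn_interp:
  fixes x :: "'i \<Rightarrow> 'i \<Rightarrow> 'a::complex_vector"
  assumes E: "ruan E0" "ruan E1" and \<theta>: "0 < \<theta>" "\<theta> < 1" and I: "finite I"
  shows "mn (interp \<theta> E0 E1) I x = interp_norm \<theta> (mn E0 I) (mn E1 I) x"
proof (rule antisym)
  note N = ruan_cseminorm[OF E(1)] ruan_cseminorm[OF E(2)]
  note M = mn_cseminorm[OF E(1)] mn_cseminorm[OF E(2)]
  note e = bij_enum[OF I]
  let ?T = "\<lambda>x i j. x (enum I i) (enum I j)"
  define f where "f = the_inv_into {..<card I} (enum I)"
  have f: "f (enum I i) = i" if "i < card I" for i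
    using that e by (simp add: f_def bij_betw_def the_inv_into_f_f)
  have fe: "enum I (f i) = i" if "i \<in> I" for i using that e by (simp add: f_def f_the_inv_into_f_bij_betw)
  let ?U = "\<lambda>y i j. y (f i) (f j)"
  have T: "clinear (?T :: _ \<Rightarrow> _ \<Rightarrow> _ \<Rightarrow> 'a)" and U: "clinear (?U :: _ \<Rightarrow> _ \<Rightarrow> _ \<Rightarrow> 'a)"
    by (auto simp: clinear_iff fun_eq_iff)
  have "interp_norm \<theta> (E0 (card I)) (E1 (card I)) (?T x) \<le> 1 * interp_norm \<theta> (mn E0 I) (mn E1 I) x"
    by (rule interp_norm_linear_same[OF N M T _ _ _ \<theta>]) (simp_all add: mn_def)
  then show "mn (interp \<theta> E0 E1) I x \<le> interp_norm \<theta> (mn E0 I) (mn E1 I) x"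
    by (simp add: mn_def[of "interp \<theta> E0 E1"] interp_def)
  have U_le: "mn E I (?U y) \<le> 1 * E (card I) y" if E: "ruan E" for E and y
  proof -
    have "mn E I (?U y) = E (card I) y"
      unfolding mn_def by (rule ruan_local[OF E]) (simp add: f)
    then show ?thesis by simp
  qed
  have "interp_norm \<theta> (mn E0 I) (mn E1 I) (?U (?T x)) \<le> 1 * interp_norm \<theta> (E0 (card I)) (E1 (card I)) (?T x)"
    by (rule interp_norm_linear_same[OF M N U _ U_le[OF E(1)] U_le[OF E(2)] \<theta>]) simp
  moreover have "interp_norm \<theta> (mn E0 I) (mn E1 I) x = interp_norm \<theta> (mn E0 I) (mn E1 I) (?U (?T x))"
    by (rule cseminorm_diff_zero[OF interp_norm_cseminorm[OF M \<theta>]], rule interp_norm_eq_zero[OF M _ _ \<theta>])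
      (auto intro!: mn_zero E I simp: fe)
  ultimately show "interp_norm \<theta> (mn E0 I) (mn E1 I) x \<le> mn (interp \<theta> E0 E1) I x"
    by (simp add: mn_def[of "interp \<theta> E0 E1"] interp_def)
qed

section \<open>The spaces \<open>S_p\<close> and \<open>ell_p\<close>\<close>

definition inv_exponent :: "ereal \<Rightarrow> real"
  where "inv_exponent p = real_of_ereal (1 / p)"

lemma inv_exponent_cases:
  assumes "1 \<le> p"
  obtains "p = \<infinity>" "inv_exponent p = 0" | "p = 1" "inv_exponent p = 1"
    | "p \<noteq> \<infinity>" "p \<noteq> 1" "0 < inv_exponent p" "inv_exponent p < 1"
proof (cases p)
  case (real r)
  have r: "1 \<le> r" using assms real by (simp add: one_ereal_def)
  have i: "inv_exponent p = 1 / r" using real r by (simp add: inv_exponent_def one_ereal_def)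
  show thesis
  proof (cases "r = 1")
    case True
    then show thesis using that(2) i real by (simp add: one_ereal_def)
  next
    case False
    then show thesis using that(3) i r real by (simp add: one_ereal_def)
  qed
next
  case PInf
  then show thesis using that(1) by (simp add: inv_exponent_def)
next
  case MInf
  then show thesis using assms by simp
qed

lemma S_p_simps:
  "S_p \<infinity> E = S_inf E" "S_p 1 E = S_one E"
  "p \<noteq> \<infinity> \<Longrightarrow> p \<noteq> 1 \<Longrightarrow> S_p p E = interp (inv_exponent p) (S_inf E) (S_one E)"
  by (simp_all add: S_p_def inv_exponent_def)

lemma ruan_S_p:
  assumes E: "ruan E" and p: "1 \<le> p"
  shows "ruan (S_p p E)"
  using p by (rule inv_exponent_cases) (auto simp: S_p_simps E intro!: ruan_S_inf ruan_S_one ruan_interp)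

lemma mn_S_p_linear:
  fixes T :: "('i \<Rightarrow> 'i \<Rightarrow> 'a::complex_vector^'n^'n) \<Rightarrow> 'j \<Rightarrow> 'j \<Rightarrow> 'b::complex_vector^'m^'m"
  assumes E: "ruan E" "ruan F" and p: "1 \<le> p" and fin: "finite I" "finite J" and T: "clinear T"
    and a: "0 < a0" "0 < a1"
    and T0: "\<And>x. mn (S_inf F) J (T x) \<le> a0 * mn (S_inf E) I x"
    and T1: "\<And>x. mn (S_one F) J (T x) \<le> a1 * mn (S_one E) I x"
  shows "mn (S_p p F) J (T x) \<le> a0 powr (1 - inv_exponent p) * a1 powr inv_exponent p * mn (S_p p E) I x"
  using p
proof (rule inv_exponent_cases)
  assume "p = \<infinity>" "inv_exponent p = 0"
  then show ?thesis using T0[of x] a by (simp add: S_p_simps)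
next
  assume "p = 1" "inv_exponent p = 1"
  then show ?thesis using T1[of x] a by (simp add: S_p_simps)
next
  assume "p \<noteq> \<infinity>" "p \<noteq> 1" and \<theta>: "0 < inv_exponent p" "inv_exponent p < 1"
  have "interp_norm (inv_exponent p) (mn (S_inf F) J) (mn (S_one F) J) (T x)
    \<le> a0 powr (1 - inv_exponent p) * a1 powr inv_exponent p
      * interp_norm (inv_exponent p) (mn (S_inf E) I) (mn (S_one E) I) x"
    by (rule interp_norm_linear[OF _ _ _ _ T a _ _ \<theta>])
      (auto intro!: mn_cseminorm ruan_S_inf ruan_S_one E T0 T1)
  then show ?thesis
    using \<open>p \<noteq> \<infinity>\<close> \<open>p \<noteq> 1\<close> \<theta> E fin by (simp add: S_p_simps mn_interp ruan_S_inf ruan_S_one)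
qed

lemma S_p_upper:
  fixes x :: "('a::complex_vector^'n^'n) matrix"
  assumes E: "ruan E" and p: "1 \<le> p" and a: "0 < a" "0 \<le> M"
    and x: "S_inf E k x \<le> M" "S_one E k x \<le> a * M"
  shows "S_p p E k x \<le> a powr inv_exponent p * M"
  using p
proof (rule inv_exponent_cases)
  assume "p = \<infinity>" "inv_exponent p = 0"
  then show ?thesis using x a by (simp add: S_p_simps)
next
  assume "p = 1" "inv_exponent p = 1"
  then show ?thesis using x a by (simp add: S_p_simps)
next
  assume "p \<noteq> \<infinity>" "p \<noteq> 1" and \<theta>: "0 < inv_exponent p" "inv_exponent p < 1"
  have "interp_norm (inv_exponent p) (S_inf E k) (S_one E k) x \<le> 1 powr (1 - inv_exponent p) * a powr inv_exponent p * M"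
    by (rule interp_norm_upper[OF _ _ _ _ _ _ _ \<theta>])
      (use x a in \<open>auto intro!: ruan_cseminorm ruan_S_inf ruan_S_one E\<close>)
  then show ?thesis using \<open>p \<noteq> \<infinity>\<close> \<open>p \<noteq> 1\<close> by (simp add: S_p_simps interp_def)
qed

lemma S_p_lower:
  fixes T :: "('a::complex_vector^'n^'n) matrix \<Rightarrow> 'b::complex_vector"
  assumes E: "ruan E" and p: "1 \<le> p" and N: "cseminorm N" and T: "clinear T" and a: "0 < a0" "0 < a1"
    and T0: "\<And>x. N (T x) \<le> a0 * S_inf E k x" and T1: "\<And>x. N (T x) \<le> a1 * S_one E k x"
  shows "N (T x) \<le> a0 powr (1 - inv_exponent p) * a1 powr inv_exponent p * S_p p E k x"
  using p
proof (rule inv_exponent_cases)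
  assume "p = \<infinity>" "inv_exponent p = 0"
  then show ?thesis using T0[of x] a by (simp add: S_p_simps)
next
  assume "p = 1" "inv_exponent p = 1"
  then show ?thesis using T1[of x] a by (simp add: S_p_simps)
next
  assume "p \<noteq> \<infinity>" "p \<noteq> 1" and \<theta>: "0 < inv_exponent p" "inv_exponent p < 1"
  have "N (T x) \<le> a0 powr (1 - inv_exponent p) * a1 powr inv_exponent p
      * interp_norm (inv_exponent p) (S_inf E k) (S_one E k) x"
    by (rule interp_norm_lower[OF _ _ N T a _ _ \<theta>])
      (auto intro!: ruan_cseminorm ruan_S_inf ruan_S_one E T0 T1)
  then show ?thesis using \<open>p \<noteq> \<infinity>\<close> \<open>p \<noteq> 1\<close> by (simp add: S_p_simps interp_def)
qed

lemma clinear_diag: "diag (x + y) = diag x + diag y" "diag (scaleC c x) = scaleC c (diag x)" "diag 0 = 0"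
  by (auto simp: diag_def vec_eq_iff)

text \<open>
  The axioms are inherited by subspaces.
\<close>

lemma ruan_comp_injection:
  assumes E: "ruan E" and D: "\<And>x y. D (x + y) = D x + D y" "\<And>c x. D (scaleC c x) = scaleC c (D x)"
  shows "ruan (\<lambda>k x. E k (amplify D x))"
proof -
  have D0: "D 0 = 0" using D(1)[of 0 0] by simp
  have Dsum: "D (\<Sum>a\<in>A. g a) = (\<Sum>a\<in>A. D (g a))" for A :: "nat set" and g
    by (induction A rule: infinite_finite_induct) (simp_all add: D0 D)
  have amp: "amplify D (x + y) = amplify D x + amplify D y" "amplify D (scaleC c x) = scaleC c (amplify D x)"
    "amplify D (direct_sum k x y) = direct_sum k (amplify D x) (amplify D y)"
    "amplify D (two_sided l \<alpha> x \<beta>) = two_sided l \<alpha> (amplify D x) \<beta>" for x y c k l \<alpha> \<beta>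
    by (auto simp: amplify_def fun_eq_iff D D0 direct_sum_def two_sided_def Dsum)
  show ?thesis
    unfolding ruan_def amp
    using ruan_nonneg[OF E] ruan_scale[OF E] ruan_triangle[OF E] ruan_direct_sum[OF E] ruan_two_sided[OF E]
    by (auto intro: ruan_local[OF E] simp: amplify_def)
qed

lemma ruan_ell_p:
  fixes E :: "('a::complex_vector) matnorms"
  assumes "ruan E" "1 \<le> p"
  shows "ruan (ell_p p E :: ('a^'m) matnorms)"
proof -
  have "(ell_p p E :: ('a^'m) matnorms) = (\<lambda>k x. S_p p E k (amplify diag x))" by (simp add: fun_eq_iff ell_p_def)
  then show ?thesis
    by (simp only:) (rule ruan_comp_injection[OF ruan_S_p[OF assms] clinear_diag(1,2)])
qed

lemma mn_ell_p: "mn (ell_p p E) I x = mn (S_p p E) I (\<lambda>i j. diag (x i j))"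
  by (simp add: mn_def ell_p_def amplify_def)

section \<open>A unitary basis of the matrix algebra\<close>

text \<open>
  An enumeration of \<open>'n\<close> by which addition modulo \<open>CARD('n)\<close> is transported to the type.
\<close>

definition idx :: "'n::finite \<Rightarrow> nat"
  where "idx = (SOME h. bij_betw h UNIV {..<CARD('n)})"

lemma bij_idx: "bij_betw (idx :: 'n::finite \<Rightarrow> nat) UNIV {..<CARD('n)}"
proof -
  have "\<exists>h. bij_betw h (UNIV :: 'n set) {..<CARD('n)}"
    using ex_bij_betw_finite_nat[of "UNIV :: 'n set"] by (simp add: atLeast0LessThan)
  then show ?thesis unfolding idx_def by (rule someI_ex)
qed

lemma idx_less: "idx (a :: 'n::finite) < CARD('n)"
  using bij_betwE[OF bij_idx] by auto

lemma idx_inj: "idx (a :: 'n::finite) = idx b \<longleftrightarrow> a = b"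
  using bij_idx by (auto simp: bij_betw_def inj_on_def)

definition shift :: "'n::finite \<Rightarrow> 'n \<Rightarrow> 'n"
  where "shift s c = the_inv_into UNIV idx ((idx c + idx s) mod CARD('n))"

lemma idx_shift: "idx (shift s c :: 'n::finite) = (idx c + idx s) mod CARD('n)"
  unfolding shift_def using bij_idx[where 'n = 'n]
  by (intro f_the_inv_into_f_bij_betw[OF bij_idx]) auto

lemma add_mod_cancel:
  fixes x y s n :: nat
  assumes "x < n" "y < n" "(x + s) mod n = (y + s) mod n"
  shows "x = y"
proof -
  have *: "x = y" if "x \<le> y" "x < n" "y < n" "(x + s) mod n = (y + s) mod n" for x y
  proof -
    have "n dvd (y + s) - (x + s)"
      using that by (subst mod_eq_dvd_iff_nat[symmetric]) auto
    then have "n dvd y - x" by simp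
    then show ?thesis using that by (auto dest: dvd_imp_le)
  qed
  show ?thesis using *[of x y] *[of y x] assms by (cases "x \<le> y") auto
qed

lemma shift_inj: "shift s c = shift s d \<longleftrightarrow> c = (d :: 'n::finite)" "shift s c = shift t c \<longleftrightarrow> s = t"
proof -
  have "c = d" if "shift s c = shift s d"
    using add_mod_cancel[where x = "idx c" and y = "idx d" and s = "idx s", OF idx_less idx_less]
      arg_cong[OF that, of idx]
    by (simp add: idx_shift idx_inj)
  then show "shift s c = shift s d \<longleftrightarrow> c = (d :: 'n::finite)" by auto
  have "s = t" if "shift s c = shift t c"
    using add_mod_cancel[where x = "idx s" and y = "idx t" and s = "idx c", OF idx_less idx_less]
      arg_cong[OF that, of idx]
    by (simp add: idx_shift idx_inj add.commute)
  then show "shift s c = shift t c \<longleftrightarrow> s = t" by auto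
qed

definition unit_root :: "'n::finite \<Rightarrow> complex"
  where "unit_root t = exp (2 * of_real pi * \<i> * of_nat (idx t) / of_nat CARD('n))"

lemma unit_root_power: "unit_root (t :: 'n::finite) ^ CARD('n) = 1"
  unfolding unit_root_def by (rule complex_root_unity) simp

lemma unit_root_inj: "unit_root (s :: 'n::finite) = unit_root t \<longleftrightarrow> s = t"
  unfolding unit_root_def
  by (subst complex_root_unity_eq) (use idx_less[of s] idx_less[of t] in \<open>auto simp: idx_inj\<close>)

lemma unit_root_unimodular: "cnj (unit_root t) * unit_root t = 1"
proof -
  have "cmod (unit_root t) = 1" unfolding unit_root_def by simp
  then show ?thesis by (metis complex_norm_square mult.commute of_real_1 power_one)
qed

text \<open>
  Orthogonality of the characters of a cyclic group, by the geometric sum.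
\<close>

lemma sum_root_powers:
  fixes s t :: "'n::finite"
  shows "(\<Sum>c\<in>(UNIV :: 'n set). cnj (unit_root s ^ idx c) * unit_root t ^ idx c) = (if s = t then of_nat CARD('n) else 0)"
proof -
  let ?z = "cnj (unit_root s) * unit_root t"
  have "(\<Sum>c\<in>(UNIV :: 'n set). cnj (unit_root s ^ idx c) * unit_root t ^ idx c) = (\<Sum>c\<in>(UNIV :: 'n set). ?z ^ idx c)"
    by (simp add: power_mult_distrib)
  also have "\<dots> = (\<Sum>k<CARD('n). ?z ^ k)" by (rule sum.reindex_bij_betw[OF bij_idx])
  also have "\<dots> = (if s = t then of_nat CARD('n) else 0)"
  proof (cases "s = t")
    case True
    then show ?thesis by (simp add: unit_root_unimodular)
  next
    case False
    have "?z \<noteq> 1"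
    proof
      assume "?z = 1"
      then have "unit_root s * ?z = unit_root s" by simp
      moreover have "unit_root s * ?z = (cnj (unit_root s) * unit_root s) * unit_root t" by (simp add: mult_ac)
      ultimately have "unit_root t = unit_root s" by (simp add: unit_root_unimodular)
      then show False using False by (simp add: unit_root_inj)
    qed
    moreover have "?z ^ CARD('n) = 1"
      by (simp add: power_mult_distrib unit_root_power complex_cnj_power[symmetric] del: complex_cnj_power)
    ultimately show ?thesis using False by (simp add: geometric_sum)
  qed
  finally show ?thesis .
qed

text \<open>
  The unitary that multiplies the basis vector c by a power of a root of unity and then shifts it cyclically.
\<close>

definition weyl :: "'n::finite \<times> 'n \<Rightarrow> 'n \<Rightarrow> 'n \<Rightarrow> complex"
  where "weyl g a c = (if a = shift (fst g) c then unit_root (snd g) ^ idx c else 0)"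

lemma weyl_isometry: "(\<Sum>a\<in>UNIV. cnj (weyl g a c) * weyl g a d) = (if c = d then 1 else 0)"
proof -
  have u: "cnj (unit_root t ^ k) * unit_root t ^ k = 1" for t :: 'a and k
    by (simp add: power_mult_distrib[symmetric] unit_root_unimodular)
  have "(\<Sum>a\<in>UNIV. cnj (weyl g a c) * weyl g a d)
    = (\<Sum>a\<in>UNIV. if a = shift (fst g) c then if c = d then 1 else 0 else 0)"
    by (intro sum.cong refl) (use u in \<open>auto simp: weyl_def shift_inj\<close>)
  then show ?thesis by simp
qed

lemma weyl_orthogonal:
  "(\<Sum>p\<in>UNIV. cnj (weyl g (fst p) (snd p)) * weyl h (fst p) (snd p)) = (if g = h then of_nat CARD('n) else 0)"
  for g h :: "'n::finite \<times> 'n"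
proof -
  obtain s t s' t' where gh: "g = (s, t)" "h = (s', t')" by (cases g; cases h)
  have "(\<Sum>p\<in>UNIV. cnj (weyl g (fst p) (snd p)) * weyl h (fst p) (snd p))
    = (\<Sum>a\<in>UNIV. \<Sum>c\<in>UNIV. cnj (weyl g a c) * weyl h a c)"
    unfolding UNIV_Times_UNIV[symmetric] sum_Times by simp
  also have "\<dots> = (\<Sum>c\<in>UNIV. \<Sum>a\<in>UNIV. cnj (weyl g a c) * weyl h a c)" by (rule sum.swap)
  also have "\<dots> = (\<Sum>c\<in>UNIV. \<Sum>a\<in>UNIV. if a = shift s c then if s = s' then cnj (unit_root t ^ idx c) * unit_root t' ^ idx c else 0 else 0)"
    by (intro sum.cong refl) (auto simp: weyl_def gh shift_inj)
  also have "\<dots> = (if s = s' then \<Sum>c\<in>(UNIV :: 'n set). cnj (unit_root t ^ idx c) * unit_root t' ^ idx c else 0)"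
    by simp
  finally show ?thesis unfolding sum_root_powers by (simp add: gh)
qed

lemma opn_cnj_le: "finite I \<Longrightarrow> finite J \<Longrightarrow> opn I J (\<lambda>i j. cnj (A i j)) \<le> opn I J A"
proof (rule opn_le)
  fix v :: "'b \<Rightarrow> complex"
  assume fin: "finite I" "finite J"
  have "(\<Sum>j\<in>J. cnj (A i j) * v j) = cnj (\<Sum>j\<in>J. A i j * cnj (v j))" for i by simp
  then show "l2 I (\<lambda>i. \<Sum>j\<in>J. cnj (A i j) * v j) \<le> opn I J A * l2 J v"
    using opn_bound[OF fin, of A "\<lambda>j. cnj (v j)"] by (simp only: complex_mod_cnj)
qed (rule opn_nonneg)

lemma opn_weyl:
  "opn UNIV UNIV (weyl g) \<le> 1" "opn UNIV UNIV (\<lambda>a c. cnj (weyl g a c)) \<le> 1"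
  "opn UNIV UNIV (\<lambda>c a. weyl g a c) \<le> 1" "opn UNIV UNIV (\<lambda>c a. cnj (weyl g a c)) \<le> 1"
proof -
  show 1: "opn UNIV UNIV (weyl g) \<le> 1" by (rule opn_isometry) (auto simp: weyl_isometry)
  show 2: "opn UNIV UNIV (\<lambda>a c. cnj (weyl g a c)) \<le> 1"
    using opn_cnj_le[of UNIV UNIV "weyl g"] 1 by simp
  show "opn UNIV UNIV (\<lambda>c a. weyl g a c) \<le> 1" using 1 by (subst opn_transpose) auto
  show "opn UNIV UNIV (\<lambda>c a. cnj (weyl g a c)) \<le> 1"
    using 2 opn_transpose[of UNIV UNIV "\<lambda>a c. cnj (weyl g a c)"] by simp
qed

text \<open>
  The orthogonality relations say that the \<open>n\<^sup>2\<close> unitaries, read as vectors, are the columns of a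
  multiple of a unitary matrix.
\<close>

lemma opn_weyl_basis:
  fixes dummy :: "'n::finite"
  defines "s \<equiv> sqrt (real CARD('n))"
  shows "opn UNIV UNIV (\<lambda>(p :: 'n \<times> 'n) g. weyl g (fst p) (snd p)) \<le> s"
    "opn UNIV UNIV (\<lambda>(p :: 'n \<times> 'n) g. cnj (weyl g (fst p) (snd p))) \<le> s"
    "opn UNIV UNIV (\<lambda>g (p :: 'n \<times> 'n). weyl g (fst p) (snd p)) \<le> s"
    "opn UNIV UNIV (\<lambda>g (p :: 'n \<times> 'n). cnj (weyl g (fst p) (snd p))) \<le> s"
proof -
  show 1: "opn UNIV UNIV (\<lambda>(p :: 'n \<times> 'n) g. weyl g (fst p) (snd p)) \<le> s"
    by (rule opn_isometry) (auto simp: weyl_orthogonal s_def)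
  show 2: "opn UNIV UNIV (\<lambda>(p :: 'n \<times> 'n) g. cnj (weyl g (fst p) (snd p))) \<le> s"
    using opn_cnj_le[of UNIV UNIV "\<lambda>(p :: 'n \<times> 'n) g. weyl g (fst p) (snd p)"] 1 by simp
  show "opn UNIV UNIV (\<lambda>g (p :: 'n \<times> 'n). weyl g (fst p) (snd p)) \<le> s"
    using 1 by (subst opn_transpose) auto
  show "opn UNIV UNIV (\<lambda>g (p :: 'n \<times> 'n). cnj (weyl g (fst p) (snd p))) \<le> s"
    using 2 opn_transpose[of UNIV UNIV "\<lambda>(p :: 'n \<times> 'n) g. cnj (weyl g (fst p) (snd p))"] by simp
qed

section \<open>Conjugation by the unitary basis\<close>

text \<open>
  Component g is \<open>u\<^sub>g x u\<^sub>g\<^sup>*\<close>.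
\<close>

definition weyl_embed :: "('a::complex_vector)^'n^'n \<Rightarrow> ('a^('n \<times> 'n))^'n^'n"
  where "weyl_embed x = (\<chi> a b. \<chi> g. \<Sum>c\<in>UNIV. \<Sum>d\<in>UNIV. scaleC (weyl g a c * cnj (weyl g b d)) (x $ c $ d))"

text \<open>
  This is the sum of the \<open>u\<^sub>g\<^sup>* y\<^sub>g u\<^sub>g\<close>.
\<close>

definition weyl_project :: "(('a::complex_vector)^('n \<times> 'n))^'n^'n \<Rightarrow> 'a^'n^'n"
  where "weyl_project y = (\<chi> a b. \<Sum>g\<in>UNIV. \<Sum>c\<in>UNIV. \<Sum>d\<in>UNIV. scaleC (cnj (weyl g c a) * weyl g d b) (y $ c $ d $ g))"

lemma embed_linear: "clinear weyl_embed"
  by (simp add: clinear_iff weyl_embed_def vec_eq_iff scaleC_add_right sum.distrib cvec.scale_sum_right scaleC_scaleC mult_ac)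

lemma project_linear: "clinear weyl_project"
  by (simp add: clinear_iff weyl_project_def vec_eq_iff scaleC_add_right sum.distrib cvec.scale_sum_right scaleC_scaleC mult_ac)

text \<open>
  By unitarity, each of the \<open>n\<^sup>2\<close> summands gives back x.
\<close>

lemma project_embed:
  fixes x :: "'a::complex_vector^'n^'n"
  shows "weyl_project (weyl_embed x) = scaleC (of_nat (CARD('n) * CARD('n))) x"
proof -
  have 1: "(\<Sum>c\<in>UNIV. \<Sum>d\<in>UNIV. scaleC (cnj (weyl g c a) * weyl g d b) (weyl_embed x $ c $ d $ g)) = x $ a $ b" for g a b
  proof -
    have "(\<Sum>c\<in>UNIV. \<Sum>d\<in>UNIV. scaleC (cnj (weyl g c a) * weyl g d b) (weyl_embed x $ c $ d $ g))
      = (\<Sum>p\<in>UNIV. \<Sum>q\<in>UNIV. scaleC ((\<Sum>c\<in>UNIV. cnj (weyl g c a) * weyl g c p)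
          * (\<Sum>d\<in>UNIV. cnj (weyl g d q) * weyl g d b)) (x $ p $ q))"
      by (rule two_sided_rep) (simp add: weyl_embed_def)
    also have "\<dots> = (\<Sum>p\<in>UNIV. \<Sum>q\<in>UNIV. scaleC ((if p = a then 1 else 0) * (if q = b then 1 else 0)) (x $ p $ q))"
      unfolding weyl_isometry by (intro sum.cong refl) auto
    also have "\<dots> = x $ a $ b" by (rule sum_delta2) auto
    finally show ?thesis .
  qed
  have nat: "(\<Sum>g\<in>(UNIV :: 'k::finite set). z) = scaleC (of_nat CARD('k)) z" for z :: 'a
    using cvec.scale_sum_left[of "\<lambda>_. 1" "UNIV :: 'k set" z] by (simp add: scaleC_one)
  show ?thesis by (simp add: vec_eq_iff weyl_project_def 1 nat card_cartesian_product)
qed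

lemma embed_tensor: "weyl_embed (matrix_tensor A e) $ a $ b $ g = scaleC (weyl_embed A $ a $ b $ g) e"
  by (simp add: weyl_embed_def cvec.scale_sum_left scaleC_scaleC)

text \<open>
  The diagonal blocks of B form a block-diagonal matrix indexed by g, and the sum over g multiplies it
  from both sides by \<open>\<Psi>\<close> and \<open>\<Phi>\<close>, which will be the matrices of \<open>opn_weyl_basis\<close>.
\<close>

lemma mn_mix:
  fixes B :: "'j \<Rightarrow> 'j \<Rightarrow> ('a::complex_vector)^'m^'m"
  assumes E: "ruan E" and fin: "finite J" "finite P" and s: "opn P UNIV \<Psi> \<le> s" "opn UNIV P \<Phi> \<le> s"
  shows "mn E (P \<times> J) (\<lambda>(p, j) (q, k). \<Sum>g\<in>UNIV. scaleC (\<Psi> p g * \<Phi> g q) (B j k $ g $ g))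
    \<le> s * mn E (J \<times> UNIV) (flat B) * s"
proof -
  let ?X = "\<lambda>(g, j) (h, k). if g = h then B j k $ g $ g else 0"
  have s0: "0 \<le> s" using order_trans[OF opn_nonneg s(1)] fin by simp
  have "mn E (P \<times> J) (\<lambda>(p, j) (q, k). \<Sum>g\<in>UNIV. scaleC (\<Psi> p g * \<Phi> g q) (B j k $ g $ g))
    \<le> opn P UNIV \<Psi> * mn E (UNIV \<times> J) ?X * opn UNIV P \<Phi>"
  proof (rule mn_two_sided_tensor_right[OF E])
    fix p q j k
    have "(\<Sum>g\<in>UNIV. \<Sum>h\<in>UNIV. scaleC (\<Psi> p g * \<Phi> h q) (?X (g, j) (h, k)))
      = (\<Sum>g\<in>UNIV. \<Sum>h\<in>UNIV. if g = h then scaleC (\<Psi> p g * \<Phi> g q) (B j k $ g $ g) else 0)"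
      by (intro sum.cong refl) auto
    then show "(case (p, j) of (p, j) \<Rightarrow> \<lambda>(q, k). \<Sum>g\<in>UNIV. scaleC (\<Psi> p g * \<Phi> g q) (B j k $ g $ g)) (q, k)
      = (\<Sum>g\<in>UNIV. \<Sum>h\<in>UNIV. scaleC (\<Psi> p g * \<Phi> h q) (?X (g, j) (h, k)))" by simp
  qed (use fin in auto)
  also have "\<dots> \<le> s * mn E (J \<times> UNIV) (flat B) * s"
  proof (intro mult_mono mult_nonneg_nonneg s)
    show "mn E (UNIV \<times> J) ?X \<le> mn E (J \<times> UNIV) (flat B)"
    proof (rule mn_block_diagonal[OF E])
      show "mn E J (\<lambda>j k. B j k $ g $ g) \<le> mn E (J \<times> UNIV) (flat B)" for g
        by (rule mn_compress[OF E, where h = "\<lambda>j. (j, g)"]) (use fin in \<open>auto simp: inj_on_def\<close>)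
    qed (use fin in \<open>auto intro: mn_nonneg[OF E]\<close>)
  qed (use s0 fin in \<open>auto intro!: mn_nonneg E opn_nonneg\<close>)
  finally show ?thesis .
qed

text \<open>
  The embedding as a map from \<open>M\<^sub>I(S\<^sub>p\<^sup>n[E])\<close> to matrices over \<open>S\<^sub>p\<^sup>N[E]\<close>, where \<open>N = n\<^sup>2\<close>: the matrix index of the
  target \<open>M\<^sub>n(\<ell>\<^sub>p[E])\<close> is joined to the index set, and the sequence is placed on the diagonal.
\<close>

definition embed_diag :: "('i \<Rightarrow> 'i \<Rightarrow> 'a::complex_vector^'n^'n) \<Rightarrow> 'i \<times> 'n \<Rightarrow> 'i \<times> 'n \<Rightarrow> 'a^('n \<times> 'n)^('n \<times> 'n)"
  where "embed_diag x = (\<lambda>(i, a) (j, b). diag (weyl_embed (x i j) $ a $ b))"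

lemma diag_nth: "diag x $ g $ h = (if g = h then x $ g else 0)"
  by (simp add: diag_def)

lemma embed_diag_linear: "clinear embed_diag"
  by (simp add: clinear_iff embed_diag_def fun_eq_iff clinear_diag clinear_add[OF embed_linear]
      clinear_scale[OF embed_linear])

text \<open>
  For \<open>p = \<infinity>\<close> the result is the direct sum of the matrices \<open>u\<^sub>g x u\<^sub>g\<^sup>*\<close>.
\<close>

lemma embed_diag_inf:
  fixes x :: "'i \<Rightarrow> 'i \<Rightarrow> 'a::complex_vector^'n^'n"
  assumes E: "ruan E" and I: "finite I"
  shows "mn (S_inf E) (I \<times> UNIV) (embed_diag x) \<le> mn (S_inf E) I x"
proof -
  let ?IN = "I \<times> (UNIV :: 'n set)"
  let ?y = "\<lambda>g p q. weyl_embed (x (fst p) (fst q)) $ snd p $ snd q $ g"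
  have "mn (S_inf E) ?IN (embed_diag x) = mn E (?IN \<times> UNIV) (flat (embed_diag x))"
    by (rule mn_S_inf[OF E]) (use I in simp)
  also have "\<dots> = mn E (UNIV \<times> ?IN) (\<lambda>p q. flat (embed_diag x) (prod.swap p) (prod.swap q))"
    by (rule mn_reindex[OF E]) (use I in \<open>auto simp: bij_betw_def\<close>)
  also have "\<dots> = mn E (UNIV \<times> ?IN) (\<lambda>(g, p) (h, q). if g = h then ?y g p q else 0)"
    by (rule mn_cong[OF E]) (use I in \<open>auto simp: embed_diag_def diag_nth\<close>)
  also have "\<dots> \<le> mn E ?IN (flat x)"
  proof (rule mn_block_diagonal[OF E])
    fix g :: "'n \<times> 'n"
    have "mn E ?IN (?y g) \<le> opn UNIV UNIV (weyl g) * mn E ?IN (flat x) * opn UNIV UNIV (\<lambda>d b. cnj (weyl g b d))"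
      by (rule mn_two_sided_tensor_left[OF E]) (use I in \<open>auto simp: weyl_embed_def\<close>)
    also have "\<dots> \<le> 1 * mn E ?IN (flat x) * 1"
      by (intro mult_mono mult_nonneg_nonneg opn_weyl opn_nonneg mn_nonneg E) auto
    finally show "mn E ?IN (?y g) \<le> mn E ?IN (flat x)" by simp
  qed (use I in \<open>auto intro: mn_nonneg[OF E]\<close>)
  also have "\<dots> = mn (S_inf E) I x" by (rule mn_S_inf[OF E I, symmetric])
  finally show ?thesis .
qed

text \<open>
  Dually to v, the pairing of \<open>embed_diag v\<close> with B is the contraction of v with a matrix W made from
  the diagonal blocks of B and the entries of the unitaries. By orthogonality of the unitaries,
  \<open>mn_mix\<close> bounds W by \<open>\<surd>n \<surd>n \<parallel>B\<parallel>\<close>.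
\<close>

lemma S1_embed_diag:
  fixes v :: "'l \<Rightarrow> 'l \<Rightarrow> complex^'n^'n"
  assumes L: "finite L"
  shows "S1 (L \<times> UNIV) (embed_diag v) \<le> CARD('n) * S1 L v"
proof (rule S1_least)
  show "0 \<le> CARD('n) * S1 L v" by (simp add: mn_nonneg ruan_S_one_scalar)
  fix m :: nat and B :: "(complex^('n \<times> 'n)^('n \<times> 'n)) matrix"
  let ?J = "{..<m}" and ?U = "UNIV :: 'n set" and ?s = "sqrt (real CARD('n))"
  note S = ruan_scalars
  define y where "y = (\<lambda>(r, (a, j)) (r', (b, k)). pairing (embed_diag v) B ((r, a), j) ((r', b), k))"
  define W where "W = (\<lambda>((a, j), c) ((b, k), d). \<Sum>g\<in>UNIV. weyl g a c * cnj (weyl g b d) * B j k $ g $ g)"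
  have "opn ((L \<times> ?U) \<times> ?J) ((L \<times> ?U) \<times> ?J) (pairing (embed_diag v) B)
    = mn scalars ((L \<times> ?U) \<times> ?J) (pairing (embed_diag v) B)" using L by (simp add: mn_scalars)
  also have "\<dots> = mn scalars (L \<times> (?U \<times> ?J)) (\<lambda>p q. pairing (embed_diag v) B ((\<lambda>(r, (a, j)). ((r, a), j)) p) ((\<lambda>(r, (a, j)). ((r, a), j)) q))"
  proof (rule mn_reindex[OF S])
    show "bij_betw (\<lambda>(r, (a, j)). ((r, a), j)) (L \<times> (?U \<times> ?J)) ((L \<times> ?U) \<times> ?J)"
      by (rule bij_betw_byWitness[where f' = "\<lambda>((r, a), j). (r, (a, j))"]) auto
  qed (use L in auto)
  also have "\<dots> = mn scalars (L \<times> (?U \<times> ?J)) y"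
    by (rule mn_cong[OF S]) (use L in \<open>auto simp: y_def\<close>)
  also have "\<dots> \<le> S1 L v * mn scalars ((?U \<times> ?J) \<times> ?U) W"
  proof (rule mn_contraction[OF S L])
    fix r r' :: 'l and p q :: "'n \<times> nat"
    obtain a j b k where pq: "p = (a, j)" "q = (b, k)" by (cases p; cases q)
    have "y (r, p) (r', q) = (\<Sum>g\<in>UNIV. \<Sum>h\<in>UNIV. (if g = h then weyl_embed (v r r') $ a $ b $ g else 0) * B j k $ g $ h)"
      by (simp add: y_def pq pairing_def embed_diag_def diag_nth)
    also have "\<dots> = (\<Sum>g\<in>UNIV. \<Sum>h\<in>UNIV. if h = g then weyl_embed (v r r') $ a $ b $ g * B j k $ g $ g else 0)"
      by (intro sum.cong refl) auto
    also have "\<dots> = (\<Sum>g\<in>UNIV. weyl_embed (v r r') $ a $ b $ g * B j k $ g $ g)" by simp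
    also have "\<dots> = (\<Sum>g\<in>UNIV. \<Sum>c\<in>UNIV. \<Sum>d\<in>UNIV. v r r' $ c $ d * (weyl g a c * cnj (weyl g b d) * B j k $ g $ g))"
      by (simp add: weyl_embed_def sum_distrib_left sum_distrib_right mult_ac)
    also have "\<dots> = (\<Sum>c\<in>UNIV. \<Sum>g\<in>UNIV. \<Sum>d\<in>UNIV. v r r' $ c $ d * (weyl g a c * cnj (weyl g b d) * B j k $ g $ g))"
      by (rule sum.swap)
    also have "\<dots> = (\<Sum>c\<in>UNIV. \<Sum>d\<in>UNIV. \<Sum>g\<in>UNIV. v r r' $ c $ d * (weyl g a c * cnj (weyl g b d) * B j k $ g $ g))"
      by (intro sum.cong refl sum.swap)
    finally show "y (r, p) (r', q) = (\<Sum>c\<in>UNIV. \<Sum>d\<in>UNIV. scaleC (v r r' $ c $ d) (W (p, c) (q, d)))"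
      by (simp add: W_def pq sum_distrib_left)
  qed simp
  also have "\<dots> \<le> S1 L v * (?s * mn scalars (?J \<times> UNIV) (flat B) * ?s)"
  proof (rule mult_left_mono)
    have "mn scalars ((?U \<times> ?J) \<times> ?U) W
      = mn scalars ((UNIV :: ('n \<times> 'n) set) \<times> ?J) (\<lambda>p q. W ((\<lambda>((a, c), j). ((a, j), c)) p) ((\<lambda>((a, c), j). ((a, j), c)) q))"
    proof (rule mn_reindex[OF S])
      show "bij_betw (\<lambda>((a, c), j). ((a, j), c)) ((UNIV :: ('n \<times> 'n) set) \<times> ?J) ((?U \<times> ?J) \<times> ?U)"
        by (rule bij_betw_byWitness[where f' = "\<lambda>((a, j), c). ((a, c), j)"]) auto
    qed auto
    also have "\<dots> = mn scalars ((UNIV :: ('n \<times> 'n) set) \<times> ?J) (\<lambda>(p, j) (q, k).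
        \<Sum>g\<in>UNIV. scaleC (weyl g (fst p) (snd p) * cnj (weyl g (fst q) (snd q))) (B j k $ g $ g))"
      by (rule mn_cong[OF S]) (auto simp: W_def)
    also have "\<dots> \<le> ?s * mn scalars (?J \<times> UNIV) (flat B) * ?s"
      by (rule mn_mix[OF S]) (auto simp: opn_weyl_basis)
    finally show "mn scalars ((?U \<times> ?J) \<times> ?U) W \<le> ?s * mn scalars (?J \<times> UNIV) (flat B) * ?s" .
  qed (simp add: mn_nonneg ruan_S_one_scalar)
  also have "\<dots> = CARD('n) * S1 L v * opn (?J \<times> UNIV) (?J \<times> UNIV) (flat B)"
    by (simp add: mn_scalars mult_ac)
  finally show "opn ((L \<times> ?U) \<times> ?J) ((L \<times> ?U) \<times> ?J) (pairing (embed_diag v) B)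
    \<le> CARD('n) * S1 L v * opn (?J \<times> UNIV) (?J \<times> UNIV) (flat B)" .
qed (use L in auto)

lemma scaleC_mult_if: "scaleC (x * (if c then y else 0)) z = (if c then scaleC (x * y) z else 0)"
  by simp

text \<open>
  The embedding acts on the trace class factor of \<open>\<alpha> (v \<otimes> w) \<beta>\<close> alone, so that the scalar case
  \<open>S1_embed_diag\<close> suffices. The new index a of the enlarged matrix is carried through \<open>\<alpha>\<close> and
  \<open>\<beta>\<close> by tensoring them with an identity matrix.
\<close>

lemma embed_diag_one:
  fixes x :: "'i \<Rightarrow> 'i \<Rightarrow> 'a::complex_vector^'n^'n"
  assumes E: "ruan E" and I: "finite I"
  shows "mn (S_one E) (I \<times> UNIV) (embed_diag x) \<le> CARD('n) * mn (S_one E) I x"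
proof (rule le_mult_limit)
  fix c assume "mn (S_one E) I x < c"
  then obtain l m :: nat and \<alpha> v w \<beta> where
    rep: "\<And>i j. i \<in> I \<Longrightarrow> j \<in> I \<Longrightarrow>
      x i j = (\<Sum>p\<in>{..<l} \<times> {..<m}. \<Sum>q\<in>{..<l} \<times> {..<m}. scaleC (\<alpha> i p * \<beta> q j) (tens v w p q))"
    and cost: "opn I ({..<l} \<times> {..<m}) \<alpha> * S1 {..<l} v * mn E {..<m} w * opn ({..<l} \<times> {..<m}) I \<beta> < c"
    by (rule mn_S_one_obtain[OF E I]) (rule that)
  let ?U = "UNIV :: 'n set" and ?P = "{..<l} \<times> {..<m}" and ?L = "{..<l} \<times> (UNIV :: 'n set)"
  define A where "A = (\<lambda>(i, a) ((r, b), s). if a = (b :: 'n) then \<alpha> i (r, s) else 0)"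
  define B where "B = (\<lambda>((r, b), s) (i, a). if b = (a :: 'n) then \<beta> (r, s) i else 0)"
  have h: "bij_betw (\<lambda>((r, s), a). ((r, a), s)) (?P \<times> ?U) (?L \<times> {..<m})"
    by (rule bij_betw_byWitness[where f' = "\<lambda>((r, a), s). ((r, s), a)"]) auto
  have A: "opn (I \<times> ?U) (?L \<times> {..<m}) A \<le> opn I ?P \<alpha>"
  proof -
    have "opn (I \<times> ?U) (?L \<times> {..<m}) A
      = opn (I \<times> ?U) (?P \<times> ?U) (\<lambda>p q. A p ((\<lambda>((r, s), a). ((r, a), s)) q))"
      using opn_reindex[OF bij_betw_id h, of "I \<times> ?U" A] I by simp
    also have "\<dots> = opn (I \<times> ?U) (?P \<times> ?U) (\<lambda>(i, k) (j, l). if k = l then \<alpha> i j else 0)"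
      by (rule opn_cong) (auto simp: A_def)
    also have "\<dots> \<le> opn I ?P \<alpha>" by (rule opn_tensor_right) (use I in auto)
    finally show ?thesis .
  qed
  have B: "opn (?L \<times> {..<m}) (I \<times> ?U) B \<le> opn ?P I \<beta>"
  proof -
    have "opn (?L \<times> {..<m}) (I \<times> ?U) B
      = opn (?P \<times> ?U) (I \<times> ?U) (\<lambda>q p. B ((\<lambda>((r, s), a). ((r, a), s)) q) p)"
      using opn_reindex[OF h bij_betw_id, of "I \<times> ?U" B] I by simp
    also have "\<dots> = opn (?P \<times> ?U) (I \<times> ?U) (\<lambda>(i, k) (j, l). if k = l then \<beta> i j else 0)"
      by (rule opn_cong) (auto simp: B_def)
    also have "\<dots> \<le> opn ?P I \<beta>" by (rule opn_tensor_right) (use I in auto)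
    finally show ?thesis .
  qed
  have "mn (S_one E) (I \<times> ?U) (embed_diag x)
    \<le> opn (I \<times> ?U) (?L \<times> {..<m}) A * S1 ?L (embed_diag v) * mn E {..<m} w * opn (?L \<times> {..<m}) (I \<times> ?U) B"
  proof (rule mn_S_one_le[OF E])
    fix i' j' assume "i' \<in> I \<times> ?U" "j' \<in> I \<times> ?U"
    then obtain i a j b where ij: "i' = (i, a)" "j' = (j, b)" "i \<in> I" "j \<in> I" by auto
    let ?T = "\<lambda>p q. matrix_tensor (embed_diag v (fst p, a) (fst q, b)) (w (snd p) (snd q))"
    have T: "diag (weyl_embed (tens v w p q) $ a $ b) = ?T p q" for p q
      by (simp add: vec_eq_iff diag_nth embed_diag_def embed_tensor)
    have "embed_diag x i' j' = diag (weyl_embed (x i j) $ a $ b)" by (simp add: embed_diag_def ij)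
    also have "\<dots> = (\<Sum>p\<in>?P. \<Sum>q\<in>?P. scaleC (\<alpha> i p * \<beta> q j) (diag (weyl_embed (tens v w p q) $ a $ b)))"
    proof -
      have D: "clinear (\<lambda>z :: 'a^'n^'n. diag (weyl_embed z $ a $ b))"
        by (simp add: clinear_iff clinear_diag clinear_add[OF embed_linear] clinear_scale[OF embed_linear])
      have Dsum: "diag (weyl_embed (\<Sum>k\<in>K. z k) $ a $ b) = (\<Sum>k\<in>K. diag (weyl_embed (z k :: 'a^'n^'n) $ a $ b))"
        for K :: "(nat \<times> nat) set" and z
        by (induction K rule: infinite_finite_induct) (simp_all add: clinear_zero[OF D] clinear_add[OF D])
      show ?thesis by (simp only: rep[OF ij(3,4)] Dsum clinear_scale[OF D])
    qed
    also have "\<dots> = (\<Sum>p\<in>?P. \<Sum>q\<in>?P. scaleC (\<alpha> i p * \<beta> q j) (?T p q))" by (simp only: T)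
    also have "\<dots> = (\<Sum>p\<in>?L \<times> {..<m}. \<Sum>q\<in>?L \<times> {..<m}. scaleC (A i' p * B q j') (tens (embed_diag v) w p q))"
    proof -
      let ?h = "\<lambda>((r, s), a). ((r, a), s)"
      have "(\<Sum>p\<in>?L \<times> {..<m}. \<Sum>q\<in>?L \<times> {..<m}. scaleC (A i' p * B q j') (tens (embed_diag v) w p q))
        = (\<Sum>p\<in>?P \<times> ?U. \<Sum>q\<in>?P \<times> ?U. scaleC (A i' (?h p) * B (?h q) j') (tens (embed_diag v) w (?h p) (?h q)))"
        by (simp only: sum.reindex_bij_betw[OF h, symmetric])
      also have "\<dots> = (\<Sum>p\<in>?P. \<Sum>a'\<in>?U. if a' = a then \<Sum>q\<in>?P. \<Sum>b'\<in>?U. if b' = b then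
          scaleC (\<alpha> i p * \<beta> q j) (?T p q) else 0 else 0)"
        unfolding sum_Times[of _ ?P ?U]
        by (intro sum.cong refl) (auto simp: A_def B_def ij scaleC_mult_if intro!: sum.cong sum.neutral)
      finally show ?thesis by simp
    qed
    finally show "embed_diag x i' j'
      = (\<Sum>p\<in>?L \<times> {..<m}. \<Sum>q\<in>?L \<times> {..<m}. scaleC (A i' p * B q j') (tens (embed_diag v) w p q))" .
  qed (use I in auto)
  also have "\<dots> \<le> opn I ?P \<alpha> * (CARD('n) * S1 {..<l} v) * mn E {..<m} w * opn ?P I \<beta>"
    using I by (intro mult_mono mult_nonneg_nonneg A B S1_embed_diag opn_nonneg mn_nonneg E ruan_S_one_scalar) auto
  also have "\<dots> = CARD('n) * (opn I ?P \<alpha> * S1 {..<l} v * mn E {..<m} w * opn ?P I \<beta>)" by (simp add: mult_ac)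
  also have "\<dots> \<le> CARD('n) * c" using cost by (intro mult_left_mono) auto
  finally show "mn (S_one E) (I \<times> ?U) (embed_diag x) \<le> CARD('n) * c" .
qed simp

text \<open>
  The projection applied to \<open>v \<otimes> w\<close>, as a function of w alone: the sum of \<open>w\<^sub>g\<^sub>g u\<^sub>g\<^sup>* v u\<^sub>g\<close>
  over g. The sequence w is given by the diagonal of a matrix, as in the definition of \<open>ell_p\<close>; the
  formula makes sense for all matrices w and is interpolated in this form.
\<close>

definition twist :: "('l \<Rightarrow> 'l \<Rightarrow> complex^'n^'n) \<Rightarrow> ('m \<Rightarrow> 'm \<Rightarrow> 'a::complex_vector^('n \<times> 'n)^('n \<times> 'n))
    \<Rightarrow> 'l \<times> 'm \<Rightarrow> 'l \<times> 'm \<Rightarrow> 'a^'n^'n"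
  where "twist v w = (\<lambda>(l, m) (l', m'). \<chi> a b. \<Sum>g\<in>UNIV. \<Sum>c\<in>UNIV. \<Sum>d\<in>UNIV.
    scaleC (v l l' $ c $ d) (scaleC (cnj (weyl g c a) * weyl g d b) (w m m' $ g $ g)))"

lemma twist_linear: "clinear (twist v)"
  by (simp add: clinear_iff twist_def fun_eq_iff vec_eq_iff scaleC_add_right sum.distrib
      cvec.scale_sum_right scaleC_scaleC mult_ac)

text \<open>
  As in \<open>S1_embed_diag\<close>, contracting v leaves a matrix that \<open>mn_mix\<close> bounds by \<open>n \<parallel>w\<parallel>\<close>.
\<close>

lemma twist_inf:
  fixes w :: "'m \<Rightarrow> 'm \<Rightarrow> 'a::complex_vector^('n::finite \<times> 'n)^('n \<times> 'n)"
  assumes E: "ruan E" and fin: "finite L" "finite M"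
  shows "mn (S_inf E) (L \<times> M) (twist v w) \<le> CARD('n) * S1 L v * mn (S_inf E) M w"
proof -
  let ?U = "UNIV :: 'n set" and ?s = "sqrt (real CARD('n))"
  define W where "W = (\<lambda>((m, a), c) ((m', b), d). \<Sum>g\<in>UNIV. scaleC (cnj (weyl g c a) * weyl g d b) (w m m' $ g $ g))"
  define y where "y = (\<lambda>(l, (m, a)) (l', (m', b)). twist v w (l, m) (l', m') $ a $ b)"
  have "mn (S_inf E) (L \<times> M) (twist v w) = mn E ((L \<times> M) \<times> ?U) (flat (twist v w))"
    by (rule mn_S_inf[OF E]) (use fin in simp)
  also have "\<dots> = mn E (L \<times> (M \<times> ?U)) (\<lambda>p q. flat (twist v w) ((\<lambda>(r, (a, j)). ((r, a), j)) p) ((\<lambda>(r, (a, j)). ((r, a), j)) q))"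
  proof (rule mn_reindex[OF E])
    show "bij_betw (\<lambda>(r, (a, j)). ((r, a), j)) (L \<times> (M \<times> ?U)) ((L \<times> M) \<times> ?U)"
      by (rule bij_betw_byWitness[where f' = "\<lambda>((r, a), j). (r, (a, j))"]) auto
  qed (use fin in auto)
  also have "\<dots> = mn E (L \<times> (M \<times> ?U)) y"
    by (rule mn_cong[OF E]) (use fin in \<open>auto simp: y_def\<close>)
  also have "\<dots> \<le> S1 L v * mn E ((M \<times> ?U) \<times> ?U) W"
  proof (rule mn_contraction[OF E fin(1)])
    fix r r' and p q :: "'m \<times> 'n"
    obtain m a m' b where pq: "p = (m, a)" "q = (m', b)" by (cases p; cases q)
    let ?G = "\<lambda>c d g. scaleC (v r r' $ c $ d) (scaleC (cnj (weyl g c a) * weyl g d b) (w m m' $ g $ g))"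
    have "y (r, p) (r', q) = (\<Sum>g\<in>UNIV. \<Sum>c\<in>UNIV. \<Sum>d\<in>UNIV. ?G c d g)"
      by (simp add: y_def pq twist_def)
    also have "\<dots> = (\<Sum>c\<in>UNIV. \<Sum>g\<in>UNIV. \<Sum>d\<in>UNIV. ?G c d g)" by (rule sum.swap)
    also have "\<dots> = (\<Sum>c\<in>UNIV. \<Sum>d\<in>UNIV. \<Sum>g\<in>UNIV. ?G c d g)" by (intro sum.cong refl sum.swap)
    finally show "y (r, p) (r', q) = (\<Sum>c\<in>UNIV. \<Sum>d\<in>UNIV. scaleC (v r r' $ c $ d) (W (p, c) (q, d)))"
      by (simp add: W_def pq cvec.scale_sum_right)
  qed (use fin in simp)
  also have "\<dots> \<le> S1 L v * (?s * mn E (M \<times> UNIV) (flat w) * ?s)"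
  proof (rule mult_left_mono)
    have "mn E ((M \<times> ?U) \<times> ?U) W
      = mn E ((UNIV :: ('n \<times> 'n) set) \<times> M) (\<lambda>p q. W ((\<lambda>((c, a), j). ((j, a), c)) p) ((\<lambda>((c, a), j). ((j, a), c)) q))"
    proof (rule mn_reindex[OF E])
      show "bij_betw (\<lambda>((c, a), j). ((j, a), c)) ((UNIV :: ('n \<times> 'n) set) \<times> M) ((M \<times> ?U) \<times> ?U)"
        by (rule bij_betw_byWitness[where f' = "\<lambda>((j, a), c). ((c, a), j)"]) auto
    qed (use fin in auto)
    also have "\<dots> = mn E ((UNIV :: ('n \<times> 'n) set) \<times> M) (\<lambda>(p, j) (q, k).
        \<Sum>g\<in>UNIV. scaleC (cnj (weyl g (fst p) (snd p)) * weyl g (fst q) (snd q)) (w j k $ g $ g))"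
      by (rule mn_cong[OF E]) (use fin in \<open>auto simp: W_def\<close>)
    also have "\<dots> \<le> ?s * mn E (M \<times> UNIV) (flat w) * ?s"
      by (rule mn_mix[OF E]) (use fin in \<open>auto simp: opn_weyl_basis\<close>)
    finally show "mn E ((M \<times> ?U) \<times> ?U) W \<le> ?s * mn E (M \<times> UNIV) (flat w) * ?s" .
  qed (simp add: mn_nonneg ruan_S_one_scalar)
  also have "\<dots> = CARD('n) * S1 L v * mn (S_inf E) M w"
    by (simp add: mn_S_inf[OF E fin(2)] mult_ac)
  finally show ?thesis .
qed

text \<open>
  In the pairing with B the two trace class matrices v and u are contracted one after the other. What
  remains is the direct sum of the matrices \<open>u\<^sub>g B u\<^sub>g\<^sup>*\<close>, up to conjugation of the entries, whose norm is at
  most that of B.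
\<close>

lemma S1_twist:
  fixes v :: "'l \<Rightarrow> 'l \<Rightarrow> complex^'n^'n" and u :: "'r \<Rightarrow> 'r \<Rightarrow> complex^('n \<times> 'n)^('n \<times> 'n)"
  assumes fin: "finite L" "finite R"
  shows "S1 (L \<times> R) (twist v u) \<le> S1 L v * S1 R u"
proof (rule S1_least)
  note S = ruan_scalars
  show "0 \<le> S1 L v * S1 R u" by (simp add: mn_nonneg ruan_S_one_scalar)
  fix m :: nat and B :: "(complex^'n^'n) matrix"
  let ?J = "{..<m}" and ?U = "UNIV :: 'n set" and ?N = "UNIV :: ('n \<times> 'n) set"
  define y where "y = (\<lambda>(l, (r, j)) (l', (r', k)). pairing (twist v u) B ((l, r), j) ((l', r'), k))"
  define b where "b g = (\<lambda>(j :: nat, c :: 'n) (k, d). \<Sum>a\<in>UNIV. \<Sum>b\<in>UNIV. cnj (weyl g c a) * weyl g d b * B j k $ a $ b)" for g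
  define Y where "Y = (\<lambda>((r, j), c) ((r', k), d). \<Sum>g\<in>UNIV. u r r' $ g $ g * b g (j, c) (k, d))"
  define Z where "Z = (\<lambda>(p, g) (q, h). if g = h then b g p q else 0)"
  have "opn ((L \<times> R) \<times> ?J) ((L \<times> R) \<times> ?J) (pairing (twist v u) B)
    = mn scalars ((L \<times> R) \<times> ?J) (pairing (twist v u) B)" using fin by (simp add: mn_scalars)
  also have "\<dots> = mn scalars (L \<times> (R \<times> ?J)) (\<lambda>p q. pairing (twist v u) B ((\<lambda>(r, (a, j)). ((r, a), j)) p) ((\<lambda>(r, (a, j)). ((r, a), j)) q))"
  proof (rule mn_reindex[OF S])
    show "bij_betw (\<lambda>(r, (a, j)). ((r, a), j)) (L \<times> (R \<times> ?J)) ((L \<times> R) \<times> ?J)"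
      by (rule bij_betw_byWitness[where f' = "\<lambda>((r, a), j). (r, (a, j))"]) auto
  qed (use fin in auto)
  also have "\<dots> = mn scalars (L \<times> (R \<times> ?J)) y"
    by (rule mn_cong[OF S]) (use fin in \<open>auto simp: y_def\<close>)
  also have "\<dots> \<le> S1 L v * mn scalars ((R \<times> ?J) \<times> ?U) Y"
  proof (rule mn_contraction[OF S fin(1)])
    fix l l' and p q :: "'r \<times> nat"
    obtain r j r' k where pq: "p = (r, j)" "q = (r', k)" by (cases p; cases q)
    let ?G = "\<lambda>a b g c d. v l l' $ c $ d * (u r r' $ g $ g * (cnj (weyl g c a) * weyl g d b * B j k $ a $ b))"
    have "y (l, p) (l', q) = (\<Sum>a\<in>?U. \<Sum>b\<in>?U. \<Sum>g\<in>?N. \<Sum>c\<in>?U. \<Sum>d\<in>?U. ?G a b g c d)"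
      by (simp add: y_def pq pairing_def twist_def sum_distrib_left sum_distrib_right mult_ac)
    also have "\<dots> = (\<Sum>(a, b, g, c, d)\<in>?U \<times> ?U \<times> ?N \<times> ?U \<times> ?U. ?G a b g c d)"
      by (simp add: sum.cartesian_product)
    also have "\<dots> = (\<Sum>(c, d, g, a, b)\<in>?U \<times> ?U \<times> ?N \<times> ?U \<times> ?U. ?G a b g c d)"
      by (rule sum.reindex_bij_witness[of _ "\<lambda>(c, d, g, a, b). (a, b, g, c, d)" "\<lambda>(a, b, g, c, d). (c, d, g, a, b)"]) auto
    also have "\<dots> = (\<Sum>c\<in>?U. \<Sum>d\<in>?U. \<Sum>g\<in>?N. \<Sum>a\<in>?U. \<Sum>b\<in>?U. ?G a b g c d)"
      by (simp add: sum.cartesian_product)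
    finally show "y (l, p) (l', q) = (\<Sum>c\<in>UNIV. \<Sum>d\<in>UNIV. scaleC (v l l' $ c $ d) (Y (p, c) (q, d)))"
      by (simp add: Y_def b_def pq sum_distrib_left)
  qed (use fin in simp)
  also have "mn scalars ((R \<times> ?J) \<times> ?U) Y
    = mn scalars (R \<times> (?J \<times> ?U)) (\<lambda>p q. Y ((\<lambda>(r, (a, j)). ((r, a), j)) p) ((\<lambda>(r, (a, j)). ((r, a), j)) q))"
  proof (rule mn_reindex[OF S])
    show "bij_betw (\<lambda>(r, (a, j)). ((r, a), j)) (R \<times> (?J \<times> ?U)) ((R \<times> ?J) \<times> ?U)"
      by (rule bij_betw_byWitness[where f' = "\<lambda>((r, a), j). (r, (a, j))"]) auto
  qed (use fin in auto)
  also have "S1 L v * \<dots> \<le> S1 L v * (S1 R u * mn scalars ((?J \<times> ?U) \<times> ?N) Z)"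
  proof (intro mult_left_mono mn_contraction[OF S fin(2)])
    fix r r' and p q :: "nat \<times> 'n"
    obtain j c k d where pq: "p = (j, c)" "q = (k, d)" by (cases p; cases q)
    have "(\<Sum>g\<in>?N. \<Sum>h\<in>?N. scaleC (u r r' $ g $ h) (Z (p, g) (q, h)))
      = (\<Sum>g\<in>?N. \<Sum>h\<in>?N. if h = g then u r r' $ g $ g * b g p q else 0)"
      by (intro sum.cong refl) (auto simp: Z_def)
    then show "Y ((\<lambda>(r, (a, j)). ((r, a), j)) (r, p)) ((\<lambda>(r, (a, j)). ((r, a), j)) (r', q))
      = (\<Sum>g\<in>?N. \<Sum>h\<in>?N. scaleC (u r r' $ g $ h) (Z (p, g) (q, h)))"
      by (simp add: Y_def pq)
  qed (simp_all add: mn_nonneg ruan_S_one_scalar)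
  also have "mn scalars ((?J \<times> ?U) \<times> ?N) Z
    = mn scalars (?N \<times> (?J \<times> ?U)) (\<lambda>p q. Z (prod.swap p) (prod.swap q))"
    by (rule mn_reindex[OF S]) (auto simp: bij_betw_def)
  also have "\<dots> = mn scalars (?N \<times> (?J \<times> ?U)) (\<lambda>(g, p) (h, q). if g = h then b g p q else 0)"
    by (rule mn_cong[OF S]) (auto simp: Z_def)
  also have "S1 L v * (S1 R u * \<dots>) \<le> S1 L v * (S1 R u * mn scalars (?J \<times> ?U) (flat B))"
  proof (intro mult_left_mono mn_block_diagonal[OF S])
    fix g :: "'n \<times> 'n"
    have "mn scalars (?J \<times> ?U) (b g) \<le> opn ?U ?U (\<lambda>c a. cnj (weyl g c a)) * mn scalars (?J \<times> ?U) (flat B)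
        * opn ?U ?U (\<lambda>b d. weyl g d b)"
      by (rule mn_two_sided_tensor_left[OF S]) (auto simp: b_def)
    also have "\<dots> \<le> 1 * mn scalars (?J \<times> ?U) (flat B) * 1"
      by (intro mult_mono mult_nonneg_nonneg opn_weyl opn_nonneg mn_nonneg S) auto
    finally show "mn scalars (?J \<times> ?U) (b g) \<le> mn scalars (?J \<times> ?U) (flat B)" by simp
  qed (simp_all add: mn_nonneg ruan_S_one_scalar S)
  finally show "opn ((L \<times> R) \<times> ?J) ((L \<times> R) \<times> ?J) (pairing (twist v u) B)
    \<le> S1 L v * S1 R u * opn (?J \<times> ?U) (?J \<times> ?U) (flat B)"
    by (simp add: mn_scalars mult_ac)
qed (use fin in auto)

text \<open>
  The trace class factors of \<open>w = \<alpha> (v' \<otimes> w') \<beta>\<close> and v combine to \<open>twist v v'\<close>, which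
  \<open>S1_twist\<close> bounds; \<open>w'\<close> is left untouched.
\<close>

lemma twist_one:
  fixes w :: "'m \<Rightarrow> 'm \<Rightarrow> 'a::complex_vector^('n::finite \<times> 'n)^('n \<times> 'n)"
    and v :: "'l \<Rightarrow> 'l \<Rightarrow> complex^'n^'n"
  assumes E: "ruan E" and fin: "finite L" "finite M"
  shows "mn (S_one E) (L \<times> M) (twist v w) \<le> S1 L v * mn (S_one E) M w"
proof (rule le_mult_limit)
  show "0 \<le> S1 L v" by (simp add: mn_nonneg ruan_S_one_scalar)
  fix c assume "mn (S_one E) M w < c"
  then obtain r s :: nat and \<alpha> v' w' \<beta> where
    rep: "\<And>i j. i \<in> M \<Longrightarrow> j \<in> M \<Longrightarrow>
      w i j = (\<Sum>p\<in>{..<r} \<times> {..<s}. \<Sum>q\<in>{..<r} \<times> {..<s}. scaleC (\<alpha> i p * \<beta> q j) (tens v' w' p q))"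
    and cost: "opn M ({..<r} \<times> {..<s}) \<alpha> * S1 {..<r} v' * mn E {..<s} w' * opn ({..<r} \<times> {..<s}) M \<beta> < c"
    by (rule mn_S_one_obtain[OF E fin(2)]) (rule that)
  let ?P = "{..<r} \<times> {..<s}" and ?L = "L \<times> {..<r}"
  define A where "A = (\<lambda>(l :: 'l, m) ((k, a), b). if l = k then \<alpha> m (a, b) else 0)"
  define B where "B = (\<lambda>((k, a), b) (l :: 'l, m). if k = l then \<beta> (a, b) m else 0)"
  let ?h = "\<lambda>(l, (a, b)). ((l, a), b)"
  have h: "bij_betw ?h (L \<times> ?P) (?L \<times> {..<s})"
    by (rule bij_betw_byWitness[where f' = "\<lambda>((l, a), b). (l, (a, b))"]) auto
  have A: "opn (L \<times> M) (?L \<times> {..<s}) A \<le> opn M ?P \<alpha>"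
  proof -
    have "opn (L \<times> M) (?L \<times> {..<s}) A = opn (L \<times> M) (L \<times> ?P) (\<lambda>p q. A p (?h q))"
      using opn_reindex[OF bij_betw_id h, of "L \<times> M" A] fin by simp
    also have "\<dots> = opn (L \<times> M) (L \<times> ?P) (\<lambda>(k, i) (l, j). if k = l then \<alpha> i j else 0)"
      by (rule opn_cong) (auto simp: A_def)
    also have "\<dots> \<le> opn M ?P \<alpha>" by (rule opn_tensor_left) (use fin in auto)
    finally show ?thesis .
  qed
  have B: "opn (?L \<times> {..<s}) (L \<times> M) B \<le> opn ?P M \<beta>"
  proof -
    have "opn (?L \<times> {..<s}) (L \<times> M) B = opn (L \<times> ?P) (L \<times> M) (\<lambda>q p. B (?h q) p)"
      using opn_reindex[OF h bij_betw_id, of "L \<times> M" B] fin by simp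
    also have "\<dots> = opn (L \<times> ?P) (L \<times> M) (\<lambda>(k, i) (l, j). if k = l then \<beta> i j else 0)"
      by (rule opn_cong) (auto simp: B_def)
    also have "\<dots> \<le> opn ?P M \<beta>" by (rule opn_tensor_left) (use fin in auto)
    finally show ?thesis .
  qed
  have "mn (S_one E) (L \<times> M) (twist v w)
    \<le> opn (L \<times> M) (?L \<times> {..<s}) A * S1 ?L (twist v v') * mn E {..<s} w' * opn (?L \<times> {..<s}) (L \<times> M) B"
  proof (rule mn_S_one_le[OF E])
    fix i' j' assume "i' \<in> L \<times> M" "j' \<in> L \<times> M"
    then obtain l m l' m' where ij: "i' = (l, m)" "j' = (l', m')" "l \<in> L" "m \<in> M" "l' \<in> L" "m' \<in> M" by auto
    let ?T = "\<lambda>p q. matrix_tensor (twist v v' (l, fst p) (l', fst q)) (w' (snd p) (snd q))"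
    let ?D = "\<lambda>z :: 'a^('n \<times> 'n)^('n \<times> 'n). twist v (\<lambda>_ _. z) (l, m) (l', m')"
    have D: "clinear ?D"
      by (simp add: clinear_iff twist_def vec_eq_iff scaleC_add_right sum.distrib
          cvec.scale_sum_right scaleC_scaleC mult_ac)
    have Dsum: "?D (\<Sum>k\<in>K. z k) = (\<Sum>k\<in>K. ?D (z k))" for K :: "(nat \<times> nat) set" and z
      by (induction K rule: infinite_finite_induct) (simp_all add: clinear_zero[OF D] clinear_add[OF D])
    have T: "?D (tens v' w' p q) = ?T p q" for p q
      by (simp add: twist_def vec_eq_iff cvec.scale_sum_left scaleC_scaleC mult_ac)
    have "twist v w i' j' = ?D (w m m')" by (simp add: twist_def ij)
    also have "\<dots> = (\<Sum>p\<in>?P. \<Sum>q\<in>?P. scaleC (\<alpha> m p * \<beta> q m') (?T p q))"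
      by (simp only: rep[OF ij(4,6)] Dsum clinear_scale[OF D] T)
    also have "\<dots> = (\<Sum>p\<in>?L \<times> {..<s}. \<Sum>q\<in>?L \<times> {..<s}. scaleC (A i' p * B q j') (tens (twist v v') w' p q))"
    proof -
      have "(\<Sum>p\<in>?L \<times> {..<s}. \<Sum>q\<in>?L \<times> {..<s}. scaleC (A i' p * B q j') (tens (twist v v') w' p q))
        = (\<Sum>p\<in>L \<times> ?P. \<Sum>q\<in>L \<times> ?P. scaleC (A i' (?h p) * B (?h q) j') (tens (twist v v') w' (?h p) (?h q)))"
        by (simp only: sum.reindex_bij_betw[OF h, symmetric])
      also have "\<dots> = (\<Sum>k\<in>L. if k = l then \<Sum>p\<in>?P. \<Sum>k'\<in>L. if k' = l' then \<Sum>q\<in>?P.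
          scaleC (\<alpha> m p * \<beta> q m') (?T p q) else 0 else 0)"
        unfolding sum_Times[of _ L ?P]
        by (intro sum.cong refl) (auto simp: A_def B_def ij intro!: sum.cong sum.neutral)
      finally show ?thesis using ij fin by simp
    qed
    finally show "twist v w i' j'
      = (\<Sum>p\<in>?L \<times> {..<s}. \<Sum>q\<in>?L \<times> {..<s}. scaleC (A i' p * B q j') (tens (twist v v') w' p q))" .
  qed (use fin in auto)
  also have "\<dots> \<le> opn M ?P \<alpha> * (S1 L v * S1 {..<r} v') * mn E {..<s} w' * opn ?P M \<beta>"
    using fin by (intro mult_mono mult_nonneg_nonneg A B S1_twist opn_nonneg mn_nonneg E ruan_S_one_scalar) auto
  also have "\<dots> = S1 L v * (opn M ?P \<alpha> * S1 {..<r} v' * mn E {..<s} w' * opn ?P M \<beta>)" by (simp add: mult_ac)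
  also have "\<dots> \<le> S1 L v * c" using cost by (intro mult_left_mono) (auto simp: mn_nonneg ruan_S_one_scalar)
  finally show "mn (S_one E) (L \<times> M) (twist v w) \<le> S1 L v * c" .
qed

section \<open>Complete contractions\<close>

text \<open>
  The case \<open>q = \<infinity>\<close>, interpolated in p between \<open>embed_diag_inf\<close> and \<open>embed_diag_one\<close>.
\<close>

lemma S_inf_weyl_embed:
  fixes x :: "('a::complex_vector^'n^'n) matrix"
  assumes E: "ruan E" and p: "1 \<le> p"
  shows "S_inf (ell_p p E) k (amplify weyl_embed x) \<le> CARD('n) powr inv_exponent p * S_p p E k x"
proof -
  let ?I = "{..<k} \<times> (UNIV :: 'n set)"
  have "S_inf (ell_p p E) k (amplify weyl_embed x)
    = mn (ell_p p E) ?I (\<lambda>(i, a) (j, b). amplify weyl_embed x i j $ a $ b)"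
    by (rule S_inf_eq[OF ruan_ell_p[OF E p]])
  also have "\<dots> = mn (S_p p E) ?I (embed_diag x)"
    unfolding mn_ell_p by (rule mn_cong[OF ruan_S_p[OF E p]]) (auto simp: embed_diag_def amplify_def)
  also have "\<dots> \<le> 1 powr (1 - inv_exponent p) * CARD('n) powr inv_exponent p * mn (S_p p E) {..<k} x"
    by (rule mn_S_p_linear[OF E E p _ _ embed_diag_linear])
      (use embed_diag_inf[OF E] embed_diag_one[OF E] in auto)
  finally show ?thesis by (simp add: mn_lessThan ruan_S_p[OF E p])
qed

text \<open>
  The endpoint \<open>q = 1\<close> costs a factor n compared with \<open>q = \<infinity>\<close>, and interpolation distributes this factor.
\<close>

lemma S_p_weyl_embed:
  fixes x :: "('a::complex_vector^'n^'n) matrix"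
  assumes E: "ruan E" and p: "1 \<le> p" and q: "1 \<le> q"
  shows "S_p q (ell_p p E) k (amplify weyl_embed x)
    \<le> CARD('n) powr (inv_exponent p + inv_exponent q) * S_p p E k x"
proof -
  let ?F = "ell_p p E :: ('a^('n \<times> 'n)) matnorms" and ?M = "CARD('n) powr inv_exponent p * S_p p E k x"
  have F: "ruan ?F" by (rule ruan_ell_p[OF E p])
  have inf: "S_inf ?F k (amplify weyl_embed x) \<le> ?M" by (rule S_inf_weyl_embed[OF E p])
  have "S_one ?F k (amplify weyl_embed x) \<le> CARD('n) * S_inf ?F k (amplify weyl_embed x)"
    by (rule S_one_le_S_inf[OF F])
  also have "\<dots> \<le> CARD('n) * ?M" using inf by (intro mult_left_mono) auto
  finally have one: "S_one ?F k (amplify weyl_embed x) \<le> CARD('n) * ?M" .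
  have "S_p q ?F k (amplify weyl_embed x) \<le> CARD('n) powr inv_exponent q * ?M"
    by (rule S_p_upper[OF F q _ _ inf one]) (auto intro!: mult_nonneg_nonneg ruan_nonneg[OF ruan_S_p[OF E p]])
  then show ?thesis by (simp add: powr_add mult_ac)
qed

lemma amplify_two_sided:
  fixes T :: "'a::complex_vector \<Rightarrow> 'b::complex_vector"
  assumes T: "clinear T"
  shows "T (\<Sum>p\<in>P. \<Sum>q\<in>Q. scaleC (c p q) (z p q)) = (\<Sum>p\<in>P. \<Sum>q\<in>Q. scaleC (c p q) (T (z p q)))"
proof -
  have sum1: "T (\<Sum>q\<in>Q. f q) = (\<Sum>q\<in>Q. T (f q))" for f
    by (induction Q rule: infinite_finite_induct) (simp_all add: clinear_zero[OF T] clinear_add[OF T])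
  have "T (\<Sum>p\<in>P. g p) = (\<Sum>p\<in>P. T (g p))" for g
    by (induction P rule: infinite_finite_induct) (simp_all add: clinear_zero[OF T] clinear_add[OF T])
  then show ?thesis by (simp add: sum1 clinear_scale[OF T])
qed

text \<open>
  Interpolation between \<open>twist_inf\<close> and \<open>twist_one\<close>. The interpolation lemma asks for strictly
  positive bounds, so \<open>\<parallel>v\<parallel>\<close> is replaced by larger numbers s.
\<close>

lemma twist_S_p:
  fixes w :: "'m \<Rightarrow> 'm \<Rightarrow> 'a::complex_vector^('n::finite \<times> 'n)^('n \<times> 'n)"
    and v :: "'l \<Rightarrow> 'l \<Rightarrow> complex^'n^'n"
  assumes E: "ruan E" and p: "1 \<le> p" and fin: "finite L" "finite M"
  shows "mn (S_p p E) (L \<times> M) (twist v w)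
    \<le> CARD('n) powr (1 - inv_exponent p) * mn (S_p p E) M w * S1 L v"
proof (rule le_mult_limit)
  let ?t = "inv_exponent p"
  show "0 \<le> CARD('n) powr (1 - ?t) * mn (S_p p E) M w"
    by (intro mult_nonneg_nonneg mn_nonneg ruan_S_p E p) simp
  fix s assume s: "S1 L v < s"
  have s0: "0 < s" using s mn_nonneg[OF ruan_S_one_scalar, of L v] by linarith
  have nn: "0 \<le> mn (S_inf E) M w" "0 \<le> mn (S_one E) M w" for w :: "'m \<Rightarrow> 'm \<Rightarrow> 'a^('n \<times> 'n)^('n \<times> 'n)"
    by (intro mn_nonneg ruan_S_inf ruan_S_one E)+
  have "mn (S_p p E) (L \<times> M) (twist v w)
    \<le> (CARD('n) * s) powr (1 - ?t) * s powr ?t * mn (S_p p E) M w"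
  proof (rule mn_S_p_linear[OF E E p fin(2) _ twist_linear])
    fix w :: "'m \<Rightarrow> 'm \<Rightarrow> 'a^('n \<times> 'n)^('n \<times> 'n)"
    show "mn (S_inf E) (L \<times> M) (twist v w) \<le> CARD('n) * s * mn (S_inf E) M w"
      by (rule order_trans[OF twist_inf[OF E fin]]) (use s nn in \<open>auto intro!: mult_right_mono\<close>)
    show "mn (S_one E) (L \<times> M) (twist v w) \<le> s * mn (S_one E) M w"
      by (rule order_trans[OF twist_one[OF E fin]]) (use s nn in \<open>auto intro!: mult_right_mono\<close>)
  qed (use s0 fin in auto)
  also have "(CARD('n) * s) powr (1 - ?t) * s powr ?t = CARD('n) powr (1 - ?t) * s"
    using s0 by (simp add: powr_mult powr_add[symmetric] mult.assoc)
  finally show "mn (S_p p E) (L \<times> M) (twist v w) \<le> CARD('n) powr (1 - ?t) * mn (S_p p E) M w * s"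
    by (simp add: mult_ac)
qed

text \<open>
  The case \<open>q = 1\<close>: by the definition of the projective tensor product it suffices to project elementary tensors.
\<close>

lemma S_one_weyl_project:
  fixes y :: "(('a::complex_vector^('n \<times> 'n))^'n^'n) matrix"
  assumes E: "ruan E" and p: "1 \<le> p"
  shows "S_p p E k (amplify weyl_project y) \<le> CARD('n) powr (1 - inv_exponent p) * S_one (ell_p p E) k y"
proof (rule le_mult_limit)
  let ?F = "ell_p p E :: ('a^('n \<times> 'n)) matnorms" and ?n = "CARD('n) powr (1 - inv_exponent p)"
  note Sp = ruan_S_p[OF E p] and F = ruan_ell_p[OF E p]
  show "0 \<le> ?n" by simp
  fix c assume c: "S_one ?F k y < c"
  obtain l m :: nat and \<alpha> v w \<beta> where
    rep: "\<And>i j. i < k \<Longrightarrow> j < k \<Longrightarrow>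
      y i j = (\<Sum>p\<in>{..<l} \<times> {..<m}. \<Sum>q\<in>{..<l} \<times> {..<m}. scaleC (\<alpha> i p * \<beta> q j) (tens v w p q))"
    and cost: "opn {..<k} ({..<l} \<times> {..<m}) \<alpha> * S_one_scalar l v * ?F m w * opn ({..<l} \<times> {..<m}) {..<k} \<beta> < c"
    by (rule S_one_obtain[OF F c]) (rule that)
  let ?P = "{..<l} \<times> {..<m}" and ?w = "\<lambda>i j. diag (w i j)"
  have w: "mn (S_p p E) {..<m} ?w = ?F m w"
    by (simp add: mn_ell_p[symmetric] mn_lessThan F)
  have tw: "weyl_project (tens v w p q) = twist v ?w p q" for p q
    by (cases p; cases q) (simp add: weyl_project_def twist_def vec_eq_iff diag_nth scaleC_scaleC mult_ac)
  have "S_p p E k (amplify weyl_project y) = mn (S_p p E) {..<k} (amplify weyl_project y)"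
    by (simp add: mn_lessThan Sp)
  also have "\<dots> \<le> opn {..<k} ?P \<alpha> * mn (S_p p E) ?P (twist v ?w) * opn ?P {..<k} \<beta>"
  proof (rule mn_two_sided[OF Sp])
    fix i j assume "i \<in> {..<k}" "j \<in> {..<k}"
    then show "amplify weyl_project y i j = (\<Sum>p\<in>?P. \<Sum>q\<in>?P. scaleC (\<alpha> i p * \<beta> q j) (twist v ?w p q))"
      by (simp add: amplify_def rep amplify_two_sided[OF project_linear] tw)
  qed auto
  also have "\<dots> \<le> opn {..<k} ?P \<alpha> * (?n * ?F m w * S_one_scalar l v) * opn ?P {..<k} \<beta>"
    using twist_S_p[OF E p, of "{..<l}" "{..<m}" v ?w]
    by (intro mult_right_mono mult_left_mono opn_nonneg) (simp_all add: w mn_lessThan ruan_S_one_scalar)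
  also have "\<dots> = ?n * (opn {..<k} ?P \<alpha> * S_one_scalar l v * ?F m w * opn ?P {..<k} \<beta>)" by (simp add: mult_ac)
  also have "\<dots> \<le> ?n * c" using cost by (intro mult_left_mono) auto
  finally show "S_p p E k (amplify weyl_project y) \<le> ?n * c" .
qed

lemma amplify_linear: "clinear T \<Longrightarrow> clinear (amplify T)"
  by (simp add: clinear_iff amplify_def fun_eq_iff)

text \<open>
  The target is a single seminorm, not an interpolation scale in q, so that the endpoint bounds are combined by
  the three lines theorem.
\<close>

lemma S_p_weyl_project:
  fixes y :: "(('a::complex_vector^('n \<times> 'n))^'n^'n) matrix"
  assumes E: "ruan E" and p: "1 \<le> p" and q: "1 \<le> q"
  shows "S_p p E k (amplify weyl_project y)
    \<le> CARD('n) powr (2 - inv_exponent p - inv_exponent q) * S_p q (ell_p p E) k y"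
proof -
  let ?F = "ell_p p E :: ('a^('n \<times> 'n)) matnorms" and ?b = "CARD('n) powr (1 - inv_exponent p)"
  note F = ruan_ell_p[OF E p]
  have one: "S_p p E k (amplify weyl_project y) \<le> ?b * S_one ?F k y" for y
    by (rule S_one_weyl_project[OF E p])
  have inf: "S_p p E k (amplify weyl_project y) \<le> (?b * CARD('n)) * S_inf ?F k y" for y
  proof -
    have "?b * S_one ?F k y \<le> ?b * (CARD('n) * S_inf ?F k y)"
      by (intro mult_left_mono S_one_le_S_inf F) simp
    with one[of y] show ?thesis by (simp only: mult.assoc)
  qed
  have "S_p p E k (amplify weyl_project y)
    \<le> (?b * CARD('n)) powr (1 - inv_exponent q) * ?b powr inv_exponent q * S_p q ?F k y"
    by (rule S_p_lower[OF F q ruan_cseminorm[OF ruan_S_p[OF E p]] amplify_linear[OF project_linear]])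
      (simp_all only: inf one, simp_all)
  also have "(?b * CARD('n)) powr (1 - inv_exponent q) * ?b powr inv_exponent q
    = CARD('n) powr (2 - inv_exponent p - inv_exponent q)"
    by (simp add: powr_mult powr_powr powr_add[symmetric] algebra_simps)
  finally show ?thesis .
qed

text \<open>
  The exponent s will be \<open>1/p + 1/q\<close>.
\<close>

definition weyl_J :: "real \<Rightarrow> ('a::complex_vector)^'n^'n \<Rightarrow> ('a^('n \<times> 'n))^'n^'n"
  where "weyl_J s x = scaleC (complex_of_real (CARD('n) powr (- s))) (weyl_embed x)"

definition weyl_R :: "real \<Rightarrow> (('a::complex_vector)^('n \<times> 'n))^'n^'n \<Rightarrow> 'a^'n^'n"
  where "weyl_R s y = scaleC (complex_of_real (CARD('n) powr (s - 2))) (weyl_project y)"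

lemma weyl_J_linear: "clinear (weyl_J s)" and weyl_R_linear: "clinear (weyl_R s)"
  by (simp_all add: clinear_iff weyl_J_def weyl_R_def clinear_add[OF embed_linear] clinear_scale[OF embed_linear]
      clinear_add[OF project_linear] clinear_scale[OF project_linear] scaleC_add_right scaleC_scaleC mult.commute)

lemma weyl_R_J: "weyl_R s (weyl_J s x) = x"
  for x :: "'a::complex_vector^'n^'n"
proof -
  let ?n = "real CARD('n)"
  have "?n powr (s - 2) * ?n powr (- s) * (?n * ?n) = ?n powr (s - 2) * ?n powr (- s) * ?n powr 2"
    by (simp add: power2_eq_square)
  also have "\<dots> = 1" by (simp only: powr_add[symmetric]) simp
  finally have "complex_of_real (?n powr (s - 2) * ?n powr (- s) * (?n * ?n)) = complex_of_real 1"
    by (rule arg_cong)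
  then have "complex_of_real (?n powr (s - 2)) * complex_of_real (?n powr (- s)) * of_nat (CARD('n) * CARD('n)) = 1"
    by (simp only: of_real_mult of_real_1 of_real_of_nat_eq of_nat_mult)
  then show ?thesis
    by (simp add: weyl_R_def weyl_J_def clinear_scale[OF project_linear] project_embed scaleC_scaleC scaleC_one mult.assoc)
qed

lemma
  fixes E :: "('a::complex_vector) matnorms" and x :: "('a^'n^'n) matrix"
    and y :: "(('a^('n \<times> 'n))^'n^'n) matrix"
  assumes E: "ruan E" and p: "1 \<le> p" and q: "1 \<le> q"
  defines "s \<equiv> inv_exponent p + inv_exponent q"
  shows weyl_J_contractive: "S_p q (ell_p p E) k (amplify (weyl_J s) x) \<le> S_p p E k x"
    and weyl_R_contractive: "S_p p E k (amplify (weyl_R s) y) \<le> S_p q (ell_p p E) k y"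
proof -
  let ?n = "real CARD('n)"
  note Sp = ruan_S_p[OF E p] and Sq = ruan_S_p[OF ruan_ell_p[OF E p] q]
  have "amplify (weyl_J s) x = scaleC (complex_of_real (?n powr (- s))) (amplify weyl_embed x)"
    by (simp add: fun_eq_iff amplify_def weyl_J_def)
  then have "S_p q (ell_p p E) k (amplify (weyl_J s) x) = ?n powr (- s) * S_p q (ell_p p E) k (amplify weyl_embed x)"
    by (simp add: ruan_scale[OF Sq])
  also have "\<dots> \<le> ?n powr (- s) * (?n powr s * S_p p E k x)"
    unfolding s_def by (intro mult_left_mono S_p_weyl_embed E p q) simp
  also have "\<dots> = S_p p E k x" by (simp add: mult.assoc[symmetric] powr_add[symmetric])
  finally show "S_p q (ell_p p E) k (amplify (weyl_J s) x) \<le> S_p p E k x" .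
  have "amplify (weyl_R s) y = scaleC (complex_of_real (?n powr (s - 2))) (amplify weyl_project y)"
    by (simp add: fun_eq_iff amplify_def weyl_R_def)
  then have "S_p p E k (amplify (weyl_R s) y) = ?n powr (s - 2) * S_p p E k (amplify weyl_project y)"
    by (simp add: ruan_scale[OF Sp])
  also have "\<dots> \<le> ?n powr (s - 2) * (?n powr (2 - inv_exponent p - inv_exponent q) * S_p q (ell_p p E) k y)"
    by (intro mult_left_mono S_p_weyl_project E p q) simp
  also have "\<dots> = S_p q (ell_p p E) k y" by (simp add: mult.assoc[symmetric] powr_add[symmetric] s_def)
  finally show "S_p p E k (amplify (weyl_R s) y) \<le> S_p q (ell_p p E) k y" .
qed

text \<open>
  Both inequalities for J come from contractions: \<open>\<parallel>J x\<parallel> \<le> \<parallel>x\<parallel> = \<parallel>R (J x)\<parallel> \<le> \<parallel>J x\<parallel>\<close>.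
\<close>

lemma weyl_complemented:
  fixes E :: "('a::complex_vector) matnorms"
  assumes E: "ruan E" and p: "1 \<le> p" and q: "1 \<le> q"
  defines "s \<equiv> inv_exponent p + inv_exponent q"
  shows "complete_isometry (S_p p E) (S_p q (ell_p p E)) (weyl_J s :: 'a^'n^'n \<Rightarrow> _)"
    and "cc_projection_onto (S_p q (ell_p p E)) (range (weyl_J s :: 'a^'n^'n \<Rightarrow> _)) (weyl_J s \<circ> weyl_R s)"
proof -
  let ?J = "weyl_J s :: 'a^'n^'n \<Rightarrow> _" and ?R = "weyl_R s :: _ \<Rightarrow> 'a^'n^'n" and ?F = "S_p q (ell_p p E)"
  note J = weyl_J_contractive[OF E p q, folded s_def] and R = weyl_R_contractive[OF E p q, folded s_def]
  have RJ: "amplify ?R (amplify ?J x) = x" for x by (simp add: fun_eq_iff amplify_def weyl_R_J)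
  have "?F k (amplify ?J x) = S_p p E k x" for k x
    using J[of k x] R[of k "amplify ?J x"] by (simp add: RJ)
  then show "complete_isometry (S_p p E) ?F ?J" by (simp add: complete_isometry_def weyl_J_linear)
  have "?F k (amplify (?J \<circ> ?R) y) \<le> ?F k y" for k y
  proof -
    have "amplify (?J \<circ> ?R) y = amplify ?J (amplify ?R y)" by (simp add: fun_eq_iff amplify_def)
    then show ?thesis using order_trans[OF J[of k "amplify ?R y"] R[of k y]] by simp
  qed
  moreover have "clinear (?J \<circ> ?R)"
  proof -
    have "clinear ?J" "clinear ?R" by (rule weyl_J_linear weyl_R_linear)+
    then show ?thesis by (simp add: clinear_iff)
  qed
  moreover have "(?J \<circ> ?R) \<circ> (?J \<circ> ?R) = ?J \<circ> ?R" by (simp add: fun_eq_iff weyl_R_J)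
  moreover have "range (?J \<circ> ?R) = range ?J"
  proof
    show "range ?J \<subseteq> range (?J \<circ> ?R)"
    proof
      fix z assume "z \<in> range ?J"
      then obtain x where "z = ?J x" by auto
      then have "z = (?J \<circ> ?R) (?J x)" by (simp add: weyl_R_J)
      then show "z \<in> range (?J \<circ> ?R)" by blast
    qed
  qed auto
  ultimately show "cc_projection_onto ?F (range ?J) (?J \<circ> ?R)"
    by (simp add: cc_projection_onto_def completely_contractive_def)
qed

section \<open>Complete positivity\<close>

text \<open>
  The vectors of the definition are indexed by an enumeration of \<open>{..<k} \<times> UNIV\<close>.
\<close>

lemma pos_Mn_iff:
  fixes x :: "(complex^'n^'n) matrix"
  shows "pos_Mn k x \<longleftrightarrow> (\<forall>v. (\<Sum>p\<in>{..<k} \<times> UNIV. \<Sum>q\<in>{..<k} \<times> UNIV. cnj (v p) * flat x p q * v q) \<in> \<real>\<^sub>\<ge>\<^sub>0)"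
proof -
  let ?h = "\<lambda>r. (r div CARD('n), from_nat_into (UNIV :: 'n set) (r mod CARD('n)))"
  let ?P = "{..<k} \<times> (UNIV :: 'n set)" and ?N = "{..<k * CARD('n)}"
  note h = bij_flatten[where 'n = 'n, of k]
  have eq: "(\<Sum>i<k * CARD('n). \<Sum>j<k * CARD('n). cnj (v (?h i)) * flatten x i j * v (?h j))
    = (\<Sum>p\<in>?P. \<Sum>q\<in>?P. cnj (v p) * flat x p q * v q)" for v
  proof -
    have "(\<Sum>i<k * CARD('n). \<Sum>j<k * CARD('n). cnj (v (?h i)) * flatten x i j * v (?h j))
      = (\<Sum>i<k * CARD('n). \<Sum>j<k * CARD('n). cnj (v (?h i)) * flat x (?h i) (?h j) * v (?h j))"
      by (simp add: flatten_def)
    also have "\<dots> = (\<Sum>i<k * CARD('n). \<Sum>q\<in>?P. cnj (v (?h i)) * flat x (?h i) q * v q)"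
      by (intro sum.cong refl sum.reindex_bij_betw[OF h])
    also have "\<dots> = (\<Sum>p\<in>?P. \<Sum>q\<in>?P. cnj (v p) * flat x p q * v q)"
      by (rule sum.reindex_bij_betw[OF h])
    finally show ?thesis .
  qed
  show ?thesis
  proof
    assume x: "pos_Mn k x"
    show "\<forall>v. (\<Sum>p\<in>?P. \<Sum>q\<in>?P. cnj (v p) * flat x p q * v q) \<in> \<real>\<^sub>\<ge>\<^sub>0"
    proof
      fix v :: "nat \<times> 'n \<Rightarrow> complex"
      have "(\<Sum>i<k * CARD('n). \<Sum>j<k * CARD('n). cnj (v (?h i)) * flatten x i j * v (?h j)) \<in> \<real>\<^sub>\<ge>\<^sub>0"
        using x by (auto simp: pos_Mn_def psd_def)
      then show "(\<Sum>p\<in>?P. \<Sum>q\<in>?P. cnj (v p) * flat x p q * v q) \<in> \<real>\<^sub>\<ge>\<^sub>0" by (simp only: eq)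
    qed
  next
    assume x: "\<forall>v. (\<Sum>p\<in>?P. \<Sum>q\<in>?P. cnj (v p) * flat x p q * v q) \<in> \<real>\<^sub>\<ge>\<^sub>0"
    show "pos_Mn k x"
      unfolding pos_Mn_def psd_def
    proof
      fix u :: "nat \<Rightarrow> complex"
      define v where "v p = u (the_inv_into ?N ?h p)" for p
      have v: "v (?h i) = u i" if "i \<in> ?N" for i
        using that h unfolding v_def by (intro arg_cong[where f = u] the_inv_into_f_f) (auto simp: bij_betw_def)
      have "(\<Sum>i<k * CARD('n). \<Sum>j<k * CARD('n). cnj (u i) * flatten x i j * u j)
        = (\<Sum>i<k * CARD('n). \<Sum>j<k * CARD('n). cnj (v (?h i)) * flatten x i j * v (?h j))"
        by (intro sum.cong refl) (simp only: v)
      then show "(\<Sum>i<k * CARD('n). \<Sum>j<k * CARD('n). cnj (u i) * flatten x i j * u j) \<in> \<real>\<^sub>\<ge>\<^sub>0"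
        using x by (simp only: eq)
    qed
  qed
qed

lemma nonneg_Reals_sum: "(\<And>a. a \<in> A \<Longrightarrow> f a \<in> \<real>\<^sub>\<ge>\<^sub>0) \<Longrightarrow> (\<Sum>a\<in>A. f a :: complex) \<in> \<real>\<^sub>\<ge>\<^sub>0"
  by (induction A rule: infinite_finite_induct) (auto intro: nonneg_Reals_add_I)

text \<open>
  Sums of congruences \<open>x \<mapsto> A x A\<^sup>*\<close> preserve positivity: the quadratic form of the result at v is
  the sum of the forms of the \<open>x\<^sub>g\<close> at \<open>A\<^sub>g\<^sup>* v\<close>.
\<close>

lemma pos_Mn_sum_congruence:
  fixes x :: "'g \<Rightarrow> (complex^'n^'n) matrix" and A :: "'g \<Rightarrow> 'n \<Rightarrow> 'n \<Rightarrow> complex"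
  assumes x: "\<And>g. g \<in> G \<Longrightarrow> pos_Mn k (x g)" and s: "0 \<le> s"
    and y: "\<And>i j a b. y i j $ a $ b = complex_of_real s *
      (\<Sum>g\<in>G. \<Sum>c\<in>UNIV. \<Sum>d\<in>UNIV. A g a c * cnj (A g b d) * x g i j $ c $ d)"
  shows "pos_Mn k y"
  unfolding pos_Mn_iff
proof
  fix v :: "nat \<times> 'n \<Rightarrow> complex"
  let ?P = "{..<k} \<times> (UNIV :: 'n set)"
  define u where "u g = (\<lambda>(i, c). \<Sum>a\<in>UNIV. cnj (A g a c) * v (i, a))" for g
  have "(\<Sum>p\<in>?P. \<Sum>q\<in>?P. cnj (v p) * flat y p q * v q)
    = complex_of_real s * (\<Sum>g\<in>G. \<Sum>p\<in>?P. \<Sum>q\<in>?P. cnj (u g p) * flat (x g) p q * u g q)"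
  proof -
    let ?f = "\<lambda>g i a j b c d. complex_of_real s * (cnj (v (i, a)) * (A g a c * cnj (A g b d) * x g i j $ c $ d) * v (j, b))"
    let ?U = "UNIV :: 'n set"
    have fin: "(\<Sum>i<k. \<Sum>a\<in>?U. \<Sum>j<k. \<Sum>b\<in>?U. \<Sum>g\<in>G. \<Sum>c\<in>?U. \<Sum>d\<in>?U. ?f g i a j b c d)
      = (\<Sum>g\<in>G. \<Sum>i<k. \<Sum>a\<in>?U. \<Sum>j<k. \<Sum>b\<in>?U. \<Sum>c\<in>?U. \<Sum>d\<in>?U. ?f g i a j b c d)"
      by (simp only: sum.swap[of _ G "{..<k}"] sum.swap[of _ G ?U])
    have sw: "(\<Sum>i<k. \<Sum>a\<in>?U. \<Sum>j<k. \<Sum>b\<in>?U. \<Sum>c\<in>?U. \<Sum>d\<in>?U. h i a j b c d)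
      = (\<Sum>i<k. \<Sum>c\<in>?U. \<Sum>j<k. \<Sum>d\<in>?U. \<Sum>a\<in>?U. \<Sum>b\<in>?U. h i a j b c d)"
      for h :: "nat \<Rightarrow> 'n \<Rightarrow> nat \<Rightarrow> 'n \<Rightarrow> 'n \<Rightarrow> 'n \<Rightarrow> complex"
    proof -
      have "(\<Sum>i<k. \<Sum>a\<in>?U. \<Sum>j<k. \<Sum>b\<in>?U. \<Sum>c\<in>?U. \<Sum>d\<in>?U. h i a j b c d)
        = (\<Sum>(i, a, j, b, c, d)\<in>{..<k} \<times> ?U \<times> {..<k} \<times> ?U \<times> ?U \<times> ?U. h i a j b c d)"
        by (simp add: sum.cartesian_product)
      also have "\<dots> = (\<Sum>(i, c, j, d, a, b)\<in>{..<k} \<times> ?U \<times> {..<k} \<times> ?U \<times> ?U \<times> ?U. h i a j b c d)"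
        by (rule sum.reindex_bij_witness[of _ "\<lambda>(i, c, j, d, a, b). (i, a, j, b, c, d)"
            "\<lambda>(i, a, j, b, c, d). (i, c, j, d, a, b)"]) auto
      also have "\<dots> = (\<Sum>i<k. \<Sum>c\<in>?U. \<Sum>j<k. \<Sum>d\<in>?U. \<Sum>a\<in>?U. \<Sum>b\<in>?U. h i a j b c d)"
        by (simp add: sum.cartesian_product)
      finally show ?thesis .
    qed
    have "(\<Sum>p\<in>?P. \<Sum>q\<in>?P. cnj (v p) * flat y p q * v q)
      = (\<Sum>i<k. \<Sum>a\<in>?U. \<Sum>j<k. \<Sum>b\<in>?U. \<Sum>g\<in>G. \<Sum>c\<in>?U. \<Sum>d\<in>?U. ?f g i a j b c d)"
      unfolding sum_Times by (simp add: y sum_distrib_left sum_distrib_right mult_ac)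
    also have "\<dots> = (\<Sum>g\<in>G. \<Sum>i<k. \<Sum>c\<in>?U. \<Sum>j<k. \<Sum>d\<in>?U. \<Sum>a\<in>?U. \<Sum>b\<in>?U. ?f g i a j b c d)"
      unfolding fin by (intro sum.cong refl sw)
    also have "\<dots> = complex_of_real s * (\<Sum>g\<in>G. \<Sum>p\<in>?P. \<Sum>q\<in>?P. cnj (u g p) * flat (x g) p q * u g q)"
    proof -
      have "complex_of_real s * (cnj (u g (i, c)) * x g i j $ c $ d * u g (j, d)) = (\<Sum>a\<in>?U. \<Sum>b\<in>?U. ?f g i a j b c d)"
        for g i j c d
      proof -
        have "complex_of_real s * (cnj (u g (i, c)) * x g i j $ c $ d * u g (j, d))
          = (complex_of_real s * x g i j $ c $ d) *
            ((\<Sum>a\<in>?U. A g a c * cnj (v (i, a))) * (\<Sum>b\<in>?U. cnj (A g b d) * v (j, b)))"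
          by (simp add: u_def cnj_sum mult_ac)
        then show ?thesis unfolding sum_product by (simp add: sum_distrib_left mult_ac)
      qed
      then show ?thesis unfolding sum_Times by (simp add: sum_distrib_left)
    qed
    finally show ?thesis .
  qed
  also have "\<dots> \<in> \<real>\<^sub>\<ge>\<^sub>0"
  proof (intro nonneg_Reals_mult_I nonneg_Reals_sum[of G])
    fix g assume "g \<in> G"
    then show "(\<Sum>p\<in>?P. \<Sum>q\<in>?P. cnj (u g p) * flat (x g) p q * u g q) \<in> \<real>\<^sub>\<ge>\<^sub>0"
      using x[of g] unfolding pos_Mn_iff by blast
  qed (simp add: s)
  finally show "(\<Sum>p\<in>?P. \<Sum>q\<in>?P. cnj (v p) * flat y p q * v q) \<in> \<real>\<^sub>\<ge>\<^sub>0" .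
qed

lemma weyl_J_completely_positive: "completely_positive pos_Mn pos_Mn_ell (weyl_J s :: complex^'n^'n \<Rightarrow> _)"
  unfolding completely_positive_def pos_Mn_ell_def
proof (intro conjI allI impI weyl_J_linear)
  fix k g and x :: "(complex^'n^'n) matrix" assume x: "pos_Mn k x"
  show "pos_Mn k (amplify (\<lambda>y. \<chi> a b. y $ a $ b $ g) (amplify (weyl_J s) x))"
    by (rule pos_Mn_sum_congruence[where G = "{()}" and x = "\<lambda>_. x" and A = "\<lambda>_. weyl g"
          and s = "real CARD('n) powr (- s)"])
      (simp_all add: x amplify_def weyl_J_def weyl_embed_def)
qed

lemma weyl_R_completely_positive: "completely_positive pos_Mn_ell pos_Mn (weyl_R s :: _ \<Rightarrow> complex^'n^'n)"
  unfolding completely_positive_def pos_Mn_ell_def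
proof (intro conjI allI impI weyl_R_linear)
  fix k and y :: "((complex^('n \<times> 'n))^'n^'n) matrix"
  assume y: "\<forall>g. pos_Mn k (amplify (\<lambda>y. \<chi> a b. y $ a $ b $ g) y)"
  show "pos_Mn k (amplify (weyl_R s) y)"
    by (rule pos_Mn_sum_congruence[where G = UNIV and x = "\<lambda>g. amplify (\<lambda>y. \<chi> a b. y $ a $ b $ g) y"
          and A = "\<lambda>g a c. cnj (weyl g c a)" and s = "real CARD('n) powr (s - 2)"])
      (rule y[rule_format], simp_all add: amplify_def weyl_R_def weyl_project_def)
qed

lemma completely_positive_comp:
  assumes "completely_positive C D T" "completely_positive D F U"
  shows "completely_positive C F (U \<circ> T)"
proof -
  have "amplify (U \<circ> T) x = amplify U (amplify T x)" for x by (simp add: fun_eq_iff amplify_def)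
  moreover have "clinear (U \<circ> T)" using assms by (simp add: completely_positive_def clinear_iff)
  ultimately show ?thesis using assms by (simp add: completely_positive_def)
qed

theorem corollary1p2:
  fixes p q :: ereal
  assumes "1 \<le> p" and "1 \<le> q"
  shows
    "(\<exists>(J :: complex^'n^'n \<Rightarrow> (complex^('n \<times> 'n))^'n^'n) P.
        complete_isometry (S_p p scalars) (S_p q (ell_p p scalars)) J \<and>
        cc_projection_onto (S_p q (ell_p p scalars)) (range J) P \<and>
        completely_positive pos_Mn pos_Mn_ell J \<and>
        completely_positive pos_Mn_ell pos_Mn_ell P) \<and>
     (\<forall>E :: ('e::complex_vector) matnorms. operator_space E \<longrightarrow>
        (\<exists>J :: 'e^'n^'n \<Rightarrow> ('e^('n \<times> 'n))^'n^'n.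
          complete_isometry (S_p p E) (S_p q (ell_p p E)) J \<and>
          completely_complemented (S_p q (ell_p p E)) (range J)))"
proof (intro conjI allI impI)
  let ?s = "inv_exponent p + inv_exponent q"
  let ?J = "weyl_J ?s :: complex^'n^'n \<Rightarrow> (complex^('n \<times> 'n))^'n^'n"
  have "completely_positive pos_Mn_ell pos_Mn_ell (?J \<circ> weyl_R ?s)"
    by (rule completely_positive_comp[OF weyl_R_completely_positive weyl_J_completely_positive])
  then show "\<exists>(J :: complex^'n^'n \<Rightarrow> (complex^('n \<times> 'n))^'n^'n) P.
        complete_isometry (S_p p scalars) (S_p q (ell_p p scalars)) J \<and>
        cc_projection_onto (S_p q (ell_p p scalars)) (range J) P \<and>
        completely_positive pos_Mn pos_Mn_ell J \<and>
        completely_positive pos_Mn_ell pos_Mn_ell P"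
    using weyl_complemented[OF ruan_scalars assms] weyl_J_completely_positive by blast
  fix E :: "'e matnorms" assume "operator_space E"
  then have E: "ruan E" by (rule operator_space_imp_ruan)
  show "\<exists>J :: 'e^'n^'n \<Rightarrow> ('e^('n \<times> 'n))^'n^'n.
          complete_isometry (S_p p E) (S_p q (ell_p p E)) J \<and>
          completely_complemented (S_p q (ell_p p E)) (range J)"
    using weyl_complemented[OF E assms] unfolding completely_complemented_def by blast
qed

end
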